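(* Let $\Gamma\curvearrowright M$ be an equivariant matroid. For every integer $i>0$, there is an isomorphism of virtual representations of $\Gamma$ $$c_M^\Gamma(i) \;\cong\; \sum_{r=1}^i\;\sum_{S\subset [r]} (-1)^{|S|} \sum_{\substack{a_0<a_1<\cdots < a_r<a_{r+1}\\ a_0 = 0,\ a_r = i,\ a_{r+1} = \operatorname{rk} M-i}} W_M^\Gamma\Big(a_{t_{r}(S)} + a_{r-1},\ldots,a_{t_{1}(S)} + a_{0}\Big),$$ where the innermost sum is over integer sequences satisfying the stated conditions.
   Context: An equivariant matroid $\Gamma\curvearrowright M$ consists of a finite group $\Gamma$, a matroid $M$ on a finite ground set $\mathcal{I}$ with lattice of flats $L$, and an action of $\Gamma$ on $\mathcal{I}$ sending flats to flats. Representations are finite-dimensional complex; virtual representations are elements of the Grothendieck group. For a flat $F$, $\operatorname{rk}F$ is its rank, $\operatorname{crk}F=\operatorname{rk}M-\operatorname{rk}F$, $\Gamma_F\subset\Gamma$ is its stabilizer, $M_F$ (localization: ground set $F$, flats $\{G\le F\}$) and $M^F$ (contraction: ground set $\mathcal{I}\smallsetminus F$, flats $\cong\{G\ge F\}$) carry induced $\Gamma_F$-actions. The Orlik–Solomon algebra $OS_M$ is the quotient of the exterior algebra over $\mathbb{C}$ on generators $e_i$ ($i\in\mathcal{I}$) by the ideal generated by $e_i$ for loops $i$ and by $\sum_{k=1}^s(-1)^{k-1}e_{c_1}\cdots\widehat{e_{c_k}}\cdots e_{c_s}$ for each circuit $\{c_1,\dots,c_s\}$; it is graded, $OS_M^j$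 in degree $j$, and $\Gamma$ acts by permuting generators. Set $H^\Gamma_M(t):=\sum_j(-1)^jt^{\operatorname{rk}M-j}[OS^j_M]$. The equivariant Kazhdan–Lusztig polynomial $P^\Gamma_M(t)$, a polynomial with virtual-representation coefficients, is the unique assignment such that: if $\operatorname{rk}M=0$ it is the trivial representation in degree $0$; if $\operatorname{rk}M>0$ its degree is $<\frac12\operatorname{rk}M$; and $t^{\operatorname{rk}M}P^\Gamma_M(t^{-1})=\sum_{[F]\in L/\Gamma}\operatorname{Ind}_{\Gamma_F}^\Gamma\big(H^{\Gamma_F}_{M_F}(t)\otimes P^{\Gamma_F}_{M^F}(t)\big)$. Let $c^\Gamma_M(i)$ be the coefficient of $t^i$ in $P^\Gamma_M(t)$. For integers $i_r,\dots,i_1$, $W^\Gamma_M(i_r,\dots,i_1)$ is the permutation representation of $\Gamma$ with basis $\{(F_r,\ldots,F_1)\in L^r : F_r\le\cdots\le F_1,\ \operatorname{crk}F_j=i_j\ \forall j\}$. For $S\subset[r]$ and $1\le j\le r$, $t_j(S):=\min\{k\ge j : k\notin S\}\in\{1,\dots,r+1\}$.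
   Formalization: In the Orlik–Solomon algebra the alternating-sum relation is imposed only for circuits with at least two elements; for a loop it would read 1 = 0, making OS vanish and contradicting the rank-0 condition on P. Loops i still give e_i = 0. *)

theory Defs
  imports
    "HOL-Algebra.Group_Action"
    "HOL-Library.Function_Algebras"
    "Jordan_Normal_Form.Matrix"
begin

section \<open>Matroids\<close>

record 'a matroid =
  ground :: "'a set"
  indeps :: "'a set set"

definition is_matroid :: "'a matroid \<Rightarrow> bool" where
  "is_matroid M \<longleftrightarrow>
     finite (ground M) \<and> indeps M \<subseteq> Pow (ground M) \<and> {} \<in> indeps M \<and>
     (\<forall>I J. I \<in> indeps M \<and> J \<subseteq> I \<longrightarrow> J \<in> indeps M) \<and>
     (\<forall>I J. I \<in> indeps M \<and> J \<in> indeps M \<and> card I < card J \<longrightarrow>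
        (\<exists>x\<in>J - I. insert x I \<in> indeps M))"

definition rk :: "'a matroid \<Rightarrow> 'a set \<Rightarrow> nat" where
  "rk M X = Max (card ` {I \<in> indeps M. I \<subseteq> X})"

abbreviation matroid_rk :: "'a matroid \<Rightarrow> nat" where
  "matroid_rk M \<equiv> rk M (ground M)"

definition crk :: "'a matroid \<Rightarrow> 'a set \<Rightarrow> int" where
  "crk M F = int (matroid_rk M) - int (rk M F)"

definition flats :: "'a matroid \<Rightarrow> 'a set set" where
  "flats M = {F. F \<subseteq> ground M \<and> (\<forall>x\<in>ground M - F. rk M F < rk M (insert x F))}"

definition circuits :: "'a matroid \<Rightarrow> 'a set set" where
  "circuits M = {C. C \<subseteq> ground M \<and> C \<notin> indeps M \<and> (\<forall>D. D \<subset> C \<longrightarrow> D \<in> indeps M)}"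

definition loops :: "'a matroid \<Rightarrow> 'a set" where
  "loops M = {x \<in> ground M. {x} \<notin> indeps M}"

definition bases_of :: "'a matroid \<Rightarrow> 'a set \<Rightarrow> 'a set set" where
  "bases_of M X = {B \<in> indeps M. B \<subseteq> X \<and> (\<forall>I\<in>indeps M. B \<subseteq> I \<and> I \<subseteq> X \<longrightarrow> I = B)}"

definition localization :: "'a matroid \<Rightarrow> 'a set \<Rightarrow> 'a matroid" where
  "localization M F = \<lparr>ground = F, indeps = {I \<in> indeps M. I \<subseteq> F}\<rparr>"

definition contraction :: "'a matroid \<Rightarrow> 'a set \<Rightarrow> 'a matroid" where
  "contraction M F =
     \<lparr>ground = ground M - F,
      indeps = {I. I \<subseteq> ground M - F \<and> (\<exists>B\<in>bases_of M F. I \<union> B \<in> indeps M)}\<rparr>"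

definition equivariant_matroid ::
  "'g monoid \<Rightarrow> 'a matroid \<Rightarrow> ('g \<Rightarrow> 'a \<Rightarrow> 'a) \<Rightarrow> bool" where
  "equivariant_matroid G M \<phi> \<longleftrightarrow>
     group G \<and> finite (carrier G) \<and> is_matroid M \<and> group_action G (ground M) \<phi> \<and>
     (\<forall>g\<in>carrier G. \<forall>F\<in>flats M. \<phi> g ` F \<in> flats M)"

definition flat_stab ::
  "'g monoid \<Rightarrow> ('g \<Rightarrow> 'a \<Rightarrow> 'a) \<Rightarrow> 'a set \<Rightarrow> 'g monoid" where
  "flat_stab G \<phi> F = G\<lparr>carrier := stabilizer G (\<lambda>g. (`) (\<phi> g)) F\<rparr>"

definition restrict_action ::
  "('g \<Rightarrow> 'a \<Rightarrow> 'a) \<Rightarrow> 'a set \<Rightarrow> 'g \<Rightarrow> 'a \<Rightarrow> 'a" where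
  "restrict_action \<phi> X = (\<lambda>g. restrict (\<phi> g) X)"


section \<open>Finite-dimensional complex representations\<close>

text \<open>A representation is a homomorphism into the invertible complex matrices of some size;
  only the values on the carrier of the group are relevant.\<close>

record 'g rep =
  rdim :: nat
  rmat :: "'g \<Rightarrow> complex mat"

definition is_rep :: "'g monoid \<Rightarrow> 'g rep \<Rightarrow> bool" where
  "is_rep G V \<longleftrightarrow>
     (\<forall>g\<in>carrier G. rmat V g \<in> carrier_mat (rdim V) (rdim V)) \<and>
     rmat V \<one>\<^bsub>G\<^esub> = 1\<^sub>m (rdim V) \<and>
     (\<forall>g\<in>carrier G. \<forall>h\<in>carrier G. rmat V (g \<otimes>\<^bsub>G\<^esub> h) = rmat V g * rmat V h)"

definition rep_iso :: "'g monoid \<Rightarrow> 'g rep \<Rightarrow> 'g rep \<Rightarrow> bool" where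
  "rep_iso G V W \<longleftrightarrow>
     rdim V = rdim W \<and>
     (\<exists>T \<in> carrier_mat (rdim V) (rdim V). invertible_mat T \<and>
        (\<forall>g\<in>carrier G. T * rmat V g = rmat W g * T))"

definition zero_rep :: "'g rep" where
  "zero_rep = \<lparr>rdim = 0, rmat = (\<lambda>_. 1\<^sub>m 0)\<rparr>"

definition triv_rep :: "'g rep" where
  "triv_rep = \<lparr>rdim = 1, rmat = (\<lambda>_. 1\<^sub>m 1)\<rparr>"

definition sum_rep :: "'g rep \<Rightarrow> 'g rep \<Rightarrow> 'g rep" where
  "sum_rep V W =
     \<lparr>rdim = rdim V + rdim W,
      rmat = (\<lambda>g. four_block_mat (rmat V g) (0\<^sub>m (rdim V) (rdim W))
                                 (0\<^sub>m (rdim W) (rdim V)) (rmat W g))\<rparr>"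

definition tensor_rep :: "'g rep \<Rightarrow> 'g rep \<Rightarrow> 'g rep" where
  "tensor_rep V W =
     (let n = rdim W in
      \<lparr>rdim = rdim V * n,
       rmat = (\<lambda>g. mat (rdim V * n) (rdim V * n)
         (\<lambda>(i, j). rmat V g $$ (i div n, j div n) * rmat W g $$ (i mod n, j mod n)))\<rparr>)"

definition left_transversal :: "'g monoid \<Rightarrow> 'g set \<Rightarrow> 'g list \<Rightarrow> bool" where
  "left_transversal G H xs \<longleftrightarrow>
     set xs \<subseteq> carrier G \<and>
     (\<forall>g\<in>carrier G. \<exists>!a. a < length xs \<and> g \<in> xs ! a <#\<^bsub>G\<^esub> H)"

text \<open>Induction of a representation \<open>V\<close> of the subgroup \<open>H\<close>: on \<open>\<Oplus>\<^sub>a x\<^sub>a V\<close>, with \<open>x\<^sub>a\<close> running through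
  representatives of the left cosets of \<open>H\<close>, the block of \<open>g\<close> in row \<open>a\<close> and column \<open>b\<close> is
  the matrix of \<open>x\<^sub>a\<^sup>-\<^sup>1 g x\<^sub>b\<close> if this lies in \<open>H\<close>, and zero otherwise.\<close>

definition ind_rep :: "'g monoid \<Rightarrow> 'g set \<Rightarrow> 'g rep \<Rightarrow> 'g rep" where
  "ind_rep G H V =
     (let xs = (SOME xs. left_transversal G H xs); n = rdim V in
      \<lparr>rdim = length xs * n,
       rmat = (\<lambda>g. mat (length xs * n) (length xs * n)
         (\<lambda>(i, j). let h = inv\<^bsub>G\<^esub> (xs ! (i div n)) \<otimes>\<^bsub>G\<^esub> g \<otimes>\<^bsub>G\<^esub> xs ! (j div n) in
            if h \<in> H then rmat V h $$ (i mod n, j mod n) else 0))\<rparr>)"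

text \<open>The permutation representation on a finite set \<open>X\<close> acted on by \<open>\<psi>\<close>, in the basis \<open>X\<close>.\<close>

definition perm_rep :: "'x set \<Rightarrow> ('g \<Rightarrow> 'x \<Rightarrow> 'x) \<Rightarrow> 'g rep" where
  "perm_rep X \<psi> =
     (let xs = (SOME xs. distinct xs \<and> set xs = X) in
      \<lparr>rdim = length xs,
       rmat = (\<lambda>g. mat (length xs) (length xs)
         (\<lambda>(i, j). if xs ! i = \<psi> g (xs ! j) then 1 else 0))\<rparr>)"


section \<open>The Grothendieck ring of representations\<close>

text \<open>A pair \<open>(V, W)\<close> stands for the formal difference \<open>V - W\<close>.\<close>

type_synonym 'g vrep = "'g rep \<times> 'g rep"

definition vreps :: "'g monoid \<Rightarrow> 'g vrep set" where
  "vreps G = {V. is_rep G V} \<times> {W. is_rep G W}"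

definition vrel :: "'g monoid \<Rightarrow> ('g vrep \<times> 'g vrep) set" where
  "vrel G = {((V, W), (V', W')). (V, W) \<in> vreps G \<and> (V', W') \<in> vreps G \<and>
     (\<exists>U. is_rep G U \<and>
        rep_iso G (sum_rep (sum_rep V W') U) (sum_rep (sum_rep V' W) U))}"

definition vadd :: "'g vrep \<Rightarrow> 'g vrep \<Rightarrow> 'g vrep" where
  "vadd x y = (sum_rep (fst x) (fst y), sum_rep (snd x) (snd y))"

definition vmult :: "'g vrep \<Rightarrow> 'g vrep \<Rightarrow> 'g vrep" where
  "vmult x y =
     (sum_rep (tensor_rep (fst x) (fst y)) (tensor_rep (snd x) (snd y)),
      sum_rep (tensor_rep (fst x) (snd y)) (tensor_rep (snd x) (fst y)))"

type_synonym 'g virtual = "'g vrep set"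

definition rep_class :: "'g monoid \<Rightarrow> 'g rep \<Rightarrow> 'g virtual" where
  "rep_class G V = vrel G `` {(V, zero_rep)}"

definition Rep :: "'g monoid \<Rightarrow> 'g virtual ring" where
  "Rep G =
     \<lparr>carrier = vreps G // vrel G,
      monoid.mult = (\<lambda>X Y. \<Union>x\<in>X. \<Union>y\<in>Y. vrel G `` {vmult x y}),
      monoid.one = rep_class G triv_rep,
      ring.zero = rep_class G zero_rep,
      ring.add = (\<lambda>X Y. \<Union>x\<in>X. \<Union>y\<in>Y. vrel G `` {vadd x y})\<rparr>"

definition Ind :: "'g monoid \<Rightarrow> 'g monoid \<Rightarrow> 'g virtual \<Rightarrow> 'g virtual" where
  "Ind G H X =
     (\<Union>x\<in>X. vrel G `` {(ind_rep G (carrier H) (fst x), ind_rep G (carrier H) (snd x))})"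


section \<open>The Orlik--Solomon algebra\<close>

text \<open>Elements of the free associative algebra on a set are finitely supported functions on words.
  The exterior algebra is its quotient by \<open>e\<^sub>x e\<^sub>x\<close> and \<open>e\<^sub>x e\<^sub>y + e\<^sub>y e\<^sub>x\<close>, so the Orlik--Solomon algebra is
  the quotient of the free algebra by these relations together with those coming from the matroid.\<close>

definition word :: "'a list \<Rightarrow> 'a list \<Rightarrow> complex" where
  "word w = (\<lambda>v. if v = w then 1 else 0)"

definition free_mult ::
  "('a list \<Rightarrow> complex) \<Rightarrow> ('a list \<Rightarrow> complex) \<Rightarrow> 'a list \<Rightarrow> complex" where
  "free_mult f h = (\<lambda>w. \<Sum>k\<le>length w. f (take k w) * h (drop k w))"

definition free_degree :: "'a set \<Rightarrow> nat \<Rightarrow> ('a list \<Rightarrow> complex) set" where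
  "free_degree E j = {f. \<forall>w. f w \<noteq> 0 \<longrightarrow> w \<in> lists E \<and> length w = j}"

definition exterior_rels :: "'a set \<Rightarrow> ('a list \<Rightarrow> complex) set" where
  "exterior_rels E =
     {word [x, x] | x. x \<in> E} \<union> {word [x, y] + word [y, x] | x y. x \<in> E \<and> y \<in> E}"

text \<open>A loop \<open>x\<close> contributes \<open>e\<^sub>x\<close>. The boundary relation is imposed for circuits with at least two
  elements: for a one-element circuit it would read \<open>1 = 0\<close>.\<close>

definition matroid_rels :: "'a matroid \<Rightarrow> ('a list \<Rightarrow> complex) set" where
  "matroid_rels M =
     {word [x] | x. x \<in> loops M} \<union>
     {(\<lambda>v. \<Sum>k<length c. (-1) ^ k * word (take k c @ drop (Suc k) c) v) | c.
        distinct c \<and> 2 \<le> length c \<and> set c \<in> circuits M}"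

definition OS_ideal :: "'a matroid \<Rightarrow> ('a list \<Rightarrow> complex) set" where
  "OS_ideal M = module.span (\<lambda>(a::complex) f w. a * f w)
     {free_mult (word u) (free_mult p (word v)) | u v p.
        u \<in> lists (ground M) \<and> v \<in> lists (ground M) \<and>
        p \<in> exterior_rels (ground M) \<union> matroid_rels M}"

text \<open>The linear extension of \<open>e\<^sub>x\<^sub>1 \<cdots> e\<^sub>x\<^sub>j \<mapsto> e\<^sub>g\<^sub>x\<^sub>1 \<cdots> e\<^sub>g\<^sub>x\<^sub>j\<close>.\<close>

definition free_action ::
  "'a set \<Rightarrow> ('g \<Rightarrow> 'a \<Rightarrow> 'a) \<Rightarrow> 'g \<Rightarrow> ('a list \<Rightarrow> complex) \<Rightarrow> 'a list \<Rightarrow> complex" where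
  "free_action E \<phi> g f = (\<lambda>v. \<Sum>w | w \<in> lists E \<and> map (\<phi> g) w = v. f w)"

text \<open>\<open>R\<close> is the matrix form, in some basis given by the classes of \<open>b 0, b 1, \<dots>\<close>, of the action
  that \<open>act\<close> induces on the quotient of the space \<open>V\<close> by its intersection with \<open>W\<close>.\<close>

definition quotient_rep ::
  "'g monoid \<Rightarrow> ('x \<Rightarrow> complex) set \<Rightarrow> ('x \<Rightarrow> complex) set \<Rightarrow>
   ('g \<Rightarrow> ('x \<Rightarrow> complex) \<Rightarrow> ('x \<Rightarrow> complex)) \<Rightarrow> 'g rep \<Rightarrow> bool" where
  "quotient_rep G V W act R \<longleftrightarrow> is_rep G R \<and>
     (\<exists>b. (\<forall>i<rdim R. b i \<in> V) \<and>
        (\<forall>f\<in>V. \<exists>c. (\<lambda>x. f x - (\<Sum>i<rdim R. c i * b i x)) \<in> W) \<and>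
        (\<forall>c. (\<lambda>x. \<Sum>i<rdim R. c i * b i x) \<in> W \<longrightarrow> (\<forall>i<rdim R. c i = 0)) \<and>
        (\<forall>g\<in>carrier G. \<forall>j<rdim R.
           (\<lambda>x. act g (b j) x - (\<Sum>i<rdim R. rmat R g $$ (i, j) * b i x)) \<in> W))"

definition OS ::
  "'g monoid \<Rightarrow> 'a matroid \<Rightarrow> ('g \<Rightarrow> 'a \<Rightarrow> 'a) \<Rightarrow> nat \<Rightarrow> 'g virtual" where
  "OS G M \<phi> j = rep_class G
     (SOME R. quotient_rep G (free_degree (ground M) j) (OS_ideal M)
        (free_action (ground M) \<phi>) R)"


section \<open>Equivariant Kazhdan--Lusztig polynomials\<close>

text \<open>Polynomials with virtual coefficients are given by their coefficient functions.\<close>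

text \<open>The coefficient of \<open>t\<^sup>k\<close> in \<open>H(t) = \<Sum>\<^sub>j (-1)\<^sup>j t\<^bsup>rk M - j\<^esup> OS\<^sup>j\<close>.\<close>

definition Hpoly ::
  "'g monoid \<Rightarrow> 'a matroid \<Rightarrow> ('g \<Rightarrow> 'a \<Rightarrow> 'a) \<Rightarrow> nat \<Rightarrow> 'g virtual" where
  "Hpoly G M \<phi> k =
     (if k \<le> matroid_rk M
      then [((-1) ^ (matroid_rk M - k) :: int)] \<cdot>\<^bsub>Rep G\<^esub> OS G M \<phi> (matroid_rk M - k)
      else \<zero>\<^bsub>Rep G\<^esub>)"

definition vpoly_mult ::
  "'g monoid \<Rightarrow> (nat \<Rightarrow> 'g virtual) \<Rightarrow> (nat \<Rightarrow> 'g virtual) \<Rightarrow> nat \<Rightarrow> 'g virtual" where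
  "vpoly_mult G p q k = (\<Oplus>\<^bsub>Rep G\<^esub>a\<in>{..k}. p a \<otimes>\<^bsub>Rep G\<^esub> q (k - a))"

text \<open>\<open>t\<^sup>n p(t\<^sup>-\<^sup>1)\<close>, for \<open>p\<close> of degree at most \<open>n\<close>.\<close>

definition vpoly_reverse ::
  "'g monoid \<Rightarrow> nat \<Rightarrow> (nat \<Rightarrow> 'g virtual) \<Rightarrow> nat \<Rightarrow> 'g virtual" where
  "vpoly_reverse G n p k = (if k \<le> n then p (n - k) else \<zero>\<^bsub>Rep G\<^esub>)"

type_synonym ('g, 'a) KL_assignment =
  "'g monoid \<Rightarrow> 'a matroid \<Rightarrow> ('g \<Rightarrow> 'a \<Rightarrow> 'a) \<Rightarrow> nat \<Rightarrow> 'g virtual"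

text \<open>The summand at a flat \<open>F\<close> is independent of the choice of \<open>F\<close> in its orbit.\<close>

definition KL_rhs :: "('g, 'a) KL_assignment \<Rightarrow> ('g, 'a) KL_assignment" where
  "KL_rhs P G M \<phi> k =
     (\<Oplus>\<^bsub>Rep G\<^esub>Q\<in>orbits G (flats M) (\<lambda>g. (`) (\<phi> g)).
        let F = (SOME F. F \<in> Q); G' = flat_stab G \<phi> F in
        Ind G G'
          (vpoly_mult G'
             (Hpoly G' (localization M F) (restrict_action \<phi> F))
             (P G' (contraction M F) (restrict_action \<phi> (ground M - F))) k))"

definition is_equivariant_KL :: "('g, 'a) KL_assignment \<Rightarrow> bool" where
  "is_equivariant_KL P \<longleftrightarrow>
     (\<forall>G M \<phi>. equivariant_matroid G M \<phi> \<longrightarrow>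
        (\<forall>k. P G M \<phi> k \<in> carrier (Rep G)) \<and>
        (matroid_rk M = 0 \<longrightarrow>
           P G M \<phi> 0 = \<one>\<^bsub>Rep G\<^esub> \<and> (\<forall>k>0. P G M \<phi> k = \<zero>\<^bsub>Rep G\<^esub>)) \<and>
        (matroid_rk M > 0 \<longrightarrow>
           (\<forall>k. real k \<ge> real (matroid_rk M) / 2 \<longrightarrow> P G M \<phi> k = \<zero>\<^bsub>Rep G\<^esub>)) \<and>
        (\<forall>k. vpoly_reverse G (matroid_rk M) (P G M \<phi>) k = KL_rhs P G M \<phi> k))"


section \<open>Flag representations\<close>

text \<open>A flag \<open>F\<^sub>r \<le> \<dots> \<le> F\<^sub>1\<close> is a function on \<open>{1..r}\<close>, as is the sequence \<open>i\<^sub>r, \<dots>, i\<^sub>1\<close> of coranks.\<close>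

definition flags :: "'a matroid \<Rightarrow> nat \<Rightarrow> (nat \<Rightarrow> int) \<Rightarrow> (nat \<Rightarrow> 'a set) set" where
  "flags M r d =
     {F \<in> {1..r} \<rightarrow>\<^sub>E flats M.
        (\<forall>j\<in>{1..<r}. F (Suc j) \<subseteq> F j) \<and> (\<forall>j\<in>{1..r}. crk M (F j) = d j)}"

definition W ::
  "'g monoid \<Rightarrow> 'a matroid \<Rightarrow> ('g \<Rightarrow> 'a \<Rightarrow> 'a) \<Rightarrow> nat \<Rightarrow> (nat \<Rightarrow> int) \<Rightarrow> 'g virtual" where
  "W G M \<phi> r d =
     rep_class G (perm_rep (flags M r d) (\<lambda>g F. \<lambda>j\<in>{1..r}. \<phi> g ` F j))"

definition t_index :: "nat set \<Rightarrow> nat \<Rightarrow> nat" where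
  "t_index S j = (LEAST k. j \<le> k \<and> k \<notin> S)"

definition index_seqs :: "'a matroid \<Rightarrow> nat \<Rightarrow> nat \<Rightarrow> (nat \<Rightarrow> int) set" where
  "index_seqs M i r =
     {a \<in> {0..r + 1} \<rightarrow>\<^sub>E UNIV. strict_mono_on {0..r + 1} a \<and>
        a 0 = 0 \<and> a r = int i \<and> a (r + 1) = int (matroid_rk M) - int i}"

end

theory Submission
  imports Defs "Jordan_Normal_Form.Determinant"
begin

text \<open>
  Elements of the representation ring are determined by their characters, so fix \<open>g \<in> G\<close> and let \<open>L\<^sup>g\<close> be
  the poset of flats fixed by \<open>g\<close>, ranked by corank. Taking characters at \<open>g\<close> turns the induction over orbits
  of flats into a sum over \<open>L\<^sup>g\<close>. The traces of \<open>g\<close> on the Orlik--Solomon algebras of the localizations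
  vanish in alternating sum, by exactness of the boundary map, and decompose over flats (Brieskorn), so they
  sum up to the Moebius function of \<open>L\<^sup>g\<close>. The recursion thus becomes a numerical Kazhdan--Lusztig recursion
  for \<open>L\<^sup>g\<close> with the nonstandard ranking inherited from \<open>M\<close>. The signed count of flags in \<open>L\<^sup>g\<close> given by the
  right-hand side solves that recursion, because the associated Z-polynomial is palindromic, as one sees by
  splitting off the smallest member of a flag.
\<close>

section \<open>Characters determine representations\<close>

text \<open>Equality in the Grothendieck group is stable isomorphism, so working with characters
  needs both directions: classes have well-defined characters, and equal characters force an
  isomorphism. The second is proved by hand, splitting off images of averaged intertwiners instead
  of decomposing into irreducibles. The poset of flats fixed by g may have covers along which the
  corank drops by more than one, so the combinatorial part asks only for a strictly decreasing
  ranking c. Let P_F be the polynomial of the interval above F and Z_E(t) = sum over F \<ge> E of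
  t^(c E - c F) P_F(t). The right side of the recursion is the sum over E of mu(E) Z_E(t). If each
  Z_E is palindromic of degree c E, then coefficient k of Z_E is the sum over F \<ge> E of
  coefficient c F - k of P_F. This depends on E only through the range of F, and the sums of mu over
  lower intervals leave just the bottom flat, that is t^n P(1/t). The Moebius function enters only
  through these sums over lower intervals. They also determine it, which gives its invariance under
  conjugation without comparing traces.\<close>

definition rchar :: "'g rep \<Rightarrow> 'g \<Rightarrow> complex" where
  "rchar V g = (\<Sum>i<rdim V. rmat V g $$ (i, i))"

lemma mat_mult_entry:
  assumes "A \<in> carrier_mat n m" "B \<in> carrier_mat m k" "i < n" "j < k"
  shows "(A * B) $$ (i, j) = (\<Sum>l<m. A $$ (i, l) * B $$ (l, j))"
  using assms by (simp add: scalar_prod_def atLeast0LessThan)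

lemma rep_carrier: "is_rep G V \<Longrightarrow> g \<in> carrier G \<Longrightarrow> rmat V g \<in> carrier_mat (rdim V) (rdim V)"
  by (simp add: is_rep_def)

lemma rep_mult:
  "is_rep G V \<Longrightarrow> g \<in> carrier G \<Longrightarrow> h \<in> carrier G \<Longrightarrow> rmat V (g \<otimes>\<^bsub>G\<^esub> h) = rmat V g * rmat V h"
  by (simp add: is_rep_def)

lemma rep_one: "is_rep G V \<Longrightarrow> rmat V \<one>\<^bsub>G\<^esub> = 1\<^sub>m (rdim V)"
  by (simp add: is_rep_def)

text \<open>The constructions below are given by matrix entries, so the homomorphism conditions are
  stated entrywise.\<close>

lemma is_repI:
  assumes "\<And>g. g \<in> carrier G \<Longrightarrow> rmat V g \<in> carrier_mat (rdim V) (rdim V)"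
    and "\<And>i j. i < rdim V \<Longrightarrow> j < rdim V \<Longrightarrow> rmat V \<one>\<^bsub>G\<^esub> $$ (i, j) = (if i = j then 1 else 0)"
    and "\<And>g h i j. g \<in> carrier G \<Longrightarrow> h \<in> carrier G \<Longrightarrow> i < rdim V \<Longrightarrow> j < rdim V \<Longrightarrow>
      rmat V (g \<otimes>\<^bsub>G\<^esub> h) $$ (i, j) = (\<Sum>k<rdim V. rmat V g $$ (i, k) * rmat V h $$ (k, j))"
    and "group G"
  shows "is_rep G V"
proof -
  interpret group G by fact
  have c: "rmat V g \<in> carrier_mat (rdim V) (rdim V)" if "g \<in> carrier G" for g
    using assms(1) that .
  have "rmat V \<one>\<^bsub>G\<^esub> = 1\<^sub>m (rdim V)"
    using assms(2) c[OF one_closed] by (intro eq_matI) auto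
  moreover have "rmat V (g \<otimes>\<^bsub>G\<^esub> h) = rmat V g * rmat V h"
    if "g \<in> carrier G" "h \<in> carrier G" for g h
    using assms(3)[OF that] c[OF that(1)] c[OF that(2)] c[OF m_closed[OF that]]
    by (intro eq_matI) (auto simp: mat_mult_entry[of _ "rdim V" "rdim V" _ "rdim V"] simp del: index_mult_mat(1))
  ultimately show ?thesis using c by (simp add: is_rep_def)
qed

section \<open>Isomorphisms of matrix representations\<close>

definition mat_inverses :: "nat \<Rightarrow> complex mat \<Rightarrow> complex mat \<Rightarrow> bool" where
  "mat_inverses n A B \<longleftrightarrow> A \<in> carrier_mat n n \<and> B \<in> carrier_mat n n \<and> A * B = 1\<^sub>m n \<and> B * A = 1\<^sub>m n"

lemma mat_inversesI:
  assumes "A \<in> carrier_mat n n" "B \<in> carrier_mat n n" "A * B = 1\<^sub>m n"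
  shows "mat_inverses n A B"
  using assms mat_mult_left_right_inverse[OF assms] by (simp add: mat_inverses_def)

lemma mat_inverses_sym: "mat_inverses n A B \<Longrightarrow> mat_inverses n B A"
  by (simp add: mat_inverses_def)

lemma mat_inverses_mult:
  assumes "mat_inverses n A A'" "mat_inverses n B B'"
  shows "mat_inverses n (A * B) (B' * A')"
proof (rule mat_inversesI)
  have c: "A \<in> carrier_mat n n" "B \<in> carrier_mat n n" "A' \<in> carrier_mat n n" "B' \<in> carrier_mat n n"
    using assms by (auto simp: mat_inverses_def)
  show "A * B \<in> carrier_mat n n" "B' * A' \<in> carrier_mat n n" using c by auto
  have "A * B * (B' * A') = A * (B * B') * A'"
    using c by (simp add: assoc_mult_mat[of _ n n _ n _ n])
  then show "A * B * (B' * A') = 1\<^sub>m n"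
    using assms c by (simp add: mat_inverses_def)
qed

lemma mat_inverses_one: "mat_inverses n (1\<^sub>m n) (1\<^sub>m n)"
  by (simp add: mat_inverses_def)

text \<open>\<open>inverts_mat\<close> does not prescribe the shape of the inverse; it is recovered
  by comparing the dimensions of the two products with those of identity matrices.\<close>

lemma invertible_mat_iff:
  assumes "T \<in> carrier_mat n n"
  shows "invertible_mat T \<longleftrightarrow> (\<exists>S. mat_inverses n T S)"
proof
  assume "invertible_mat T"
  then obtain S where S: "inverts_mat T S" "inverts_mat S T"
    by (auto simp: invertible_mat_def)
  have TS: "T * S = 1\<^sub>m n" and ST: "S * T = 1\<^sub>m (dim_row S)"
    using S assms by (auto simp: inverts_mat_def)
  have "dim_col S = n" using arg_cong[OF TS, of dim_col] by simp
  moreover have "dim_row S = n" using arg_cong[OF ST, of dim_col] assms by simp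
  ultimately have "S \<in> carrier_mat n n" by auto
  then show "\<exists>S. mat_inverses n T S" using mat_inversesI[OF assms _ TS] by blast
next
  assume "\<exists>S. mat_inverses n T S"
  then show "invertible_mat T"
    by (auto simp: invertible_mat_def mat_inverses_def inverts_mat_def)
qed

lemma rep_isoI:
  assumes "rdim V = n" "rdim V' = n" "mat_inverses n T S"
    and "\<And>g. g \<in> carrier G \<Longrightarrow> T * rmat V g = rmat V' g * T"
  shows "rep_iso G V V'"
  using assms invertible_mat_iff[of T n] by (auto simp: rep_iso_def mat_inverses_def)

lemma rep_isoE:
  assumes "rep_iso G V V'"
  obtains T S where "rdim V' = rdim V" "mat_inverses (rdim V) T S"
    "\<And>g. g \<in> carrier G \<Longrightarrow> T * rmat V g = rmat V' g * T"
proof -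
  obtain T where T: "rdim V = rdim V'" "T \<in> carrier_mat (rdim V) (rdim V)" "invertible_mat T"
    "\<forall>g\<in>carrier G. T * rmat V g = rmat V' g * T"
    using assms by (auto simp: rep_iso_def)
  moreover obtain S where "mat_inverses (rdim V) T S"
    using T invertible_mat_iff by blast
  ultimately show thesis using that[of T S] by auto
qed

lemma rep_iso_sym:
  assumes "is_rep G V" "is_rep G V'" "rep_iso G V V'"
  shows "rep_iso G V' V"
proof -
  obtain T S where TS: "rdim V' = rdim V" "mat_inverses (rdim V) T S"
    "\<And>g. g \<in> carrier G \<Longrightarrow> T * rmat V g = rmat V' g * T"
    using assms(3) by (rule rep_isoE) blast
  let ?n = "rdim V"
  have c: "T \<in> carrier_mat ?n ?n" "S \<in> carrier_mat ?n ?n" "T * S = 1\<^sub>m ?n" "S * T = 1\<^sub>m ?n"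
    using TS by (auto simp: mat_inverses_def)
  show ?thesis
  proof (rule rep_isoI[of _ ?n _ S T])
    fix g assume g: "g \<in> carrier G"
    have v: "rmat V g \<in> carrier_mat ?n ?n" and w: "rmat V' g \<in> carrier_mat ?n ?n"
      using rep_carrier[OF assms(1) g] rep_carrier[OF assms(2) g] TS(1) by auto
    have "S * rmat V' g = S * rmat V' g * (T * S)" using c v w by simp
    also have "\<dots> = S * (rmat V' g * T) * S"
      using c v w by (simp add: assoc_mult_mat[of _ ?n ?n _ ?n _ ?n])
    also have "\<dots> = S * (T * rmat V g) * S" using TS(3)[OF g] by simp
    also have "S * (T * rmat V g) = S * T * rmat V g"
      using c v by (intro assoc_mult_mat[symmetric]) auto
    also have "S * T * rmat V g * S = rmat V g * S" using c v by simp
    finally show "S * rmat V' g = rmat V g * S" .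
  qed (use TS mat_inverses_sym in auto)
qed

lemma rep_iso_trans:
  assumes "is_rep G U" "is_rep G V" "is_rep G V'" "rep_iso G U V" "rep_iso G V V'"
  shows "rep_iso G U V'"
proof -
  obtain T S where TS: "rdim V = rdim U" "mat_inverses (rdim U) T S"
    "\<And>g. g \<in> carrier G \<Longrightarrow> T * rmat U g = rmat V g * T"
    using assms(4) by (rule rep_isoE) blast
  obtain T' S' where TS': "rdim V' = rdim V" "mat_inverses (rdim V) T' S'"
    "\<And>g. g \<in> carrier G \<Longrightarrow> T' * rmat V g = rmat V' g * T'"
    using assms(5) by (rule rep_isoE) blast
  let ?n = "rdim U"
  have c: "T \<in> carrier_mat ?n ?n" "T' \<in> carrier_mat ?n ?n"
    using TS TS' by (auto simp: mat_inverses_def)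
  show ?thesis
  proof (rule rep_isoI[of _ ?n _ "T' * T" "S * S'"])
    show "mat_inverses ?n (T' * T) (S * S')"
      using TS TS' by (intro mat_inverses_mult) auto
    fix g assume g: "g \<in> carrier G"
    have m: "rmat U g \<in> carrier_mat ?n ?n" "rmat V g \<in> carrier_mat ?n ?n" "rmat V' g \<in> carrier_mat ?n ?n"
      using rep_carrier[OF assms(1) g] rep_carrier[OF assms(2) g] rep_carrier[OF assms(3) g] TS(1) TS'(1)
      by auto
    have "T' * T * rmat U g = T' * (T * rmat U g)"
      using c m by (simp add: assoc_mult_mat[of _ ?n ?n _ ?n _ ?n])
    also have "\<dots> = T' * rmat V g * T"
      using c m TS(3)[OF g] by (simp add: assoc_mult_mat[of _ ?n ?n _ ?n _ ?n])
    also have "\<dots> = rmat V' g * (T' * T)"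
      using c m TS'(3)[OF g] by (simp add: assoc_mult_mat[of _ ?n ?n _ ?n _ ?n])
    finally show "T' * T * rmat U g = rmat V' g * (T' * T)" .
  qed (use TS TS' in auto)
qed

section \<open>Traces, averaging and intertwiners\<close>

lemma trace_mult_commute:
  assumes "A \<in> carrier_mat n m" "B \<in> carrier_mat m n"
  shows "(\<Sum>i<n. (A * B) $$ (i, i)) = (\<Sum>i<m. (B * A) $$ (i, i :: nat) :: complex)"
proof -
  have "(\<Sum>i<n. (A * B) $$ (i, i)) = (\<Sum>i<n. \<Sum>l<m. A $$ (i, l) * B $$ (l, i))"
    using assms by (intro sum.cong) (auto simp: mat_mult_entry simp del: index_mult_mat(1))
  also have "\<dots> = (\<Sum>l<m. \<Sum>i<n. B $$ (l, i) * A $$ (i, l))"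
    by (subst sum.swap) (simp add: mult.commute)
  also have "\<dots> = (\<Sum>i<m. (B * A) $$ (i, i))"
    using assms by (intro sum.cong) (auto simp: mat_mult_entry simp del: index_mult_mat(1))
  finally show ?thesis .
qed

lemma rchar_iso:
  assumes "is_rep G V" "is_rep G V'" "rep_iso G V V'" "g \<in> carrier G"
  shows "rchar V g = rchar V' g"
proof -
  obtain T S where TS: "rdim V' = rdim V" "mat_inverses (rdim V) T S"
    "\<And>g. g \<in> carrier G \<Longrightarrow> T * rmat V g = rmat V' g * T"
    using assms(3) by (rule rep_isoE) blast
  let ?n = "rdim V"
  have c: "T \<in> carrier_mat ?n ?n" "S \<in> carrier_mat ?n ?n" "T * S = 1\<^sub>m ?n" "S * T = 1\<^sub>m ?n"
    using TS by (auto simp: mat_inverses_def)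
  have v: "rmat V g \<in> carrier_mat ?n ?n" and w: "rmat V' g \<in> carrier_mat ?n ?n"
    using rep_carrier[OF assms(1,4)] rep_carrier[OF assms(2,4)] TS(1) by auto
  have "rmat V g = S * (T * rmat V g)"
    using c v by (simp add: assoc_mult_mat[of _ ?n ?n _ ?n _ ?n, symmetric])
  also have "\<dots> = S * (rmat V' g * T)" using TS(3)[OF assms(4)] by simp
  finally have "rchar V g = (\<Sum>i<?n. (S * (rmat V' g * T)) $$ (i, i))"
    by (simp add: rchar_def)
  also have "\<dots> = (\<Sum>i<?n. (rmat V' g * T * S) $$ (i, i))"
    using c w by (intro trace_mult_commute) auto
  also have "rmat V' g * T * S = rmat V' g"
    using c w by (simp add: assoc_mult_mat[of _ ?n ?n _ ?n _ ?n])
  finally show ?thesis using TS(1) by (simp add: rchar_def)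
qed

lemma rchar_one: "is_rep G V \<Longrightarrow> rchar V \<one>\<^bsub>G\<^esub> = of_nat (rdim V)"
  by (simp add: rchar_def rep_one)

lemma sum_group_translate:
  assumes "group G" "g \<in> carrier G"
  shows "(\<Sum>h\<in>carrier G. f h) = (\<Sum>h\<in>carrier G. f (g \<otimes>\<^bsub>G\<^esub> h))"
proof -
  interpret group G by fact
  show ?thesis
    by (rule sum.reindex_bij_witness[of _ "\<lambda>h. g \<otimes>\<^bsub>G\<^esub> h" "\<lambda>h. inv\<^bsub>G\<^esub> g \<otimes>\<^bsub>G\<^esub> h"])
      (use assms in \<open>auto simp: m_assoc[symmetric]\<close>)
qed

text \<open>The averaged Gram matrix is positive definite and intertwines a representation with its
  conjugate dual.\<close>

lemma rchar_inv:
  assumes "group G" "finite (carrier G)" "is_rep G V" "g \<in> carrier G"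
  shows "rchar V (inv\<^bsub>G\<^esub> g) = cnj (rchar V g)"
proof -
  interpret group G by fact
  let ?n = "rdim V"
  define v where "v = (\<lambda>h i j. rmat V h $$ (i, j))"
  define H where "H = mat ?n ?n (\<lambda>(i, j). \<Sum>h\<in>carrier G. \<Sum>k<?n. cnj (v h k i) * v h k j)"
  have H: "H \<in> carrier_mat ?n ?n" by (simp add: H_def)
  have vc: "rmat V h \<in> carrier_mat ?n ?n" if "h \<in> carrier G" for h
    using rep_carrier[OF assms(3) that] .
  have vm: "v (x \<otimes>\<^bsub>G\<^esub> h) i j = (\<Sum>k<?n. v x i k * v h k j)"
    if "x \<in> carrier G" "h \<in> carrier G" "i < ?n" "j < ?n" for x h i j
    using that vc unfolding v_def rep_mult[OF assms(3) that(1,2)]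
    by (simp add: mat_mult_entry[of _ ?n ?n _ ?n] del: index_mult_mat(1))
  \<comment> \<open>A kernel vector u gives 0 = u* H u, the sum over h of the squared lengths of h
    u. The summand at the identity is the squared length of u itself.\<close>
  have "det H \<noteq> 0"
  proof
    assume "det H = 0"
    then obtain u where u: "u \<in> carrier_vec ?n" "u \<noteq> 0\<^sub>v ?n" "H *\<^sub>v u = 0\<^sub>v ?n"
      using det_0_iff_vec_prod_zero[OF H] by auto
    have Hu: "(\<Sum>j<?n. H $$ (i, j) * u $ j) = 0" if "i < ?n" for i
      using arg_cong[OF u(3), of "\<lambda>w. w $ i"] that H u(1)
      by (simp add: scalar_prod_def atLeast0LessThan)
    define y where "y = (\<lambda>h k. \<Sum>j<?n. v h k j * u $ j)"
    have "0 = (\<Sum>i<?n. cnj (u $ i) * (\<Sum>j<?n. H $$ (i, j) * u $ j))"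
      using Hu by simp
    also have "\<dots> = (\<Sum>i<?n. \<Sum>j<?n. \<Sum>h\<in>carrier G. \<Sum>k<?n. (cnj (v h k i) * cnj (u $ i)) * (v h k j * u $ j))"
    proof (rule sum.cong[OF refl])
      fix i assume i: "i \<in> {..<?n}"
      have "(\<Sum>j<?n. H $$ (i, j) * u $ j) = (\<Sum>j<?n. (\<Sum>h\<in>carrier G. \<Sum>k<?n. cnj (v h k i) * v h k j) * u $ j)"
        using i by (intro sum.cong refl) (simp add: H_def)
      then show "cnj (u $ i) * (\<Sum>j<?n. H $$ (i, j) * u $ j) =
          (\<Sum>j<?n. \<Sum>h\<in>carrier G. \<Sum>k<?n. (cnj (v h k i) * cnj (u $ i)) * (v h k j * u $ j))"
        by (simp only: sum_distrib_left sum_distrib_right) (simp only: mult_ac)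
    qed
    also have "\<dots> = (\<Sum>h\<in>carrier G. \<Sum>k<?n. \<Sum>i<?n. \<Sum>j<?n. (cnj (v h k i) * cnj (u $ i)) * (v h k j * u $ j))"
    proof -
      have "(\<Sum>i<?n. \<Sum>j<?n. \<Sum>h\<in>carrier G. \<Sum>k<?n. F i j h k) = (\<Sum>h\<in>carrier G. \<Sum>k<?n. \<Sum>i<?n. \<Sum>j<?n. F i j h k)"
        for F :: "nat \<Rightarrow> nat \<Rightarrow> 'a \<Rightarrow> nat \<Rightarrow> complex"
      proof -
        have "(\<Sum>i<?n. \<Sum>j<?n. \<Sum>h\<in>carrier G. \<Sum>k<?n. F i j h k) = (\<Sum>(i,j)\<in>{..<?n}\<times>{..<?n}. \<Sum>(h,k)\<in>carrier G\<times>{..<?n}. F i j h k)"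
          unfolding sum.cartesian_product[symmetric] ..
        also have "\<dots> = (\<Sum>(h,k)\<in>carrier G\<times>{..<?n}. \<Sum>(i,j)\<in>{..<?n}\<times>{..<?n}. F i j h k)"
          unfolding split_def by (rule sum.swap)
        finally show ?thesis unfolding sum.cartesian_product[symmetric] .
      qed
      then show ?thesis .
    qed
    also have "\<dots> = (\<Sum>h\<in>carrier G. \<Sum>k<?n. cnj (y h k) * y h k)"
      unfolding y_def cnj_sum complex_cnj_mult sum_product ..
    also have "\<dots> = of_real (\<Sum>h\<in>carrier G. \<Sum>k<?n. (cmod (y h k))\<^sup>2)"
      unfolding of_real_sum complex_norm_square by (simp only: mult.commute)
    finally have "complex_of_real (\<Sum>h\<in>carrier G. \<Sum>k<?n. (cmod (y h k))\<^sup>2) = 0" by (rule sym)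
    then have "(\<Sum>h\<in>carrier G. \<Sum>k<?n. (cmod (y h k))\<^sup>2) = 0" by (simp only: of_real_eq_0_iff)
    then have "(\<Sum>k<?n. (cmod (y \<one>\<^bsub>G\<^esub> k))\<^sup>2) = 0"
      using assms(2) by (subst (asm) sum_nonneg_eq_0_iff) (auto intro: sum_nonneg)
    then have "\<forall>k<?n. y \<one>\<^bsub>G\<^esub> k = 0"
      by (subst (asm) sum_nonneg_eq_0_iff) auto
    moreover have "y \<one>\<^bsub>G\<^esub> k = u $ k" if "k < ?n" for k
    proof -
      have "y \<one>\<^bsub>G\<^esub> k = (\<Sum>j<?n. if j = k then u $ k else 0)"
        unfolding y_def v_def rep_one[OF assms(3)] using that by (intro sum.cong) auto
      then show ?thesis using that by simp
    qed
    ultimately have "u = 0\<^sub>v ?n" using u(1) by (intro eq_vecI) auto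
    then show False using u(2) by simp
  qed
  then obtain K where K: "K \<in> carrier_mat ?n ?n" "K * H = 1\<^sub>m ?n" "H * K = 1\<^sub>m ?n"
    using det_non_zero_imp_unit[OF H, of "()"] by (auto simp: Units_def ring_mat_def)
  \<comment> \<open>D is the conjugate transpose of the matrix of the inverse of g. Once H
    intertwines, V(g) is similar to D, and the trace of D is the conjugate of the character at the
    inverse.\<close>
  define D where "D = mat ?n ?n (\<lambda>(i, j). cnj (v (inv\<^bsub>G\<^esub> g) j i))"
  have D: "D \<in> carrier_mat ?n ?n" by (simp add: D_def)
  have HV: "H * rmat V g = D * H"
  proof (rule eq_matI)
    fix i j assume ij: "i < dim_row (D * H)" "j < dim_col (D * H)"
    then have ij: "i < ?n" "j < ?n" using D H by auto
    have "(H * rmat V g) $$ (i, j) = (\<Sum>l<?n. (\<Sum>h\<in>carrier G. \<Sum>k<?n. cnj (v h k i) * v h k l) * v g l j)"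
      using ij vc[OF assms(4)] by (simp add: H_def v_def mat_mult_entry[of _ ?n ?n _ ?n] del: index_mult_mat(1))
    also have "\<dots> = (\<Sum>h\<in>carrier G. \<Sum>k<?n. \<Sum>l<?n. cnj (v h k i) * v h k l * v g l j)"
      by (simp only: sum_distrib_right)
        (subst sum.swap, rule sum.cong[OF refl], rule sum.swap)
    also have "\<dots> = (\<Sum>h\<in>carrier G. \<Sum>k<?n. cnj (v h k i) * v (h \<otimes>\<^bsub>G\<^esub> g) k j)"
      using ij assms(4) by (intro sum.cong refl) (simp add: vm sum_distrib_left mult.assoc)
    also have "\<dots> = (\<Sum>h\<in>carrier G. \<Sum>k<?n. cnj (v (h \<otimes>\<^bsub>G\<^esub> inv\<^bsub>G\<^esub> g) k i) * v h k j)"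
      by (rule sum.reindex_bij_witness[of _ "\<lambda>h. h \<otimes>\<^bsub>G\<^esub> inv\<^bsub>G\<^esub> g" "\<lambda>h. h \<otimes>\<^bsub>G\<^esub> g"])
        (use assms(4) in \<open>auto simp: m_assoc\<close>)
    also have "\<dots> = (\<Sum>h\<in>carrier G. \<Sum>k<?n. \<Sum>l<?n. cnj (v h k l) * cnj (v (inv\<^bsub>G\<^esub> g) l i) * v h k j)"
      using ij assms(4) by (intro sum.cong refl) (simp add: vm sum_distrib_right)
    also have "\<dots> = (\<Sum>l<?n. cnj (v (inv\<^bsub>G\<^esub> g) l i) * (\<Sum>h\<in>carrier G. \<Sum>k<?n. cnj (v h k l) * v h k j))"
      by (subst sum.swap[of _ "{..<?n}" "{..<?n}"], subst sum.swap)
        (simp only: sum_distrib_left mult_ac)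
    also have "\<dots> = (D * H) $$ (i, j)"
      using ij by (simp add: H_def D_def mat_mult_entry[of _ ?n ?n _ ?n] del: index_mult_mat(1))
    finally show "(H * rmat V g) $$ (i, j) = (D * H) $$ (i, j)" .
  qed (use D H vc[OF assms(4)] in auto)
  have "rmat V g = K * (H * rmat V g)"
    using K H vc[OF assms(4)] by (simp add: assoc_mult_mat[of _ ?n ?n _ ?n _ ?n, symmetric])
  then have "rchar V g = (\<Sum>i<?n. (K * (D * H)) $$ (i, i))" by (simp add: rchar_def HV)
  also have "\<dots> = (\<Sum>i<?n. (D * H * K) $$ (i, i))"
    using K D H by (intro trace_mult_commute) auto
  also have "D * H * K = D"
    using K D H by (simp add: assoc_mult_mat[of _ ?n ?n _ ?n _ ?n])
  also have "(\<Sum>i<?n. D $$ (i, i)) = cnj (rchar V (inv\<^bsub>G\<^esub> g))"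
    by (simp add: D_def v_def rchar_def)
  finally show ?thesis by simp
qed

text \<open>\<open>T p q\<close> averages the matrix unit with entry 1 at (p, q) between the two
  representations, up to a factor. If all of them vanished, adding the (p, q) entry of
  \<open>T p q\<close> over all p and q would make the sum over h of the squared absolute values of
  the common character zero, although its value at the identity is the dimension.\<close>

lemma nonzero_intertwiner:
  assumes "group G" "finite (carrier G)" "is_rep G V" "is_rep G V'"
    and "rdim V = n" "rdim V' = n" "n > 0" "\<And>g. g \<in> carrier G \<Longrightarrow> rchar V g = rchar V' g"
  obtains T where "T \<in> carrier_mat n n" "T \<noteq> 0\<^sub>m n n"
    "\<And>g. g \<in> carrier G \<Longrightarrow> T * rmat V g = rmat V' g * T"
proof -
  interpret group G by fact
  define v where "v = (\<lambda>h i j. rmat V h $$ (i, j))"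
  define w where "w = (\<lambda>h i j. rmat V' h $$ (i, j))"
  have vc: "rmat V h \<in> carrier_mat n n" "rmat V' h \<in> carrier_mat n n" if "h \<in> carrier G" for h
    using rep_carrier[OF assms(3) that] rep_carrier[OF assms(4) that] assms by auto
  have vm: "v (x \<otimes>\<^bsub>G\<^esub> h) i j = (\<Sum>k<n. v x i k * v h k j)"
       "w (x \<otimes>\<^bsub>G\<^esub> h) i j = (\<Sum>k<n. w x i k * w h k j)"
    if "x \<in> carrier G" "h \<in> carrier G" "i < n" "j < n" for x h i j
    using that vc unfolding v_def w_def rep_mult[OF assms(3) that(1,2)] rep_mult[OF assms(4) that(1,2)]
    by (simp_all add: mat_mult_entry[of _ n n _ n] del: index_mult_mat(1))
  define T where "T = (\<lambda>p q. mat n n (\<lambda>(i, j). \<Sum>h\<in>carrier G. w h i p * v (inv\<^bsub>G\<^esub> h) q j))"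
  have T: "T p q \<in> carrier_mat n n" for p q by (simp add: T_def)
  have inter: "T p q * rmat V g = rmat V' g * T p q" if "g \<in> carrier G" "p < n" "q < n" for g p q
  proof (rule eq_matI)
    fix i j assume "i < dim_row (rmat V' g * T p q)" "j < dim_col (rmat V' g * T p q)"
    then have ij: "i < n" "j < n" using T[of p q] vc[OF that(1)] by auto
    have "(T p q * rmat V g) $$ (i, j) = (\<Sum>l<n. (\<Sum>h\<in>carrier G. w h i p * v (inv\<^bsub>G\<^esub> h) q l) * v g l j)"
      using ij vc[OF that(1)] by (simp add: T_def v_def mat_mult_entry[of _ n n _ n] del: index_mult_mat(1))
    also have "\<dots> = (\<Sum>h\<in>carrier G. w h i p * v (inv\<^bsub>G\<^esub> h \<otimes>\<^bsub>G\<^esub> g) q j)"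
      using ij that by (simp add: vm sum_distrib_right sum_distrib_left mult.assoc)
        (subst sum.swap, simp)
    also have "\<dots> = (\<Sum>h\<in>carrier G. w (g \<otimes>\<^bsub>G\<^esub> h) i p * v (inv\<^bsub>G\<^esub> (g \<otimes>\<^bsub>G\<^esub> h) \<otimes>\<^bsub>G\<^esub> g) q j)"
      by (rule sum_group_translate) fact+
    also have "\<dots> = (\<Sum>h\<in>carrier G. w (g \<otimes>\<^bsub>G\<^esub> h) i p * v (inv\<^bsub>G\<^esub> h) q j)"
      using that by (intro sum.cong refl) (simp add: inv_mult_group m_assoc)
    also have "\<dots> = (\<Sum>l<n. w g i l * (\<Sum>h\<in>carrier G. w h l p * v (inv\<^bsub>G\<^esub> h) q j))"
      using ij that by (simp add: vm sum_distrib_right sum_distrib_left mult.assoc)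
        (subst sum.swap, simp)
    also have "\<dots> = (rmat V' g * T p q) $$ (i, j)"
      using ij vc[OF that(1)] by (simp add: T_def w_def mat_mult_entry[of _ n n _ n] del: index_mult_mat(1))
    finally show "(T p q * rmat V g) $$ (i, j) = (rmat V' g * T p q) $$ (i, j)" .
  qed (use T[of p q] vc[OF that(1)] in auto)
  \<comment> \<open>The entry (p, q) of \<open>T p q\<close> involves only diagonal entries, so the
    double sum factors into two characters.\<close>
  have "\<exists>p<n. \<exists>q<n. T p q \<noteq> 0\<^sub>m n n"
  proof (rule ccontr)
    assume "\<not> ?thesis"
    then have z: "T p q $$ (p, q) = 0" if "p < n" "q < n" for p q using that by auto
    have "0 = (\<Sum>p<n. \<Sum>q<n. T p q $$ (p, q))" using z by simp
    also have "\<dots> = (\<Sum>p<n. \<Sum>q<n. \<Sum>h\<in>carrier G. w h p p * v (inv\<^bsub>G\<^esub> h) q q)"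
      by (simp add: T_def)
    also have "\<dots> = (\<Sum>h\<in>carrier G. \<Sum>p<n. \<Sum>q<n. w h p p * v (inv\<^bsub>G\<^esub> h) q q)"
      by (subst (2) sum.swap, subst sum.swap) simp
    also have "\<dots> = (\<Sum>h\<in>carrier G. rchar V' h * rchar V (inv\<^bsub>G\<^esub> h))"
      by (simp add: sum_product rchar_def v_def w_def assms(5,6))
    also have "\<dots> = (\<Sum>h\<in>carrier G. of_real ((cmod (rchar V h))\<^sup>2))"
    proof (rule sum.cong[OF refl])
      fix h assume h: "h \<in> carrier G"
      show "rchar V' h * rchar V (inv\<^bsub>G\<^esub> h) = of_real ((cmod (rchar V h))\<^sup>2)"
        unfolding rchar_inv[OF assms(1,2,3) h] assms(8)[OF h, symmetric] complex_norm_square ..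
    qed
    also have "\<dots> = of_real (\<Sum>h\<in>carrier G. (cmod (rchar V h))\<^sup>2)" by simp
    finally have "complex_of_real (\<Sum>h\<in>carrier G. (cmod (rchar V h))\<^sup>2) = 0" by (rule sym)
    then have "(\<Sum>h\<in>carrier G. (cmod (rchar V h))\<^sup>2) = 0" by (simp only: of_real_eq_0_iff)
    then have "rchar V \<one>\<^bsub>G\<^esub> = 0"
      using assms(2) by (subst (asm) sum_nonneg_eq_0_iff) auto
    then show False using rchar_one[OF assms(3)] assms(5,7) by simp
  qed
  then show thesis using that T inter by blast
qed

section \<open>Rank normal form of a complex matrix\<close>

lemma mat_inverses_permutation:
  fixes \<pi> \<rho> :: "nat \<Rightarrow> nat"
  assumes "\<And>i. i < n \<Longrightarrow> \<pi> i < n" "\<And>i. i < n \<Longrightarrow> \<rho> (\<pi> i) = i" "\<And>i. i < n \<Longrightarrow> \<rho> i < n" "\<And>i. i < n \<Longrightarrow> \<pi> (\<rho> i) = i"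
  shows "mat_inverses n (mat n n (\<lambda>(i, j). if j = \<pi> i then 1 else 0)) (mat n n (\<lambda>(i, j). if j = \<rho> i then 1 else 0))"
proof (rule mat_inversesI)
  show "mat n n (\<lambda>(i, j). if j = \<pi> i then 1 else 0) * mat n n (\<lambda>(i, j). if j = \<rho> i then 1 else 0) = (1\<^sub>m n :: complex mat)"
    (is "?A * ?B = _")
  proof (rule eq_matI)
    fix i j assume "i < dim_row (1\<^sub>m n :: complex mat)" "j < dim_col (1\<^sub>m n :: complex mat)"
    then have ij: "i < n" "j < n" by auto
    have "(?A * ?B) $$ (i, j) = (\<Sum>l<n. (if l = \<pi> i then 1 else 0) * (if j = \<rho> l then 1 else 0))"
      using ij by (subst mat_mult_entry[of _ n n _ n]) auto
    also have "\<dots> = (\<Sum>l<n. if l = \<pi> i then (if j = \<rho> l then 1 else 0) else 0)"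
      by (intro sum.cong) auto
    also have "\<dots> = (if j = i then 1 else 0)" using ij assms by simp
    finally show "(?A * ?B) $$ (i, j) = (1\<^sub>m n :: complex mat) $$ (i, j)" using ij by auto
  qed auto
qed auto

lemma permutation_mat_mult:
  assumes "\<And>i. i < n \<Longrightarrow> \<pi> i < n" "A \<in> carrier_mat n m" "i < n" "j < m"
  shows "(mat n n (\<lambda>(i, j). if j = \<pi> i then 1 else 0) * A) $$ (i, j) = (A $$ (\<pi> i, j) :: complex)"
proof -
  have "(mat n n (\<lambda>(i, j). if j = \<pi> i then 1 else 0) * A) $$ (i, j)
      = (\<Sum>l<n. (if l = \<pi> i then 1 else 0) * A $$ (l, j))"
    using assms by (subst mat_mult_entry[of _ n n _ m]) auto
  also have "\<dots> = (\<Sum>l<n. if l = \<pi> i then A $$ (l, j) else 0)" by (intro sum.cong) auto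
  finally show ?thesis using assms by simp
qed

lemma mult_permutation_mat:
  assumes "\<And>i. i < n \<Longrightarrow> \<pi> i < n" "\<And>i. i < n \<Longrightarrow> \<rho> (\<pi> i) = i" "\<And>i. i < n \<Longrightarrow> \<rho> i < n" "\<And>i. i < n \<Longrightarrow> \<pi> (\<rho> i) = i"
    and "A \<in> carrier_mat m n" "i < m" "j < n"
  shows "(A * mat n n (\<lambda>(i, j). if j = \<pi> i then 1 else 0)) $$ (i, j) = (A $$ (i, \<rho> j) :: complex)"
proof -
  have "(A * mat n n (\<lambda>(i, j). if j = \<pi> i then 1 else 0)) $$ (i, j)
      = (\<Sum>l<n. A $$ (i, l) * (if j = \<pi> l then 1 else 0))"
    using assms by (subst mat_mult_entry[of _ m n _ n]) auto
  also have "\<dots> = (\<Sum>l<n. if l = \<rho> j then A $$ (i, l) else 0)"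
    using assms by (intro sum.cong) auto
  finally show ?thesis using assms by simp
qed

text \<open>\<open>B\<close> scales the pivot row and clears the first column, \<open>A\<close>
  clears the first row, and \<open>T'\<close> is the Schur complement of the pivot.\<close>

lemma pivot_elimination:
  fixes T :: "complex mat"
  assumes T: "T \<in> carrier_mat (Suc n) (Suc n)" and t: "T $$ (0, 0) \<noteq> 0"
  obtains A A' B B' T' where "mat_inverses (Suc n) A A'" "mat_inverses (Suc n) B B'" "T' \<in> carrier_mat n n"
    "B * T * A = four_block_mat (1\<^sub>m 1) (0\<^sub>m 1 n) (0\<^sub>m n 1) T'"
proof -
  let ?t = "T $$ (0, 0)" and ?m = "Suc n"
  define B where "B = mat ?m ?m (\<lambda>(i, j). if j = 0 then if i = 0 then 1 / ?t else - T $$ (i, 0) / ?t else if i = j then 1 else 0)"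
  define B' where "B' = mat ?m ?m (\<lambda>(i, j). if j = 0 then T $$ (i, 0) else if i = j then 1 else 0)"
  define A where "A = mat ?m ?m (\<lambda>(i, j). if i = 0 then if j = 0 then 1 else - T $$ (0, j) / ?t else if i = j then 1 else 0)"
  define A' where "A' = mat ?m ?m (\<lambda>(i, j). if i = 0 then if j = 0 then 1 else T $$ (0, j) / ?t else if i = j then 1 else 0)"
  define T' where "T' = mat n n (\<lambda>(i, j). T $$ (Suc i, Suc j) - T $$ (Suc i, 0) * T $$ (0, Suc j) / ?t)"
  have B: "B \<in> carrier_mat ?m ?m" and B': "B' \<in> carrier_mat ?m ?m"
    and A: "A \<in> carrier_mat ?m ?m" and A': "A' \<in> carrier_mat ?m ?m"
    by (auto simp: B_def B'_def A_def A'_def)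
  have split: "(\<Sum>l<?m. f l) = f 0 + (\<Sum>l<n. f (Suc l))" for f :: "nat \<Rightarrow> complex"
    by (rule sum.lessThan_Suc_shift)
  have delta: "(\<Sum>l<n. (if i = l then 1 else 0) * f l) = (if i < n then f i else 0)"
    "(\<Sum>l<n. f l * (if l = i then 1 else 0)) = (if i < n then f i else 0)"
    "(\<Sum>l<n. if i = l then f l else 0) = (if i < n then f i else 0)"
    "(\<Sum>l<n. if l = i then f l else 0) = (if i < n then f i else 0)" for f :: "nat \<Rightarrow> complex" and i
  proof -
    show "(\<Sum>l<n. if i = l then f l else 0) = (if i < n then f i else 0)" by simp
    then have *: "(\<Sum>l<n. if l = i then f l else 0) = (if i < n then f i else 0)" by simp
    have "(\<Sum>l<n. (if i = l then 1 else 0) * f l) = (\<Sum>l<n. if l = i then f l else 0)"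
      by (intro sum.cong) auto
    then show "(\<Sum>l<n. (if i = l then 1 else 0) * f l) = (if i < n then f i else 0)" using * by simp
    have "(\<Sum>l<n. f l * (if l = i then 1 else 0)) = (\<Sum>l<n. if l = i then f l else 0)"
      by (intro sum.cong) auto
    then show "(\<Sum>l<n. f l * (if l = i then 1 else 0)) = (if i < n then f i else 0)" using * by simp
    show "(\<Sum>l<n. if l = i then f l else 0) = (if i < n then f i else 0)" by fact
  qed
  have BT: "(B * X) $$ (i, j) = (if i = 0 then X $$ (0, j) / ?t else X $$ (i, j) - T $$ (i, 0) * X $$ (0, j) / ?t)"
    if "X \<in> carrier_mat ?m ?m" "i < ?m" "j < ?m" for X i j
  proof (cases i)
    case 0
    then show ?thesis using that by (subst mat_mult_entry[OF B that(1)]) (auto simp: split B_def simp del: sum.lessThan_Suc)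
  next
    case (Suc i')
    then show ?thesis using that by (subst mat_mult_entry[OF B that(1)]) (auto simp: split B_def delta simp del: sum.lessThan_Suc)
  qed
  have TA: "(X * A) $$ (i, j) = (if j = 0 then X $$ (i, 0) else X $$ (i, j) - X $$ (i, 0) * T $$ (0, j) / ?t)"
    if "X \<in> carrier_mat ?m ?m" "i < ?m" "j < ?m" for X i j
  proof (cases j)
    case 0
    then show ?thesis using that by (subst mat_mult_entry[OF that(1) A]) (auto simp: split A_def simp del: sum.lessThan_Suc)
  next
    case (Suc j')
    then show ?thesis using that by (subst mat_mult_entry[OF that(1) A]) (auto simp: split A_def delta simp del: sum.lessThan_Suc)
  qed
  have "mat_inverses ?m B B'"
  proof (rule mat_inversesI[OF B B'], rule eq_matI)
    fix i j assume "i < dim_row (1\<^sub>m ?m :: complex mat)" "j < dim_col (1\<^sub>m ?m :: complex mat)"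
    then have ij: "i < ?m" "j < ?m" by auto
    show "(B * B') $$ (i, j) = (1\<^sub>m ?m :: complex mat) $$ (i, j)"
      unfolding BT[OF B' ij] using ij t by (auto simp: B'_def)
  qed (use B B' in auto)
  moreover have "mat_inverses ?m A' A"
  proof (rule mat_inversesI[OF A' A], rule eq_matI)
    fix i j assume "i < dim_row (1\<^sub>m ?m :: complex mat)" "j < dim_col (1\<^sub>m ?m :: complex mat)"
    then have ij: "i < ?m" "j < ?m" by auto
    show "(A' * A) $$ (i, j) = (1\<^sub>m ?m :: complex mat) $$ (i, j)"
      unfolding TA[OF A' ij] using ij t by (auto simp: A'_def)
  qed (use A A' in auto)
  moreover have "B * T * A = four_block_mat (1\<^sub>m 1) (0\<^sub>m 1 n) (0\<^sub>m n 1) T'"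
  proof (rule eq_matI)
    fix i j assume "i < dim_row (four_block_mat (1\<^sub>m 1) (0\<^sub>m 1 n) (0\<^sub>m n 1) T')"
      "j < dim_col (four_block_mat (1\<^sub>m 1) (0\<^sub>m 1 n) (0\<^sub>m n 1) T')"
    then have ij: "i < ?m" "j < ?m" by (auto simp: T'_def)
    have BTc: "B * T \<in> carrier_mat ?m ?m" using B T by simp
    show "(B * T * A) $$ (i, j) = four_block_mat (1\<^sub>m 1) (0\<^sub>m 1 n) (0\<^sub>m n 1) T' $$ (i, j)"
      unfolding TA[OF BTc ij] using ij t T
      by (cases i; cases j) (auto simp: BT T'_def simp del: index_mult_mat(1))
  qed (use A B T in \<open>auto simp: T'_def\<close>)
  ultimately show thesis using that[of A A' B B' T'] mat_inverses_sym by (auto simp: T'_def)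
qed

text \<open>Gauss elimination with full pivoting: transpositions bring a nonzero entry to the
  corner, elimination splits off a 1, and the Schur complement is handled recursively.\<close>

lemma rank_normal_form:
  fixes T :: "complex mat"
  assumes "T \<in> carrier_mat n n"
  shows "\<exists>A A' B B' r. mat_inverses n A A' \<and> mat_inverses n B B' \<and> r \<le> n \<and>
    B * T * A = mat n n (\<lambda>(i, j). if i = j \<and> i < r then 1 else 0)"
  using assms
proof (induction n arbitrary: T)
  case 0
  then show ?case
    by (intro exI[of _ "1\<^sub>m 0"] exI[of _ 0] conjI mat_inverses_one eq_matI) auto
next
  case (Suc n)
  let ?m = "Suc n"
  show ?case
  proof (cases "T = 0\<^sub>m ?m ?m")
    case True
    then show ?thesis
      by (intro exI[of _ "1\<^sub>m ?m"] exI[of _ 0] conjI mat_inverses_one eq_matI) auto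
  next
    case False
    then obtain p q where pq: "p < ?m" "q < ?m" "T $$ (p, q) \<noteq> 0"
      using Suc.prems by (metis carrier_matD eq_matI index_zero_mat(1) index_zero_mat(2) index_zero_mat(3))
    define sw where "sw = (\<lambda>p i. if i = 0 then p else if i = p then 0 else i :: nat)"
    define P where "P = (\<lambda>p. mat ?m ?m (\<lambda>(i, j). if j = sw p i then 1 else 0 :: complex))"
    have sw: "sw p i < ?m" "sw p (sw p i) = i" if "p < ?m" "i < ?m" for p i
      using that by (auto simp: sw_def)
    have P: "mat_inverses ?m (P p) (P p)" if "p < ?m" for p
      unfolding P_def using sw that by (intro mat_inverses_permutation) auto
    have Pc: "P p \<in> carrier_mat ?m ?m" for p by (simp add: P_def)
    define T1 where "T1 = P p * T * P q"
    have T1: "T1 \<in> carrier_mat ?m ?m" unfolding T1_def using Pc Suc.prems by (meson mult_carrier_mat)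
    have "T1 $$ (0, 0) = (P p * T) $$ (0, sw q 0)"
      unfolding T1_def P_def using sw[of q] pq Pc Suc.prems
      by (intro mult_permutation_mat[where m = ?m]) auto
    also have "\<dots> = T $$ (sw p 0, sw q 0)"
      unfolding P_def using sw pq Suc.prems
      by (intro permutation_mat_mult) auto
    finally have "T1 $$ (0, 0) \<noteq> 0" using pq by (simp add: sw_def)
    then obtain A A' B B' T' where E: "mat_inverses ?m A A'" "mat_inverses ?m B B'" "T' \<in> carrier_mat n n"
      "B * T1 * A = four_block_mat (1\<^sub>m 1) (0\<^sub>m 1 n) (0\<^sub>m n 1) T'"
      by (rule pivot_elimination[OF T1])
    obtain C C' D D' r where IH: "mat_inverses n C C'" "mat_inverses n D D'" "r \<le> n"
      "D * T' * C = mat n n (\<lambda>(i, j). if i = j \<and> i < r then 1 else 0)"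
      using Suc.IH[OF E(3)] by blast
    let ?bd = "\<lambda>X. four_block_mat (1\<^sub>m 1) (0\<^sub>m 1 n) (0\<^sub>m n 1) X :: complex mat"
    have bdm: "?bd X * ?bd Y = ?bd (X * Y)" if "X \<in> carrier_mat n n" "Y \<in> carrier_mat n n" for X Y
      using that by (subst mult_four_block_mat[of _ 1 1 _ n _ n _ _ 1 _ n]) auto
    have bd1: "?bd (1\<^sub>m n) = 1\<^sub>m ?m" using four_block_one_mat[of 1 n] by simp
    have bdc: "?bd X \<in> carrier_mat ?m ?m" if "X \<in> carrier_mat n n" for X
      using that by (metis four_block_carrier_mat one_carrier_mat plus_1_eq_Suc)
    have bdi: "mat_inverses ?m (?bd X) (?bd Y)" if "mat_inverses n X Y" for X Y
      using that bdm bdc bd1 by (auto simp: mat_inverses_def)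
    have c: "A \<in> carrier_mat ?m ?m" "B \<in> carrier_mat ?m ?m" "C \<in> carrier_mat n n" "D \<in> carrier_mat n n"
      using E IH by (auto simp: mat_inverses_def)
    have "(?bd D * (B * P p)) * T * (P q * A * ?bd C) = ?bd D * (B * T1 * A) * ?bd C"
    proof -
      have "(X * (B * P p)) * T * (P q * A * Y) = X * (B * (P p * T * P q) * A) * Y"
        if "X \<in> carrier_mat ?m ?m" "Y \<in> carrier_mat ?m ?m" for X Y
        using c Pc Suc.prems that by (simp add: assoc_mult_mat[of _ ?m ?m _ ?m _ ?m] mult_carrier_mat[of _ ?m ?m _ ?m])
      from this[OF bdc[OF c(4)] bdc[OF c(3)]] show ?thesis unfolding T1_def .
    qed
    also have "\<dots> = ?bd (D * T' * C)"
      unfolding E(4) bdm[OF c(4) E(3)] bdm[OF mult_carrier_mat[OF c(4) E(3)] c(3)] ..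
    also have "\<dots> = mat ?m ?m (\<lambda>(i, j). if i = j \<and> i < Suc r then 1 else 0)"
      unfolding IH(4) by (rule eq_matI) auto
    finally show ?thesis
      using mat_inverses_mult[OF mat_inverses_mult[OF P[OF pq(2)] E(1)] bdi[OF IH(1)]]
        mat_inverses_mult[OF bdi[OF IH(2)] mat_inverses_mult[OF E(2) P[OF pq(1)]]] IH(3)
      by (meson Suc_le_mono)
  qed
qed

section \<open>Complete reducibility and direct sums\<close>

lemma four_block_mat_eqD:
  assumes "four_block_mat A B C D = four_block_mat A' B' C' D'"
    and "A \<in> carrier_mat n n" "B \<in> carrier_mat n m" "C \<in> carrier_mat m n" "D \<in> carrier_mat m m"
    and "A' \<in> carrier_mat n n" "B' \<in> carrier_mat n m" "C' \<in> carrier_mat m n" "D' \<in> carrier_mat m m"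
  shows "A = A'" "B = B'" "C = C'" "D = D'"
proof -
  have e: "four_block_mat A B C D $$ (i, j) = four_block_mat A' B' C' D' $$ (i, j)" for i j
    using assms(1) by simp
  show "A = A'"
  proof (rule eq_matI)
    fix i j assume "i < dim_row A'" "j < dim_col A'"
    then show "A $$ (i, j) = A' $$ (i, j)" using e[of i j] assms(2-) by simp
  qed (use assms in auto)
  show "B = B'"
  proof (rule eq_matI)
    fix i j assume "i < dim_row B'" "j < dim_col B'"
    then show "B $$ (i, j) = B' $$ (i, j)" using e[of i "n + j"] assms(2-) by simp
  qed (use assms in auto)
  show "C = C'"
  proof (rule eq_matI)
    fix i j assume "i < dim_row C'" "j < dim_col C'"
    then show "C $$ (i, j) = C' $$ (i, j)" using e[of "n + i" j] assms(2-) by simp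
  qed (use assms in auto)
  show "D = D'"
  proof (rule eq_matI)
    fix i j assume "i < dim_row D'" "j < dim_col D'"
    then show "D $$ (i, j) = D' $$ (i, j)" using e[of "n + i" "n + j"] assms(2-) by simp
  qed (use assms in auto)
qed

text \<open>Maschke: averaging the lower left block over the group yields the intertwiner.\<close>

lemma block_triangular_rep_split:
  assumes G: "group G" "finite (carrier G)" and V: "is_rep G V" "rdim V = n + m"
    and c: "\<And>g. g \<in> carrier G \<Longrightarrow> a g \<in> carrier_mat n n" "\<And>g. g \<in> carrier G \<Longrightarrow> c g \<in> carrier_mat m n"
      "\<And>g. g \<in> carrier G \<Longrightarrow> d g \<in> carrier_mat m m"
    and eq: "\<And>g. g \<in> carrier G \<Longrightarrow> rmat V g = four_block_mat (a g) (0\<^sub>m n m) (c g) (d g)"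
  shows "is_rep G \<lparr>rdim = n, rmat = a\<rparr>" "is_rep G \<lparr>rdim = m, rmat = d\<rparr>"
    and "rep_iso G V (sum_rep \<lparr>rdim = n, rmat = a\<rparr> \<lparr>rdim = m, rmat = d\<rparr>)"
proof -
  interpret group G by fact
  \<comment> \<open>Multiplicativity read off block by block: the diagonal blocks are
    representations and the lower left block is a cocycle.\<close>
  have mult: "a (g \<otimes>\<^bsub>G\<^esub> h) = a g * a h" "c (g \<otimes>\<^bsub>G\<^esub> h) = c g * a h + d g * c h" "d (g \<otimes>\<^bsub>G\<^esub> h) = d g * d h"
    if gh: "g \<in> carrier G" "h \<in> carrier G" for g h
  proof -
    have "four_block_mat (a (g \<otimes>\<^bsub>G\<^esub> h)) (0\<^sub>m n m) (c (g \<otimes>\<^bsub>G\<^esub> h)) (d (g \<otimes>\<^bsub>G\<^esub> h))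
      = four_block_mat (a g) (0\<^sub>m n m) (c g) (d g) * four_block_mat (a h) (0\<^sub>m n m) (c h) (d h)"
      using eq rep_mult[OF V(1) gh] gh by simp
    also have "\<dots> = four_block_mat (a g * a h + 0\<^sub>m n m * c h) (a g * 0\<^sub>m n m + 0\<^sub>m n m * d h)
       (c g * a h + d g * c h) (c g * 0\<^sub>m n m + d g * d h)"
      by (rule mult_four_block_mat[OF c(1)[OF gh(1)] zero_carrier_mat c(2)[OF gh(1)] c(3)[OF gh(1)]
        c(1)[OF gh(2)] zero_carrier_mat c(2)[OF gh(2)] c(3)[OF gh(2)]])
    finally have E: "four_block_mat (a (g \<otimes>\<^bsub>G\<^esub> h)) (0\<^sub>m n m) (c (g \<otimes>\<^bsub>G\<^esub> h)) (d (g \<otimes>\<^bsub>G\<^esub> h)) = \<dots>" .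
    have cc: "a g * a h + 0\<^sub>m n m * c h \<in> carrier_mat n n" "a g * 0\<^sub>m n m + 0\<^sub>m n m * d h \<in> carrier_mat n m"
      "c g * a h + d g * c h \<in> carrier_mat m n" "c g * 0\<^sub>m n m + d g * d h \<in> carrier_mat m m"
      using c[OF gh(1)] c[OF gh(2)] by auto
    note F = four_block_mat_eqD[OF E c(1)[OF m_closed[OF gh]] zero_carrier_mat c(2,3)[OF m_closed[OF gh]] cc]
    show "a (g \<otimes>\<^bsub>G\<^esub> h) = a g * a h" "c (g \<otimes>\<^bsub>G\<^esub> h) = c g * a h + d g * c h" "d (g \<otimes>\<^bsub>G\<^esub> h) = d g * d h"
      using F c[OF gh(1)] c[OF gh(2)] by auto
  qed
  have "four_block_mat (a \<one>\<^bsub>G\<^esub>) (0\<^sub>m n m) (c \<one>\<^bsub>G\<^esub>) (d \<one>\<^bsub>G\<^esub>) = four_block_mat (1\<^sub>m n) (0\<^sub>m n m) (0\<^sub>m m n) (1\<^sub>m m)"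
    using eq[OF one_closed] rep_one[OF V(1)] V(2) by simp
  then have one: "a \<one>\<^bsub>G\<^esub> = 1\<^sub>m n" "d \<one>\<^bsub>G\<^esub> = 1\<^sub>m m"
    using c[OF one_closed] four_block_mat_eqD[of "a \<one>\<^bsub>G\<^esub>" "0\<^sub>m n m" "c \<one>\<^bsub>G\<^esub>" "d \<one>\<^bsub>G\<^esub>" "1\<^sub>m n" "0\<^sub>m n m" "0\<^sub>m m n" "1\<^sub>m m" n m]
    by auto
  show ra: "is_rep G \<lparr>rdim = n, rmat = a\<rparr>" and rd: "is_rep G \<lparr>rdim = m, rmat = d\<rparr>"
    using c mult one by (auto simp: is_rep_def)
  let ?k = "of_nat (card (carrier G)) :: complex"
  have k0: "?k \<noteq> 0" using G(2) one_closed by auto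
  \<comment> \<open>Replacing h by g h under the average and expanding c(g h) by the cocycle rule
    yields X a(g) = c(g) + d(g) X.\<close>
  define X where "X = mat m n (\<lambda>(i, j). (\<Sum>h\<in>carrier G. (c h * a (inv\<^bsub>G\<^esub> h)) $$ (i, j)) / ?k)"
  have X: "X \<in> carrier_mat m n" by (simp add: X_def)
  have key: "X * a g = c g + d g * X" if g: "g \<in> carrier G" for g
  proof (rule eq_matI)
    fix i j assume "i < dim_row (c g + d g * X)" "j < dim_col (c g + d g * X)"
    then have ij: "i < m" "j < n" using c[OF g] X by auto
    have "?k * (X * a g) $$ (i, j) = ?k * (\<Sum>l<n. ((\<Sum>h\<in>carrier G. (c h * a (inv\<^bsub>G\<^esub> h)) $$ (i, l)) / ?k) * a g $$ (l, j))"
      using ij c(1)[OF g] by (subst mat_mult_entry[OF X]) (auto simp: X_def simp del: index_mult_mat(1))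
    also have "\<dots> = (\<Sum>l<n. (\<Sum>h\<in>carrier G. (c h * a (inv\<^bsub>G\<^esub> h)) $$ (i, l)) * a g $$ (l, j))"
      using k0 by (simp add: sum_distrib_left del: index_mult_mat(1))
    also have "\<dots> = (\<Sum>h\<in>carrier G. \<Sum>l<n. (c h * a (inv\<^bsub>G\<^esub> h)) $$ (i, l) * a g $$ (l, j))"
      by (simp only: sum_distrib_right) (rule sum.swap)
    also have "\<dots> = (\<Sum>h\<in>carrier G. (c h * a (inv\<^bsub>G\<^esub> h \<otimes>\<^bsub>G\<^esub> g)) $$ (i, j))"
    proof (rule sum.cong[OF refl])
      fix h assume h: "h \<in> carrier G"
      have "(\<Sum>l<n. (c h * a (inv\<^bsub>G\<^esub> h)) $$ (i, l) * a g $$ (l, j)) = (c h * a (inv\<^bsub>G\<^esub> h) * a g) $$ (i, j)"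
        using c[OF h] c[OF inv_closed[OF h]] c[OF g] ij by (subst mat_mult_entry[of _ m n _ n]) auto
      also have "c h * a (inv\<^bsub>G\<^esub> h) * a g = c h * a (inv\<^bsub>G\<^esub> h \<otimes>\<^bsub>G\<^esub> g)"
        using c[OF h] c[OF inv_closed[OF h]] c[OF g] mult h g by simp
      finally show "(\<Sum>l<n. (c h * a (inv\<^bsub>G\<^esub> h)) $$ (i, l) * a g $$ (l, j)) = (c h * a (inv\<^bsub>G\<^esub> h \<otimes>\<^bsub>G\<^esub> g)) $$ (i, j)" .
    qed
    also have "\<dots> = (\<Sum>h\<in>carrier G. (c (g \<otimes>\<^bsub>G\<^esub> h) * a (inv\<^bsub>G\<^esub> (g \<otimes>\<^bsub>G\<^esub> h) \<otimes>\<^bsub>G\<^esub> g)) $$ (i, j))"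
      by (rule sum_group_translate) fact+
    also have "\<dots> = (\<Sum>h\<in>carrier G. c g $$ (i, j) + (d g * (c h * a (inv\<^bsub>G\<^esub> h))) $$ (i, j))"
    proof (rule sum.cong[OF refl])
      fix h assume h: "h \<in> carrier G"
      have "inv\<^bsub>G\<^esub> (g \<otimes>\<^bsub>G\<^esub> h) \<otimes>\<^bsub>G\<^esub> g = inv\<^bsub>G\<^esub> h"
        using g h by (simp add: inv_mult_group m_assoc)
      then have "c (g \<otimes>\<^bsub>G\<^esub> h) * a (inv\<^bsub>G\<^esub> (g \<otimes>\<^bsub>G\<^esub> h) \<otimes>\<^bsub>G\<^esub> g) = (c g * a h + d g * c h) * a (inv\<^bsub>G\<^esub> h)"
        using mult(2)[OF g h] by simp
      also have "\<dots> = c g * a h * a (inv\<^bsub>G\<^esub> h) + d g * c h * a (inv\<^bsub>G\<^esub> h)"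
        using c[OF h] c[OF inv_closed[OF h]] c[OF g] by (intro add_mult_distrib_mat) auto
      also have "c g * a h * a (inv\<^bsub>G\<^esub> h) = c g * a (h \<otimes>\<^bsub>G\<^esub> inv\<^bsub>G\<^esub> h)"
        unfolding mult(1)[OF h inv_closed[OF h]] using c[OF h] c[OF inv_closed[OF h]] c[OF g] by simp
      also have "\<dots> = c g" using h one c[OF g] by simp
      also have "d g * c h * a (inv\<^bsub>G\<^esub> h) = d g * (c h * a (inv\<^bsub>G\<^esub> h))"
        using c[OF h] c[OF inv_closed[OF h]] c[OF g] by simp
      finally show "(c (g \<otimes>\<^bsub>G\<^esub> h) * a (inv\<^bsub>G\<^esub> (g \<otimes>\<^bsub>G\<^esub> h) \<otimes>\<^bsub>G\<^esub> g)) $$ (i, j)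
         = c g $$ (i, j) + (d g * (c h * a (inv\<^bsub>G\<^esub> h))) $$ (i, j)"
        using ij c[OF h] c[OF inv_closed[OF h]] c[OF g] by (simp del: index_mult_mat(1))
    qed
    also have "\<dots> = ?k * c g $$ (i, j) + (\<Sum>h\<in>carrier G. \<Sum>l<m. d g $$ (i, l) * (c h * a (inv\<^bsub>G\<^esub> h)) $$ (l, j))"
    proof -
      have "(d g * (c h * a (inv\<^bsub>G\<^esub> h))) $$ (i, j) = (\<Sum>l<m. d g $$ (i, l) * (c h * a (inv\<^bsub>G\<^esub> h)) $$ (l, j))"
        if h: "h \<in> carrier G" for h
        using c[OF h] c[OF inv_closed[OF h]] c[OF g] ij by (intro mat_mult_entry[of _ m m _ n]) auto
      then show ?thesis by (simp add: sum.distrib del: index_mult_mat(1))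
    qed
    also have "(\<Sum>h\<in>carrier G. \<Sum>l<m. d g $$ (i, l) * (c h * a (inv\<^bsub>G\<^esub> h)) $$ (l, j)) = ?k * (d g * X) $$ (i, j)"
    proof -
      have "?k * (d g * X) $$ (i, j) = ?k * (\<Sum>l<m. d g $$ (i, l) * ((\<Sum>h\<in>carrier G. (c h * a (inv\<^bsub>G\<^esub> h)) $$ (l, j)) / ?k))"
        using ij c(3)[OF g] by (subst mat_mult_entry[OF _ X]) (auto simp: X_def simp del: index_mult_mat(1))
      also have "\<dots> = (\<Sum>l<m. \<Sum>h\<in>carrier G. d g $$ (i, l) * (c h * a (inv\<^bsub>G\<^esub> h)) $$ (l, j))"
      proof -
        have "?k * (\<Sum>l<m. x l * (s l / ?k)) = (\<Sum>l<m. x l * s l)" for x s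
          using k0 by (simp add: sum_distrib_left)
        then show ?thesis by (simp only: sum_distrib_left[symmetric])
      qed
      finally show ?thesis by (subst sum.swap) simp
    qed
    finally have "?k * (X * a g) $$ (i, j) = ?k * (c g $$ (i, j) + (d g * X) $$ (i, j))"
      by (simp add: distrib_left)
    then have "(X * a g) $$ (i, j) = c g $$ (i, j) + (d g * X) $$ (i, j)" using k0 by (simp del: index_mult_mat(1))
    then show "(X * a g) $$ (i, j) = (c g + d g * X) $$ (i, j)" using ij c[OF g] X by (simp del: index_mult_mat(1))
  qed (use c[OF g] X in auto)
  \<comment> \<open>Conjugation by the unipotent matrix with lower left block -X removes the block
    c.\<close>
  let ?T = "\<lambda>Y. four_block_mat (1\<^sub>m n) (0\<^sub>m n m) Y (1\<^sub>m m) :: complex mat"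
  have "?T (- X) * ?T X = ?T (- X + X)"
    using X by (subst mult_four_block_mat[of _ n n _ m _ m _ _ n _ m]) auto
  also have "- X + X = 0\<^sub>m m n" using X by (intro eq_matI) auto
  finally have inv: "mat_inverses (n + m) (?T (- X)) (?T X)"
    using X by (intro mat_inversesI) auto
  show "rep_iso G V (sum_rep \<lparr>rdim = n, rmat = a\<rparr> \<lparr>rdim = m, rmat = d\<rparr>)"
  proof (rule rep_isoI[OF _ _ inv])
    fix g assume g: "g \<in> carrier G"
    have "?T (- X) * rmat V g = four_block_mat (a g) (0\<^sub>m n m) (- X * a g + c g) (d g)"
      unfolding eq[OF g] using c[OF g] X by (subst mult_four_block_mat[of _ n n _ m _ m _ _ n _ m]) auto
    also have "- X * a g + c g = d g * (- X)"
    proof (rule eq_matI)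
      fix i j assume "i < dim_row (d g * (- X))" "j < dim_col (d g * (- X))"
      then have ij: "i < m" "j < n" using c[OF g] X by auto
      have "- X * a g = - (X * a g)" "d g * (- X) = - (d g * X)" using c[OF g] X by auto
      moreover have "(X * a g) $$ (i, j) = c g $$ (i, j) + (d g * X) $$ (i, j)"
        unfolding key[OF g] using ij c[OF g] X by (simp del: index_mult_mat(1))
      ultimately show "(- X * a g + c g) $$ (i, j) = (d g * (- X)) $$ (i, j)"
        using ij c[OF g] X by (simp del: index_mult_mat(1))
    qed (use c[OF g] X in auto)
    also have "four_block_mat (a g) (0\<^sub>m n m) (d g * (- X)) (d g) = four_block_mat (a g) (0\<^sub>m n m) (0\<^sub>m m n) (d g) * ?T (- X)"
      using c[OF g] X by (subst mult_four_block_mat[of _ n n _ m _ m _ _ n _ m]) auto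
    finally show "?T (- X) * rmat V g = rmat (sum_rep \<lparr>rdim = n, rmat = a\<rparr> \<lparr>rdim = m, rmat = d\<rparr>) g * ?T (- X)"
      by (simp add: sum_rep_def)
  qed (use V in \<open>auto simp: sum_rep_def\<close>)
qed

lemma sum_rep_is_rep:
  assumes "group G" "is_rep G V" "is_rep G V'"
  shows "is_rep G (sum_rep V V')"
proof -
  interpret group G by fact
  have c: "rmat V g \<in> carrier_mat (rdim V) (rdim V)" "rmat V' g \<in> carrier_mat (rdim V') (rdim V')" if "g \<in> carrier G" for g
    using rep_carrier[OF assms(2) that] rep_carrier[OF assms(3) that] by auto
  show ?thesis
    unfolding is_rep_def
  proof (intro conjI ballI)
    fix g h assume gh: "g \<in> carrier G" "h \<in> carrier G"
    show "rmat (sum_rep V V') g \<in> carrier_mat (rdim (sum_rep V V')) (rdim (sum_rep V V'))"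
      using c[OF gh(1)] by (auto simp: sum_rep_def)
    show "rmat (sum_rep V V') (g \<otimes>\<^bsub>G\<^esub> h) = rmat (sum_rep V V') g * rmat (sum_rep V V') h"
      using c[OF gh(1)] c[OF gh(2)] gh
      by (simp add: sum_rep_def rep_mult[OF assms(2)] rep_mult[OF assms(3)])
        (subst mult_four_block_mat[of _ "rdim V" "rdim V" _ "rdim V'" _ "rdim V'" _ _ "rdim V" _ "rdim V'"], auto)
  qed (simp add: sum_rep_def rep_one[OF assms(2)] rep_one[OF assms(3)])
qed

lemma rchar_sum_rep:
  assumes "is_rep G V" "is_rep G V'" "g \<in> carrier G"
  shows "rchar (sum_rep V V') g = rchar V g + rchar V' g"
proof -
  have c: "dim_row (rmat V g) = rdim V" "dim_row (rmat V' g) = rdim V'" "dim_col (rmat V g) = rdim V" "dim_col (rmat V' g) = rdim V'"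
    using rep_carrier[OF assms(1,3)] rep_carrier[OF assms(2,3)] by auto
  let ?n = "rdim V" and ?m = "rdim V'"
  let ?F = "four_block_mat (rmat V g) (0\<^sub>m ?n ?m) (0\<^sub>m ?m ?n) (rmat V' g)"
  have "rchar (sum_rep V V') g = (\<Sum>i<?n + ?m. ?F $$ (i, i))" by (simp add: rchar_def sum_rep_def)
  also have "\<dots> = (\<Sum>i<?n. ?F $$ (i, i)) + (\<Sum>i<?m. ?F $$ (?n + i, ?n + i))"
  proof -
    have "(\<Sum>i<n + m. f i) = (\<Sum>i<n. f i) + (\<Sum>i<m. f (n + i))" for f :: "nat \<Rightarrow> complex" and n m
      by (induction m) (auto simp: add.assoc)
    then show ?thesis .
  qed
  also have "\<dots> = rchar V g + rchar V' g"
    using c by (simp add: rchar_def)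
  finally show ?thesis .
qed

lemma conj_rep:
  assumes "group G" "is_rep G V" "rdim V = n" "mat_inverses n A A'"
  shows "is_rep G \<lparr>rdim = n, rmat = \<lambda>g. A' * rmat V g * A\<rparr>"
    and "rep_iso G V \<lparr>rdim = n, rmat = \<lambda>g. A' * rmat V g * A\<rparr>"
proof -
  interpret group G by fact
  have c: "A \<in> carrier_mat n n" "A' \<in> carrier_mat n n" "A * A' = 1\<^sub>m n" "A' * A = 1\<^sub>m n"
    using assms by (auto simp: mat_inverses_def)
  have v: "rmat V g \<in> carrier_mat n n" if "g \<in> carrier G" for g
    using rep_carrier[OF assms(2) that] assms(3) by simp
  show "is_rep G \<lparr>rdim = n, rmat = \<lambda>g. A' * rmat V g * A\<rparr>"
    unfolding is_rep_def rep.simps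
  proof (intro conjI ballI)
    fix g h assume gh: "g \<in> carrier G" "h \<in> carrier G"
    show "A' * rmat V g * A \<in> carrier_mat n n" using c v[OF gh(1)] by auto
    have "A' * rmat V g * A * (A' * rmat V h * A) = A' * rmat V g * (A * A') * (rmat V h * A)"
      using c(1,2) v[OF gh(1)] v[OF gh(2)] by (simp add: assoc_mult_mat[of _ n n _ n _ n] mult_carrier_mat[of _ n n _ n])
    also have "\<dots> = A' * rmat V (g \<otimes>\<^bsub>G\<^esub> h) * A"
      using c v[OF gh(1)] v[OF gh(2)] rep_mult[OF assms(2) gh] by (simp add: assoc_mult_mat[of _ n n _ n _ n] mult_carrier_mat[of _ n n _ n])
    finally show "A' * rmat V (g \<otimes>\<^bsub>G\<^esub> h) * A = A' * rmat V g * A * (A' * rmat V h * A)" by simp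
  qed (use c rep_one[OF assms(2)] assms(3) in simp)
  show "rep_iso G V \<lparr>rdim = n, rmat = \<lambda>g. A' * rmat V g * A\<rparr>"
  proof (rule rep_isoI[of _ n _ A' A])
    show "mat_inverses n A' A" using assms(4) by (rule mat_inverses_sym)
    fix g assume g: "g \<in> carrier G"
    have "A' * rmat V g * A * A' = A' * rmat V g * (A * A')"
      using c(1,2) v[OF g] by (simp add: assoc_mult_mat[of _ n n _ n _ n] mult_carrier_mat[of _ n n _ n])
    then show "A' * rmat V g = rmat \<lparr>rdim = n, rmat = \<lambda>g. A' * rmat V g * A\<rparr> g * A'"
      using c v[OF g] by simp
  qed (use assms in auto)
qed

text \<open>The swap is built in because the two triangular decompositions to be compared carry
  their common block in opposite corners.\<close>

lemma sum_rep_swap_iso: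
  assumes "is_rep G V" "is_rep G U" "is_rep G U'" "rep_iso G U U'"
  shows "rep_iso G (sum_rep V U) (sum_rep U' V)"
proof -
  obtain S S' where S: "rdim U' = rdim U" "mat_inverses (rdim U) S S'"
    "\<And>g. g \<in> carrier G \<Longrightarrow> S * rmat U g = rmat U' g * S"
    using assms(4) by (rule rep_isoE) blast
  let ?r = "rdim V" and ?m = "rdim U"
  have c: "S \<in> carrier_mat ?m ?m" "S' \<in> carrier_mat ?m ?m" "S * S' = 1\<^sub>m ?m"
    using S(2) by (auto simp: mat_inverses_def)
  let ?T = "four_block_mat (0\<^sub>m ?m ?r) S (1\<^sub>m ?r) (0\<^sub>m ?r ?m)"
  let ?T' = "four_block_mat (0\<^sub>m ?r ?m) (1\<^sub>m ?r) S' (0\<^sub>m ?m ?r)"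
  have "?T * ?T' = four_block_mat (1\<^sub>m ?m) (0\<^sub>m ?m ?r) (0\<^sub>m ?r ?m) (1\<^sub>m ?r)"
    using c by (subst mult_four_block_mat[of _ ?m ?r _ ?m _ ?r _ _ ?m _ ?r]) auto
  moreover have "?T \<in> carrier_mat (?r + ?m) (?r + ?m)"
    using four_block_carrier_mat[of "0\<^sub>m ?m ?r" ?m ?r "0\<^sub>m ?r ?m" ?r ?m] by (simp add: add.commute)
  moreover have "?T' \<in> carrier_mat (?r + ?m) (?r + ?m)"
    using four_block_carrier_mat[of "0\<^sub>m ?r ?m" ?r ?m "0\<^sub>m ?m ?r" ?m ?r] by (simp add: add.commute)
  ultimately have inv: "mat_inverses (?r + ?m) ?T ?T'"
    by (intro mat_inversesI) (auto simp: add.commute)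
  show ?thesis
  proof (rule rep_isoI[OF _ _ inv])
    fix g assume g: "g \<in> carrier G"
    have m: "rmat V g \<in> carrier_mat ?r ?r" "rmat U g \<in> carrier_mat ?m ?m" "rmat U' g \<in> carrier_mat ?m ?m"
      using rep_carrier[OF assms(1) g] rep_carrier[OF assms(2) g] rep_carrier[OF assms(3) g] S(1) by auto
    have "?T * rmat (sum_rep V U) g = four_block_mat (0\<^sub>m ?m ?r) (S * rmat U g) (rmat V g) (0\<^sub>m ?r ?m)"
      using m c by (simp add: sum_rep_def) (subst mult_four_block_mat[of _ ?m ?r _ ?m _ ?r _ _ ?r _ ?m], auto)
    moreover have "rmat (sum_rep U' V) g * ?T = four_block_mat (0\<^sub>m ?m ?r) (rmat U' g * S) (rmat V g) (0\<^sub>m ?r ?m)"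
      using m c S(1) by (simp add: sum_rep_def) (subst mult_four_block_mat[of _ ?m ?m _ ?r _ ?r _ _ ?r _ ?m], auto)
    ultimately show "?T * rmat (sum_rep V U) g = rmat (sum_rep U' V) g * ?T"
      using S(3)[OF g] by simp
  qed (use S(1) in \<open>auto simp: sum_rep_def\<close>)
qed

lemma rep_iso_zero_dim:
  assumes "is_rep G V" "is_rep G V'" "rdim V = 0" "rdim V' = 0"
  shows "rep_iso G V V'"
proof (rule rep_isoI[OF assms(3,4) mat_inverses_one])
  fix g assume "g \<in> carrier G"
  then show "1\<^sub>m 0 * rmat V g = rmat V' g * 1\<^sub>m 0"
    using rep_carrier[OF assms(1)] rep_carrier[OF assms(2)] assms(3,4) by (intro eq_matI) auto
qed

text \<open>Splitting off the image of a nonzero intertwiner from both sides leaves complements with equal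
  characters.\<close>

lemma rep_iso_if_rchar_eq:
  assumes "group G" "finite (carrier G)" "is_rep G V" "is_rep G V'"
    and "\<And>g. g \<in> carrier G \<Longrightarrow> rchar V g = rchar V' g"
  shows "rep_iso G V V'"
  using assms(3-)
proof (induction "rdim V" arbitrary: V V' rule: less_induct)
  case less
  interpret group G by fact
  define n where "n = rdim V"
  have "rdim V' = n"
    using less(4)[OF one_closed] rchar_one[OF less(2)] rchar_one[OF less(3)] by (simp add: n_def)
  note dims = n_def[symmetric] this
  show ?case
  proof (cases "n = 0")
    case True
    then show ?thesis using dims less rep_iso_zero_dim by blast
  next
    case False
    then have "n > 0" by simp
    obtain T where T: "T \<in> carrier_mat n n" "T \<noteq> 0\<^sub>m n n"
      "\<And>g. g \<in> carrier G \<Longrightarrow> T * rmat V g = rmat V' g * T"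
      by (rule nonzero_intertwiner[OF assms(1,2) less(2,3) dims \<open>n > 0\<close> less(4)]) (assumption, rule that)
    obtain A A' B B' r where E: "mat_inverses n A A'" "mat_inverses n B B'" "r \<le> n"
      "B * T * A = mat n n (\<lambda>(i, j). if i = j \<and> i < r then 1 else 0)"
      using rank_normal_form[OF T(1)] by blast
    define m where "m = n - r"
    have nm: "n = m + r" "n = r + m" using E(3) by (auto simp: m_def)
    have cAB: "A \<in> carrier_mat n n" "A' \<in> carrier_mat n n" "B \<in> carrier_mat n n" "B' \<in> carrier_mat n n"
      "A * A' = 1\<^sub>m n" "B' * B = 1\<^sub>m n"
      using E by (auto simp: mat_inverses_def)
    have "r > 0"
    proof (rule ccontr)
      assume "\<not> r > 0"
      then have "B * T * A = 0\<^sub>m n n" unfolding E(4) by (intro eq_matI) auto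
      then have "B' * (B * T * A) * A' = 0\<^sub>m n n" using cAB by simp
      moreover have "B' * (B * T * A) * A' = (B' * B) * T * (A * A')"
        using cAB(1-4) T(1) by (simp add: assoc_mult_mat[of _ n n _ n _ n] mult_carrier_mat[of _ n n _ n])
      ultimately show False using T cAB by simp
    qed
    \<comment> \<open>This permutation of the rows moves the identity block of the normal form to
      the lower left corner. Comparing the entries of D V = W D then shows that both representations
      have vanishing upper right block, and that the top left r x r block of the first is the bottom
      right one of the second.\<close>
    define \<pi> where "\<pi> = (\<lambda>i. if i < m then r + i else i - m)"
    define \<rho> where "\<rho> = (\<lambda>i. if i < r then m + i else i - r)"
    have perm: "\<And>i. i < n \<Longrightarrow> \<pi> i < n" "\<And>i. i < n \<Longrightarrow> \<rho> (\<pi> i) = i" "\<And>i. i < n \<Longrightarrow> \<rho> i < n" "\<And>i. i < n \<Longrightarrow> \<pi> (\<rho> i) = i"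
      using nm by (auto simp: \<pi>_def \<rho>_def)
    define Q where "Q = mat n n (\<lambda>(i, j). if j = \<pi> i then 1 else 0 :: complex)"
    define Q' where "Q' = mat n n (\<lambda>(i, j). if j = \<rho> i then 1 else 0 :: complex)"
    have Q: "mat_inverses n Q Q'"
      unfolding Q_def Q'_def by (rule mat_inverses_permutation) (use perm in auto)
    have Qc: "Q \<in> carrier_mat n n" by (simp add: Q_def)
    define C where "C = Q * B"
    define C' where "C' = B' * Q'"
    have C: "mat_inverses n C C'" unfolding C_def C'_def by (rule mat_inverses_mult[OF Q E(2)])
    have cC: "C \<in> carrier_mat n n" "C' \<in> carrier_mat n n" "C' * C = 1\<^sub>m n"
      using C by (auto simp: mat_inverses_def)
    define D where "D = C * T * A"
    have Dc: "D \<in> carrier_mat n n" using cC cAB T by (auto simp: D_def)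
    have D: "D $$ (i, j) = (if i = m + j \<and> j < r then 1 else 0)" if "i < n" "j < n" for i j
    proof -
      have "D = Q * (B * T * A)" unfolding D_def C_def
        using Qc cAB T(1) by (simp add: assoc_mult_mat[of _ n n _ n _ n] mult_carrier_mat[of _ n n _ n])
      also have "\<dots> $$ (i, j) = (B * T * A) $$ (\<pi> i, j)"
        unfolding Q_def using perm cAB T(1) that by (intro permutation_mat_mult) auto
      also have "\<dots> = (if i = m + j \<and> j < r then 1 else 0)"
        unfolding E(4) using that perm nm by (auto simp: \<pi>_def)
      finally show ?thesis .
    qed
    let ?V1 = "\<lambda>g. A' * rmat V g * A" and ?W1 = "\<lambda>g. C * rmat V' g * C'"
    let ?V = "\<lparr>rdim = n, rmat = ?V1\<rparr>" and ?W = "\<lparr>rdim = n, rmat = ?W1\<rparr>"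
    note cV = conj_rep[OF assms(1) less(2) dims(1) E(1)]
    note cW = conj_rep[OF assms(1) less(3) dims(2) mat_inverses_sym[OF C]]
    have v: "rmat V g \<in> carrier_mat n n" "rmat V' g \<in> carrier_mat n n" if "g \<in> carrier G" for g
      using rep_carrier[OF less(2) that] rep_carrier[OF less(3) that] dims by auto
    have v1: "?V1 g \<in> carrier_mat n n" "?W1 g \<in> carrier_mat n n" if "g \<in> carrier G" for g
      using v[OF that] cAB cC by auto
    have DV: "D * ?V1 g = ?W1 g * D" if g: "g \<in> carrier G" for g
    proof -
      have "D * ?V1 g = C * T * (A * A') * (rmat V g * A)" unfolding D_def
        using cAB(1-4) cC(1,2) T(1) v[OF g] by (simp add: assoc_mult_mat[of _ n n _ n _ n] mult_carrier_mat[of _ n n _ n])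
      also have "\<dots> = C * (T * rmat V g) * A"
        using cAB cC(1,2) T(1) v[OF g] by (simp add: assoc_mult_mat[of _ n n _ n _ n] mult_carrier_mat[of _ n n _ n])
      also have "\<dots> = C * rmat V' g * (C' * C) * (T * A)"
        using cAB cC T(1) v[OF g] unfolding T(3)[OF g] by (simp add: assoc_mult_mat[of _ n n _ n _ n] mult_carrier_mat[of _ n n _ n])
      also have "\<dots> = ?W1 g * D" unfolding D_def
        using cAB(1-4) cC(1,2) T(1) v[OF g] by (simp add: assoc_mult_mat[of _ n n _ n _ n] mult_carrier_mat[of _ n n _ n])
      finally show ?thesis .
    qed
    have L: "(D * ?V1 g) $$ (i, j) = (if m \<le> i then ?V1 g $$ (i - m, j) else 0)"
      if g: "g \<in> carrier G" and ij: "i < n" "j < n" for g i j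
    proof -
      have "(D * ?V1 g) $$ (i, j) = (\<Sum>l<n. (if i = m + l \<and> l < r then 1 else 0) * ?V1 g $$ (l, j))"
        using ij D by (subst mat_mult_entry[OF Dc v1(1)[OF g]]) (auto intro!: sum.cong)
      also have "\<dots> = (\<Sum>l<n. if l = i - m then (if m \<le> i then ?V1 g $$ (l, j) else 0) else 0)"
        using ij nm by (intro sum.cong) auto
      finally show ?thesis using less_imp_diff_less[OF ij(1), of m] by simp
    qed
    have R: "(?W1 g * D) $$ (i, j) = (if j < r then ?W1 g $$ (i, m + j) else 0)"
      if g: "g \<in> carrier G" and ij: "i < n" "j < n" for g i j
    proof -
      have "(?W1 g * D) $$ (i, j) = (\<Sum>l<n. ?W1 g $$ (i, l) * (if l = m + j \<and> j < r then 1 else 0))"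
        using ij D by (subst mat_mult_entry[OF v1(2)[OF g] Dc]) (auto intro!: sum.cong)
      also have "\<dots> = (\<Sum>l<n. if l = m + j then (if j < r then ?W1 g $$ (i, l) else 0) else 0)"
        using ij nm by (intro sum.cong) auto
      finally show ?thesis using ij nm by simp
    qed
    have LR: "(if m \<le> i then ?V1 g $$ (i - m, j) else 0) = (if j < r then ?W1 g $$ (i, m + j) else 0)"
      if "g \<in> carrier G" "i < n" "j < n" for g i j
      using L[OF that] R[OF that] DV[OF that(1)] by simp
    define a where "a = (\<lambda>g. mat r r (\<lambda>(i, j). ?V1 g $$ (i, j)))"
    define c where "c = (\<lambda>g. mat m r (\<lambda>(i, j). ?V1 g $$ (r + i, j)))"
    define d where "d = (\<lambda>g. mat m m (\<lambda>(i, j). ?V1 g $$ (r + i, r + j)))"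
    define e where "e = (\<lambda>g. mat m m (\<lambda>(i, j). ?W1 g $$ (i, j)))"
    define b where "b = (\<lambda>g. mat r m (\<lambda>(i, j). ?W1 g $$ (m + i, j)))"
    have V1: "rmat ?V g = four_block_mat (a g) (0\<^sub>m r m) (c g) (d g)" if g: "g \<in> carrier G" for g
    proof (rule eq_matI)
      fix i j assume "i < dim_row (four_block_mat (a g) (0\<^sub>m r m) (c g) (d g))"
        "j < dim_col (four_block_mat (a g) (0\<^sub>m r m) (c g) (d g))"
      then have ij: "i < r + m" "j < r + m" by (auto simp: a_def d_def)
      have "?V1 g $$ (i, j) = 0" if "i < r" "\<not> j < r"
        using LR[OF g, of "m + i" j] that ij nm by simp
      then show "rmat ?V g $$ (i, j) = four_block_mat (a g) (0\<^sub>m r m) (c g) (d g) $$ (i, j)"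
        using ij by (auto simp: a_def c_def d_def simp del: index_mult_mat(1))
    qed (use v1[OF g] nm in \<open>auto simp: a_def d_def\<close>)
    have W1: "rmat ?W g = four_block_mat (e g) (0\<^sub>m m r) (b g) (a g)" if g: "g \<in> carrier G" for g
    proof (rule eq_matI)
      fix i j assume "i < dim_row (four_block_mat (e g) (0\<^sub>m m r) (b g) (a g))"
        "j < dim_col (four_block_mat (e g) (0\<^sub>m m r) (b g) (a g))"
      then have ij: "i < m + r" "j < m + r" by (auto simp: a_def e_def)
      have j: "m + (j - m) = j" "j - m < r" "j - m < n" "i < n" if "\<not> j < m"
        using that ij nm(1) by auto
      have "?W1 g $$ (i, j) = 0" if "i < m" "\<not> j < m"
        using LR[OF g, of i "j - m"] j[OF that(2)] that by (simp del: index_mult_mat(1))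
      moreover have "?W1 g $$ (i, j) = ?V1 g $$ (i - m, j - m)" if "\<not> i < m" "\<not> j < m"
        using LR[OF g, of i "j - m"] j[OF that(2)] that by (simp del: index_mult_mat(1))
      ultimately show "rmat ?W g $$ (i, j) = four_block_mat (e g) (0\<^sub>m m r) (b g) (a g) $$ (i, j)"
        using ij by (auto simp: a_def b_def e_def simp del: index_mult_mat(1))
    qed (use v1[OF g] nm in \<open>auto simp: a_def e_def\<close>)
    have dV: "rdim ?V = r + m" and dW: "rdim ?W = m + r" using nm by auto
    have blocks: "a g \<in> carrier_mat r r" "c g \<in> carrier_mat m r" "d g \<in> carrier_mat m m"
      "e g \<in> carrier_mat m m" "b g \<in> carrier_mat r m" for g
      by (simp_all add: a_def b_def c_def d_def e_def)
    note sV = block_triangular_rep_split[OF assms(1,2) cV(1) dV blocks(1-3) V1]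
    note sW = block_triangular_rep_split[OF assms(1,2) cW(1) dW blocks(4,5,1) W1]
    let ?a = "\<lparr>rdim = r, rmat = a\<rparr>" and ?d = "\<lparr>rdim = m, rmat = d\<rparr>" and ?e = "\<lparr>rdim = m, rmat = e\<rparr>"
    have ra: "is_rep G ?a" and rd: "is_rep G ?d" and isoV: "rep_iso G ?V (sum_rep ?a ?d)"
      by (rule sV; assumption)+
    have re: "is_rep G ?e" and isoW: "rep_iso G ?W (sum_rep ?e ?a)"
      by (rule sW; assumption)+
    note rad = sum_rep_is_rep[OF assms(1) ra rd] and rea = sum_rep_is_rep[OF assms(1) re ra]
    have iV: "rep_iso G V (sum_rep ?a ?d)"
      by (rule rep_iso_trans[OF less(2) cV(1) rad cV(2) isoV])
    have iW: "rep_iso G V' (sum_rep ?e ?a)"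
      by (rule rep_iso_trans[OF less(3) cW(1) rea cW(2) isoW])
    \<comment> \<open>Cancelling the character of the common block leaves complements of dimension m
      < n, because r > 0.\<close>
    have "rchar ?d g = rchar ?e g" if g: "g \<in> carrier G" for g
      using rchar_iso[OF less(2) rad iV g] rchar_iso[OF less(3) rea iW g] less(4)[OF g]
        rchar_sum_rep[OF ra rd g] rchar_sum_rep[OF re ra g] by simp
    moreover have "rdim ?d < rdim V" using \<open>r > 0\<close> nm dims by simp
    ultimately have "rep_iso G ?d ?e" using less(1) rd re by blast
    then have "rep_iso G (sum_rep ?a ?d) (sum_rep ?e ?a)"
      by (rule sum_rep_swap_iso[OF ra rd re])
    then have "rep_iso G V (sum_rep ?e ?a)"
      by (rule rep_iso_trans[OF less(2) rad rea iV])
    then show ?thesis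
      by (rule rep_iso_trans[OF less(2) rea less(3) _ rep_iso_sym[OF less(3) rea iW]])
  qed
qed

section \<open>The representation ring\<close>

lemma zero_rep_is_rep: "is_rep G zero_rep"
  by (simp add: is_rep_def zero_rep_def)

lemma triv_rep_is_rep: "is_rep G triv_rep"
  by (simp add: is_rep_def triv_rep_def)

lemma rchar_zero_rep [simp]: "rchar zero_rep g = 0"
  by (simp add: rchar_def zero_rep_def)

lemma rchar_triv_rep [simp]: "rchar triv_rep g = 1"
  by (simp add: rchar_def triv_rep_def)

section \<open>Tensor products and permutation representations\<close>

lemma sum_div_mod:
  fixes f :: "nat \<Rightarrow> nat \<Rightarrow> 'b :: comm_monoid_add"
  shows "(\<Sum>k<m * n. f (k div n) (k mod n)) = (\<Sum>a<m. \<Sum>b<n. f a b)"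
proof -
  have "(\<Sum>k<m * n. f (k div n) (k mod n)) = (\<Sum>(a, b)\<in>{..<m} \<times> {..<n}. f a b)"
  proof (rule sum.reindex_bij_witness[of _ "\<lambda>(a, b). a * n + b" "\<lambda>k. (k div n, k mod n)"])
    fix k assume k: "k \<in> {..<m * n}"
    then have "n > 0" by (cases "n = 0") auto
    with k show "(k div n, k mod n) \<in> {..<m} \<times> {..<n}"
      by (auto simp: less_mult_imp_div_less)
  next
    fix p assume "p \<in> {..<m} \<times> {..<n}"
    then obtain a b where p: "p = (a, b)" "a < m" "b < n" by auto
    have "a * n + b < Suc a * n" using p by simp
    also have "\<dots> \<le> m * n" using p by (intro mult_right_mono) auto
    finally show "(case p of (a, b) \<Rightarrow> a * n + b) \<in> {..<m * n}" using p by simp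
  qed auto
  then show ?thesis by (simp add: sum.cartesian_product)
qed

lemma div_mod_less: "i < m * n \<Longrightarrow> i div n < m \<and> i mod n < (n :: nat)"
  by (cases "n = 0") (auto simp: less_mult_imp_div_less)

lemma tensor_rep_is_rep:
  assumes "group G" "is_rep G V" "is_rep G U"
  shows "is_rep G (tensor_rep V U)"
proof (rule is_repI)
  let ?m = "rdim V" and ?n = "rdim U"
  have dim: "rdim (tensor_rep V U) = ?m * ?n" by (simp add: tensor_rep_def Let_def)
  have ent: "rmat (tensor_rep V U) g $$ (i, j) = rmat V g $$ (i div ?n, j div ?n) * rmat U g $$ (i mod ?n, j mod ?n)"
    if "i < ?m * ?n" "j < ?m * ?n" for g i j
    using that by (simp add: tensor_rep_def Let_def)
  show "group G" by fact
  show "rmat (tensor_rep V U) g \<in> carrier_mat (rdim (tensor_rep V U)) (rdim (tensor_rep V U))" for g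
    by (simp add: tensor_rep_def Let_def)
  fix i j assume ij: "i < rdim (tensor_rep V U)" "j < rdim (tensor_rep V U)"
  then have ij': "i < ?m * ?n" "j < ?m * ?n" by (auto simp: dim)
  note b = div_mod_less[OF ij'(1)] div_mod_less[OF ij'(2)]
  have "i = j \<longleftrightarrow> i div ?n = j div ?n \<and> i mod ?n = j mod ?n"
    by (metis div_mult_mod_eq)
  then show "rmat (tensor_rep V U) \<one>\<^bsub>G\<^esub> $$ (i, j) = (if i = j then 1 else 0)"
    unfolding ent[OF ij'] rep_one[OF assms(2)] rep_one[OF assms(3)] using b by auto
  fix g h assume gh: "g \<in> carrier G" "h \<in> carrier G"
  note c = rep_carrier[OF assms(2)] rep_carrier[OF assms(3)]
  have "rmat (tensor_rep V U) (g \<otimes>\<^bsub>G\<^esub> h) $$ (i, j)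
     = (\<Sum>a<?m. rmat V g $$ (i div ?n, a) * rmat V h $$ (a, j div ?n)) * (\<Sum>b<?n. rmat U g $$ (i mod ?n, b) * rmat U h $$ (b, j mod ?n))"
    unfolding ent[OF ij'] rep_mult[OF assms(2) gh] rep_mult[OF assms(3) gh]
    using b c gh by (simp add: mat_mult_entry[of _ ?m ?m _ ?m] mat_mult_entry[of _ ?n ?n _ ?n] del: index_mult_mat(1))
  also have "\<dots> = (\<Sum>a<?m. \<Sum>b<?n. (rmat V g $$ (i div ?n, a) * rmat U g $$ (i mod ?n, b)) * (rmat V h $$ (a, j div ?n) * rmat U h $$ (b, j mod ?n)))"
    unfolding sum_product by (intro sum.cong refl) (simp add: mult_ac)
  also have "\<dots> = (\<Sum>k<?m * ?n. (rmat V g $$ (i div ?n, k div ?n) * rmat U g $$ (i mod ?n, k mod ?n)) * (rmat V h $$ (k div ?n, j div ?n) * rmat U h $$ (k mod ?n, j mod ?n)))"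
    by (rule sum_div_mod[symmetric])
  also have "\<dots> = (\<Sum>k<rdim (tensor_rep V U). rmat (tensor_rep V U) g $$ (i, k) * rmat (tensor_rep V U) h $$ (k, j))"
    unfolding dim using ij' by (intro sum.cong refl) (simp add: ent)
  finally show "rmat (tensor_rep V U) (g \<otimes>\<^bsub>G\<^esub> h) $$ (i, j) = \<dots>" .
qed

lemma rchar_tensor_rep: "rchar (tensor_rep V U) g = rchar V g * rchar U g"
proof -
  let ?m = "rdim V" and ?n = "rdim U"
  have "rchar (tensor_rep V U) g = (\<Sum>k<?m * ?n. rmat V g $$ (k div ?n, k div ?n) * rmat U g $$ (k mod ?n, k mod ?n))"
    by (simp add: rchar_def tensor_rep_def Let_def)
  also have "\<dots> = (\<Sum>a<?m. \<Sum>b<?n. rmat V g $$ (a, a) * rmat U g $$ (b, b))"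
    by (rule sum_div_mod)
  also have "\<dots> = rchar V g * rchar U g"
    by (simp add: rchar_def sum_product)
  finally show ?thesis .
qed

text \<open>The diagonal of a permutation matrix marks the fixed points, so the enumeration of
  \<open>X\<close> chosen in \<open>perm_rep\<close> drops out of the character.\<close>

lemma perm_rep_props:
  fixes \<psi> :: "'g \<Rightarrow> 'x \<Rightarrow> 'x"
  assumes "group G" "finite X"
    and "\<And>g x. g \<in> carrier G \<Longrightarrow> x \<in> X \<Longrightarrow> \<psi> g x \<in> X"
    and "\<And>x. x \<in> X \<Longrightarrow> \<psi> \<one>\<^bsub>G\<^esub> x = x"
    and "\<And>g h x. g \<in> carrier G \<Longrightarrow> h \<in> carrier G \<Longrightarrow> x \<in> X \<Longrightarrow> \<psi> (g \<otimes>\<^bsub>G\<^esub> h) x = \<psi> g (\<psi> h x)"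
  shows "is_rep G (perm_rep X \<psi>)"
    and "rchar (perm_rep X \<psi>) g = of_nat (card {x \<in> X. \<psi> g x = x})"
proof -
  define xs where "xs = (SOME xs. distinct xs \<and> set xs = X)"
  have xs: "distinct xs" "set xs = X"
    using someI_ex[OF finite_distinct_list[OF assms(2)]] unfolding xs_def by (metis (mono_tags, lifting) someI_ex assms(2) finite_distinct_list)+
  let ?V = "perm_rep X \<psi>"
  have V: "?V = \<lparr>rdim = length xs, rmat = (\<lambda>g. mat (length xs) (length xs) (\<lambda>(i, j). if xs ! i = \<psi> g (xs ! j) then 1 else 0))\<rparr>"
    by (simp add: perm_rep_def xs_def Let_def)
  show "is_rep G ?V"
  proof (rule is_repI)
    show "group G" by fact
    show "rmat ?V g \<in> carrier_mat (rdim ?V) (rdim ?V)" for g by (simp add: V)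
    fix i j assume "i < rdim ?V" "j < rdim ?V"
    then have ij: "i < length xs" "j < length xs" by (auto simp: V)
    then have x: "xs ! i \<in> X" "xs ! j \<in> X" using xs(2) nth_mem by blast+
    show "rmat ?V \<one>\<^bsub>G\<^esub> $$ (i, j) = (if i = j then 1 else 0)"
      using ij xs(1) by (simp add: V assms(4)[OF x(2)] nth_eq_iff_index_eq)
    fix g h assume gh: "g \<in> carrier G" "h \<in> carrier G"
    obtain k where k: "k < length xs" "xs ! k = \<psi> h (xs ! j)"
      using assms(3)[OF gh(2) x(2)] xs(2) by (metis in_set_conv_nth)
    have "(\<Sum>l<length xs. rmat ?V g $$ (i, l) * rmat ?V h $$ (l, j)) = (\<Sum>l<length xs. if l = k then (if xs ! i = \<psi> g (xs ! l) then 1 else 0) else 0)"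
    proof (rule sum.cong[OF refl])
      fix l assume "l \<in> {..<length xs}"
      then have "xs ! l = \<psi> h (xs ! j) \<longleftrightarrow> l = k" "l < length xs"
        using k nth_eq_iff_index_eq[OF xs(1), of l k] by auto
      then show "rmat ?V g $$ (i, l) * rmat ?V h $$ (l, j) = (if l = k then (if xs ! i = \<psi> g (xs ! l) then 1 else 0) else 0)"
        using ij by (simp add: V)
    qed
    also have "\<dots> = (if xs ! i = \<psi> g (xs ! k) then 1 else 0)" using k by simp
    also have "\<dots> = rmat ?V (g \<otimes>\<^bsub>G\<^esub> h) $$ (i, j)" using ij k by (simp add: V assms(5)[OF gh x(2)])
    finally show "rmat ?V (g \<otimes>\<^bsub>G\<^esub> h) $$ (i, j) = (\<Sum>l<rdim ?V. rmat ?V g $$ (i, l) * rmat ?V h $$ (l, j))"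
      by (simp add: V)
  qed
  have "rchar ?V g = (\<Sum>i<length xs. if \<psi> g (xs ! i) = xs ! i then 1 else 0)"
    by (auto simp: rchar_def V intro!: sum.cong)
  also have "\<dots> = (\<Sum>x\<in>X. if \<psi> g x = x then 1 else 0)"
    using sum.reindex_bij_betw[OF bij_betw_nth[OF xs(1) refl xs(2)[symmetric]], of "\<lambda>x. if \<psi> g x = x then 1 else (0::complex)"]
    by simp
  also have "\<dots> = of_nat (card {x \<in> X. \<psi> g x = x})"
    using assms(2) by (simp add: sum.If_cases Int_def)
  finally show "rchar ?V g = of_nat (card {x \<in> X. \<psi> g x = x})" .
qed

section \<open>Virtual characters and the ring operations\<close>

definition vchar :: "'g virtual \<Rightarrow> 'g \<Rightarrow> complex" where
  "vchar X g = (let x = SOME x. x \<in> X in rchar (fst x) g - rchar (snd x) g)"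

locale finite_group = group G for G :: "'g monoid" (structure) +
  assumes finite_carrier: "finite (carrier G)"
begin

text \<open>In one direction the stabilizing summand cancels from the characters. In the other,
  equal characters yield an honest isomorphism, so the stabilizing summand can be taken
  zero.\<close>

lemma vrel_iff:
  "(x, y) \<in> vrel G \<longleftrightarrow> x \<in> vreps G \<and> y \<in> vreps G \<and>
     (\<forall>g\<in>carrier G. rchar (fst x) g - rchar (snd x) g = rchar (fst y) g - rchar (snd y) g)"
proof (cases "x \<in> vreps G \<and> y \<in> vreps G")
  case True
  obtain a b c d where xy: "x = (a, b)" "y = (c, d)" by fastforce
  have r: "is_rep G a" "is_rep G b" "is_rep G c" "is_rep G d"
    using True by (auto simp: xy vreps_def)
  note sr = sum_rep_is_rep[OF is_group]
  have iff: "(x, y) \<in> vrel G \<longleftrightarrow> (\<exists>U. is_rep G U \<and> rep_iso G (sum_rep (sum_rep a d) U) (sum_rep (sum_rep c b) U))"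
    using True by (auto simp: vrel_def xy)
  show ?thesis
  proof
    assume "(x, y) \<in> vrel G"
    then obtain U where U: "is_rep G U" "rep_iso G (sum_rep (sum_rep a d) U) (sum_rep (sum_rep c b) U)"
      using iff by blast
    have "rchar a g + rchar d g + rchar U g = rchar c g + rchar b g + rchar U g" if g: "g \<in> carrier G" for g
      using rchar_iso[OF sr[OF sr[OF r(1,4)] U(1)] sr[OF sr[OF r(3,2)] U(1)] U(2) g]
      by (simp add: rchar_sum_rep[OF sr[OF r(1,4)] U(1) g] rchar_sum_rep[OF sr[OF r(3,2)] U(1) g]
          rchar_sum_rep[OF r(1,4) g] rchar_sum_rep[OF r(3,2) g])
    then have "rchar a g - rchar b g = rchar c g - rchar d g" if "g \<in> carrier G" for g
      using that by (auto simp: algebra_simps)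
    then show "x \<in> vreps G \<and> y \<in> vreps G \<and> (\<forall>g\<in>carrier G. rchar (fst x) g - rchar (snd x) g = rchar (fst y) g - rchar (snd y) g)"
      using True by (simp add: xy)
  next
    assume *: "x \<in> vreps G \<and> y \<in> vreps G \<and> (\<forall>g\<in>carrier G. rchar (fst x) g - rchar (snd x) g = rchar (fst y) g - rchar (snd y) g)"
    have "rep_iso G (sum_rep (sum_rep a d) zero_rep) (sum_rep (sum_rep c b) zero_rep)"
    proof (rule rep_iso_if_rchar_eq[OF is_group finite_carrier])
      fix g assume g: "g \<in> carrier G"
      have "rchar a g - rchar b g = rchar c g - rchar d g" using * g by (auto simp: xy)
      then show "rchar (sum_rep (sum_rep a d) zero_rep) g = rchar (sum_rep (sum_rep c b) zero_rep) g"
        using g r by (simp add: rchar_sum_rep[of G] sr zero_rep_is_rep algebra_simps)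
    qed (intro sr r zero_rep_is_rep)+
    then show "(x, y) \<in> vrel G" using iff zero_rep_is_rep by blast
  qed
qed (auto simp: vrel_def)

abbreviation vclass :: "'g vrep \<Rightarrow> 'g virtual" where
  "vclass x \<equiv> vrel G `` {x}"

lemma vclass_self: "x \<in> vreps G \<Longrightarrow> x \<in> vclass x"
  by (auto simp: vrel_iff)

text \<open>\<open>vchar\<close> evaluates a chosen member of the class; by \<open>vrel_iff\<close>
  every member has the same difference of characters.\<close>

lemma vchar_vclass:
  assumes "x \<in> vreps G" "g \<in> carrier G"
  shows "vchar (vclass x) g = rchar (fst x) g - rchar (snd x) g"
proof -
  have "(SOME y. y \<in> vclass x) \<in> vclass x"
    by (rule someI) (rule vclass_self[OF assms(1)])
  then have "(x, SOME y. y \<in> vclass x) \<in> vrel G" by (rule Image_singleton_iff[THEN iffD1])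
  then show ?thesis using assms(2) unfolding vrel_iff vchar_def Let_def by simp
qed

lemma vclass_eqI:
  assumes "x \<in> vreps G" "y \<in> vreps G"
    and "\<And>g. g \<in> carrier G \<Longrightarrow> rchar (fst x) g - rchar (snd x) g = rchar (fst y) g - rchar (snd y) g"
  shows "vclass x = vclass y"
  using assms by (auto simp: vrel_iff)

lemma carrier_Rep: "carrier (Rep G) = vclass ` vreps G"
  by (auto simp: Rep_def quotient_def)

lemma vclass_closed: "x \<in> vreps G \<Longrightarrow> vclass x \<in> carrier (Rep G)"
  by (simp add: carrier_Rep)

text \<open>The extensionality principle through which both the additive laws of the representation
  ring and the final isomorphism are verified.\<close>

lemma Rep_eqI:
  assumes "X \<in> carrier (Rep G)" "Y \<in> carrier (Rep G)" "\<And>g. g \<in> carrier G \<Longrightarrow> vchar X g = vchar Y g"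
  shows "X = Y"
proof -
  obtain x y where xy: "X = vclass x" "x \<in> vreps G" "Y = vclass y" "y \<in> vreps G"
    using assms(1,2) by (auto simp: carrier_Rep)
  show ?thesis unfolding xy
    using xy assms(3) by (intro vclass_eqI) (auto simp: vchar_vclass)
qed

text \<open>Operations on classes are unions over representatives; a family constant on the nonempty
  class collapses to its value.\<close>

lemma vclass_UN_eq:
  assumes "x \<in> vreps G" "\<And>y. y \<in> vclass x \<Longrightarrow> f y = A"
  shows "(\<Union>y\<in>vclass x. f y) = A"
  using assms vclass_self[OF assms(1)] by auto

lemma vadd_vreps: "x \<in> vreps G \<Longrightarrow> y \<in> vreps G \<Longrightarrow> vadd x y \<in> vreps G"
  by (auto simp: vadd_def vreps_def intro!: sum_rep_is_rep[OF is_group])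

lemma vmult_vreps: "x \<in> vreps G \<Longrightarrow> y \<in> vreps G \<Longrightarrow> vmult x y \<in> vreps G"
  by (auto simp: vmult_def vreps_def intro!: sum_rep_is_rep[OF is_group] tensor_rep_is_rep[OF is_group])

lemma vadd_char:
  assumes "x \<in> vreps G" "y \<in> vreps G" "g \<in> carrier G"
  shows "rchar (fst (vadd x y)) g - rchar (snd (vadd x y)) g =
    (rchar (fst x) g - rchar (snd x) g) + (rchar (fst y) g - rchar (snd y) g)"
  using assms by (auto simp: vadd_def vreps_def rchar_sum_rep[of G])

lemma vmult_char:
  assumes "x \<in> vreps G" "y \<in> vreps G" "g \<in> carrier G"
  shows "rchar (fst (vmult x y)) g - rchar (snd (vmult x y)) g =
    (rchar (fst x) g - rchar (snd x) g) * (rchar (fst y) g - rchar (snd y) g)"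
  using assms by (auto simp: vmult_def vreps_def rchar_sum_rep[of G] rchar_tensor_rep
      tensor_rep_is_rep[OF is_group] algebra_simps)

lemma Rep_add_vclass:
  assumes "x \<in> vreps G" "y \<in> vreps G"
  shows "vclass x \<oplus>\<^bsub>Rep G\<^esub> vclass y = vclass (vadd x y)"
proof -
  have "vclass x \<oplus>\<^bsub>Rep G\<^esub> vclass y = (\<Union>x'\<in>vclass x. \<Union>y'\<in>vclass y. vclass (vadd x' y'))"
    by (simp add: Rep_def)
  also have "\<dots> = vclass (vadd x y)"
    using assms by (intro vclass_UN_eq vclass_eqI vadd_vreps) (auto simp: vrel_iff vadd_char)
  finally show ?thesis .
qed

lemma Rep_mult_vclass:
  assumes "x \<in> vreps G" "y \<in> vreps G"
  shows "vclass x \<otimes>\<^bsub>Rep G\<^esub> vclass y = vclass (vmult x y)"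
proof -
  have "vclass x \<otimes>\<^bsub>Rep G\<^esub> vclass y = (\<Union>x'\<in>vclass x. \<Union>y'\<in>vclass y. vclass (vmult x' y'))"
    by (simp add: Rep_def)
  also have "\<dots> = vclass (vmult x y)"
    using assms by (intro vclass_UN_eq vclass_eqI vmult_vreps) (auto simp: vrel_iff vmult_char)
  finally show ?thesis .
qed

lemma Rep_add:
  assumes "X \<in> carrier (Rep G)" "Y \<in> carrier (Rep G)"
  shows "X \<oplus>\<^bsub>Rep G\<^esub> Y \<in> carrier (Rep G)"
    and "g \<in> carrier G \<Longrightarrow> vchar (X \<oplus>\<^bsub>Rep G\<^esub> Y) g = vchar X g + vchar Y g"
  using assms
  by (auto simp: carrier_Rep Rep_add_vclass vadd_vreps vchar_vclass vadd_char intro!: imageI)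

lemma Rep_mult:
  assumes "X \<in> carrier (Rep G)" "Y \<in> carrier (Rep G)"
  shows "X \<otimes>\<^bsub>Rep G\<^esub> Y \<in> carrier (Rep G)"
    and "g \<in> carrier G \<Longrightarrow> vchar (X \<otimes>\<^bsub>Rep G\<^esub> Y) g = vchar X g * vchar Y g"
  using assms
  by (auto simp: carrier_Rep Rep_mult_vclass vmult_vreps vchar_vclass vmult_char intro!: imageI)

lemma rep_class:
  assumes "is_rep G V"
  shows "rep_class G V \<in> carrier (Rep G)" and "g \<in> carrier G \<Longrightarrow> vchar (rep_class G V) g = rchar V g"
proof -
  have "(V, zero_rep) \<in> vreps G" using assms zero_rep_is_rep by (auto simp: vreps_def)
  then show "rep_class G V \<in> carrier (Rep G)" "g \<in> carrier G \<Longrightarrow> vchar (rep_class G V) g = rchar V g"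
    unfolding rep_class_def by (auto simp: vclass_closed vchar_vclass)
qed

lemma Rep_zero: "\<zero>\<^bsub>Rep G\<^esub> \<in> carrier (Rep G)" "g \<in> carrier G \<Longrightarrow> vchar \<zero>\<^bsub>Rep G\<^esub> g = 0"
  using rep_class[OF zero_rep_is_rep] by (auto simp: Rep_def)

lemma Rep_one: "\<one>\<^bsub>Rep G\<^esub> \<in> carrier (Rep G)" "g \<in> carrier G \<Longrightarrow> vchar \<one>\<^bsub>Rep G\<^esub> g = 1"
  using rep_class[OF triv_rep_is_rep] by (auto simp: Rep_def)

text \<open>Makes finite sums and integer multiples available. The additive inverse of a formal
  difference exchanges its two members.\<close>

lemma abelian_group_Rep: "abelian_group (Rep G)"
proof (rule abelian_groupI)
  fix X assume "X \<in> carrier (Rep G)"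
  then obtain x where x: "X = vclass x" "x \<in> vreps G" by (auto simp: carrier_Rep)
  obtain a b where ab: "x = (a, b)" by fastforce
  have v: "(b, a) \<in> vreps G" using x ab by (auto simp: vreps_def)
  have "vclass (b, a) \<oplus>\<^bsub>Rep G\<^esub> X = \<zero>\<^bsub>Rep G\<^esub>"
    using x v by (intro Rep_eqI) (auto simp: Rep_add Rep_zero vclass_closed vchar_vclass ab)
  then show "\<exists>y\<in>carrier (Rep G). y \<oplus>\<^bsub>Rep G\<^esub> X = \<zero>\<^bsub>Rep G\<^esub>"
    using vclass_closed[OF v] by blast
next
  fix X Y Z assume XYZ: "X \<in> carrier (Rep G)" "Y \<in> carrier (Rep G)" "Z \<in> carrier (Rep G)"
  show "X \<oplus>\<^bsub>Rep G\<^esub> Y \<oplus>\<^bsub>Rep G\<^esub> Z = X \<oplus>\<^bsub>Rep G\<^esub> (Y \<oplus>\<^bsub>Rep G\<^esub> Z)"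
    using XYZ by (intro Rep_eqI) (simp_all add: Rep_add)
  show "X \<oplus>\<^bsub>Rep G\<^esub> Y = Y \<oplus>\<^bsub>Rep G\<^esub> X"
    using XYZ by (intro Rep_eqI) (simp_all add: Rep_add)
  show "\<zero>\<^bsub>Rep G\<^esub> \<oplus>\<^bsub>Rep G\<^esub> X = X"
    using XYZ by (intro Rep_eqI) (simp_all add: Rep_add Rep_zero)
qed (auto simp: Rep_add Rep_zero)

lemma Rep_finsum:
  assumes "finite A" "\<And>a. a \<in> A \<Longrightarrow> f a \<in> carrier (Rep G)"
  shows "(\<Oplus>\<^bsub>Rep G\<^esub>a\<in>A. f a) \<in> carrier (Rep G)"
    and "g \<in> carrier G \<Longrightarrow> vchar (\<Oplus>\<^bsub>Rep G\<^esub>a\<in>A. f a) g = (\<Sum>a\<in>A. vchar (f a) g)"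
proof -
  interpret R: abelian_group "Rep G" by (rule abelian_group_Rep)
  show "(\<Oplus>\<^bsub>Rep G\<^esub>a\<in>A. f a) \<in> carrier (Rep G)" using assms by (intro R.finsum_closed) auto
  assume g: "g \<in> carrier G"
  show "vchar (\<Oplus>\<^bsub>Rep G\<^esub>a\<in>A. f a) g = (\<Sum>a\<in>A. vchar (f a) g)"
    using assms
  proof (induction A rule: finite_induct)
    case empty
    then show ?case using g by (simp add: Rep_zero)
  next
    case (insert x F)
    then have "(\<Oplus>\<^bsub>Rep G\<^esub>a\<in>insert x F. f a) = f x \<oplus>\<^bsub>Rep G\<^esub> (\<Oplus>\<^bsub>Rep G\<^esub>a\<in>F. f a)"
      by (intro R.finsum_insert) auto
    moreover have "(\<Oplus>\<^bsub>Rep G\<^esub>a\<in>F. f a) \<in> carrier (Rep G)" using insert by (intro R.finsum_closed) auto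
    ultimately show ?case using insert g by (simp add: Rep_add)
  qed
qed

lemma Rep_int_multiple:
  fixes k :: int
  assumes "X \<in> carrier (Rep G)"
  shows "[k] \<cdot>\<^bsub>Rep G\<^esub> X \<in> carrier (Rep G)"
    and "g \<in> carrier G \<Longrightarrow> vchar ([k] \<cdot>\<^bsub>Rep G\<^esub> X) g = of_int k * vchar X g"
proof -
  interpret R: abelian_group "Rep G" by (rule abelian_group_Rep)
  show "[k] \<cdot>\<^bsub>Rep G\<^esub> X \<in> carrier (Rep G)" using assms by (rule R.add.int_pow_closed)
  assume g: "g \<in> carrier G"
  have nat: "vchar ([n] \<cdot>\<^bsub>Rep G\<^esub> X) g = of_nat n * vchar X g" for n :: nat
  proof (induction n)
    case 0
    then show ?case using g by (simp add: Rep_zero)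
  next
    case (Suc n)
    then show ?case using g assms R.add.nat_pow_closed[OF assms]
      by (simp add: Rep_add algebra_simps)
  qed
  have neg: "vchar (\<ominus>\<^bsub>Rep G\<^esub> Y) g = - vchar Y g" if "Y \<in> carrier (Rep G)" for Y
  proof -
    have "vchar (\<ominus>\<^bsub>Rep G\<^esub> Y \<oplus>\<^bsub>Rep G\<^esub> Y) g = 0" using that g by (simp add: R.l_neg Rep_zero)
    then show ?thesis using that g by (simp add: Rep_add add_eq_0_iff2)
  qed
  show "vchar ([k] \<cdot>\<^bsub>Rep G\<^esub> X) g = of_int k * vchar X g"
  proof (cases "k \<ge> 0")
    case True
    then show ?thesis using nat[of "nat k"] by (simp add: add_pow_int_ge)
  next
    case False
    then show ?thesis using nat[of "nat (- k)"] neg[OF R.add.nat_pow_closed[OF assms]]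
      by (simp add: add_pow_int_lt)
  qed
qed

end

section \<open>Induced characters\<close>

context finite_group
begin

lemma l_coset_iff:
  assumes "subgroup H G" "x \<in> carrier G" "y \<in> carrier G"
  shows "y \<in> x <# H \<longleftrightarrow> inv x \<otimes> y \<in> H"
proof
  assume "y \<in> x <# H"
  then obtain h where h: "h \<in> H" "y = x \<otimes> h" by (auto simp: l_coset_def)
  then show "inv x \<otimes> y \<in> H"
    using assms subgroup.mem_carrier[OF assms(1) h(1)] by (simp add: m_assoc[symmetric])
next
  assume h: "inv x \<otimes> y \<in> H"
  have "y = x \<otimes> (inv x \<otimes> y)" using assms by (simp add: m_assoc[symmetric])
  then show "y \<in> x <# H" using h by (auto simp: l_coset_def)
qed

text \<open>Enumerate the left cosets without repetition and pick one element from each.\<close>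

lemma left_transversal_exists:
  assumes H: "subgroup H G"
  shows "\<exists>xs. left_transversal G H xs"
proof -
  let ?C = "(\<lambda>x. x <# H) ` carrier G"
  obtain cs where cs: "distinct cs" "set cs = ?C"
    using finite_distinct_list[OF finite_imageI[OF finite_carrier, of "\<lambda>x. x <# H"]] by auto
  define pick where "pick = (\<lambda>c. SOME x. x \<in> carrier G \<and> x <# H = c)"
  have pick: "pick c \<in> carrier G \<and> pick c <# H = c" if c: "c \<in> ?C" for c
  proof -
    obtain x where "x \<in> carrier G \<and> x <# H = c" using c by auto
    then show ?thesis unfolding pick_def by (rule someI)
  qed
  let ?xs = "map pick cs"
  have "\<exists>!a. a < length ?xs \<and> g \<in> ?xs ! a <# H" if g: "g \<in> carrier G" for g
  proof -
    have gg: "g \<in> g <# H" using g H by (simp add: l_coset_iff subgroup.one_closed)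
    have iff: "g \<in> ?xs ! a <# H \<longleftrightarrow> cs ! a = g <# H" if a: "a < length ?xs" for a
    proof -
      have "cs ! a \<in> ?C" using a cs(2) nth_mem by (metis length_map)
      then have p: "pick (cs ! a) \<in> carrier G" "pick (cs ! a) <# H = cs ! a" using pick by auto
      have "cs ! a = g <# H" if "g \<in> cs ! a"
        using l_repr_independence[of g "pick (cs ! a)" H] p that H by simp
      then show ?thesis using p gg a by auto
    qed
    obtain a where "a < length cs" "cs ! a = g <# H"
      using g cs(2) by (metis image_eqI in_set_conv_nth)
    then show ?thesis
      using iff nth_eq_iff_index_eq[OF cs(1)] by (intro ex1I[of _ a]) (simp_all del: nth_map, metis)
  qed
  then show ?thesis using pick cs(2) by (intro exI[of _ ?xs]) (auto simp: left_transversal_def)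
qed

text \<open>The choice made inside \<open>ind_rep\<close>, so that its matrices can be described
  with this list.\<close>

definition transversal :: "'g set \<Rightarrow> 'g list" where
  "transversal H = (SOME xs. left_transversal G H xs)"

lemma transversal:
  assumes "subgroup H G"
  shows "a < length (transversal H) \<Longrightarrow> transversal H ! a \<in> carrier G"
    and "g \<in> carrier G \<Longrightarrow> \<exists>!a. a < length (transversal H) \<and> inv (transversal H ! a) \<otimes> g \<in> H"
proof -
  have t: "left_transversal G H (transversal H)"
    unfolding transversal_def by (rule someI_ex[OF left_transversal_exists[OF assms]])
  show c: "transversal H ! a \<in> carrier G" if "a < length (transversal H)" for a
    using t that nth_mem by (auto simp: left_transversal_def)
  show "\<exists>!a. a < length (transversal H) \<and> inv (transversal H ! a) \<otimes> g \<in> H" if g: "g \<in> carrier G"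
  proof -
    have "\<exists>!a. a < length (transversal H) \<and> g \<in> transversal H ! a <# H"
      using t g by (auto simp: left_transversal_def)
    moreover have "a < length (transversal H) \<and> g \<in> transversal H ! a <# H \<longleftrightarrow>
        a < length (transversal H) \<and> inv (transversal H ! a) \<otimes> g \<in> H" for a
      using l_coset_iff[OF assms c g] by auto
    ultimately show ?thesis by simp
  qed
qed

text \<open>For given h and column block b exactly one row block c has its element in
  \<open>H\<close>, namely the coset containing h x_b. Products of these block-monomial matrices
  therefore have a single contributing term, and the trace only sees the blocks with a = b.\<close>

lemma ind_rep_props:
  assumes H: "subgroup H G" and V: "is_rep (G\<lparr>carrier := H\<rparr>) V"
  shows "is_rep G (ind_rep G H V)"
    and "rchar (ind_rep G H V) g = (\<Sum>a<length (transversal H).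
      let h = inv (transversal H ! a) \<otimes> g \<otimes> transversal H ! a in if h \<in> H then rchar V h else 0)"
proof -
  define xs where "xs = transversal H"
  define L where "L = length xs"
  define n where "n = rdim V"
  define t where "t = (\<lambda>a g b. inv (xs ! a) \<otimes> g \<otimes> xs ! b)"
  let ?I = "ind_rep G H V"
  have tr: "(SOME xs. left_transversal G H xs) = xs" by (simp add: xs_def transversal_def)
  have I: "rdim ?I = L * n" "rmat ?I g = mat (L * n) (L * n)
      (\<lambda>(i, j). if t (i div n) g (j div n) \<in> H then rmat V (t (i div n) g (j div n)) $$ (i mod n, j mod n) else 0)" for g
    unfolding ind_rep_def Let_def tr n_def L_def t_def by simp_all
  have x: "xs ! a \<in> carrier G" if "a < L" for a
    using transversal(1)[OF H] that by (simp add: xs_def L_def)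
  have ex1: "\<exists>!a. a < L \<and> inv (xs ! a) \<otimes> g \<in> H" if "g \<in> carrier G" for g
    using transversal(2)[OF H that] by (simp add: xs_def L_def)
  have Hc: "h \<in> carrier G" if "h \<in> H" for h using subgroup.mem_carrier[OF H that] .
  have Hm: "h \<otimes> k \<in> H" if "h \<in> H" "k \<in> H" for h k using subgroup.m_closed[OF H that] .
  have Hi: "inv h \<in> H" if "h \<in> H" for h using subgroup.m_inv_closed[OF H that] .
  have Vc: "rmat V h \<in> carrier_mat n n" if "h \<in> H" for h
    using rep_carrier[OF V] that by (simp add: n_def)
  have Vm: "rmat V (h \<otimes> k) = rmat V h * rmat V k" if "h \<in> H" "k \<in> H" for h k
    using rep_mult[OF V] that by simp
  have V1: "rmat V \<one> = 1\<^sub>m n" using rep_one[OF V] by (simp add: n_def)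
  show "is_rep G ?I"
  proof (rule is_repI)
    show "group G" by (rule is_group)
    show "rmat ?I g \<in> carrier_mat (rdim ?I) (rdim ?I)" for g by (simp add: I)
    fix i j assume "i < rdim ?I" "j < rdim ?I"
    then have ij: "i < L * n" "j < L * n" by (auto simp: I)
    define a b where "a = i div n" and "b = j div n"
    define p q where "p = i mod n" and "q = j mod n"
    have ab: "a < L" "b < L" "p < n" "q < n"
      using div_mod_less[OF ij(1)] div_mod_less[OF ij(2)] by (auto simp: a_def b_def p_def q_def)
    have eq: "i = j \<longleftrightarrow> a = b \<and> p = q"
      unfolding a_def b_def p_def q_def by (metis div_mult_mod_eq)
    have "t a \<one> b \<in> H \<longleftrightarrow> a = b"
    proof -
      have "inv (xs ! b) \<otimes> xs ! b \<in> H" using x[OF ab(2)] subgroup.one_closed[OF H] by simp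
      then show ?thesis using ex1[OF x[OF ab(2)]] ab x by (auto simp: t_def)
    qed
    moreover have "t a \<one> a = \<one>" using x[OF ab(1)] by (simp add: t_def)
    ultimately show "rmat ?I \<one> $$ (i, j) = (if i = j then 1 else 0)"
      using ij ab by (auto simp: I eq V1 a_def[symmetric] b_def[symmetric] p_def[symmetric] q_def[symmetric])
    fix g h assume gh: "g \<in> carrier G" "h \<in> carrier G"
    obtain c where c: "c < L" "inv (xs ! c) \<otimes> (h \<otimes> xs ! b) \<in> H"
      "\<And>c'. c' < L \<Longrightarrow> inv (xs ! c') \<otimes> (h \<otimes> xs ! b) \<in> H \<Longrightarrow> c' = c"
      using ex1[of "h \<otimes> xs ! b"] gh x[OF ab(2)] by blast
    have tc: "t c' h b \<in> H \<longleftrightarrow> c' = c" if "c' < L" for c'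
    proof -
      have "t c' h b = inv (xs ! c') \<otimes> (h \<otimes> xs ! b)"
        using gh x[OF that] x[OF ab(2)] by (simp add: t_def m_assoc)
      then show ?thesis using c(2) c(3)[OF that] by auto
    qed
    \<comment> \<open>The representative x_c cancels between the two factors.\<close>
    have tm: "t a (g \<otimes> h) b = t a g c \<otimes> t c h b"
    proof -
      have cancel: "(A \<otimes> y) \<otimes> (inv y \<otimes> B) = A \<otimes> B" if "A \<in> carrier G" "B \<in> carrier G" "y \<in> carrier G" for A B y
      proof -
        have "y \<otimes> (inv y \<otimes> B) = B" using that by (simp add: m_assoc[symmetric])
        then show ?thesis using m_assoc[of A y "inv y \<otimes> B"] that by simp
      qed
      have "t a g c \<otimes> t c h b = (inv (xs ! a) \<otimes> g \<otimes> xs ! c) \<otimes> (inv (xs ! c) \<otimes> (h \<otimes> xs ! b))"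
        using gh x[OF ab(2)] x[OF c(1)] by (simp add: t_def m_assoc[of "inv (xs ! c)" h "xs ! b"])
      also have "\<dots> = (inv (xs ! a) \<otimes> g) \<otimes> (h \<otimes> xs ! b)"
        using gh x[OF ab(1)] x[OF ab(2)] x[OF c(1)] by (intro cancel) auto
      also have "\<dots> = t a (g \<otimes> h) b"
        using gh x[OF ab(1)] x[OF ab(2)] by (simp add: t_def m_assoc)
      finally show ?thesis by simp
    qed
    have tH: "t c h b \<in> H" using tc[OF c(1)] by simp
    have tcar: "t a g c \<in> carrier G" using gh x[OF ab(1)] x[OF c(1)] by (simp add: t_def)
    have tiff: "t a (g \<otimes> h) b \<in> H \<longleftrightarrow> t a g c \<in> H"
    proof
      assume "t a (g \<otimes> h) b \<in> H"
      then have "t a g c \<otimes> t c h b \<otimes> inv (t c h b) \<in> H" using tm Hm Hi tH by simp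
      then show "t a g c \<in> H" using tcar Hc[OF tH] by (simp add: m_assoc)
    qed (use tm Hm tH in simp)
    have "(\<Sum>k<L * n. rmat ?I g $$ (i, k) * rmat ?I h $$ (k, j)) =
      (\<Sum>k<L * n. (if t a g (k div n) \<in> H then rmat V (t a g (k div n)) $$ (p, k mod n) else 0) *
         (if t (k div n) h b \<in> H then rmat V (t (k div n) h b) $$ (k mod n, q) else 0))"
      using ij by (intro sum.cong refl) (simp add: I a_def b_def p_def q_def)
    also have "\<dots> = (\<Sum>d<L. \<Sum>l<n. (if t a g d \<in> H then rmat V (t a g d) $$ (p, l) else 0) *
         (if t d h b \<in> H then rmat V (t d h b) $$ (l, q) else 0))"
      by (rule sum_div_mod[where f = "\<lambda>d l. (if t a g d \<in> H then rmat V (t a g d) $$ (p, l) else 0) *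
         (if t d h b \<in> H then rmat V (t d h b) $$ (l, q) else 0)"])
    also have "\<dots> = (\<Sum>d<L. if d = c then (\<Sum>l<n. (if t a g d \<in> H then rmat V (t a g d) $$ (p, l) else 0) * rmat V (t d h b) $$ (l, q)) else 0)"
      using tc by (intro sum.cong refl) auto
    also have "\<dots> = (\<Sum>l<n. (if t a g c \<in> H then rmat V (t a g c) $$ (p, l) else 0) * rmat V (t c h b) $$ (l, q))"
      using c(1) by simp
    also have "\<dots> = (if t a (g \<otimes> h) b \<in> H then rmat V (t a (g \<otimes> h) b) $$ (p, q) else 0)"
    proof (cases "t a g c \<in> H")
      case True
      then show ?thesis using tiff tm Vm[OF True tH] mat_mult_entry[OF Vc[OF True] Vc[OF tH] ab(3,4)] by simp
    qed (use tiff in simp)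
    also have "\<dots> = rmat ?I (g \<otimes> h) $$ (i, j)"
      using ij by (simp add: I a_def b_def p_def q_def)
    finally show "rmat ?I (g \<otimes> h) $$ (i, j) = (\<Sum>k<rdim ?I. rmat ?I g $$ (i, k) * rmat ?I h $$ (k, j))"
      by (simp add: I)
  qed
  have "rchar ?I g = (\<Sum>k<L * n. if t (k div n) g (k div n) \<in> H then rmat V (t (k div n) g (k div n)) $$ (k mod n, k mod n) else 0)"
    by (simp add: rchar_def I)
  also have "\<dots> = (\<Sum>a<L. \<Sum>l<n. if t a g a \<in> H then rmat V (t a g a) $$ (l, l) else 0)"
    by (rule sum_div_mod[where f = "\<lambda>a l. if t a g a \<in> H then rmat V (t a g a) $$ (l, l) else 0"])
  also have "\<dots> = (\<Sum>a<L. let h = t a g a in if h \<in> H then rchar V h else 0)"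
    by (intro sum.cong refl) (simp add: rchar_def n_def Let_def)
  finally show "rchar ?I g = (\<Sum>a<length (transversal H).
      let h = inv (transversal H ! a) \<otimes> g \<otimes> transversal H ! a in if h \<in> H then rchar V h else 0)"
    by (simp add: L_def xs_def t_def)
qed

lemma finite_group_subgroup:
  assumes "subgroup H G"
  shows "finite_group (G\<lparr>carrier := H\<rparr>)"
  using subgroup.subgroup_is_group[OF assms is_group] finite_subset[OF subgroup.subset[OF assms] finite_carrier]
  by (simp add: finite_group_def finite_group_axioms_def)

text \<open>The character of an induced representation depends only on the character on
  \<open>H\<close>, so the union over representatives in \<open>Ind\<close> is a single
  class.\<close>

lemma Ind_props:
  assumes H: "subgroup H G" and X: "X \<in> carrier (Rep (G\<lparr>carrier := H\<rparr>))"
  shows "Ind G (G\<lparr>carrier := H\<rparr>) X \<in> carrier (Rep G)"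
    and "g \<in> carrier G \<Longrightarrow> vchar (Ind G (G\<lparr>carrier := H\<rparr>) X) g = (\<Sum>a<length (transversal H).
      let h = inv (transversal H ! a) \<otimes> g \<otimes> transversal H ! a in if h \<in> H then vchar X h else 0)"
proof -
  let ?H = "G\<lparr>carrier := H\<rparr>"
  interpret H: finite_group ?H by (rule finite_group_subgroup[OF H])
  obtain x where x: "X = H.vclass x" "x \<in> vreps ?H"
    using X unfolding H.carrier_Rep by blast
  define I where "I = (\<lambda>y :: 'g vrep. (ind_rep G H (fst y), ind_rep G H (snd y)))"
  have I: "I y \<in> vreps G" if "y \<in> vreps ?H" for y
    using that by (auto simp: I_def vreps_def ind_rep_props(1)[OF H])
  have Ichar: "rchar (fst (I y)) g - rchar (snd (I y)) g = (\<Sum>a<length (transversal H).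
      let h = inv (transversal H ! a) \<otimes> g \<otimes> transversal H ! a in if h \<in> H then rchar (fst y) h - rchar (snd y) h else 0)"
    if "y \<in> vreps ?H" for y g
  proof -
    have r: "is_rep ?H (fst y)" "is_rep ?H (snd y)" using that by (auto simp: vreps_def)
    show ?thesis
      unfolding I_def fst_conv snd_conv ind_rep_props(2)[OF H r(1)] ind_rep_props(2)[OF H r(2)]
      by (simp add: sum_subtractf[symmetric] Let_def if_distrib cong: if_cong)
  qed
  have vH: "y \<in> vreps ?H" "\<And>h. h \<in> H \<Longrightarrow> rchar (fst x) h - rchar (snd x) h = rchar (fst y) h - rchar (snd y) h"
    if "y \<in> H.vclass x" for y
    using that H.vrel_iff[of x y] by auto
  have "Ind G ?H X = (\<Union>y\<in>H.vclass x. vclass (I y))"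
    by (simp add: Ind_def x I_def)
  also have "\<dots> = vclass (I x)"
  proof (rule H.vclass_UN_eq[OF x(2)])
    fix y assume y: "y \<in> H.vclass x"
    show "vclass (I y) = vclass (I x)"
      by (rule vclass_eqI[OF I[OF vH(1)[OF y]] I[OF x(2)]])
        (use vH[OF y] in \<open>auto simp: Ichar x(2) Let_def intro!: sum.cong\<close>)
  qed
  finally have eq: "Ind G ?H X = vclass (I x)" .
  show "Ind G ?H X \<in> carrier (Rep G)" unfolding eq by (rule vclass_closed[OF I[OF x(2)]])
  assume g: "g \<in> carrier G"
  show "vchar (Ind G ?H X) g = (\<Sum>a<length (transversal H).
      let h = inv (transversal H ! a) \<otimes> g \<otimes> transversal H ! a in if h \<in> H then vchar X h else 0)"
    unfolding eq vchar_vclass[OF I[OF x(2)] g] Ichar[OF x(2)]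
    using H.vchar_vclass[OF x(2)] x(1) by (auto simp: Let_def intro!: sum.cong)
qed

text \<open>The fixed points of \<open>g\<close> in the orbit of \<open>F\<close> are the translates \<open>x\<^sub>a F\<close> with
  \<open>x\<^sub>a\<^sup>-\<^sup>1 g x\<^sub>a\<close> in the stabilizer of \<open>F\<close>.\<close>

lemma vchar_orbit_sum:
  fixes \<alpha> :: "'g \<Rightarrow> 'x \<Rightarrow> 'x"
  assumes fin: "finite E"
    and cl: "\<And>g x. g \<in> carrier G \<Longrightarrow> x \<in> E \<Longrightarrow> \<alpha> g x \<in> E"
    and one: "\<And>x. x \<in> E \<Longrightarrow> \<alpha> \<one> x = x"
    and mult: "\<And>g h x. g \<in> carrier G \<Longrightarrow> h \<in> carrier G \<Longrightarrow> x \<in> E \<Longrightarrow> \<alpha> (g \<otimes> h) x = \<alpha> g (\<alpha> h x)"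
    and X: "\<And>x. x \<in> E \<Longrightarrow> X x \<in> carrier (Rep (G\<lparr>carrier := stabilizer G \<alpha> x\<rparr>))"
    and \<Psi>: "\<And>x h. x \<in> E \<Longrightarrow> h \<in> stabilizer G \<alpha> x \<Longrightarrow> vchar (X x) h = \<Psi> x h"
    and conj: "\<And>x g k. x \<in> E \<Longrightarrow> g \<in> carrier G \<Longrightarrow> k \<in> carrier G \<Longrightarrow> \<alpha> g (\<alpha> k x) = \<alpha> k x \<Longrightarrow>
       \<Psi> (\<alpha> k x) g = \<Psi> x (inv k \<otimes> g \<otimes> k)"
  shows "(\<Oplus>\<^bsub>Rep G\<^esub>Q\<in>orbits G E \<alpha>. let x = SOME x. x \<in> Q in Ind G (G\<lparr>carrier := stabilizer G \<alpha> x\<rparr>) (X x)) \<in> carrier (Rep G)"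
    and "g \<in> carrier G \<Longrightarrow>
      vchar (\<Oplus>\<^bsub>Rep G\<^esub>Q\<in>orbits G E \<alpha>. let x = SOME x. x \<in> Q in Ind G (G\<lparr>carrier := stabilizer G \<alpha> x\<rparr>) (X x)) g
      = (\<Sum>x | x \<in> E \<and> \<alpha> g x = x. \<Psi> x g)"
proof -
  have act_inv: "\<alpha> (inv g) (\<alpha> g x) = x" if "g \<in> carrier G" "x \<in> E" for g x
    using mult[of "inv g" g x] that one by simp
  have S: "subgroup (stabilizer G \<alpha> x) G" if "x \<in> E" for x
  proof (rule subgroupI)
    show "stabilizer G \<alpha> x \<noteq> {}" using one[OF that] by (auto simp: stabilizer_def)
    fix a b assume a: "a \<in> stabilizer G \<alpha> x"
    show "inv a \<in> stabilizer G \<alpha> x" using a act_inv[of a x] that by (auto simp: stabilizer_def)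
    assume b: "b \<in> stabilizer G \<alpha> x"
    show "a \<otimes> b \<in> stabilizer G \<alpha> x" using a b that by (auto simp: stabilizer_def mult)
  qed (auto simp: stabilizer_def)
  have same: "orbit G \<alpha> x = orbit G \<alpha> y" if x: "x \<in> E" and y: "y \<in> orbit G \<alpha> x" for x y
  proof -
    obtain k where k: "k \<in> carrier G" "y = \<alpha> k x" using y by (auto simp: orbit_def)
    show ?thesis
    proof (intro equalityI subsetI)
      fix z assume "z \<in> orbit G \<alpha> x"
      then obtain h where h: "h \<in> carrier G" "z = \<alpha> h x" by (auto simp: orbit_def)
      have "z = \<alpha> (h \<otimes> inv k) y"
        using k h x mult[of "h \<otimes> inv k" k x] by (simp add: m_assoc)
      moreover have "h \<otimes> inv k \<in> carrier G" using h k by simp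
      ultimately show "z \<in> orbit G \<alpha> y" unfolding orbit_def by blast
    next
      fix z assume "z \<in> orbit G \<alpha> y"
      then obtain h where h: "h \<in> carrier G" "z = \<alpha> h y" by (auto simp: orbit_def)
      have "z = \<alpha> (h \<otimes> k) x" using k h x mult[of h k x] by simp
      moreover have "h \<otimes> k \<in> carrier G" using h k by simp
      ultimately show "z \<in> orbit G \<alpha> x" unfolding orbit_def by blast
    qed
  qed
  let ?O = "orbits G E \<alpha>"
  define rp where "rp = (\<lambda>Q. SOME x :: 'x. x \<in> Q)"
  have orb: "Q \<subseteq> E" "rp Q \<in> E" "Q = orbit G \<alpha> (rp Q)" if Q: "Q \<in> ?O" for Q
  proof -
    obtain x where x: "x \<in> E" "Q = orbit G \<alpha> x" using Q by (auto simp: orbits_def)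
    have "x \<in> Q" using x one[OF x(1)] by (force simp: orbit_def)
    then have rp: "rp Q \<in> Q" unfolding rp_def by (rule someI)
    show "Q \<subseteq> E" using x cl by (auto simp: orbit_def)
    then show "rp Q \<in> E" using rp by auto
    show "Q = orbit G \<alpha> (rp Q)" using same[of x "rp Q"] x rp by simp
  qed
  have finO: "finite ?O"
    by (rule finite_subset[of _ "Pow E"]) (use orb(1) fin in auto)
  let ?H = "\<lambda>x. stabilizer G \<alpha> x"
  have I: "Ind G (G\<lparr>carrier := ?H (rp Q)\<rparr>) (X (rp Q)) \<in> carrier (Rep G)" if "Q \<in> ?O" for Q
    using Ind_props(1)[OF S X] orb(2)[OF that] by blast
  have eq: "(\<Oplus>\<^bsub>Rep G\<^esub>Q\<in>?O. let x = SOME x. x \<in> Q in Ind G (G\<lparr>carrier := ?H x\<rparr>) (X x))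
     = (\<Oplus>\<^bsub>Rep G\<^esub>Q\<in>?O. Ind G (G\<lparr>carrier := ?H (rp Q)\<rparr>) (X (rp Q)))"
    by (simp add: rp_def Let_def)
  show "(\<Oplus>\<^bsub>Rep G\<^esub>Q\<in>?O. let x = SOME x. x \<in> Q in Ind G (G\<lparr>carrier := ?H x\<rparr>) (X x)) \<in> carrier (Rep G)"
    unfolding eq by (rule Rep_finsum(1)[OF finO I])
  assume g: "g \<in> carrier G"
  have orbit_term: "vchar (Ind G (G\<lparr>carrier := ?H (rp Q)\<rparr>) (X (rp Q))) g = (\<Sum>x | x \<in> Q \<and> \<alpha> g x = x. \<Psi> x g)" if Q: "Q \<in> ?O" for Q
  proof -
    let ?x = "rp Q" and ?xs = "transversal (?H (rp Q))"
    note x = orb(2)[OF Q] and t = transversal[OF S[OF orb(2)[OF Q]]]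
    have stab: "inv (?xs ! a) \<otimes> g \<otimes> ?xs ! a \<in> ?H ?x \<longleftrightarrow> \<alpha> g (\<alpha> (?xs ! a) ?x) = \<alpha> (?xs ! a) ?x"
      if a: "a < length ?xs" for a
    proof -
      have m: "\<alpha> (inv (?xs ! a) \<otimes> g \<otimes> ?xs ! a) ?x = \<alpha> (inv (?xs ! a)) (\<alpha> g (\<alpha> (?xs ! a) ?x))"
        using t(1)[OF a] g x cl by (simp add: mult)
      show ?thesis
      proof
        assume "inv (?xs ! a) \<otimes> g \<otimes> ?xs ! a \<in> ?H ?x"
        then have "\<alpha> (inv (?xs ! a)) (\<alpha> g (\<alpha> (?xs ! a) ?x)) = ?x" using m by (simp add: stabilizer_def)
        then have "\<alpha> (?xs ! a) (\<alpha> (inv (?xs ! a)) (\<alpha> g (\<alpha> (?xs ! a) ?x))) = \<alpha> (?xs ! a) ?x" by simp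
        then show "\<alpha> g (\<alpha> (?xs ! a) ?x) = \<alpha> (?xs ! a) ?x"
          using act_inv[of "inv (?xs ! a)"] t(1)[OF a] g x cl by simp
      next
        assume "\<alpha> g (\<alpha> (?xs ! a) ?x) = \<alpha> (?xs ! a) ?x"
        then show "inv (?xs ! a) \<otimes> g \<otimes> ?xs ! a \<in> ?H ?x"
          using m act_inv[OF t(1)[OF a] x] t(1)[OF a] g by (simp add: stabilizer_def)
      qed
    qed
    \<comment> \<open>Orbit-stabilizer: the coset representatives of the stabilizer enumerate the
      orbit without repetition, which converts the sum over cosets into a sum over points.\<close>
    have bij: "bij_betw (\<lambda>a. \<alpha> (?xs ! a) ?x) {..<length ?xs} Q"
    proof (rule bij_betw_imageI)
      have st: "inv k \<otimes> h \<in> ?H ?x \<longleftrightarrow> \<alpha> h ?x = \<alpha> k ?x" if "k \<in> carrier G" "h \<in> carrier G" for k h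
      proof -
        have "\<alpha> (inv k \<otimes> h) ?x = \<alpha> (inv k) (\<alpha> h ?x)" using that x by (simp add: mult)
        moreover have "\<alpha> (inv k) (\<alpha> h ?x) = ?x \<longleftrightarrow> \<alpha> h ?x = \<alpha> k ?x"
          using act_inv[OF that(1) x] act_inv[of "inv k" "\<alpha> h ?x"] that cl[OF that(2) x] by auto
        ultimately show ?thesis using that by (simp add: stabilizer_def)
      qed
      show "inj_on (\<lambda>a. \<alpha> (?xs ! a) ?x) {..<length ?xs}"
      proof (rule inj_onI)
        fix a b assume ab: "a \<in> {..<length ?xs}" "b \<in> {..<length ?xs}" "\<alpha> (?xs ! a) ?x = \<alpha> (?xs ! b) ?x"
        then have c: "?xs ! a \<in> carrier G" "?xs ! b \<in> carrier G" using t(1) by auto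
        have "inv (?xs ! a) \<otimes> ?xs ! b \<in> ?H ?x" "inv (?xs ! b) \<otimes> ?xs ! b \<in> ?H ?x"
          using st[OF c(1,2)] st[OF c(2,2)] ab(3) by auto
        then show "a = b" using t(2)[OF c(2)] ab(1,2) by auto
      qed
      show "(\<lambda>a. \<alpha> (?xs ! a) ?x) ` {..<length ?xs} = Q"
      proof
        show "(\<lambda>a. \<alpha> (?xs ! a) ?x) ` {..<length ?xs} \<subseteq> Q"
          using t(1) by (subst orb(3)[OF Q]) (auto simp: orbit_def)
        show "Q \<subseteq> (\<lambda>a. \<alpha> (?xs ! a) ?x) ` {..<length ?xs}"
        proof
          fix y assume "y \<in> Q"
          then obtain h where h: "h \<in> carrier G" "y = \<alpha> h ?x"
            using orb(3)[OF Q] by (auto simp: orbit_def)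
          obtain a where a: "a < length ?xs" "inv (?xs ! a) \<otimes> h \<in> ?H ?x" using t(2)[OF h(1)] by blast
          then have "y = \<alpha> (?xs ! a) ?x" using st[OF t(1)[OF a(1)] h(1)] h(2) by simp
          then show "y \<in> (\<lambda>a. \<alpha> (?xs ! a) ?x) ` {..<length ?xs}" using a(1) by blast
        qed
      qed
    qed
    have "vchar (Ind G (G\<lparr>carrier := ?H ?x\<rparr>) (X ?x)) g
       = (\<Sum>a<length ?xs. let h = inv (?xs ! a) \<otimes> g \<otimes> ?xs ! a in if h \<in> ?H ?x then vchar (X ?x) h else 0)"
      by (rule Ind_props(2)[OF S[OF x] X[OF x] g])
    also have "\<dots> = (\<Sum>a<length ?xs. if \<alpha> g (\<alpha> (?xs ! a) ?x) = \<alpha> (?xs ! a) ?x then \<Psi> (\<alpha> (?xs ! a) ?x) g else 0)"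
    proof (rule sum.cong[OF refl])
      fix a assume "a \<in> {..<length ?xs}"
      then have a: "a < length ?xs" by simp
      show "(let h = inv (?xs ! a) \<otimes> g \<otimes> ?xs ! a in if h \<in> ?H ?x then vchar (X ?x) h else 0)
        = (if \<alpha> g (\<alpha> (?xs ! a) ?x) = \<alpha> (?xs ! a) ?x then \<Psi> (\<alpha> (?xs ! a) ?x) g else 0)"
        using stab[OF a] \<Psi>[OF x] conj[OF x g t(1)[OF a]] by (auto simp: Let_def)
    qed
    also have "\<dots> = (\<Sum>x\<in>Q. if \<alpha> g x = x then \<Psi> x g else 0)"
      by (rule sum.reindex_bij_betw[OF bij])
    also have "\<dots> = (\<Sum>x | x \<in> Q \<and> \<alpha> g x = x. \<Psi> x g)"
      using finite_subset[OF orb(1)[OF Q] fin] by (simp add: sum.If_cases Int_def)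
    finally show ?thesis .
  qed
  have "vchar (\<Oplus>\<^bsub>Rep G\<^esub>Q\<in>?O. Ind G (G\<lparr>carrier := ?H (rp Q)\<rparr>) (X (rp Q))) g = (\<Sum>Q\<in>?O. vchar (Ind G (G\<lparr>carrier := ?H (rp Q)\<rparr>) (X (rp Q))) g)"
    by (rule Rep_finsum(2)[OF finO I g])
  also have "\<dots> = (\<Sum>Q\<in>?O. \<Sum>x | x \<in> Q \<and> \<alpha> g x = x. \<Psi> x g)"
    by (intro sum.cong refl orbit_term)
  \<comment> \<open>Orbits partition \<open>E\<close>, so the sums over the fixed points in the
    single orbits combine.\<close>
  also have "\<dots> = (\<Sum>x\<in>(\<Union>Q\<in>?O. {x. x \<in> Q \<and> \<alpha> g x = x}). \<Psi> x g)"
  proof (rule sum.UNION_disjoint[symmetric])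
    show "\<forall>Q\<in>?O. \<forall>Q'\<in>?O. Q \<noteq> Q' \<longrightarrow> {x. x \<in> Q \<and> \<alpha> g x = x} \<inter> {x. x \<in> Q' \<and> \<alpha> g x = x} = {}"
    proof (intro ballI impI)
      fix Q Q' assume "Q \<in> ?O" "Q' \<in> ?O" "Q \<noteq> Q'"
      then show "{x. x \<in> Q \<and> \<alpha> g x = x} \<inter> {x. x \<in> Q' \<and> \<alpha> g x = x} = {}"
        using orb(2,3) same by (metis (no_types, lifting) disjoint_iff mem_Collect_eq)
    qed
  qed (use finO finite_subset[OF orb(1) fin] in auto)
  also have "(\<Union>Q\<in>?O. {x. x \<in> Q \<and> \<alpha> g x = x}) = {x. x \<in> E \<and> \<alpha> g x = x}"
  proof -
    have "\<exists>Q\<in>?O. x \<in> Q" if "x \<in> E" for x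
      using that one[OF that] by (intro bexI[of _ "orbit G \<alpha> x"]) (force simp: orbit_def orbits_def)+
    then show ?thesis using orb(1) by blast
  qed
  finally show "vchar (\<Oplus>\<^bsub>Rep G\<^esub>Q\<in>?O. let x = SOME x. x \<in> Q in Ind G (G\<lparr>carrier := ?H x\<rparr>) (X x)) g
      = (\<Sum>x | x \<in> E \<and> \<alpha> g x = x. \<Psi> x g)"
    unfolding eq .
qed

end

section \<open>Kazhdan--Lusztig numbers of a ranked poset\<close>

text \<open>\<open>flags\<close> for an arbitrary family of sets and ranking; it will be used for
  the flats fixed by a group element.\<close>

definition chains :: "'b set set \<Rightarrow> ('b set \<Rightarrow> int) \<Rightarrow> nat \<Rightarrow> (nat \<Rightarrow> int) \<Rightarrow> (nat \<Rightarrow> 'b set) set" where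
  "chains L c r d =
     {F \<in> {1..r} \<rightarrow>\<^sub>E L. (\<forall>j\<in>{1..<r}. F (Suc j) \<subseteq> F j) \<and> (\<forall>j\<in>{1..r}. c (F j) = d j)}"

text \<open>The index sequences with both final values free. Removing the smallest member of a chain
  leads to final values other than i and rk M - i.\<close>

definition steps :: "nat \<Rightarrow> int \<Rightarrow> int \<Rightarrow> (nat \<Rightarrow> int) set" where
  "steps r p q = {a \<in> {0..r + 1} \<rightarrow>\<^sub>E UNIV. strict_mono_on {0..r + 1} a \<and> a 0 = 0 \<and> a r = p \<and> a (r + 1) = q}"

definition signed_chains :: "'b set set \<Rightarrow> ('b set \<Rightarrow> int) \<Rightarrow> nat \<Rightarrow> int \<Rightarrow> int \<Rightarrow> int" where
  "signed_chains L c r p q = (\<Sum>S\<in>Pow {1..r}. (- 1) ^ card S *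
     (\<Sum>a\<in>steps r p q. int (card (chains L c r (\<lambda>j. a (t_index S j) + a (j - 1))))))"

definition above :: "'b set set \<Rightarrow> 'b set \<Rightarrow> 'b set set" where
  "above L E = {X \<in> L. E \<subseteq> X}"

lemma finite_chains: "finite L \<Longrightarrow> finite (chains L c r d)"
  unfolding chains_def by (rule finite_subset[of _ "{1..r} \<rightarrow>\<^sub>E L"]) (auto intro: finite_PiE)

lemma chains_cong: "(\<And>j. j \<in> {1..r} \<Longrightarrow> d j = d' j) \<Longrightarrow> chains L c r d = chains L c r d'"
  by (auto simp: chains_def)

lemma card_chains_transport:
  assumes "bij_betw \<theta> L L'" "\<And>X Y. X \<in> L \<Longrightarrow> Y \<in> L \<Longrightarrow> \<theta> X \<subseteq> \<theta> Y \<longleftrightarrow> X \<subseteq> Y"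
    and "\<And>X. X \<in> L \<Longrightarrow> c' (\<theta> X) = c X"
  shows "card (chains L c r d) = card (chains L' c' r d)"
proof -
  define \<eta> where "\<eta> = inv_into L \<theta>"
  have \<eta>: "\<eta> X \<in> L" "\<theta> (\<eta> X) = X" if "X \<in> L'" for X
    using that assms(1) by (auto simp: \<eta>_def bij_betw_def inv_into_into f_inv_into_f)
  have \<eta>\<theta>: "\<eta> (\<theta> X) = X" "\<theta> X \<in> L'" if "X \<in> L" for X
    using that assms(1) by (auto simp: \<eta>_def bij_betw_def)
  have "bij_betw (\<lambda>F. \<lambda>j\<in>{1..r}. \<theta> (F j)) (chains L c r d) (chains L' c' r d)"
  proof (rule bij_betwI[where g = "\<lambda>F. \<lambda>j\<in>{1..r}. \<eta> (F j)"])
    show "(\<lambda>F. \<lambda>j\<in>{1..r}. \<theta> (F j)) \<in> chains L c r d \<rightarrow> chains L' c' r d"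
    proof
      fix F assume F: "F \<in> chains L c r d"
      then have L: "F j \<in> L" if "j \<in> {1..r}" for j using that by (auto simp: chains_def)
      show "(\<lambda>j\<in>{1..r}. \<theta> (F j)) \<in> chains L' c' r d"
        using F L \<eta>\<theta> assms(2,3) by (auto simp: chains_def)
    qed
    show "(\<lambda>F. \<lambda>j\<in>{1..r}. \<eta> (F j)) \<in> chains L' c' r d \<rightarrow> chains L c r d"
    proof
      fix F assume F: "F \<in> chains L' c' r d"
      then have L: "F j \<in> L'" if "j \<in> {1..r}" for j using that by (auto simp: chains_def)
      have "\<eta> (F (Suc j)) \<subseteq> \<eta> (F j)" if j: "j \<in> {1..<r}" for j
      proof -
        have "F (Suc j) \<subseteq> F j" using F j by (auto simp: chains_def)
        moreover have "F (Suc j) \<in> L'" "F j \<in> L'" using L j by auto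
        ultimately show ?thesis using \<eta> assms(2)[of "\<eta> (F (Suc j))" "\<eta> (F j)"] by simp
      qed
      moreover have "c (\<eta> (F j)) = d j" if j: "j \<in> {1..r}" for j
        using F j L[OF j] \<eta>[OF L[OF j]] assms(3)[of "\<eta> (F j)"] by (auto simp: chains_def)
      ultimately show "(\<lambda>j\<in>{1..r}. \<eta> (F j)) \<in> chains L c r d"
        using L \<eta> by (auto simp: chains_def)
    qed
    fix F assume "F \<in> chains L c r d"
    then show "(\<lambda>j\<in>{1..r}. \<eta> ((\<lambda>j\<in>{1..r}. \<theta> (F j)) j)) = F"
      using \<eta>\<theta> by (intro ext) (auto simp: chains_def PiE_def Pi_def extensional_def)
  next
    fix F assume "F \<in> chains L' c' r d"
    then show "(\<lambda>j\<in>{1..r}. \<theta> ((\<lambda>j\<in>{1..r}. \<eta> (F j)) j)) = F"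
      using \<eta> by (intro ext) (auto simp: chains_def PiE_def Pi_def extensional_def)
  qed
  then show ?thesis by (rule bij_betw_same_card)
qed

lemma chains_decreasing:
  assumes "F \<in> chains L c r d" "1 \<le> i" "i \<le> j" "j \<le> r"
  shows "F j \<subseteq> F i"
  using assms(3,4)
proof (induction j rule: dec_induct)
  case (step k)
  then have "F (Suc k) \<subseteq> F k" using assms(1,2) by (auto simp: chains_def)
  then show ?case using step by auto
qed auto

text \<open>Chains decrease with the index, so the entry at \<open>Suc r\<close> lies below all
  others and the remaining entries form a chain above it.\<close>

lemma card_chains_Suc:
  assumes "finite L"
  shows "card (chains L c (Suc r) d) =
    (\<Sum>F\<in>L. if c F = d (Suc r) then card (chains (above L F) c r d) else 0)"
proof -
  let ?A = "{F \<in> L. c F = d (Suc r)}"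
  have "bij_betw (\<lambda>F. (F (Suc r), restrict F {1..r})) (chains L c (Suc r) d)
     (SIGMA F:?A. chains (above L F) c r d)"
  proof (rule bij_betwI[where g = "\<lambda>(X, F). F(Suc r := X)"])
    show "(\<lambda>F. (F (Suc r), restrict F {1..r})) \<in> chains L c (Suc r) d \<rightarrow> (SIGMA F:?A. chains (above L F) c r d)"
    proof
      fix F assume F: "F \<in> chains L c (Suc r) d"
      have "F (Suc r) \<subseteq> F j" if "j \<in> {1..r}" for j
        using chains_decreasing[OF F, of j "Suc r"] that by auto
      then have "restrict F {1..r} \<in> {1..r} \<rightarrow>\<^sub>E above L (F (Suc r))"
        using F by (intro restrict_PiE_iff[THEN iffD2]) (auto simp: chains_def above_def)
      then show "(F (Suc r), restrict F {1..r}) \<in> (SIGMA F:?A. chains (above L F) c r d)"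
        using F by (auto simp: chains_def)
    qed
    show "(\<lambda>(X, F). F(Suc r := X)) \<in> (SIGMA F:?A. chains (above L F) c r d) \<rightarrow> chains L c (Suc r) d"
    proof
      fix p assume "p \<in> (SIGMA F:?A. chains (above L F) c r d)"
      then obtain X F where p: "p = (X, F)" "X \<in> L" "c X = d (Suc r)" "F \<in> chains (above L X) c r d" by auto
      have 1: "F j \<in> L" "X \<subseteq> F j" "c (F j) = d j" if "j \<in> {1..r}" for j
        using p(4) that by (auto simp: chains_def above_def PiE_def Pi_def)
      have 2: "F (Suc j) \<subseteq> F j" if "j \<in> {1..<r}" for j
        using p(4) that by (auto simp: chains_def)
      have 3: "F j = undefined" if "j \<notin> {1..r}" for j
        using p(4) that by (auto simp: chains_def PiE_def extensional_def)
      have "F(Suc r := X) \<in> {1..Suc r} \<rightarrow>\<^sub>E L"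
        using 1 3 p(2) by (auto simp: PiE_def Pi_def extensional_def)
      moreover have "(F(Suc r := X)) (Suc j) \<subseteq> (F(Suc r := X)) j" if "j \<in> {1..<Suc r}" for j
        using that 1(2)[of j] 2[of j] by (cases "j = r") auto
      moreover have "c ((F(Suc r := X)) j) = d j" if "j \<in> {1..Suc r}" for j
        using that 1(3)[of j] p(3) by (cases "j = Suc r") auto
      ultimately show "(case p of (X, F) \<Rightarrow> F(Suc r := X)) \<in> chains L c (Suc r) d"
        unfolding p(1) by (simp add: chains_def)
    qed
    fix F assume "F \<in> chains L c (Suc r) d"
    then show "(case (F (Suc r), restrict F {1..r}) of (X, F) \<Rightarrow> F(Suc r := X)) = F"
      by (intro ext) (auto simp: chains_def PiE_def extensional_def)
  next
    fix p assume "p \<in> (SIGMA F:?A. chains (above L F) c r d)"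
    then obtain X F where p: "p = (X, F)" "F \<in> chains (above L X) c r d" by auto
    then have "F j = undefined" if "j \<notin> {1..r}" for j
      using that by (auto simp: chains_def PiE_def extensional_def)
    then show "((case p of (X, F) \<Rightarrow> F(Suc r := X)) (Suc r), restrict (case p of (X, F) \<Rightarrow> F(Suc r := X)) {1..r}) = p"
      unfolding p(1) by (auto simp: fun_eq_iff)
  qed
  then have "card (chains L c (Suc r) d) = card (SIGMA F:?A. chains (above L F) c r d)"
    by (rule bij_betw_same_card)
  also have "\<dots> = (\<Sum>F\<in>?A. card (chains (above L F) c r d))"
    using assms by (intro card_SigmaI) (auto simp: above_def intro!: finite_chains)
  also have "\<dots> = (\<Sum>F\<in>L. if c F = d (Suc r) then card (chains (above L F) c r d) else 0)"
    using assms by (simp add: sum.inter_filter)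
  finally show ?thesis .
qed

section \<open>The index function and the integer sequences\<close>

lemma t_index_eqI:
  assumes "j \<le> k" "k \<notin> S" "\<And>l. j \<le> l \<Longrightarrow> l < k \<Longrightarrow> l \<in> S"
  shows "t_index S j = k"
  unfolding t_index_def using assms by (intro Least_equality) (auto simp: not_less[symmetric])

lemma t_index_props:
  assumes "S \<subseteq> {1..r}" "j \<le> Suc r"
  shows "t_index S j \<le> Suc r" "j \<le> t_index S j" "t_index S j \<notin> S"
    "\<And>l. j \<le> l \<Longrightarrow> l < t_index S j \<Longrightarrow> l \<in> S"
proof -
  have ex: "j \<le> Suc r \<and> Suc r \<notin> S" using assms by auto
  show "t_index S j \<le> Suc r" unfolding t_index_def by (rule Least_le[of _ "Suc r"]) (rule ex)
  have "j \<le> t_index S j \<and> t_index S j \<notin> S" unfolding t_index_def by (rule LeastI[of _ "Suc r"]) (rule ex)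
  then show "j \<le> t_index S j" "t_index S j \<notin> S" by auto
  show "\<And>l. j \<le> l \<Longrightarrow> l < t_index S j \<Longrightarrow> l \<in> S"
    unfolding t_index_def using not_less_Least by blast
qed

lemma t_index_Suc: "S \<subseteq> {1..r} \<Longrightarrow> t_index S (Suc r) = Suc r"
  by (rule t_index_eqI) auto

text \<open>Putting r + 1 into the set affects only those j whose first gap was r + 1; their gap
  moves on to r + 2.\<close>

lemma t_index_insert:
  assumes "S \<subseteq> {1..r}" "j \<le> Suc r"
  shows "t_index (insert (Suc r) S) j = (if t_index S j = Suc r then Suc (Suc r) else t_index S j)"
proof (cases "t_index S j = Suc r")
  case True
  have "t_index (insert (Suc r) S) j = Suc (Suc r)"
    using assms t_index_props(4)[OF assms] True by (intro t_index_eqI) (auto simp: less_Suc_eq)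
  then show ?thesis using True by simp
next
  case False
  have "t_index (insert (Suc r) S) j = t_index S j"
    using assms t_index_props[OF assms] False by (intro t_index_eqI) auto
  then show ?thesis using False by simp
qed

lemma steps_bounds:
  assumes "a \<in> steps r p q" "j \<le> r + 1"
  shows "int j \<le> a j" "a j \<le> q"
proof -
  have m: "a i < a k" if "i < k" "k \<le> r + 1" for i k
    using assms(1) that by (auto simp: steps_def strict_mono_on_def)
  show "int j \<le> a j" using assms(2)
  proof (induction j)
    case 0
    then show ?case using assms(1) by (simp add: steps_def)
  next
    case (Suc j)
    then show ?case using m[of j "Suc j"] by auto
  qed
  have "a (r + 1) = q" using assms(1) by (simp add: steps_def)
  then show "a j \<le> q" using m[of j "r + 1"] assms(2) by (cases "j = r + 1") auto
qed

lemma steps_bounds_p: "a \<in> steps r p q \<Longrightarrow> int r \<le> p \<and> p < q"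
  using steps_bounds(1)[of a r p q r] by (auto simp: steps_def strict_mono_on_def)

lemma finite_steps: "finite (steps r p q)"
proof (rule finite_subset[of _ "{0..r + 1} \<rightarrow>\<^sub>E {0..q}"])
  show "steps r p q \<subseteq> {0..r + 1} \<rightarrow>\<^sub>E {0..q}"
  proof
    fix a assume a: "a \<in> steps r p q"
    have "a j \<in> {0..q}" if "j \<in> {0..r + 1}" for j
      using steps_bounds[OF a, of j] that by auto
    then show "a \<in> {0..r + 1} \<rightarrow>\<^sub>E {0..q}" using a by (auto simp: steps_def PiE_def)
  qed
qed (auto intro: finite_PiE)

text \<open>A sequence ending in b, p, q can be shortened in two ways: dropping q leaves one ending
  in b, p, and dropping p leaves one ending in b, q. In both cases b runs through the integers from
  0 to p - 1, and p < q allows the dropped value to be restored.\<close>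

lemma sum_steps_Suc:
  fixes \<phi> :: "(nat \<Rightarrow> int) \<Rightarrow> int"
  assumes "p < q"
  shows "(\<Sum>a\<in>steps (Suc r) p q. \<phi> (restrict a {0..r + 1})) = (\<Sum>b\<in>{0..<p}. \<Sum>a\<in>steps r b p. \<phi> a)"
    and "(\<Sum>a\<in>steps (Suc r) p q. \<phi> (restrict (a(r + 1 := q)) {0..r + 1})) = (\<Sum>b\<in>{0..<p}. \<Sum>a\<in>steps r b q. \<phi> a)"
proof -
  have mono: "a i < a k" if "a \<in> steps r' p' q'" "i < k" "k \<le> r' + 1" for a i k r' p' q'
    using that by (auto simp: steps_def strict_mono_on_def)
  have vals: "a 0 = 0" "a r' = p'" "a (r' + 1) = q'" "\<And>j. r' + 1 < j \<Longrightarrow> a j = undefined"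
    if "a \<in> steps r' p' q'" for a r' p' q'
    using that by (auto simp: steps_def PiE_def extensional_def)
  have mem: "a \<in> steps r' p' q'"
    if "a 0 = 0" "a r' = p'" "a (r' + 1) = q'" "\<And>j. r' + 1 < j \<Longrightarrow> a j = undefined"
      "\<And>i k. i < k \<Longrightarrow> k \<le> r' + 1 \<Longrightarrow> a i < a k" for a r' p' q'
    using that by (auto simp: steps_def strict_mono_on_def PiE_def extensional_def)
  show "(\<Sum>a\<in>steps (Suc r) p q. \<phi> (restrict a {0..r + 1})) = (\<Sum>b\<in>{0..<p}. \<Sum>a\<in>steps r b p. \<phi> a)"
    unfolding sum.Sigma[OF finite_atLeastLessThan_int ballI[OF finite_steps]]
  proof (rule sum.reindex_bij_witness[of _ "\<lambda>(b, a). a(r + 2 := q)" "\<lambda>a. (a r, restrict a {0..r + 1})"])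
    fix a assume a: "a \<in> steps (Suc r) p q"
    note v = vals[OF a]
    have "0 \<le> a r" using steps_bounds(1)[OF a, of r] by simp
    moreover have "a r < p" using mono[OF a, of r "Suc r"] v by simp
    moreover have "restrict a {0..r + 1} \<in> steps r (a r) p"
      using v mono[OF a] by (intro mem) auto
    ultimately show "(a r, restrict a {0..r + 1}) \<in> Sigma {0..<p} (\<lambda>b. steps r b p)" by simp
    show "(case (a r, restrict a {0..r + 1}) of (b, a) \<Rightarrow> a(r + 2 := q)) = a"
      using v by (auto simp: fun_eq_iff)
    show "(case (a r, restrict a {0..r + 1}) of (b, a) \<Rightarrow> \<phi> a) = \<phi> (restrict a {0..r + 1})" by simp
  next
    fix y assume "y \<in> Sigma {0..<p} (\<lambda>b. steps r b p)"
    then obtain b a where y: "y = (b, a)" "0 \<le> b" "b < p" "a \<in> steps r b p" by auto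
    note v = vals[OF y(4)]
    have "(a(r + 2 := q)) i < (a(r + 2 := q)) k" if ik: "i < k" "k \<le> Suc r + 1" for i k
    proof (cases "k = r + 2")
      case True
      have "a i \<le> p" using mono[OF y(4), of i "r + 1"] v ik True by (cases "i = r + 1") auto
      then show ?thesis using True ik assms by auto
    next
      case False
      then show ?thesis using mono[OF y(4) ik(1)] ik by auto
    qed
    then show "(case y of (b, a) \<Rightarrow> a(r + 2 := q)) \<in> steps (Suc r) p q"
      unfolding y(1) using v by (auto intro!: mem)
    show "((case y of (b, a) \<Rightarrow> a(r + 2 := q)) r, restrict (case y of (b, a) \<Rightarrow> a(r + 2 := q)) {0..r + 1}) = y"
      unfolding y(1) using v by (auto simp: fun_eq_iff)
  qed
  show "(\<Sum>a\<in>steps (Suc r) p q. \<phi> (restrict (a(r + 1 := q)) {0..r + 1})) = (\<Sum>b\<in>{0..<p}. \<Sum>a\<in>steps r b q. \<phi> a)"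
    unfolding sum.Sigma[OF finite_atLeastLessThan_int ballI[OF finite_steps]]
  proof (rule sum.reindex_bij_witness[of _ "\<lambda>(b, a). a(r + 1 := p, r + 2 := q)" "\<lambda>a. (a r, restrict (a(r + 1 := q)) {0..r + 1})"])
    fix a assume a: "a \<in> steps (Suc r) p q"
    note v = vals[OF a]
    have "0 \<le> a r" using steps_bounds(1)[OF a, of r] by simp
    moreover have "a r < p" using mono[OF a, of r "Suc r"] v by simp
    moreover have "restrict (a(r + 1 := q)) {0..r + 1} \<in> steps r (a r) q"
    proof (rule mem)
      fix i k assume ik: "i < k" "k \<le> r + 1"
      have "a i < a k" using mono[OF a, of i k] ik by simp
      moreover have "a k \<le> q" using steps_bounds(2)[OF a, of k] ik by simp
      ultimately show "restrict (a(r + 1 := q)) {0..r + 1} i < restrict (a(r + 1 := q)) {0..r + 1} k"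
        using ik by auto
    qed (use v in auto)
    ultimately show "(a r, restrict (a(r + 1 := q)) {0..r + 1}) \<in> Sigma {0..<p} (\<lambda>b. steps r b q)" by simp
    show "(case (a r, restrict (a(r + 1 := q)) {0..r + 1}) of (b, a) \<Rightarrow> a(r + 1 := p, r + 2 := q)) = a"
      using v by (auto simp: fun_eq_iff)
    show "(case (a r, restrict (a(r + 1 := q)) {0..r + 1}) of (b, a) \<Rightarrow> \<phi> a) = \<phi> (restrict (a(r + 1 := q)) {0..r + 1})" by simp
  next
    fix y assume "y \<in> Sigma {0..<p} (\<lambda>b. steps r b q)"
    then obtain b a where y: "y = (b, a)" "0 \<le> b" "b < p" "a \<in> steps r b q" by auto
    note v = vals[OF y(4)]
    have "(a(r + 1 := p, r + 2 := q)) i < (a(r + 1 := p, r + 2 := q)) k" if ik: "i < k" "k \<le> Suc r + 1" for i k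
    proof -
      have ib: "a i \<le> b" if "i \<le> r" using mono[OF y(4), of i r] v that by (cases "i = r") auto
      consider "k = r + 2" "i = r + 1" | "k = r + 2" "i \<le> r" | "k = r + 1" "i \<le> r" | "k \<le> r" using ik by linarith
      then show ?thesis
      proof cases
        case 4
        then show ?thesis using mono[OF y(4) ik(1)] ik by auto
      qed (use ib y(3) assms in auto)
    qed
    then show "(case y of (b, a) \<Rightarrow> a(r + 1 := p, r + 2 := q)) \<in> steps (Suc r) p q"
      unfolding y(1) using v by (auto intro!: mem)
    show "((case y of (b, a) \<Rightarrow> a(r + 1 := p, r + 2 := q)) r, restrict ((case y of (b, a) \<Rightarrow> a(r + 1 := p, r + 2 := q))(r + 1 := q)) {0..r + 1}) = y"
      unfolding y(1) using v by (auto simp: fun_eq_iff)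
  qed
qed

text \<open>Peeling off the smallest member of a chain, according to whether \<open>r + 1 \<in> S\<close>.\<close>

lemma signed_chains_Suc:
  assumes L: "finite L" and pq: "p < q"
  shows "signed_chains L c (Suc r) p q = (\<Sum>F\<in>L. \<Sum>b\<in>{0..<p}.
      (if c F = p + b then signed_chains (above L F) c r b p else 0)
      - (if c F = q + b then signed_chains (above L F) c r b q else 0))"
proof -
  define d where "d = (\<lambda>S a j. a (t_index S j) + a (j - 1) :: int)"
  \<comment> \<open>This summand reads a sequence only up to index r + 1, so both cases of the
    peeling are its values at a shortened sequence.\<close>
  define \<phi> where "\<phi> = (\<lambda>S a. \<Sum>F\<in>L. if c F = a (r + 1) + a r then int (card (chains (above L F) c r (d S a))) else 0)"
  \<comment> \<open>Case r + 1 not in the set: the index r + 2 is never selected, so the last value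
    q is irrelevant.\<close>
  have 1: "int (card (chains L c (Suc r) (d S a))) = \<phi> S (restrict a {0..r + 1})"
    if S: "S \<subseteq> {1..r}" for S a
  proof -
    have "chains (above L F) c r (d S a) = chains (above L F) c r (d S (restrict a {0..r + 1}))" for F
    proof (rule chains_cong)
      fix j assume j: "j \<in> {1..r}"
      then show "d S a j = d S (restrict a {0..r + 1}) j"
        using t_index_props(1)[OF S, of j] by (auto simp: d_def)
    qed
    moreover have "d S a (Suc r) = a (Suc r) + a r" by (simp add: d_def t_index_Suc[OF S])
    ultimately have "int (if c F = d S a (Suc r) then card (chains (above L F) c r (d S a)) else 0)
        = (if c F = restrict a {0..r + 1} (r + 1) + restrict a {0..r + 1} r
           then int (card (chains (above L F) c r (d S (restrict a {0..r + 1})))) else 0)" for F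
      by simp
    then show ?thesis unfolding card_chains_Suc[OF L] \<phi>_def of_nat_sum by (rule sum.cong[OF refl])
  qed
  \<comment> \<open>Case r + 1 in the set: every selected index r + 1 becomes r + 2, so q takes the
    place of p and the smallest member has corank q + a_r.\<close>
  have 2: "int (card (chains L c (Suc r) (d (insert (Suc r) S) a))) = \<phi> S (restrict (a(r + 1 := q)) {0..r + 1})"
    if S: "S \<subseteq> {1..r}" and a: "a \<in> steps (Suc r) p q" for S a
  proof -
    have q: "a (Suc (Suc r)) = q" using a by (simp add: steps_def)
    have "chains (above L F) c r (d (insert (Suc r) S) a) = chains (above L F) c r (d S (restrict (a(r + 1 := q)) {0..r + 1}))" for F
    proof (rule chains_cong)
      fix j assume j: "j \<in> {1..r}"
      then show "d (insert (Suc r) S) a j = d S (restrict (a(r + 1 := q)) {0..r + 1}) j"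
        using t_index_props(1)[OF S, of j] q by (auto simp: d_def t_index_insert[OF S])
    qed
    moreover have "d (insert (Suc r) S) a (Suc r) = q + a r"
      using t_index_insert[OF S, of "Suc r"] t_index_Suc[OF S] q by (simp add: d_def)
    ultimately have "int (if c F = d (insert (Suc r) S) a (Suc r) then card (chains (above L F) c r (d (insert (Suc r) S) a)) else 0)
        = (if c F = restrict (a(r + 1 := q)) {0..r + 1} (r + 1) + restrict (a(r + 1 := q)) {0..r + 1} r
           then int (card (chains (above L F) c r (d S (restrict (a(r + 1 := q)) {0..r + 1})))) else 0)" for F
      by simp
    then show ?thesis unfolding card_chains_Suc[OF L] \<phi>_def of_nat_sum by (rule sum.cong[OF refl])
  qed
  have collect: "(\<Sum>S\<in>Pow {1..r}. (- 1) ^ card S * (\<Sum>b\<in>{0..<p}. \<Sum>a\<in>steps r b u. \<phi> S a))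
     = (\<Sum>F\<in>L. \<Sum>b\<in>{0..<p}. if c F = u + b then signed_chains (above L F) c r b u else 0)" for u
  proof -
    have "(\<Sum>S\<in>Pow {1..r}. (- 1) ^ card S * (\<Sum>b\<in>{0..<p}. \<Sum>a\<in>steps r b u. \<phi> S a))
      = (\<Sum>S\<in>Pow {1..r}. \<Sum>b\<in>{0..<p}. \<Sum>F\<in>L. if c F = u + b then (- 1) ^ card S * (\<Sum>a\<in>steps r b u. int (card (chains (above L F) c r (d S a)))) else 0)"
    proof (rule sum.cong[OF refl])
      fix S assume "S \<in> Pow {1..r :: nat}"
      have "(\<Sum>a\<in>steps r b u. \<phi> S a) = (\<Sum>F\<in>L. if c F = u + b then (\<Sum>a\<in>steps r b u. int (card (chains (above L F) c r (d S a)))) else 0)" for b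
      proof -
        have "(\<Sum>a\<in>steps r b u. \<phi> S a) = (\<Sum>a\<in>steps r b u. \<Sum>F\<in>L. if c F = u + b then int (card (chains (above L F) c r (d S a))) else 0)"
          by (intro sum.cong refl) (auto simp: \<phi>_def steps_def intro!: sum.cong)
        also have "\<dots> = (\<Sum>F\<in>L. \<Sum>a\<in>steps r b u. if c F = u + b then int (card (chains (above L F) c r (d S a))) else 0)"
          by (rule sum.swap)
        finally show ?thesis by (auto intro!: sum.cong)
      qed
      then show "(- 1) ^ card S * (\<Sum>b\<in>{0..<p}. \<Sum>a\<in>steps r b u. \<phi> S a) =
         (\<Sum>b\<in>{0..<p}. \<Sum>F\<in>L. if c F = u + b then (- 1) ^ card S * (\<Sum>a\<in>steps r b u. int (card (chains (above L F) c r (d S a)))) else 0)"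
        by (simp add: sum_distrib_left if_distrib cong: if_cong)
    qed
    also have "\<dots> = (\<Sum>b\<in>{0..<p}. \<Sum>F\<in>L. \<Sum>S\<in>Pow {1..r}. if c F = u + b then (- 1) ^ card S * (\<Sum>a\<in>steps r b u. int (card (chains (above L F) c r (d S a)))) else 0)"
      by (subst sum.swap) (intro sum.cong refl sum.swap)
    also have "\<dots> = (\<Sum>F\<in>L. \<Sum>b\<in>{0..<p}. \<Sum>S\<in>Pow {1..r}. if c F = u + b then (- 1) ^ card S * (\<Sum>a\<in>steps r b u. int (card (chains (above L F) c r (d S a)))) else 0)"
      by (rule sum.swap)
    also have "\<dots> = (\<Sum>F\<in>L. \<Sum>b\<in>{0..<p}. if c F = u + b then signed_chains (above L F) c r b u else 0)"
      by (intro sum.cong refl) (simp add: signed_chains_def d_def)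
    finally show ?thesis .
  qed
  \<comment> \<open>The two halves correspond to the two cases; the extra element of the set
    supplies the minus sign.\<close>
  have Pow: "Pow {1..Suc r} = Pow {1..r} \<union> insert (Suc r) ` Pow {1..r}"
    by (simp add: atLeastAtMostSuc_conv Pow_insert)
  have inj: "inj_on (insert (Suc r)) (Pow {1..r})"
    by (rule inj_onI) (metis Pow_iff atLeastAtMost_iff insert_ident not_less_eq_eq order_refl subset_eq)
  have cd: "card (insert (Suc r) S) = Suc (card S)" if "S \<in> Pow {1..r}" for S
    using that finite_subset[of S "{1..r}"] by (subst card_insert_disjoint) auto
  let ?s = "\<lambda>S. \<Sum>a\<in>steps (Suc r) p q. int (card (chains L c (Suc r) (d S a)))"
  have "signed_chains L c (Suc r) p q = (\<Sum>S\<in>Pow {1..Suc r}. (- 1) ^ card S * ?s S)"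
    by (simp add: signed_chains_def d_def)
  also have "\<dots> = (\<Sum>S\<in>Pow {1..r}. (- 1) ^ card S * ?s S) + (\<Sum>S\<in>insert (Suc r) ` Pow {1..r}. (- 1) ^ card S * ?s S)"
    unfolding Pow by (rule sum.union_disjoint) auto
  also have "(\<Sum>S\<in>insert (Suc r) ` Pow {1..r}. (- 1) ^ card S * ?s S) = - (\<Sum>S\<in>Pow {1..r}. (- 1) ^ card S * ?s (insert (Suc r) S))"
    unfolding sum.reindex[OF inj] sum_negf[symmetric] by (intro sum.cong refl) (simp add: cd del: Pow_iff)
  also have "(\<Sum>S\<in>Pow {1..r}. (- 1) ^ card S * ?s S) = (\<Sum>S\<in>Pow {1..r}. (- 1) ^ card S * (\<Sum>b\<in>{0..<p}. \<Sum>a\<in>steps r b p. \<phi> S a))"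
    by (intro sum.cong refl) (simp add: 1 sum_steps_Suc(1)[OF pq, symmetric])
  also have "(\<Sum>S\<in>Pow {1..r}. (- 1) ^ card S * ?s (insert (Suc r) S)) = (\<Sum>S\<in>Pow {1..r}. (- 1) ^ card S * (\<Sum>b\<in>{0..<p}. \<Sum>a\<in>steps r b q. \<phi> S a))"
    by (intro sum.cong refl) (simp add: 2 sum_steps_Suc(2)[OF pq, symmetric])
  finally show ?thesis unfolding collect by (simp add: sum_subtractf)
qed

text \<open>In a poset of rank \<open>n\<close>; in rank 0 the condition \<open>2 * i < n\<close> on the degree does not apply.\<close>

definition kl_number :: "'b set set \<Rightarrow> ('b set \<Rightarrow> int) \<Rightarrow> int \<Rightarrow> int \<Rightarrow> int" where
  "kl_number L c n i =
     (if n = 0 then if i = 0 then 1 else 0 else \<Sum>r\<in>{0..nat i}. signed_chains L c r i (n - i))"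

section \<open>Support and invariance of the Kazhdan--Lusztig numbers\<close>

lemma signed_chains_eq_0: "\<not> (int r \<le> p \<and> p < q) \<Longrightarrow> signed_chains L c r p q = 0"
proof -
  assume "\<not> (int r \<le> p \<and> p < q)"
  then have "steps r p q = {}" using steps_bounds_p by blast
  then show ?thesis by (simp add: signed_chains_def)
qed

text \<open>The empty chain with the sequence 0 < q; it is the source of the constant term
  1.\<close>

lemma signed_chains_0: "signed_chains L c 0 p q = (if p = 0 \<and> 0 < q then 1 else 0)"
proof (cases "p = 0 \<and> 0 < q")
  case True
  have "steps 0 p q = {\<lambda>j\<in>{0..1}. if j = 0 then 0 else q}"
  proof (intro equalityI subsetI)
    fix a assume a: "a \<in> steps 0 p q"
    then have "a 0 = 0" "a 1 = q" "\<And>j. j > 1 \<Longrightarrow> a j = undefined"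
      by (auto simp: steps_def PiE_def extensional_def)
    then have "a = (\<lambda>j\<in>{0..1}. if j = 0 then 0 else q)"
      by (auto simp: fun_eq_iff le_Suc_eq not_le)
    then show "a \<in> {\<lambda>j\<in>{0..1}. if j = 0 then 0 else q}" by simp
  qed (use True in \<open>auto simp: steps_def strict_mono_on_def\<close>)
  moreover have "chains L c 0 d = {\<lambda>_. undefined}" for d by (auto simp: chains_def)
  ultimately show ?thesis using True by (simp add: signed_chains_def)
next
  case False
  have "p = 0 \<and> 0 < q" if "a \<in> steps 0 p q" for a
    using steps_bounds_p[OF that] that by (auto simp: steps_def)
  then have "steps 0 p q = {}" using False by blast
  then show ?thesis using False by (simp add: signed_chains_def)
qed

lemma signed_chains_transport:
  assumes "bij_betw \<theta> L L'" "\<And>X Y. X \<in> L \<Longrightarrow> Y \<in> L \<Longrightarrow> \<theta> X \<subseteq> \<theta> Y \<longleftrightarrow> X \<subseteq> Y"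
    and "\<And>X. X \<in> L \<Longrightarrow> c' (\<theta> X) = c X"
  shows "signed_chains L c r p q = signed_chains L' c' r p q"
  unfolding signed_chains_def by (simp add: card_chains_transport[where \<theta> = \<theta> and c = c and c' = c', OF assms])

text \<open>Applied to translation by a group element and to the passage between a contraction and
  the flats above \<open>F\<close>.\<close>

lemma kl_number_transport:
  assumes "bij_betw \<theta> L L'" "\<And>X Y. X \<in> L \<Longrightarrow> Y \<in> L \<Longrightarrow> \<theta> X \<subseteq> \<theta> Y \<longleftrightarrow> X \<subseteq> Y"
    and "\<And>X. X \<in> L \<Longrightarrow> c' (\<theta> X) = c X"
  shows "kl_number L c n i = kl_number L' c' n i"
  unfolding kl_number_def by (simp add: signed_chains_transport[where \<theta> = \<theta> and c = c and c' = c', OF assms])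

text \<open>In positive rank the degree bound comes from the strict increase of the sequences, which
  forces i < n - i.\<close>

lemma kl_number_eq_0:
  assumes "n \<ge> 0" "i < 0 \<or> n \<le> 2 * i" "n = 0 \<Longrightarrow> i \<noteq> 0"
  shows "kl_number L c n i = 0"
  using assms by (auto simp: kl_number_def intro!: sum.neutral signed_chains_eq_0)

lemma kl_number_0: "n \<ge> 0 \<Longrightarrow> kl_number L c n 0 = 1"
  by (auto simp: kl_number_def signed_chains_0)

text \<open>Chains longer than i contribute nothing, so one cutoff can serve all the intervals
  appearing in a sum.\<close>

lemma kl_number_eq_sum:
  assumes "n \<noteq> 0" "int R \<ge> i"
  shows "kl_number L c n i = (\<Sum>r\<in>{0..R}. signed_chains L c r i (n - i))"
proof -
  have "(\<Sum>r\<in>{0..nat i}. signed_chains L c r i (n - i)) = (\<Sum>r\<in>{0..max R (nat i)}. signed_chains L c r i (n - i))"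
    by (rule sum.mono_neutral_left) (auto intro!: signed_chains_eq_0)
  also have "\<dots> = (\<Sum>r\<in>{0..R}. signed_chains L c r i (n - i))"
    using assms(2) by (intro sum.mono_neutral_right) (auto intro!: signed_chains_eq_0)
  finally show ?thesis using assms(1) by (simp add: kl_number_def)
qed

section \<open>Palindromicity of the Z-polynomial and the recursion\<close>

locale ranked_poset =
  fixes L :: "'b set set" and c :: "'b set \<Rightarrow> int" and top :: "'b set"
  assumes fin: "finite L" and top: "top \<in> L" "\<And>X. X \<in> L \<Longrightarrow> X \<subseteq> top" "c top = 0"
    and strict: "\<And>X Y. X \<in> L \<Longrightarrow> Y \<in> L \<Longrightarrow> X \<subset> Y \<Longrightarrow> c Y < c X"
begin

abbreviation kl :: "'b set \<Rightarrow> int \<Rightarrow> int" where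
  "kl E i \<equiv> kl_number (above L E) c (c E) i"

lemma c_mono: "X \<in> L \<Longrightarrow> Y \<in> L \<Longrightarrow> X \<subseteq> Y \<Longrightarrow> c Y \<le> c X"
  using strict[of X Y] by (cases "X = Y") (auto simp: psubset_eq intro: less_imp_le)

lemma c_nonneg: "X \<in> L \<Longrightarrow> 0 \<le> c X"
  using c_mono[OF _ top(1)] top(2,3) by auto

lemma c_eq_0: "X \<in> L \<Longrightarrow> c X = 0 \<longleftrightarrow> X = top"
  using strict[OF _ top(1)] top(2,3) by fastforce

lemma finite_above: "finite (above L E)"
  using fin by (simp add: above_def)

text \<open>Peel the smallest member F off the chains counted by \<open>kl E k\<close>. The terms of
  corank k + b add up to \<open>kl F (c F - k)\<close>, those of corank c E - k + b to
  \<open>kl F (k - c E + c F)\<close> with a minus sign. The bound b < k excludes F = E from the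
  second kind, and the missing term is \<open>kl E k\<close> itself.\<close>

lemma kl_palindromic_below:
  assumes E: "E \<in> L" and k: "0 < k" "2 * k < c E"
  shows "(\<Sum>F\<in>above L E. kl F (k - c E + c F)) = (\<Sum>F\<in>above L E. kl F (c F - k))"
proof -
  let ?n = "c E" and ?U = "above L E"
  have U: "F \<in> L" "E \<subseteq> F" "c F \<le> ?n" "0 \<le> c F" "above ?U F = above L F" if "F \<in> ?U" for F
    using that c_mono[OF E] c_nonneg by (auto simp: above_def)
  define R where "R = nat k - 1"
  have R: "nat k = Suc R" using k by (simp add: R_def)
  have "kl E k = (\<Sum>r\<in>{0..Suc R}. signed_chains ?U c r k (?n - k))"
    using k R by (intro kl_number_eq_sum) auto
  \<comment> \<open>The empty chain contributes only in degree 0, and k > 0.\<close>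
  also have "\<dots> = (\<Sum>r\<in>{0..R}. signed_chains ?U c (Suc r) k (?n - k))"
    using k by (subst sum.atLeast0_atMost_Suc_shift) (simp add: signed_chains_0)
  also have "\<dots> = (\<Sum>r\<in>{0..R}. \<Sum>F\<in>?U. \<Sum>b\<in>{0..<k}.
      (if c F = k + b then signed_chains (above ?U F) c r b k else 0)
      - (if c F = ?n - k + b then signed_chains (above ?U F) c r b (?n - k) else 0))"
    using k by (intro sum.cong refl signed_chains_Suc finite_above) auto
  also have "\<dots> = (\<Sum>F\<in>?U. \<Sum>b\<in>{0..<k}. \<Sum>r\<in>{0..R}.
      (if c F = k + b then signed_chains (above ?U F) c r b k else 0)
      - (if c F = ?n - k + b then signed_chains (above ?U F) c r b (?n - k) else 0))"
    by (subst sum.swap) (intro sum.cong refl sum.swap)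
  also have "\<dots> = (\<Sum>F\<in>?U. (\<Sum>b\<in>{0..<k}. if c F = k + b then kl F b else 0)
      - (\<Sum>b\<in>{0..<k}. if c F = ?n - k + b then kl F b else 0))"
  proof (rule sum.cong[OF refl])
    fix F assume F: "F \<in> ?U"
    \<comment> \<open>If c F = u + b then u = c F - b, which is the last value required in
      \<open>kl F b\<close>; the cutoff suffices since b \<le> k - 1.\<close>
    have s: "(\<Sum>r\<in>{0..R}. if c F = u + b then signed_chains (above ?U F) c r b u else 0) = (if c F = u + b then kl F b else 0)"
      if "b \<in> {0..<k}" "u > 0" for b u
    proof (cases "c F = u + b")
      case True
      have "kl F b = (\<Sum>r\<in>{0..R}. signed_chains (above L F) c r b (c F - b))"
        using True that R by (intro kl_number_eq_sum) auto
      then show ?thesis using True U(5)[OF F] by simp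
    qed simp
    show "(\<Sum>b\<in>{0..<k}. \<Sum>r\<in>{0..R}.
      (if c F = k + b then signed_chains (above ?U F) c r b k else 0)
      - (if c F = ?n - k + b then signed_chains (above ?U F) c r b (?n - k) else 0))
      = (\<Sum>b\<in>{0..<k}. if c F = k + b then kl F b else 0) - (\<Sum>b\<in>{0..<k}. if c F = ?n - k + b then kl F b else 0)"
      unfolding sum_subtractf using k by (intro arg_cong2[where f = minus] sum.cong refl s) auto
  qed
  also have "\<dots> = (\<Sum>F\<in>?U. kl F (c F - k) - (if F = E then 0 else kl F (k - ?n + c F)))"
  proof (rule sum.cong[OF refl])
    fix F assume F: "F \<in> ?U"
    have pick: "(\<Sum>b\<in>{0..<k}. if c F = u + b then kl F b else 0) = (if 0 \<le> c F - u \<and> c F - u < k then kl F (c F - u) else 0)" for u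
    proof -
      have "(\<Sum>b\<in>{0..<k}. if c F = u + b then kl F b else 0) = (\<Sum>b\<in>{0..<k}. if b = c F - u then kl F b else 0)"
        by (intro sum.cong refl) auto
      then show ?thesis by simp
    qed
    \<comment> \<open>When c F = k + b, the range condition b < k says 2 b < c F, so restricting b
      loses only numbers that vanish by the degree bound.\<close>
    have 1: "(\<Sum>b\<in>{0..<k}. if c F = k + b then kl F b else 0) = kl F (c F - k)"
      unfolding pick using U(4)[OF F] k kl_number_eq_0[where n = "c F" and i = "c F - k" and L = "above L F" and c = c]
      by auto
    \<comment> \<open>For F = E the equation would force b = k, just outside the range.\<close>
    have 2: "(\<Sum>b\<in>{0..<k}. if c F = ?n - k + b then kl F b else 0) = (if F = E then 0 else kl F (k - ?n + c F))"
    proof (cases "F = E")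
      case False
      then have "c F < ?n" using strict[OF E U(1)[OF F]] U(2)[OF F] by auto
      moreover have idx: "c F - (?n - k) = k - ?n + c F" by simp
      ultimately show ?thesis unfolding pick idx
        using False U(4)[OF F] k kl_number_eq_0[where n = "c F" and i = "k - ?n + c F" and L = "above L F" and c = c]
        by auto
    qed (auto simp: pick)
    show "(\<Sum>b\<in>{0..<k}. if c F = k + b then kl F b else 0) - (\<Sum>b\<in>{0..<k}. if c F = ?n - k + b then kl F b else 0)
      = kl F (c F - k) - (if F = E then 0 else kl F (k - ?n + c F))"
      unfolding 1 2 ..
  qed
  also have "\<dots> = (\<Sum>F\<in>?U. kl F (c F - k)) - ((\<Sum>F\<in>?U. kl F (k - ?n + c F)) - kl E k)"
  proof -
    have E': "E \<in> ?U" using E by (simp add: above_def)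
    have "(\<Sum>F\<in>?U. if F = E then 0 else kl F (k - ?n + c F)) = (\<Sum>F\<in>?U - {E}. kl F (k - ?n + c F))"
      using finite_above by (simp add: sum.If_cases Collect_conv_if Diff_eq[symmetric] if_distrib sum.delta_remove)
    also have "\<dots> = (\<Sum>F\<in>?U. kl F (k - ?n + c F)) - kl E k"
      using E' finite_above by (simp add: sum_diff1)
    finally show ?thesis by (simp add: sum_subtractf)
  qed
  finally show ?thesis by simp
qed

text \<open>The two sides are the coefficients of Z_E at k and at c E - k, so exchanging these
  indices reduces everything to 2 k < c E. For k = 0 the only contributions are the constant terms
  at \<open>E\<close> and at \<open>top\<close>.\<close>

lemma kl_palindromic:
  assumes E: "E \<in> L"
  shows "(\<Sum>F\<in>above L E. kl F (k - c E + c F)) = (\<Sum>F\<in>above L E. kl F (c F - k))"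
proof -
  have U: "F \<in> L" "E \<subseteq> F" "c F \<le> c E" "0 \<le> c F" if "F \<in> above L E" for F
    using that c_mono[OF E] c_nonneg by (auto simp: above_def)
  have EU: "E \<in> above L E" "top \<in> above L E" using E top by (auto simp: above_def)
  have small: "(\<Sum>F\<in>above L E. kl F (k - c E + c F)) = (\<Sum>F\<in>above L E. kl F (c F - k))" if k: "2 * k < c E" for k
  proof -
    consider "k < 0" | "k = 0" | "k > 0" by linarith
    then show ?thesis
    proof cases
      case 1
      have "kl F (k - c E + c F) = 0" "kl F (c F - k) = 0" if "F \<in> above L E" for F
        using U[OF that] 1 by (auto intro!: kl_number_eq_0)
      then show ?thesis by simp
    next
      case 2
      have "kl F (k - c E + c F) = (if F = E then 1 else 0)" if F: "F \<in> above L E" for F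
      proof (cases "F = E")
        case False
        then have "c F < c E" using strict[OF E U(1)[OF F]] U(2)[OF F] by auto
        then show ?thesis using U[OF F] 2 False by (auto intro!: kl_number_eq_0)
      qed (use 2 c_nonneg[OF E] kl_number_0 in auto)
      moreover have "kl F (c F - k) = (if F = top then 1 else 0)" if F: "F \<in> above L E" for F
      proof (cases "F = top")
        case False
        then have "c F > 0" using c_eq_0[OF U(1)[OF F]] U(4)[OF F] by auto
        then show ?thesis using 2 False by (auto intro!: kl_number_eq_0)
      qed (use 2 top kl_number_0[of 0] in auto)
      ultimately show ?thesis using EU finite_above by simp
    next
      case 3
      then show ?thesis by (rule kl_palindromic_below[OF E _ k])
    qed
  qed
  consider "2 * k < c E" | "2 * k = c E" | "2 * k > c E" by linarith
  then show ?thesis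
  proof cases
    case 2
    then have idx: "k - c E + c F = c F - k" for F by linarith
    show ?thesis by (rule sum.cong[OF refl]) (simp only: idx)
  next
    case 3
    then have 3: "2 * (c E - k) < c E" by simp
    have "c E - k - c E + c F = c F - k" "c F - (c E - k) = k - c E + c F" for F by simp_all
    with small[OF 3] show ?thesis by simp
  qed (rule small)
qed

text \<open>The inner sum over \<open>E\<close> is coefficient a of the polynomial playing the role
  of H for the interval below F. Exchanging the sums gives the combination of the Z_E weighted by
  mu; palindromicity makes the coefficient independent of \<open>c E\<close>, after which the sums
  of mu over lower intervals can be evaluated.\<close>

lemma kl_recursion:
  fixes \<mu> :: "'b set \<Rightarrow> complex" and k :: nat
  assumes botF: "botF \<in> L" "\<And>X. X \<in> L \<Longrightarrow> botF \<subseteq> X"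
    and \<mu>: "\<And>F. F \<in> L \<Longrightarrow> (\<Sum>E | E \<in> L \<and> E \<subseteq> F. \<mu> E) = (if F = botF then 1 else 0)"
  shows "(\<Sum>F\<in>L. \<Sum>a\<le>k. (\<Sum>E | E \<in> L \<and> E \<subseteq> F \<and> c E - c F = int a. \<mu> E) * of_int (kl F (int (k - a))))
    = of_int (kl botF (c botF - int k))"
proof -
  have inner: "(\<Sum>a\<le>k. (\<Sum>E | E \<in> L \<and> E \<subseteq> F \<and> c E - c F = int a. \<mu> E) * of_int (kl F (int (k - a))))
     = (\<Sum>E\<in>L. if E \<subseteq> F then \<mu> E * of_int (kl F (int k - c E + c F)) else 0)" if F: "F \<in> L" for F
  proof -
    have "(\<Sum>a\<le>k. (\<Sum>E | E \<in> L \<and> E \<subseteq> F \<and> c E - c F = int a. \<mu> E) * of_int (kl F (int (k - a))))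
      = (\<Sum>a\<le>k. \<Sum>E\<in>L. if E \<subseteq> F \<and> c E - c F = int a then \<mu> E * of_int (kl F (int (k - a))) else 0)"
      using fin by (intro sum.cong refl) (simp add: sum.inter_filter[symmetric] sum_distrib_right)
    also have "\<dots> = (\<Sum>E\<in>L. \<Sum>a\<le>k. if E \<subseteq> F \<and> c E - c F = int a then \<mu> E * of_int (kl F (int (k - a))) else 0)"
      by (rule sum.swap)
    also have "\<dots> = (\<Sum>E\<in>L. if E \<subseteq> F then \<mu> E * of_int (kl F (int k - c E + c F)) else 0)"
    proof (rule sum.cong[OF refl])
      fix E assume E: "E \<in> L"
      show "(\<Sum>a\<le>k. if E \<subseteq> F \<and> c E - c F = int a then \<mu> E * of_int (kl F (int (k - a))) else 0)
        = (if E \<subseteq> F then \<mu> E * of_int (kl F (int k - c E + c F)) else 0)"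
      proof (cases "E \<subseteq> F")
        case True
        have d: "c F \<le> c E" using c_mono[OF E F True] .
        have "(\<Sum>a\<le>k. if E \<subseteq> F \<and> c E - c F = int a then \<mu> E * of_int (kl F (int (k - a))) else 0)
           = (\<Sum>a\<le>k. if a = nat (c E - c F) then \<mu> E * of_int (kl F (int k - c E + c F)) else 0)"
        proof (rule sum.cong[OF refl])
          fix a assume a: "a \<in> {..k}"
          have "c E - c F = int a \<longleftrightarrow> a = nat (c E - c F)" using d by auto
          moreover have "int (k - a) = int k - c E + c F" if "c E - c F = int a" using that a by (simp add: of_nat_diff)
          ultimately show "(if E \<subseteq> F \<and> c E - c F = int a then \<mu> E * of_int (kl F (int (k - a))) else 0)
            = (if a = nat (c E - c F) then \<mu> E * of_int (kl F (int k - c E + c F)) else 0)" using True by auto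
        qed
        also have "\<dots> = \<mu> E * of_int (kl F (int k - c E + c F))"
        \<comment> \<open>If the difference of coranks exceeds k, no a is selected, and the right
          side vanishes because its degree argument is negative.\<close>
        proof (cases "nat (c E - c F) \<le> k")
          case False
          then have "kl F (int k - c E + c F) = 0" using c_nonneg[OF F] by (intro kl_number_eq_0) auto
          then show ?thesis using False by simp
        qed simp
        finally show ?thesis using True by simp
      qed simp
    qed
    finally show ?thesis .
  qed
  have "(\<Sum>F\<in>L. \<Sum>a\<le>k. (\<Sum>E | E \<in> L \<and> E \<subseteq> F \<and> c E - c F = int a. \<mu> E) * of_int (kl F (int (k - a))))
    = (\<Sum>F\<in>L. \<Sum>E\<in>L. if E \<subseteq> F then \<mu> E * of_int (kl F (int k - c E + c F)) else 0)"
    by (intro sum.cong refl inner)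
  also have "\<dots> = (\<Sum>E\<in>L. \<Sum>F\<in>L. if E \<subseteq> F then \<mu> E * of_int (kl F (int k - c E + c F)) else 0)"
    by (rule sum.swap)
  also have "\<dots> = (\<Sum>E\<in>L. \<mu> E * of_int (\<Sum>F\<in>above L E. kl F (int k - c E + c F)))"
    using fin by (intro sum.cong refl) (simp add: above_def sum.inter_filter[symmetric] sum_distrib_left)
  also have "\<dots> = (\<Sum>E\<in>L. \<mu> E * of_int (\<Sum>F\<in>above L E. kl F (c F - int k)))"
    by (simp only: kl_palindromic cong: sum.cong)
  also have "\<dots> = (\<Sum>E\<in>L. \<Sum>F\<in>L. if E \<subseteq> F then \<mu> E * of_int (kl F (c F - int k)) else 0)"
    using fin by (intro sum.cong refl) (simp add: above_def sum.inter_filter[symmetric] sum_distrib_left)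
  also have "\<dots> = (\<Sum>F\<in>L. \<Sum>E\<in>L. if E \<subseteq> F then \<mu> E * of_int (kl F (c F - int k)) else 0)"
    by (rule sum.swap)
  also have "\<dots> = (\<Sum>F\<in>L. (\<Sum>E | E \<in> L \<and> E \<subseteq> F. \<mu> E) * of_int (kl F (c F - int k)))"
    using fin by (intro sum.cong refl) (simp add: sum.inter_filter[symmetric] sum_distrib_right)
  also have "\<dots> = (\<Sum>F\<in>L. if F = botF then of_int (kl F (c F - int k)) else 0)"
    by (intro sum.cong refl) (simp add: \<mu>)
  also have "\<dots> = of_int (kl botF (c botF - int k))" using botF fin by simp
  finally show ?thesis .
qed

end

text \<open>The sums over lower intervals determine the value at F from those at smaller sets, so an
  order isomorphism matching the bottoms transports the function by induction on the
  cardinality.\<close>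

lemma moebius_transport:
  fixes \<mu> \<mu>' :: "'b set \<Rightarrow> complex"
  assumes fin: "finite L" "finite L'" "\<And>X. X \<in> L \<Longrightarrow> finite X"
    and \<theta>: "bij_betw \<theta> L L'" "\<And>X Y. X \<in> L \<Longrightarrow> Y \<in> L \<Longrightarrow> \<theta> X \<subseteq> \<theta> Y \<longleftrightarrow> X \<subseteq> Y"
    and botF: "botF \<in> L" "\<theta> botF = botF'"
    and \<mu>: "\<And>F. F \<in> L \<Longrightarrow> (\<Sum>E | E \<in> L \<and> E \<subseteq> F. \<mu> E) = (if F = botF then 1 else 0)"
    and \<mu>': "\<And>F. F \<in> L' \<Longrightarrow> (\<Sum>E | E \<in> L' \<and> E \<subseteq> F. \<mu>' E) = (if F = botF' then 1 else 0)"
    and F: "F \<in> L"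
  shows "\<mu>' (\<theta> F) = \<mu> F"
  using F
proof (induction "card F" arbitrary: F rule: less_induct)
  case less
  let ?A = "{E. E \<in> L \<and> E \<subset> F}"
  have \<theta>L: "\<theta> X \<in> L'" if "X \<in> L" for X using \<theta>(1) that by (auto simp: bij_betw_def)
  have inj: "\<theta> X = \<theta> Y \<longleftrightarrow> X = Y" if "X \<in> L" "Y \<in> L" for X Y
    using \<theta>(1) that by (auto simp: bij_betw_def inj_on_def)
  have 1: "(\<Sum>E | E \<in> L \<and> E \<subseteq> F. \<mu> E) = \<mu> F + (\<Sum>E\<in>?A. \<mu> E)"
  proof -
    have "{E. E \<in> L \<and> E \<subseteq> F} = insert F ?A" using less.prems by auto
    then show ?thesis using fin(1) by simp
  qed
  have 2: "(\<Sum>E | E \<in> L' \<and> E \<subseteq> \<theta> F. \<mu>' E) = \<mu>' (\<theta> F) + (\<Sum>E\<in>?A. \<mu>' (\<theta> E))"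
  proof -
    have "{E. E \<in> L' \<and> E \<subseteq> \<theta> F} = \<theta> ` insert F ?A"
    proof (intro equalityI subsetI)
      fix E assume "E \<in> {E. E \<in> L' \<and> E \<subseteq> \<theta> F}"
      then obtain X where X: "X \<in> L" "E = \<theta> X" "\<theta> X \<subseteq> \<theta> F" using \<theta>(1) by (auto simp: bij_betw_def)
      then have "X \<subseteq> F" using \<theta>(2)[OF X(1) less.prems] by simp
      then show "E \<in> \<theta> ` insert F ?A" using X by auto
    qed (use \<theta>(2) \<theta>L less.prems in auto)
    moreover have "inj_on \<theta> (insert F ?A)" using inj less.prems by (auto simp: inj_on_def)
    ultimately have "(\<Sum>E | E \<in> L' \<and> E \<subseteq> \<theta> F. \<mu>' E) = (\<Sum>E\<in>insert F ?A. \<mu>' (\<theta> E))"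
      by (simp only: sum.reindex o_def)
    then show ?thesis using fin(1) by simp
  qed
  have "\<mu>' (\<theta> E) = \<mu> E" if "E \<in> ?A" for E
    using that less.hyps[of E] psubset_card_mono[OF fin(3)[OF less.prems], of E] by auto
  then have "(\<Sum>E\<in>?A. \<mu>' (\<theta> E)) = (\<Sum>E\<in>?A. \<mu> E)" by (intro sum.cong) auto
  moreover have "\<theta> F = botF' \<longleftrightarrow> F = botF" using inj[OF less.prems botF(1)] botF(2) by auto
  ultimately show ?case using 1 2 \<mu>[OF less.prems] \<mu>'[OF \<theta>L[OF less.prems]] by auto
qed

section \<open>Matroids and their flats\<close>

locale finite_matroid =
  fixes M :: "'a matroid"
  assumes matroid: "is_matroid M"
begin

abbreviation "E \<equiv> ground M"

lemma finite_ground: "finite E"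
  using matroid by (simp add: is_matroid_def)

lemma indep_subset: "I \<in> indeps M \<Longrightarrow> I \<subseteq> E"
  using matroid by (auto simp: is_matroid_def)

lemma indep_finite: "I \<in> indeps M \<Longrightarrow> finite I"
  using indep_subset finite_ground finite_subset by blast

lemma indep_empty: "{} \<in> indeps M"
  using matroid by (simp add: is_matroid_def)

lemma indep_mono: "I \<in> indeps M \<Longrightarrow> J \<subseteq> I \<Longrightarrow> J \<in> indeps M"
  using matroid unfolding is_matroid_def by blast

lemma augment: "I \<in> indeps M \<Longrightarrow> J \<in> indeps M \<Longrightarrow> card I < card J \<Longrightarrow> \<exists>x\<in>J - I. insert x I \<in> indeps M"
  using matroid unfolding is_matroid_def by blast

lemma finite_indeps: "finite (indeps M)"
  using finite_subset[of "indeps M" "Pow E"] indep_subset finite_ground by auto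

lemma rk_ge: "I \<in> indeps M \<Longrightarrow> I \<subseteq> X \<Longrightarrow> card I \<le> rk M X"
  unfolding rk_def using finite_indeps by (intro Max_ge) auto

lemma rk_obtain:
  obtains I where "I \<in> indeps M" "I \<subseteq> X" "card I = rk M X"
proof -
  have "rk M X \<in> card ` {I \<in> indeps M. I \<subseteq> X}"
    unfolding rk_def using finite_indeps indep_empty by (intro Max_in) auto
  then show thesis using that by auto
qed

lemma rk_mono: "X \<subseteq> Y \<Longrightarrow> rk M X \<le> rk M Y"
proof -
  assume XY: "X \<subseteq> Y"
  obtain I where "I \<in> indeps M" "I \<subseteq> X" "card I = rk M X" by (rule rk_obtain)
  then show ?thesis using rk_ge[of I Y] XY by auto
qed

lemma rk_insert_ge: "rk M X \<le> rk M (insert x X)"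
  by (rule rk_mono) auto

lemma rk_le_card: "finite X \<Longrightarrow> rk M X \<le> card X"
proof -
  assume X: "finite X"
  obtain I where "I \<in> indeps M" "I \<subseteq> X" "card I = rk M X" by (rule rk_obtain)
  then show ?thesis using card_mono[OF X, of I] by auto
qed

lemma rk_indep: "I \<in> indeps M \<Longrightarrow> rk M I = card I"
  using rk_le_card[OF indep_finite] rk_ge[of I I] by (simp add: order_antisym)

lemma indep_iff_rk: "finite X \<Longrightarrow> X \<in> indeps M \<longleftrightarrow> rk M X = card X"
proof -
  assume X: "finite X"
  obtain I where I: "I \<in> indeps M" "I \<subseteq> X" "card I = rk M X" by (rule rk_obtain)
  then show ?thesis using card_subset_eq[OF X I(2)] rk_indep[of X] by auto
qed

text \<open>A largest independent set between I and X has full rank, since otherwise it could be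
  augmented from a set attaining the rank.\<close>

lemma indep_extend:
  assumes "I \<in> indeps M" "I \<subseteq> X"
  obtains J where "J \<in> indeps M" "I \<subseteq> J" "J \<subseteq> X" "card J = rk M X"
proof -
  let ?A = "{J \<in> indeps M. I \<subseteq> J \<and> J \<subseteq> X}"
  have A: "finite ?A" "I \<in> ?A" using finite_indeps assms by auto
  have "Max (card ` ?A) \<in> card ` ?A" using A by (intro Max_in) auto
  then obtain J where J: "J \<in> ?A" "card J = Max (card ` ?A)" by auto
  have J2: "card K \<le> card J" if "K \<in> ?A" for K
    unfolding J(2) using A(1) that by (intro Max_ge) auto
  have "card J = rk M X"
  proof (rule ccontr)
    assume "card J \<noteq> rk M X"
    moreover have "card J \<le> rk M X" using rk_ge J(1) by simp
    ultimately have "card J < rk M X" by simp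
    moreover obtain K where K: "K \<in> indeps M" "K \<subseteq> X" "card K = rk M X" by (rule rk_obtain)
    ultimately obtain x where x: "x \<in> K - J" "insert x J \<in> indeps M" using augment[of J K] J(1) by auto
    then have "insert x J \<in> ?A" using K J(1) by auto
    then have "card (insert x J) \<le> card J" by (rule J2)
    then show False using x indep_finite[of J] J(1) by simp
  qed
  then show thesis using that[of J] J(1) by auto
qed

lemma rk_insert_le: "rk M (insert x X) \<le> Suc (rk M X)"
proof -
  obtain J where J: "J \<in> indeps M" "J \<subseteq> insert x X" "card J = rk M (insert x X)" by (rule rk_obtain)
  have "card (J - {x}) \<le> rk M X" using J indep_mono[of J "J - {x}"] by (intro rk_ge) auto
  moreover have "card J \<le> Suc (card (J - {x}))"
    using card.remove[OF indep_finite[OF J(1)], of x] by (cases "x \<in> J") auto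
  ultimately show ?thesis using J(3) by simp
qed

text \<open>The piece of submodularity behind the closure operator. Extend a maximal independent
  subset of X to one of Y and then to one of Y with x; if x were gained in the last step, it could
  already be added to the first set.\<close>

lemma rk_insert_eq_mono:
  assumes "X \<subseteq> Y" "rk M (insert x X) = rk M X"
  shows "rk M (insert x Y) = rk M Y"
proof (rule ccontr)
  assume "rk M (insert x Y) \<noteq> rk M Y"
  then have less: "rk M Y < rk M (insert x Y)" using rk_insert_ge[of Y x] by auto
  obtain I where I: "I \<in> indeps M" "I \<subseteq> X" "card I = rk M X" by (rule rk_obtain)
  obtain J where J: "J \<in> indeps M" "I \<subseteq> J" "J \<subseteq> Y" "card J = rk M Y"
    using indep_extend[of I Y] I assms(1) by auto
  obtain K where K: "K \<in> indeps M" "J \<subseteq> K" "K \<subseteq> insert x Y" "card K = rk M (insert x Y)"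
    using indep_extend[of J "insert x Y"] J by auto
  have "x \<in> K" "x \<notin> Y"
  proof -
    show "x \<in> K"
    proof (rule ccontr)
      assume "x \<notin> K"
      then have "card K \<le> rk M Y" using K by (intro rk_ge) auto
      then show False using K(4) less by simp
    qed
    show "x \<notin> Y" using less by (auto simp: insert_absorb)
  qed
  then have "insert x I \<in> indeps M" "x \<notin> I" using indep_mono[OF K(1)] J K I assms(1) by auto
  then have "card (insert x I) \<le> rk M (insert x X)" using I by (intro rk_ge) auto
  then show False using \<open>x \<notin> I\<close> I indep_finite[OF I(1)] assms(2) by simp
qed

section \<open>Closure, flats and circuits\<close>

definition cl :: "'a set \<Rightarrow> 'a set" where
  "cl X = {x \<in> E. rk M (insert x X) = rk M X}"

lemma cl_subset_ground: "cl X \<subseteq> E"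
  by (auto simp: cl_def)

lemma subset_cl: "X \<subseteq> E \<Longrightarrow> X \<subseteq> cl X"
  by (auto simp: cl_def insert_absorb)

lemma rk_between:
  assumes "X \<subseteq> Y" "Y \<subseteq> X \<union> cl X"
  shows "rk M Y = rk M X"
proof -
  have "finite Z \<Longrightarrow> Z \<subseteq> cl X \<Longrightarrow> rk M (X \<union> Z) = rk M X" for Z
  proof (induction Z rule: finite_induct)
    case (insert z Z)
    have "rk M (insert z (X \<union> Z)) = rk M (X \<union> Z)"
      by (rule rk_insert_eq_mono[of X]) (use insert in \<open>auto simp: cl_def\<close>)
    then show ?case using insert by simp
  qed simp
  from this[of "cl X"] have "rk M (X \<union> cl X) = rk M X"
    using finite_subset[OF cl_subset_ground finite_ground] by simp
  then show ?thesis using rk_mono[OF assms(1)] rk_mono[OF assms(2)] by simp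
qed

lemma rk_cl: "X \<subseteq> E \<Longrightarrow> rk M (cl X) = rk M X"
  using subset_cl by (intro rk_between) auto

lemma flat_subset: "F \<in> flats M \<Longrightarrow> F \<subseteq> E"
  by (simp add: flats_def)

lemma finite_flats: "finite (flats M)"
  by (rule finite_subset[of _ "Pow E"]) (auto simp: flats_def finite_ground)

lemma cl_flat: "X \<subseteq> E \<Longrightarrow> cl X \<in> flats M"
proof -
  assume X: "X \<subseteq> E"
  have "rk M (cl X) < rk M (insert x (cl X))" if "x \<in> E - cl X" for x
  proof -
    have "rk M X < rk M (insert x X)" using that rk_insert_ge[of X x] by (force simp: cl_def)
    also have "\<dots> \<le> rk M (insert x (cl X))" using subset_cl[OF X] by (intro rk_mono) auto
    finally show ?thesis using rk_cl[OF X] by simp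
  qed
  then show ?thesis using cl_subset_ground by (auto simp: flats_def)
qed

lemma cl_subset_flat: "F \<in> flats M \<Longrightarrow> X \<subseteq> F \<Longrightarrow> cl X \<subseteq> F"
proof
  fix x assume F: "F \<in> flats M" "X \<subseteq> F" and x: "x \<in> cl X"
  have "rk M (insert x F) = rk M F" by (rule rk_insert_eq_mono[OF F(2)]) (use x in \<open>simp add: cl_def\<close>)
  then show "x \<in> F" using F(1) x by (metis (no_types, lifting) DiffI cl_def flats_def less_irrefl mem_Collect_eq)
qed

lemma cl_flat_eq: "F \<in> flats M \<Longrightarrow> cl F = F"
  using cl_subset_flat[of F F] subset_cl[OF flat_subset] by auto

lemma cl_mono: "X \<subseteq> Y \<Longrightarrow> Y \<subseteq> E \<Longrightarrow> cl X \<subseteq> cl Y"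
  using cl_subset_flat[OF cl_flat] subset_cl by blast

lemma cl_eqI:
  assumes "X \<subseteq> Y" "Y \<subseteq> E" "rk M X = rk M Y"
  shows "cl X = cl Y"
proof
  show "cl X \<subseteq> cl Y" using assms by (intro cl_mono) auto
  have "Y \<subseteq> cl X"
  proof
    fix y assume y: "y \<in> Y"
    have "rk M (insert y X) = rk M X"
      using rk_insert_ge[of X y] rk_mono[of "insert y X" Y] assms y by auto
    then show "y \<in> cl X" using y assms by (auto simp: cl_def)
  qed
  then show "cl Y \<subseteq> cl X" using assms by (intro cl_subset_flat[OF cl_flat]) auto
qed

lemma flat_rk_strict: "F \<in> flats M \<Longrightarrow> F' \<in> flats M \<Longrightarrow> F \<subset> F' \<Longrightarrow> rk M F < rk M F'"
proof -
  assume F: "F \<in> flats M" "F' \<in> flats M" "F \<subset> F'"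
  then obtain x where x: "x \<in> F'" "x \<notin> F" by auto
  then have "rk M F < rk M (insert x F)" using F flat_subset[OF F(2)] by (auto simp: flats_def)
  also have "\<dots> \<le> rk M F'" using F x by (intro rk_mono) auto
  finally show ?thesis .
qed

lemma ground_flat: "E \<in> flats M"
  by (simp add: flats_def)

lemma rk_empty: "rk M {} = 0"
  using rk_indep[OF indep_empty] by simp

lemma bot_flat: "cl {} \<in> flats M" "F \<in> flats M \<Longrightarrow> cl {} \<subseteq> F" "rk M (cl {}) = 0"
  using cl_flat[of "{}"] cl_subset_flat[of F "{}"] rk_cl[of "{}"] rk_empty by auto

lemma flat_rk_0: "F \<in> flats M \<Longrightarrow> rk M F = 0 \<longleftrightarrow> F = cl {}"
  using bot_flat flat_rk_strict[of "cl {}" F] by (metis less_irrefl psubsetI)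

lemma loops_eq: "loops M = cl {}"
proof -
  have "{x} \<notin> indeps M \<longleftrightarrow> rk M {x} = 0" for x
    using indep_iff_rk[of "{x}"] rk_le_card[of "{x}"] by auto
  then show ?thesis by (auto simp: loops_def cl_def rk_empty)
qed

text \<open>Describes independence through closure, hence through flats; this is how a bijection
  known only to preserve flats can be shown to preserve independence.\<close>

lemma indep_iff_cl: "I \<subseteq> E \<Longrightarrow> I \<in> indeps M \<longleftrightarrow> (\<forall>x\<in>I. x \<notin> cl (I - {x}))"
proof
  assume I: "I \<subseteq> E" "I \<in> indeps M"
  show "\<forall>x\<in>I. x \<notin> cl (I - {x})"
  proof
    fix x assume x: "x \<in> I"
    have "rk M (I - {x}) \<le> card (I - {x})" using indep_finite[OF I(2)] by (intro rk_le_card) auto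
    also have "\<dots> < rk M I" using card_Diff1_less[OF indep_finite[OF I(2)] x] rk_indep[OF I(2)] by simp
    finally show "x \<notin> cl (I - {x})" using x by (simp add: cl_def insert_absorb)
  qed
next
  assume I: "I \<subseteq> E" "\<forall>x\<in>I. x \<notin> cl (I - {x})"
  obtain J where J: "J \<in> indeps M" "J \<subseteq> I" "card J = rk M I" by (rule rk_obtain)
  have "J = I"
  proof (rule ccontr)
    assume "J \<noteq> I"
    then obtain x where x: "x \<in> I" "x \<notin> J" using J by auto
    have "rk M I \<le> rk M (I - {x})" using J x rk_ge[OF J(1), of "I - {x}"] by auto
    then have "rk M (insert x (I - {x})) = rk M (I - {x})"
      using rk_mono[of "I - {x}" I] x by (simp add: insert_absorb)
    then show False using I x by (auto simp: cl_def)
  qed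
  then show "I \<in> indeps M" using J by simp
qed

text \<open>The rank of a circuit is attained after deleting any one element. Consequently all terms
  of a circuit relation span the same flat.\<close>

lemma circuit_cl:
  assumes "C \<in> circuits M" "x \<in> C"
  shows "cl (C - {x}) = cl C"
proof (rule cl_eqI)
  have C: "C \<subseteq> E" "C \<notin> indeps M" "C - {x} \<in> indeps M" "finite C"
    using assms finite_subset[OF _ finite_ground] by (auto simp: circuits_def)
  show "C \<subseteq> E" by fact
  have "rk M C \<noteq> card C" using C indep_iff_rk by auto
  then have "rk M C < card C" using rk_le_card[OF C(4)] by simp
  then have "rk M C \<le> rk M (C - {x})" using rk_indep[OF C(3)] assms(2) C(4) by simp
  then show "rk M (C - {x}) = rk M C" using rk_mono[of "C - {x}" C] by auto
qed auto

lemma dependent_contains_circuit: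
  assumes "X \<subseteq> E" "X \<notin> indeps M"
  shows "\<exists>C\<in>circuits M. C \<subseteq> X"
proof -
  have "finite X" using assms(1) finite_ground finite_subset by blast
  then show ?thesis using assms
  proof (induction X rule: finite_psubset_induct)
    case (psubset X)
    show ?case
    proof (cases "X \<in> circuits M")
      case False
      then obtain D where D: "D \<subset> X" "D \<notin> indeps M" using psubset by (auto simp: circuits_def)
      then obtain C where "C \<in> circuits M" "C \<subseteq> D" using psubset.IH[OF D(1)] psubset.prems by auto
      then show ?thesis using D(1) by blast
    qed auto
  qed
qed

text \<open>By minimality a circuit with at least two elements has independent singletons. Hence the
  boundary taken over nonloops sees every letter of such a circuit.\<close>

lemma circuit_no_loop:
  assumes "C \<in> circuits M" "2 \<le> card C" "x \<in> C"
  shows "x \<notin> loops M"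
proof -
  have "{x} \<subset> C" using assms by (auto simp: psubset_eq)
  then show ?thesis using assms(1) by (auto simp: circuits_def loops_def)
qed

end

section \<open>Automorphisms\<close>

definition matroid_aut :: "'a matroid \<Rightarrow> ('a \<Rightarrow> 'a) \<Rightarrow> bool" where
  "matroid_aut M \<sigma> \<longleftrightarrow> bij_betw \<sigma> (ground M) (ground M) \<and>
     (\<forall>X. X \<subseteq> ground M \<longrightarrow> (\<sigma> ` X \<in> indeps M \<longleftrightarrow> X \<in> indeps M))"

context finite_matroid
begin

text \<open>Injectivity makes the induced map permute the finite set of flats, so it commutes with
  closure, and closure determines independence.\<close>

lemma matroid_autI:
  assumes \<sigma>: "bij_betw \<sigma> E E" and fl: "\<And>F. F \<in> flats M \<Longrightarrow> \<sigma> ` F \<in> flats M"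
  shows "matroid_aut M \<sigma>"
proof -
  have inj: "inj_on \<sigma> E" and im: "\<sigma> ` E = E" using \<sigma> by (auto simp: bij_betw_def)
  have "inj_on ((`) \<sigma>) (flats M)"
    using inj by (intro inj_onI) (metis flat_subset inj_on_image_eq_iff)
  then have surj: "(`) \<sigma> ` flats M = flats M"
    using fl finite_flats by (intro endo_inj_surj) auto
  have cl: "cl (\<sigma> ` X) = \<sigma> ` cl X" if X: "X \<subseteq> E" for X
  proof
    show "cl (\<sigma> ` X) \<subseteq> \<sigma> ` cl X"
      using X subset_cl by (intro cl_subset_flat fl cl_flat image_mono) auto
    have "cl (\<sigma> ` X) \<in> flats M" using X im by (intro cl_flat) auto
    then obtain F where F: "F \<in> flats M" "\<sigma> ` F = cl (\<sigma> ` X)" using surj by (metis image_iff)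
    have "\<sigma> ` X \<subseteq> \<sigma> ` F" unfolding F(2) using X im by (intro subset_cl) auto
    then have "X \<subseteq> F" using inj X flat_subset[OF F(1)] by (metis inj_on_image_mem_iff image_subset_iff subsetI subset_iff)
    then have "cl X \<subseteq> F" by (rule cl_subset_flat[OF F(1)])
    then show "\<sigma> ` cl X \<subseteq> cl (\<sigma> ` X)" using F(2) by auto
  qed
  have "\<sigma> ` X \<in> indeps M \<longleftrightarrow> X \<in> indeps M" if X: "X \<subseteq> E" for X
  proof -
    have "\<sigma> x \<in> cl (\<sigma> ` X - {\<sigma> x}) \<longleftrightarrow> x \<in> cl (X - {x})" if x: "x \<in> X" for x
    proof -
      have "\<sigma> ` X - {\<sigma> x} = \<sigma> ` (X - {x})"
        using inj X x by (auto simp: inj_on_def)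
      then have "cl (\<sigma> ` X - {\<sigma> x}) = \<sigma> ` cl (X - {x})" using cl[of "X - {x}"] X by auto
      then show ?thesis using inj_on_image_mem_iff[OF inj, of x "cl (X - {x})"] x X cl_subset_ground by auto
    qed
    then show ?thesis
      using indep_iff_cl[OF X] indep_iff_cl[of "\<sigma> ` X"] X im by auto
  qed
  then show ?thesis using \<sigma> by (simp add: matroid_aut_def)
qed

lemma aut_rk:
  assumes "matroid_aut M \<sigma>" "X \<subseteq> E"
  shows "rk M (\<sigma> ` X) = rk M X"
proof -
  have inj: "inj_on \<sigma> E" using assms(1) by (auto simp: matroid_aut_def bij_betw_def)
  have card: "card (\<sigma> ` I) = card I" if "I \<subseteq> E" for I
    using inj_on_subset[OF inj that] by (rule card_image)
  obtain I where I: "I \<in> indeps M" "I \<subseteq> X" "card I = rk M X" by (rule rk_obtain)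
  have "\<sigma> ` I \<in> indeps M" using I assms by (auto simp: matroid_aut_def)
  then have 1: "rk M X \<le> rk M (\<sigma> ` X)" using rk_ge[of "\<sigma> ` I" "\<sigma> ` X"] I assms(2) card[of I] by auto
  obtain J where J: "J \<in> indeps M" "J \<subseteq> \<sigma> ` X" "card J = rk M (\<sigma> ` X)" by (rule rk_obtain)
  obtain K where K: "K \<subseteq> X" "J = \<sigma> ` K" using J(2) by (auto simp: subset_image_iff)
  have "K \<in> indeps M" using K J(1) assms by (auto simp: matroid_aut_def)
  then have "rk M (\<sigma> ` X) \<le> rk M X" using rk_ge[of K X] K J(3) card[of K] assms(2) by auto
  with 1 show ?thesis by simp
qed

lemma aut_loops: "matroid_aut M \<sigma> \<Longrightarrow> x \<in> E \<Longrightarrow> \<sigma> x \<in> loops M \<longleftrightarrow> x \<in> loops M"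
proof -
  assume a: "matroid_aut M \<sigma>" "x \<in> E"
  then have "\<sigma> ` {x} \<in> indeps M \<longleftrightarrow> {x} \<in> indeps M" unfolding matroid_aut_def by blast
  moreover have "\<sigma> x \<in> E" using a by (auto simp: matroid_aut_def bij_betw_def)
  ultimately show ?thesis using a(2) by (simp add: loops_def)
qed

lemma aut_circuits: "matroid_aut M \<sigma> \<Longrightarrow> C \<in> circuits M \<Longrightarrow> \<sigma> ` C \<in> circuits M"
proof -
  assume a: "matroid_aut M \<sigma>" and C: "C \<in> circuits M"
  have inj: "inj_on \<sigma> E" and im: "\<sigma> ` E = E" using a by (auto simp: matroid_aut_def bij_betw_def)
  have CE: "C \<subseteq> E" using C by (simp add: circuits_def)
  have "D \<in> indeps M" if D: "D \<subset> \<sigma> ` C" for D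
  proof -
    obtain D' where D': "D' \<subseteq> C" "D = \<sigma> ` D'" using D by (auto simp: subset_image_iff psubset_eq)
    then have "D' \<subset> C" using D by auto
    then have "D' \<in> indeps M" using C by (simp add: circuits_def)
    then show ?thesis using a D' CE by (auto simp: matroid_aut_def)
  qed
  then show ?thesis using C CE im a by (auto simp: circuits_def matroid_aut_def)
qed

lemma aut_cl:
  assumes "matroid_aut M \<sigma>" "X \<subseteq> E"
  shows "cl (\<sigma> ` X) = \<sigma> ` cl X"
proof -
  have im: "\<sigma> ` E = E" using assms by (auto simp: matroid_aut_def bij_betw_def)
  have "\<sigma> x \<in> cl (\<sigma> ` X) \<longleftrightarrow> x \<in> cl X" if "x \<in> E" for x
    using aut_rk[OF assms(1), of "insert x X"] aut_rk[OF assms] that assms(2) im by (auto simp: cl_def)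
  moreover have "\<exists>x\<in>E. y = \<sigma> x" if "y \<in> cl (\<sigma> ` X)" for y
    using that cl_subset_ground im by blast
  ultimately show ?thesis using cl_subset_ground by blast
qed

section \<open>Localization and contraction\<close>

lemma localization_matroid: "is_matroid (localization M F)" if "F \<subseteq> E"
proof -
  have "finite F" using that finite_ground finite_subset by blast
  then show ?thesis
    unfolding is_matroid_def localization_def matroid.simps
  proof (intro conjI allI impI)
    fix I J assume "I \<in> {I \<in> indeps M. I \<subseteq> F} \<and> J \<in> {I \<in> indeps M. I \<subseteq> F} \<and> card I < card J"
    then have IJ: "I \<in> indeps M" "J \<in> indeps M" "card I < card J" "I \<subseteq> F" "J \<subseteq> F" by auto
    then show "\<exists>x\<in>J - I. insert x I \<in> {I \<in> indeps M. I \<subseteq> F}"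
      using augment[OF IJ(1-3)] by auto
  qed (use indep_empty indep_mono in auto)
qed

lemma rk_localization: "X \<subseteq> F \<Longrightarrow> rk (localization M F) X = rk M X"
proof -
  assume "X \<subseteq> F"
  then have "{I \<in> {I \<in> indeps M. I \<subseteq> F}. I \<subseteq> X} = {I \<in> indeps M. I \<subseteq> X}" by auto
  then show ?thesis by (simp add: rk_def localization_def)
qed

text \<open>For X inside the flat F, elements outside F raise the rank automatically because the
  closure of X stays in F.\<close>

lemma flats_localization: "F \<in> flats M \<Longrightarrow> flats (localization M F) = {X \<in> flats M. X \<subseteq> F}"
proof -
  assume F: "F \<in> flats M"
  have "X \<in> flats (localization M F) \<longleftrightarrow> X \<in> flats M" if X: "X \<subseteq> F" for X
  proof -
    have 1: "X \<in> flats (localization M F) \<longleftrightarrow> (\<forall>x\<in>F - X. rk M X < rk M (insert x X))"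
    proof -
      have "ground (localization M F) = F" by (simp add: localization_def)
      moreover have "rk (localization M F) (insert x X) = rk M (insert x X)" if "x \<in> F" for x
        using X that by (intro rk_localization) auto
      ultimately show ?thesis using X rk_localization[OF X] by (auto simp: flats_def)
    qed
    have "rk M X < rk M (insert x X)" if x: "x \<in> E - F" for x
    proof (rule ccontr)
      assume "\<not> ?thesis"
      then have "x \<in> cl X" using x rk_insert_ge[of X x] by (auto simp: cl_def)
      then show False using cl_subset_flat[OF F X] x by auto
    qed
    then have "X \<in> flats M \<longleftrightarrow> (\<forall>x\<in>F - X. rk M X < rk M (insert x X))"
      using X flat_subset[OF F] by (auto simp: flats_def)
    with 1 show ?thesis by simp
  qed
  moreover have "X \<subseteq> F" if "X \<in> flats (localization M F)" for X
    using that by (simp add: flats_def localization_def)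
  ultimately show ?thesis by auto
qed

lemma bases_of_iff: "B \<in> bases_of M F \<longleftrightarrow> B \<in> indeps M \<and> B \<subseteq> F \<and> card B = rk M F"
proof
  assume B: "B \<in> bases_of M F"
  then obtain J where "J \<in> indeps M" "B \<subseteq> J" "J \<subseteq> F" "card J = rk M F"
    using indep_extend[of B F] by (auto simp: bases_of_def)
  then show "B \<in> indeps M \<and> B \<subseteq> F \<and> card B = rk M F" using B by (auto simp: bases_of_def)
next
  assume B: "B \<in> indeps M \<and> B \<subseteq> F \<and> card B = rk M F"
  have "I = B" if "I \<in> indeps M" "B \<subseteq> I" "I \<subseteq> F" for I
  proof -
    have "card I \<le> card B" using B rk_ge[OF that(1,3)] by simp
    then show ?thesis using card_seteq[OF indep_finite[OF that(1)] that(2)] by simp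
  qed
  then show "B \<in> bases_of M F" using B by (auto simp: bases_of_def)
qed

lemma rk_Un_le: "finite I \<Longrightarrow> rk M (I \<union> F) \<le> card I + rk M F"
proof (induction I rule: finite_induct)
  case (insert x I)
  then show ?case using rk_insert_le[of x "I \<union> F"] by simp
qed simp

text \<open>A rank criterion that eliminates the choice of a basis of F.\<close>

lemma contraction_indep_iff:
  assumes "I \<subseteq> E - F"
  shows "I \<in> indeps (contraction M F) \<longleftrightarrow> rk M (I \<union> F) = card I + rk M F"
proof
  have finI: "finite I" using assms finite_ground finite_subset by blast
  assume "I \<in> indeps (contraction M F)"
  then obtain B where B: "B \<in> indeps M" "B \<subseteq> F" "card B = rk M F" "I \<union> B \<in> indeps M"
    by (auto simp: contraction_def bases_of_iff)
  have "card I + card B = card (I \<union> B)"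
    using assms B finI indep_finite[OF B(1)] by (intro card_Un_disjoint[symmetric]) auto
  also have "\<dots> \<le> rk M (I \<union> F)" using B by (intro rk_ge) auto
  finally show "rk M (I \<union> F) = card I + rk M F" using B rk_Un_le[OF finI, of F] by simp
next
  assume r: "rk M (I \<union> F) = card I + rk M F"
  obtain B where B: "B \<in> indeps M" "B \<subseteq> F" "card B = rk M F" by (rule rk_obtain)
  obtain K where K: "K \<in> indeps M" "B \<subseteq> K" "K \<subseteq> I \<union> F" "card K = rk M (I \<union> F)"
    using indep_extend[of B "I \<union> F"] B by auto
  have finI: "finite I" using assms finite_ground finite_subset by blast
  have "card (K \<inter> F) \<le> rk M F" using indep_mono[OF K(1)] by (intro rk_ge) auto
  moreover have "card K = card (K \<inter> F) + card (K - F)"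
    using indep_finite[OF K(1)] by (metis Int_Diff_Un Int_Diff_disjoint card_Un_disjoint finite_Diff finite_Int)
  ultimately have "card I \<le> card (K - F)" using K(4) r by simp
  moreover have "K - F \<subseteq> I" using K(3) by auto
  ultimately have "K - F = I" using card_seteq[OF finI] by auto
  then have "I \<union> B \<in> indeps M" using indep_mono[OF K(1), of "I \<union> B"] K(2) by auto
  then show "I \<in> indeps (contraction M F)" using assms B by (auto simp: contraction_def bases_of_iff)
qed

lemma contraction_ground: "ground (contraction M F) = E - F"
  by (simp add: contraction_def)

lemma contraction_indep_subset: "I \<in> indeps (contraction M F) \<Longrightarrow> I \<subseteq> E - F"
  by (auto simp: contraction_def)

lemma contraction_matroid: "is_matroid (contraction M F)"
  unfolding is_matroid_def contraction_ground
proof (intro conjI allI impI)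
  show "finite (E - F)" using finite_ground by simp
  show "indeps (contraction M F) \<subseteq> Pow (E - F)" using contraction_indep_subset by auto
  show "{} \<in> indeps (contraction M F)" using contraction_indep_iff[of "{}" F] by simp
  fix I J
  {
    assume "I \<in> indeps (contraction M F) \<and> J \<subseteq> I"
    then obtain B where "I \<subseteq> E - F" "B \<in> bases_of M F" "I \<union> B \<in> indeps M" "J \<subseteq> I"
      by (auto simp: contraction_def)
    then have "J \<subseteq> E - F" "B \<in> bases_of M F" "J \<union> B \<in> indeps M"
      using indep_mono[of "I \<union> B" "J \<union> B"] by auto
    then show "J \<in> indeps (contraction M F)" by (auto simp: contraction_def)
  }
  assume IJ: "I \<in> indeps (contraction M F) \<and> J \<in> indeps (contraction M F) \<and> card I < card J"
  then have sub: "I \<subseteq> E - F" "J \<subseteq> E - F" using contraction_indep_subset by auto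
  have finI: "finite I" using sub finite_ground finite_subset by blast
  have rI: "rk M (I \<union> F) = card I + rk M F" and rJ: "rk M (J \<union> F) = card J + rk M F"
    using IJ contraction_indep_iff[OF sub(1)] contraction_indep_iff[OF sub(2)] by auto
  \<comment> \<open>If no element of J raised the rank of I \<union> F, then J would lie in its
    closure, and card J \<le> card I would follow.\<close>
  have "\<exists>x\<in>J. rk M (insert x (I \<union> F)) \<noteq> rk M (I \<union> F)"
  proof (rule ccontr)
    assume "\<not> ?thesis"
    then have "J \<subseteq> cl (I \<union> F)" using sub by (auto simp: cl_def)
    then have "rk M (J \<union> (I \<union> F)) = rk M (I \<union> F)" by (intro rk_between) auto
    moreover have "rk M (J \<union> F) \<le> rk M (J \<union> (I \<union> F))" by (intro rk_mono) auto
    ultimately show False using rI rJ IJ by simp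
  qed
  then obtain x where x: "x \<in> J" "rk M (insert x (I \<union> F)) \<noteq> rk M (I \<union> F)" by auto
  then have xI: "x \<notin> I" by (auto simp: insert_absorb)
  have "rk M (insert x (I \<union> F)) = Suc (rk M (I \<union> F))"
    using x(2) rk_insert_le[of x "I \<union> F"] rk_insert_ge[of "I \<union> F" x] by auto
  then have "insert x I \<in> indeps (contraction M F)"
    using sub x xI finI rI by (subst contraction_indep_iff) auto
  then show "\<exists>x\<in>J - I. insert x I \<in> indeps (contraction M F)" using x xI by auto
qed

lemma rk_contraction:
  assumes "X \<subseteq> E - F"
  shows "rk (contraction M F) X = rk M (X \<union> F) - rk M F"
proof -
  interpret C: finite_matroid "contraction M F" by unfold_locales (rule contraction_matroid)
  obtain I where I: "I \<in> indeps (contraction M F)" "I \<subseteq> X" "card I = rk (contraction M F) X" by (rule C.rk_obtain)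
  have "rk M (I \<union> F) = card I + rk M F"
    using I(1) contraction_indep_iff[of I F] contraction_indep_subset by auto
  moreover have "rk M (I \<union> F) \<le> rk M (X \<union> F)" using I by (intro rk_mono) auto
  ultimately have 1: "rk (contraction M F) X \<le> rk M (X \<union> F) - rk M F" using I(3) by simp
  obtain B where B: "B \<in> indeps M" "B \<subseteq> F" "card B = rk M F" by (rule rk_obtain)
  obtain K where K: "K \<in> indeps M" "B \<subseteq> K" "K \<subseteq> X \<union> F" "card K = rk M (X \<union> F)"
    using indep_extend[of B "X \<union> F"] B by auto
  have "card (K \<inter> F) \<le> rk M F" using indep_mono[OF K(1)] by (intro rk_ge) auto
  moreover have "card K = card (K \<inter> F) + card (K - F)"
    using indep_finite[OF K(1)] by (metis Int_Diff_Un Int_Diff_disjoint card_Un_disjoint finite_Diff finite_Int)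
  ultimately have c: "rk M (X \<union> F) - rk M F \<le> card (K - F)" using K(4) by simp
  have "(K - F) \<union> B \<in> indeps M" using indep_mono[OF K(1)] K(2) by auto
  then have "K - F \<in> indeps (contraction M F)"
    using K(3) B assms by (auto simp: contraction_def bases_of_iff)
  then have "card (K - F) \<le> rk (contraction M F) X" using K(3) by (intro C.rk_ge) auto
  with 1 c show ?thesis by simp
qed

lemma flats_contraction:
  assumes "F \<subseteq> E"
  shows "flats (contraction M F) = {X. X \<subseteq> E - F \<and> X \<union> F \<in> flats M}"
proof -
  have "X \<in> flats (contraction M F) \<longleftrightarrow> X \<union> F \<in> flats M" if X: "X \<subseteq> E - F" for X
  proof -
    have "rk (contraction M F) X < rk (contraction M F) (insert x X) \<longleftrightarrow> rk M (X \<union> F) < rk M (insert x (X \<union> F))"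
      if "x \<in> E - F" for x
      using rk_contraction[OF X] rk_contraction[of "insert x X" F] that X
        rk_mono[of F "X \<union> F"] by auto
    then have "X \<in> flats (contraction M F) \<longleftrightarrow> (\<forall>x\<in>E - F - X. rk M (X \<union> F) < rk M (insert x (X \<union> F)))"
      using X by (auto simp: flats_def contraction_ground)
    also have "\<dots> \<longleftrightarrow> X \<union> F \<in> flats M" using X assms by (auto simp: flats_def)
    finally show ?thesis .
  qed
  moreover have "X \<subseteq> E - F" if "X \<in> flats (contraction M F)" for X
    using that by (simp add: flats_def contraction_ground)
  ultimately show ?thesis by auto
qed

text \<open>Coranks survive contraction unchanged, so the ranking of the upper interval is simply
  the restriction of \<open>crk M\<close>.\<close>

lemma crk_contraction:
  assumes "F \<subseteq> X" "X \<subseteq> E"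
  shows "crk (contraction M F) (X - F) = crk M X"
proof -
  have "E - F \<union> F = E" "X - F \<union> F = X" using assms by auto
  moreover have "rk M F \<le> rk M X" "rk M F \<le> rk M E" using assms by (auto intro!: rk_mono)
  ultimately show ?thesis
    using assms by (simp add: crk_def contraction_ground rk_contraction Diff_mono of_nat_diff)
qed

end

section \<open>Traces on quotients of function spaces\<close>

text \<open>This scalar multiplication is the one in \<open>OS_ideal\<close>, so its span becomes
  \<open>fv.span\<close>.\<close>

interpretation fv: vector_space "\<lambda>(a :: complex) (f :: 'x \<Rightarrow> complex) w. a * f w"
  by unfold_locales (auto simp: fun_eq_iff algebra_simps)

lemma sum_fun_eq: "(\<Sum>i\<in>I. f i) = (\<lambda>x. \<Sum>i\<in>I. f i x :: complex)"
  by (induction I rule: infinite_finite_induct) (auto simp: fun_eq_iff)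

definition flin :: "(('x \<Rightarrow> complex) \<Rightarrow> ('y \<Rightarrow> complex)) \<Rightarrow> bool" where
  "flin T \<longleftrightarrow> (\<forall>f g a. T (\<lambda>x. f x + a * g x) = (\<lambda>y. T f y + a * T g y))"

lemma flinD: "flin T \<Longrightarrow> T (\<lambda>x. f x + a * g x) = (\<lambda>y. T f y + a * T g y)"
  unfolding flin_def by simp

lemma flin_add: "flin T \<Longrightarrow> T (\<lambda>x. f x + g x) = (\<lambda>y. T f y + T g y)"
  using flinD[of T f 1 g] by simp

lemma flin_zero: "flin T \<Longrightarrow> T (\<lambda>x. 0) = (\<lambda>y. 0)"
  using flinD[of T "\<lambda>x. 0" "- 1" "\<lambda>x. 0"] by simp

lemma flin_scale: "flin T \<Longrightarrow> T (\<lambda>x. a * g x) = (\<lambda>y. a * T g y)"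
  using flinD[of T "\<lambda>x. 0" a g] flin_zero[of T] by simp

lemma flin_diff: "flin T \<Longrightarrow> T (\<lambda>x. f x - g x) = (\<lambda>y. T f y - T g y)"
  using flinD[of T f "- 1" g] by simp

lemma flin_sum: "flin T \<Longrightarrow> T (\<lambda>x. \<Sum>i\<in>I. c i * b i x) = (\<lambda>y. \<Sum>i\<in>I. c i * T (b i) y)"
proof (induction I rule: infinite_finite_induct)
  case (insert i I)
  then have "T (\<lambda>x. c i * b i x + (\<Sum>i\<in>I. c i * b i x)) = (\<lambda>y. c i * T (b i) y + (\<Sum>i\<in>I. c i * T (b i) y))"
    using flin_add[of T "\<lambda>x. c i * b i x" "\<lambda>x. \<Sum>i\<in>I. c i * b i x"] flin_scale[of T "c i" "b i"] by simp
  then show ?case using insert by simp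
qed (auto simp: flin_zero)

lemma flin_comp: "flin S \<Longrightarrow> flin T \<Longrightarrow> flin (\<lambda>f. S (T f))"
  by (simp add: flin_def)

lemma flin_minus: "flin S \<Longrightarrow> flin T \<Longrightarrow> flin (\<lambda>f y. S f y - T f y)"
  by (simp add: flin_def algebra_simps)

lemma subspace_add: "fv.subspace U \<Longrightarrow> f \<in> U \<Longrightarrow> g \<in> U \<Longrightarrow> (\<lambda>x. f x + g x) \<in> U"
  using fv.subspace_add[of U f g] by (simp add: plus_fun_def)

lemma subspace_scale: "fv.subspace U \<Longrightarrow> f \<in> U \<Longrightarrow> (\<lambda>x. a * f x) \<in> U"
  using fv.subspace_scale[of U f a] by simp

lemma subspace_zero: "fv.subspace U \<Longrightarrow> (\<lambda>x. 0) \<in> U"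
  using fv.subspace_0[of U] by (simp add: zero_fun_def)

lemma subspace_diff: "fv.subspace U \<Longrightarrow> f \<in> U \<Longrightarrow> g \<in> U \<Longrightarrow> (\<lambda>x. f x - g x) \<in> U"
  using subspace_add[of U f "\<lambda>x. - 1 * g x"] subspace_scale[of U g "- 1"] by simp

lemma subspace_sum: "fv.subspace U \<Longrightarrow> (\<And>i. i \<in> I \<Longrightarrow> f i \<in> U) \<Longrightarrow> (\<lambda>x. \<Sum>i\<in>I. f i x) \<in> U"
  using fv.subspace_sum[of U I f] by (simp add: sum_fun_eq)

lemma subspaceI:
  assumes "(\<lambda>x. 0) \<in> U" "\<And>f g. f \<in> U \<Longrightarrow> g \<in> U \<Longrightarrow> (\<lambda>x. f x + g x) \<in> U" "\<And>a f. f \<in> U \<Longrightarrow> (\<lambda>x. a * f x) \<in> U"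
  shows "fv.subspace U"
  using assms by (intro fv.subspaceI) (auto simp: zero_fun_def plus_fun_def)

lemma flin_span:
  assumes "flin T" "\<And>x. x \<in> S \<Longrightarrow> T x \<in> U" "fv.subspace U" "f \<in> fv.span S"
  shows "T f \<in> U"
proof -
  have "fv.subspace {f. T f \<in> U}"
  proof (rule subspaceI)
    show "(\<lambda>x. 0) \<in> {f. T f \<in> U}" using flin_zero[OF assms(1)] subspace_zero[OF assms(3)] by simp
    show "(\<lambda>x. f x + g x) \<in> {f. T f \<in> U}" if "f \<in> {f. T f \<in> U}" "g \<in> {f. T f \<in> U}" for f g
      using that flin_add[OF assms(1), of f g] subspace_add[OF assms(3), of "T f" "T g"] by simp
    show "(\<lambda>x. a * f x) \<in> {f. T f \<in> U}" if "f \<in> {f. T f \<in> U}" for a f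
      using that flin_scale[OF assms(1), of a f] subspace_scale[OF assms(3), of "T f" a] by simp
  qed
  then have "fv.span S \<subseteq> {f. T f \<in> U}" using assms(2) by (intro fv.span_minimal) auto
  then show ?thesis using assms(4) by auto
qed

section \<open>Bases, coordinates and traces modulo a subspace\<close>

definition qbasis :: "('x \<Rightarrow> complex) set \<Rightarrow> ('x \<Rightarrow> complex) set \<Rightarrow> 'i set \<Rightarrow> ('i \<Rightarrow> 'x \<Rightarrow> complex) \<Rightarrow> bool" where
  "qbasis V U I b \<longleftrightarrow> finite I \<and> (\<forall>i\<in>I. b i \<in> V) \<and>
     (\<forall>f\<in>V. \<exists>c. (\<lambda>x. f x - (\<Sum>i\<in>I. c i * b i x)) \<in> U) \<and>
     (\<forall>c. (\<lambda>x. \<Sum>i\<in>I. c i * b i x) \<in> U \<longrightarrow> (\<forall>i\<in>I. c i = 0))"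

lemma qbasis_spanning: "qbasis V U I b \<Longrightarrow> f \<in> V \<Longrightarrow> \<exists>c. (\<lambda>x. f x - (\<Sum>i\<in>I. c i * b i x)) \<in> U"
  by (simp add: qbasis_def)

lemma qbasis_indep: "qbasis V U I b \<Longrightarrow> (\<lambda>x. \<Sum>i\<in>I. c i * b i x) \<in> U \<Longrightarrow> i \<in> I \<Longrightarrow> c i = 0"
  by (simp add: qbasis_def)

definition qcoord :: "('x \<Rightarrow> complex) set \<Rightarrow> 'i set \<Rightarrow> ('i \<Rightarrow> 'x \<Rightarrow> complex) \<Rightarrow> ('x \<Rightarrow> complex) \<Rightarrow> 'i \<Rightarrow> complex" where
  "qcoord U I b f = (SOME c. (\<lambda>x. f x - (\<Sum>i\<in>I. c i * b i x)) \<in> U)"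

text \<open>The trace of the endomorphism that T induces on V / (V \<inter> U), computed without
  forming the quotient. It is meaningful when T preserves V and U.\<close>

definition qtrace :: "('x \<Rightarrow> complex) set \<Rightarrow> 'i set \<Rightarrow> ('i \<Rightarrow> 'x \<Rightarrow> complex) \<Rightarrow>
    (('x \<Rightarrow> complex) \<Rightarrow> ('x \<Rightarrow> complex)) \<Rightarrow> complex" where
  "qtrace U I b T = (\<Sum>i\<in>I. qcoord U I b (T (b i)) i)"

lemma qcoord:
  assumes "qbasis V U I b" "f \<in> V"
  shows "(\<lambda>x. f x - (\<Sum>i\<in>I. qcoord U I b f i * b i x)) \<in> U"
  unfolding qcoord_def by (rule someI_ex[OF qbasis_spanning[OF assms]])

lemma qcoord_eqI:
  assumes "fv.subspace U" "qbasis V U I b" "(\<lambda>x. f x - (\<Sum>i\<in>I. c i * b i x)) \<in> U" "i \<in> I"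
  shows "qcoord U I b f i = c i"
proof -
  have "(\<lambda>x. f x - (\<Sum>i\<in>I. qcoord U I b f i * b i x)) \<in> U"
    unfolding qcoord_def by (rule someI[of _ c]) fact
  from subspace_diff[OF assms(1,3) this]
  have "(\<lambda>x. \<Sum>i\<in>I. (qcoord U I b f i - c i) * b i x) \<in> U"
    by (simp add: sum_subtractf left_diff_distrib)
  then have "qcoord U I b f i - c i = 0"
    using qbasis_indep[OF assms(2), of "\<lambda>i. qcoord U I b f i - c i" i] assms(4) by simp
  then show ?thesis by simp
qed

lemma qcoord_comp:
  assumes X: "fv.subspace X" "fv.subspace X'" "qbasis Y X K e" "qbasis Y' X' K' e'" "i \<in> K"
    and P: "P (e i) \<in> Y'" and Q: "\<And>f. f \<in> X' \<Longrightarrow> Q f \<in> X" "flin Q" "\<And>j. j \<in> K' \<Longrightarrow> Q (e' j) \<in> Y"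
  shows "qcoord X K e (Q (P (e i))) i = (\<Sum>j\<in>K'. qcoord X' K' e' (P (e i)) j * qcoord X K e (Q (e' j)) i)"
proof (rule qcoord_eqI[where c = "\<lambda>k. \<Sum>j\<in>K'. qcoord X' K' e' (P (e i)) j * qcoord X K e (Q (e' j)) k", OF X(1,3) _ X(5)])
  let ?p = "qcoord X' K' e' (P (e i))" and ?q = "\<lambda>j. qcoord X K e (Q (e' j))"
  have "Q (\<lambda>x. P (e i) x - (\<Sum>j\<in>K'. ?p j * e' j x)) \<in> X" using qcoord[OF X(4) P] by (rule Q(1))
  then have 1: "(\<lambda>x. Q (P (e i)) x - (\<Sum>j\<in>K'. ?p j * Q (e' j) x)) \<in> X"
    by (simp add: flin_diff[OF Q(2)] flin_sum[OF Q(2)])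
  have 2: "(\<lambda>x. \<Sum>j\<in>K'. ?p j * (Q (e' j) x - (\<Sum>k\<in>K. ?q j k * e k x))) \<in> X"
    by (intro subspace_sum subspace_scale X(1) qcoord[OF X(3)] Q(3))
  have "(\<lambda>x. (Q (P (e i)) x - (\<Sum>j\<in>K'. ?p j * Q (e' j) x)) + (\<Sum>j\<in>K'. ?p j * (Q (e' j) x - (\<Sum>k\<in>K. ?q j k * e k x)))) \<in> X"
    using subspace_add[OF X(1) 1 2] .
  also have "(\<lambda>x. (Q (P (e i)) x - (\<Sum>j\<in>K'. ?p j * Q (e' j) x)) + (\<Sum>j\<in>K'. ?p j * (Q (e' j) x - (\<Sum>k\<in>K. ?q j k * e k x))))
    = (\<lambda>x. Q (P (e i)) x - (\<Sum>k\<in>K. (\<Sum>j\<in>K'. ?p j * ?q j k) * e k x))"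
  proof
    fix x
    have "(\<Sum>j\<in>K'. ?p j * (\<Sum>k\<in>K. ?q j k * e k x)) = (\<Sum>k\<in>K. (\<Sum>j\<in>K'. ?p j * ?q j k) * e k x)"
      unfolding sum_distrib_left sum_distrib_right by (subst sum.swap) (simp add: mult.assoc)
    then show "(Q (P (e i)) x - (\<Sum>j\<in>K'. ?p j * Q (e' j) x)) + (\<Sum>j\<in>K'. ?p j * (Q (e' j) x - (\<Sum>k\<in>K. ?q j k * e k x)))
       = Q (P (e i)) x - (\<Sum>k\<in>K. (\<Sum>j\<in>K'. ?p j * ?q j k) * e k x)"
      by (simp add: right_diff_distrib sum_subtractf)
  qed
  finally show "(\<lambda>x. Q (P (e i)) x - (\<Sum>k\<in>K. (\<Sum>j\<in>K'. ?p j * ?q j k) * e k x)) \<in> X" .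
qed

text \<open>Cyclicity for maps between two different quotients. With P the identity it gives
  independence of the basis; with the boundary as one of the maps it relates neighbouring
  degrees.\<close>

lemma qtrace_commute:
  assumes U: "fv.subspace U" "fv.subspace U'" and b: "qbasis V U I b" "qbasis V' U' J b'"
    and P: "\<And>f. f \<in> V \<Longrightarrow> P f \<in> V'" "\<And>f. f \<in> U \<Longrightarrow> P f \<in> U'" "flin P"
    and Q: "\<And>f. f \<in> V' \<Longrightarrow> Q f \<in> V" "\<And>f. f \<in> U' \<Longrightarrow> Q f \<in> U" "flin Q"
  shows "qtrace U I b (\<lambda>f. Q (P f)) = qtrace U' J b' (\<lambda>f. P (Q f))"
proof -
  have bV: "b i \<in> V" if "i \<in> I" for i using b that by (auto simp: qbasis_def)
  have bV': "b' j \<in> V'" if "j \<in> J" for j using b that by (auto simp: qbasis_def)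
  have "qtrace U I b (\<lambda>f. Q (P f)) = (\<Sum>i\<in>I. \<Sum>j\<in>J. qcoord U' J b' (P (b i)) j * qcoord U I b (Q (b' j)) i)"
    unfolding qtrace_def by (intro sum.cong refl qcoord_comp[OF U b]) (use P Q bV bV' in auto)
  also have "\<dots> = (\<Sum>j\<in>J. \<Sum>i\<in>I. qcoord U I b (Q (b' j)) i * qcoord U' J b' (P (b i)) j)"
    by (subst sum.swap) (simp add: mult.commute)
  also have "\<dots> = qtrace U' J b' (\<lambda>f. P (Q f))"
    unfolding qtrace_def by (intro sum.cong refl qcoord_comp[OF U(2,1) b(2,1), symmetric]) (use P Q bV bV' in auto)
  finally show ?thesis .
qed

lemma qtrace_basis_change:
  assumes "fv.subspace U" "qbasis V U I b" "qbasis V U J b'"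
    and "\<And>f. f \<in> V \<Longrightarrow> T f \<in> V" "\<And>f. f \<in> U \<Longrightarrow> T f \<in> U" "flin T"
  shows "qtrace U I b T = qtrace U J b' T"
  using qtrace_commute[OF assms(1,1-3), of "\<lambda>f. f" T] assms by (simp add: flin_def)

lemma qtrace_add:
  assumes "fv.subspace U" "qbasis V U I b" "\<And>i. i \<in> I \<Longrightarrow> S (b i) \<in> V" "\<And>i. i \<in> I \<Longrightarrow> T (b i) \<in> V"
    and "\<And>i. i \<in> I \<Longrightarrow> R (b i) = (\<lambda>x. S (b i) x + T (b i) x)"
  shows "qtrace U I b R = qtrace U I b S + qtrace U I b T"
  unfolding qtrace_def sum.distrib[symmetric]
proof (rule sum.cong[OF refl])
  fix i assume i: "i \<in> I"
  have "(\<lambda>x. (S (b i) x - (\<Sum>k\<in>I. qcoord U I b (S (b i)) k * b k x)) + (T (b i) x - (\<Sum>k\<in>I. qcoord U I b (T (b i)) k * b k x))) \<in> U"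
    by (intro subspace_add assms(1) qcoord[OF assms(2)] assms(3,4) i)
  then have "(\<lambda>x. R (b i) x - (\<Sum>k\<in>I. (qcoord U I b (S (b i)) k + qcoord U I b (T (b i)) k) * b k x)) \<in> U"
    unfolding assms(5)[OF i] by (simp add: distrib_right sum.distrib algebra_simps)
  then show "qcoord U I b (R (b i)) i = qcoord U I b (S (b i)) i + qcoord U I b (T (b i)) i"
    by (rule qcoord_eqI[where c = "\<lambda>k. qcoord U I b (S (b i)) k + qcoord U I b (T (b i)) k", OF assms(1,2) _ i])
qed

lemma quotient_rep_rchar:
  assumes R: "quotient_rep G V U act R" and U: "fv.subspace U" and J: "qbasis V U J b'" and g: "g \<in> carrier G"
    and T: "\<And>f. f \<in> V \<Longrightarrow> act g f \<in> V" "\<And>f. f \<in> U \<Longrightarrow> act g f \<in> U" "flin (act g)"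
  shows "rchar R g = qtrace U J b' (act g)"
proof -
  obtain b where b: "\<forall>i<rdim R. b i \<in> V" "\<forall>f\<in>V. \<exists>c. (\<lambda>x. f x - (\<Sum>i<rdim R. c i * b i x)) \<in> U"
    "\<forall>c. (\<lambda>x. \<Sum>i<rdim R. c i * b i x) \<in> U \<longrightarrow> (\<forall>i<rdim R. c i = 0)"
    "\<forall>g\<in>carrier G. \<forall>j<rdim R. (\<lambda>x. act g (b j) x - (\<Sum>i<rdim R. rmat R g $$ (i, j) * b i x)) \<in> U"
    using R unfolding quotient_rep_def by (elim conjE exE) (rule that)
  have q: "qbasis V U {..<rdim R} b" using b(1-3) by (simp add: qbasis_def)
  have "rchar R g = qtrace U {..<rdim R} b (act g)"
    unfolding rchar_def qtrace_def
  proof (rule sum.cong[OF refl])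
    fix j assume j: "j \<in> {..<rdim R}"
    show "rmat R g $$ (j, j) = qcoord U {..<rdim R} b (act g (b j)) j"
      using qcoord_eqI[OF U q, of "act g (b j)" "\<lambda>i. rmat R g $$ (i, j)" j] b(4) g j by simp
  qed
  also have "\<dots> = qtrace U J b' (act g)" by (rule qtrace_basis_change[OF U q J T])
  finally show ?thesis .
qed

text \<open>\<open>OS\<close> chooses a matrix form, so one has to exist. Coordinates of the images
  of basis vectors give the matrices, and the mult condition is the uniqueness of coordinates modulo
  U.\<close>

lemma quotient_rep_exists:
  assumes G: "group G" and U: "fv.subspace U" and J: "qbasis V U J b'"
    and T: "\<And>g f. g \<in> carrier G \<Longrightarrow> f \<in> V \<Longrightarrow> act g f \<in> V" "\<And>g f. g \<in> carrier G \<Longrightarrow> f \<in> U \<Longrightarrow> act g f \<in> U"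
      "\<And>g. g \<in> carrier G \<Longrightarrow> flin (act g)"
    and one: "\<And>f. f \<in> V \<Longrightarrow> act \<one>\<^bsub>G\<^esub> f = f"
    and mult: "\<And>g h f. g \<in> carrier G \<Longrightarrow> h \<in> carrier G \<Longrightarrow> f \<in> V \<Longrightarrow> act (g \<otimes>\<^bsub>G\<^esub> h) f = act g (act h f)"
  shows "\<exists>R. quotient_rep G V U act R"
proof -
  interpret group G by fact
  have "finite J" using J by (simp add: qbasis_def)
  then obtain e where e: "bij_betw e {..<card J} J"
    using ex_bij_betw_nat_finite[of J] by (auto simp: atLeast0LessThan)
  define n where "n = card J"
  define b where "b = (\<lambda>i. b' (e i))"
  have re: "(\<Sum>j\<in>J. c j * b' j x) = (\<Sum>i<n. c (e i) * b i x)" for c x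
    unfolding b_def n_def by (rule sum.reindex_bij_betw[OF e, symmetric])
  have q: "qbasis V U {..<n} b"
    unfolding qbasis_def
  proof (intro conjI allI ballI impI)
    fix i assume i: "i \<in> {..<n}"
    then have "e i \<in> J" using e by (auto simp: n_def bij_betw_def)
    then show "b i \<in> V" using J by (simp add: b_def qbasis_def)
    fix c assume c: "(\<lambda>x. \<Sum>i<n. c i * b i x) \<in> U"
    let ?c = "\<lambda>j. c (inv_into {..<n} e j)"
    have "(\<lambda>x. \<Sum>j\<in>J. ?c j * b' j x) = (\<lambda>x. \<Sum>i<n. c i * b i x)"
      unfolding re using e by (intro ext sum.cong refl) (auto simp: n_def bij_betw_def)
    then have "?c (e i) = 0" using c qbasis_indep[OF J, of ?c "e i"] \<open>e i \<in> J\<close> by simp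
    then show "c i = 0" using e i by (auto simp: n_def bij_betw_def)
  next
    fix f assume "f \<in> V"
    then obtain c where "(\<lambda>x. f x - (\<Sum>j\<in>J. c j * b' j x)) \<in> U" using qbasis_spanning[OF J] by blast
    then have "(\<lambda>x. f x - (\<Sum>i<n. c (e i) * b i x)) \<in> U" unfolding re .
    then show "\<exists>c. (\<lambda>x. f x - (\<Sum>i<n. c i * b i x)) \<in> U" by (rule exI[of _ "\<lambda>i. c (e i)"])
  qed simp
  have bV: "b i \<in> V" if "i < n" for i using q that by (auto simp: qbasis_def)
  define R where "R = \<lparr>rdim = n, rmat = \<lambda>g. mat n n (\<lambda>(i, j). qcoord U {..<n} b (act g (b j)) i)\<rparr>"
  have act: "(\<lambda>x. act g (b j) x - (\<Sum>i<n. rmat R g $$ (i, j) * b i x)) \<in> U" if g: "g \<in> carrier G" "j < n" for g j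
    using qcoord[OF q T(1)[OF g(1) bV[OF g(2)]]] g(2) by (simp add: R_def)
  have "is_rep G R"
  proof (rule is_repI)
    show "group G" by fact
    show "rmat R g \<in> carrier_mat (rdim R) (rdim R)" for g by (simp add: R_def)
    fix i j assume "i < rdim R" "j < rdim R"
    then have ij: "i < n" "j < n" by (auto simp: R_def)
    have "(\<lambda>x. act \<one>\<^bsub>G\<^esub> (b j) x - (\<Sum>i<n. (if i = j then 1 else 0) * b i x)) = (\<lambda>x. 0)"
    proof
      fix x
      have "(\<Sum>i<n. (if i = j then 1 else 0) * b i x) = (\<Sum>i<n. if i = j then b i x else 0)"
        by (intro sum.cong) auto
      then show "act \<one>\<^bsub>G\<^esub> (b j) x - (\<Sum>i<n. (if i = j then 1 else 0) * b i x) = 0"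
        using ij one[OF bV[OF ij(2)]] by simp
    qed
    then have "qcoord U {..<n} b (act \<one>\<^bsub>G\<^esub> (b j)) i = (if i = j then 1 else 0)"
      using qcoord_eqI[OF U q, of "act \<one>\<^bsub>G\<^esub> (b j)" "\<lambda>i. if i = j then 1 else 0" i] subspace_zero[OF U] ij by simp
    then show "rmat R \<one>\<^bsub>G\<^esub> $$ (i, j) = (if i = j then 1 else 0)" using ij by (simp add: R_def)
    fix g h assume gh: "g \<in> carrier G" "h \<in> carrier G"
    let ?r = "\<lambda>k. rmat R h $$ (k, j)"
    have "act g (\<lambda>x. act h (b j) x - (\<Sum>k<n. ?r k * b k x)) \<in> U"
      by (rule T(2)[OF gh(1) act[OF gh(2) ij(2)]])
    then have 1: "(\<lambda>x. act g (act h (b j)) x - (\<Sum>k<n. ?r k * act g (b k) x)) \<in> U"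
      by (simp add: flin_diff[OF T(3)[OF gh(1)]] flin_sum[OF T(3)[OF gh(1)]])
    have 2: "(\<lambda>x. \<Sum>k\<in>{..<n}. ?r k * (act g (b k) x - (\<Sum>i<n. rmat R g $$ (i, k) * b i x))) \<in> U"
      by (intro subspace_sum subspace_scale U act[OF gh(1)]) simp
    have "(\<lambda>x. act (g \<otimes>\<^bsub>G\<^esub> h) (b j) x - (\<Sum>i<n. (\<Sum>k<n. rmat R g $$ (i, k) * ?r k) * b i x))
      = (\<lambda>x. (act g (act h (b j)) x - (\<Sum>k<n. ?r k * act g (b k) x)) + (\<Sum>k\<in>{..<n}. ?r k * (act g (b k) x - (\<Sum>i<n. rmat R g $$ (i, k) * b i x))))"
    proof
      fix x
      have "(\<Sum>k<n. ?r k * (\<Sum>i<n. rmat R g $$ (i, k) * b i x)) = (\<Sum>i<n. (\<Sum>k<n. rmat R g $$ (i, k) * ?r k) * b i x)"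
        unfolding sum_distrib_left sum_distrib_right by (subst sum.swap) (simp add: mult_ac)
      then show "act (g \<otimes>\<^bsub>G\<^esub> h) (b j) x - (\<Sum>i<n. (\<Sum>k<n. rmat R g $$ (i, k) * ?r k) * b i x)
        = (act g (act h (b j)) x - (\<Sum>k<n. ?r k * act g (b k) x)) + (\<Sum>k\<in>{..<n}. ?r k * (act g (b k) x - (\<Sum>i<n. rmat R g $$ (i, k) * b i x)))"
        using mult[OF gh bV[OF ij(2)]] by (simp add: right_diff_distrib sum_subtractf)
    qed
    then have "(\<lambda>x. act (g \<otimes>\<^bsub>G\<^esub> h) (b j) x - (\<Sum>i<n. (\<Sum>k<n. rmat R g $$ (i, k) * ?r k) * b i x)) \<in> U"
      using subspace_add[OF U 1 2] by simp
    then have "qcoord U {..<n} b (act (g \<otimes>\<^bsub>G\<^esub> h) (b j)) i = (\<Sum>k<n. rmat R g $$ (i, k) * ?r k)"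
      using qcoord_eqI[OF U q, of "act (g \<otimes>\<^bsub>G\<^esub> h) (b j)" "\<lambda>i. \<Sum>k<n. rmat R g $$ (i, k) * ?r k" i] ij by simp
    then show "rmat R (g \<otimes>\<^bsub>G\<^esub> h) $$ (i, j) = (\<Sum>k<rdim R. rmat R g $$ (i, k) * rmat R h $$ (k, j))"
      using ij by (simp add: R_def)
  qed
  moreover have "rdim R = n" by (simp add: R_def)
  ultimately have "quotient_rep G V U act R"
    unfolding quotient_rep_def using q act by (intro conjI exI[of _ b]) (simp_all add: qbasis_def)
  then show ?thesis by blast
qed

section \<open>Functions supported on a finite set\<close>

definition supported :: "'x set \<Rightarrow> ('x \<Rightarrow> complex) set" where
  "supported Y = {f. \<forall>w. f w \<noteq> 0 \<longrightarrow> w \<in> Y}"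

lemma supported_expand:
  assumes "finite Y" "f \<in> supported Y"
  shows "f = (\<lambda>x. \<Sum>w\<in>Y. f w * word w x)"
proof
  fix x
  have "(\<Sum>w\<in>Y. f w * word w x) = (\<Sum>w\<in>Y. if w = x then f x else 0)"
    by (intro sum.cong) (auto simp: word_def)
  then show "f x = (\<Sum>w\<in>Y. f w * word w x)" using assms by (auto simp: supported_def)
qed

lemma supported_in_subspace:
  assumes "finite Y" "fv.subspace U" "\<And>w. w \<in> Y \<Longrightarrow> word w \<in> U" "f \<in> supported Y"
  shows "f \<in> U"
  by (subst supported_expand[OF assms(1,4)]) (intro subspace_sum subspace_scale assms(2,3))

lemma flin_eq_on_supported:
  assumes "finite Y" "flin S" "flin T" "\<And>w. w \<in> Y \<Longrightarrow> S (word w) = T (word w)" "f \<in> supported Y"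
  shows "S f = T f"
proof -
  have "S (\<lambda>x. \<Sum>w\<in>Y. f w * word w x) = T (\<lambda>x. \<Sum>w\<in>Y. f w * word w x)"
    unfolding flin_sum[OF assms(2)] flin_sum[OF assms(3)] using assms(4) by (intro ext sum.cong) auto
  then show ?thesis using supported_expand[OF assms(1,5)] by simp
qed

text \<open>Greedy selection: a new word joins the basis unless it is congruent to a combination of
  those chosen so far. Basis vectors that are words can be sorted by the flat that their letters
  span.\<close>

lemma qbasis_words_exists:
  assumes "finite Y" and U: "fv.subspace U"
  shows "\<exists>B\<subseteq>Y. qbasis (supported Y) U B word"
  using assms(1)
proof (induction Y rule: finite_induct)
  case empty
  have "f = (\<lambda>x. 0)" if "f \<in> supported {}" for f :: "'a list \<Rightarrow> complex"
    using that by (auto simp: supported_def)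
  then show ?case using subspace_zero[OF U] by (auto simp: qbasis_def)
next
  case (insert y Y)
  then obtain B where B: "B \<subseteq> Y" "qbasis (supported Y) U B word" by blast
  have finB: "finite B" using B by (simp add: qbasis_def)
  have wsup: "word w \<in> supported Z" if "w \<in> Z" for w :: "'a list" and Z
    using that by (auto simp: supported_def word_def)
  have ind: "\<forall>i\<in>B. c i = 0" if "(\<lambda>x. \<Sum>i\<in>B. c i * word i x) \<in> U" for c
    using qbasis_indep[OF B(2) that] by blast
  have split: "\<exists>c a. (\<lambda>x. f x - (a * word y x + (\<Sum>i\<in>B. c i * word i x))) \<in> U" if f: "f \<in> supported (insert y Y)" for f
  proof -
    have "(\<lambda>x. f x - f y * word y x) \<in> supported Y" using f by (auto simp: supported_def word_def)
    then obtain c where "(\<lambda>x. f x - f y * word y x - (\<Sum>i\<in>B. c i * word i x)) \<in> U"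
      using qbasis_spanning[OF B(2)] by blast
    then show ?thesis by (intro exI[of _ c] exI[of _ "f y"]) (simp add: diff_diff_eq)
  qed
  show ?case
  proof (cases "\<exists>c. (\<lambda>x. word y x - (\<Sum>i\<in>B. c i * word i x)) \<in> U")
    case True
    then obtain d where d: "(\<lambda>x. word y x - (\<Sum>i\<in>B. d i * word i x)) \<in> U" by blast
    have "qbasis (supported (insert y Y)) U B word"
      unfolding qbasis_def
    proof (intro conjI ballI allI impI)
      fix f assume "f \<in> supported (insert y Y)"
      then obtain c a where ca: "(\<lambda>x. f x - (a * word y x + (\<Sum>i\<in>B. c i * word i x))) \<in> U" using split by blast
      have "(\<lambda>x. (f x - (a * word y x + (\<Sum>i\<in>B. c i * word i x))) + a * (word y x - (\<Sum>i\<in>B. d i * word i x))) \<in> U"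
        by (rule subspace_add[OF U ca subspace_scale[OF U d]])
      then have "(\<lambda>x. f x - (\<Sum>i\<in>B. (c i + a * d i) * word i x)) \<in> U"
        by (simp add: distrib_right sum.distrib sum_distrib_left mult.assoc algebra_simps)
      then show "\<exists>c. (\<lambda>x. f x - (\<Sum>i\<in>B. c i * word i x)) \<in> U" by (rule exI[of _ "\<lambda>i. c i + a * d i"])
    qed (use finB B(1) wsup ind in auto)
    then show ?thesis using B(1) by blast
  next
    case False
    have yB: "y \<notin> B" using B(1) insert.hyps by auto
    have "qbasis (supported (insert y Y)) U (insert y B) word"
      unfolding qbasis_def
    proof (intro conjI ballI allI impI)
      fix f assume "f \<in> supported (insert y Y)"
      then obtain c a where ca: "(\<lambda>x. f x - (a * word y x + (\<Sum>i\<in>B. c i * word i x))) \<in> U" using split by blast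
      have "(\<Sum>i\<in>B. (c(y := a)) i * word i x) = (\<Sum>i\<in>B. c i * word i x)" for x
        using yB by (intro sum.cong) auto
      then show "\<exists>c. (\<lambda>x. f x - (\<Sum>i\<in>insert y B. c i * word i x)) \<in> U"
        using ca finB yB by (intro exI[of _ "c(y := a)"]) simp
    next
      fix c i assume c: "(\<lambda>x. \<Sum>i\<in>insert y B. c i * word i x) \<in> U" and i: "i \<in> insert y B"
      then have c: "(\<lambda>x. c y * word y x + (\<Sum>i\<in>B. c i * word i x)) \<in> U" using finB yB by simp
      have "c y = 0"
      proof (rule ccontr)
        assume "c y \<noteq> 0"
        have "(\<lambda>x. word y x - (\<Sum>i\<in>B. (- c i / c y) * word i x)) = (\<lambda>x. 1 / c y * (c y * word y x + (\<Sum>i\<in>B. c i * word i x)))"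
        proof
          fix x
          have "(\<Sum>i\<in>B. (- c i / c y) * word i x) = - (1 / c y * (\<Sum>i\<in>B. c i * word i x))"
            unfolding sum_distrib_left sum_negf[symmetric] by (intro sum.cong refl) simp
          then show "word y x - (\<Sum>i\<in>B. (- c i / c y) * word i x) = 1 / c y * (c y * word y x + (\<Sum>i\<in>B. c i * word i x))"
            using \<open>c y \<noteq> 0\<close> by (simp add: distrib_left)
        qed
        then have "(\<lambda>x. word y x - (\<Sum>i\<in>B. (- c i / c y) * word i x)) \<in> U"
          using subspace_scale[OF U c, of "1 / c y"] by simp
        then have "\<exists>c. (\<lambda>x. word y x - (\<Sum>i\<in>B. c i * word i x)) \<in> U"
          by (rule exI[of _ "\<lambda>i. - c i / c y"])
        with False show False by (rule notE)
      qed
      then have "(\<lambda>x. \<Sum>i\<in>B. c i * word i x) \<in> U" using c by simp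
      then show "c i = 0" using ind[of c] i \<open>c y = 0\<close> by auto
    qed (use finB B(1) wsup in auto)
    then show ?thesis using B(1) by blast
  qed
qed

section \<open>The Orlik--Solomon ideal\<close>

text \<open>Left multiplication by the generator of \<open>a\<close>, written out on words so that
  statements about words go by induction.\<close>

definition lsh :: "'a \<Rightarrow> ('a list \<Rightarrow> complex) \<Rightarrow> 'a list \<Rightarrow> complex" where
  "lsh a f v = (case v of [] \<Rightarrow> 0 | x # v' \<Rightarrow> if x = a then f v' else 0)"

lemma lsh_simps [simp]: "lsh a f [] = 0" "lsh a f (x # v) = (if x = a then f v else 0)"
  by (simp_all add: lsh_def)

lemma flin_lsh: "flin (lsh a)"
  unfolding flin_def by (intro allI ext) (simp add: lsh_def split: list.split)

lemma word_Cons: "word (a # w) = lsh a (word w)"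
proof
  fix v show "word (a # w) v = lsh a (word w) v" by (cases v) (auto simp: word_def)
qed

lemma free_mult_lsh: "free_mult (lsh a p) f = lsh a (free_mult p f)"
proof
  fix v show "free_mult (lsh a p) f v = lsh a (free_mult p f) v"
  proof (cases v)
    case Nil
    then show ?thesis by (simp add: free_mult_def)
  next
    case (Cons x v')
    have "free_mult (lsh a p) f v = (\<Sum>k\<le>length v'. lsh a p (x # take k v') * f (drop k v'))"
      unfolding Cons free_mult_def by (simp add: sum.atMost_Suc_shift del: sum.atMost_Suc)
    then show ?thesis unfolding Cons by (simp add: free_mult_def)
  qed
qed

lemma flin_free_mult_left: "flin (\<lambda>p. free_mult p f)"
  unfolding flin_def free_mult_def
  by (intro allI ext) (simp add: distrib_right sum.distrib sum_distrib_left mult.assoc)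

lemma flin_free_mult_right: "flin (free_mult p)"
  unfolding flin_def free_mult_def
  by (intro allI ext) (simp add: distrib_left sum.distrib sum_distrib_left mult_ac)

lemma free_mult_word_Nil: "free_mult (word []) f = f"
proof
  fix v
  have "free_mult (word []) f v = (\<Sum>k\<le>length v. if k = 0 then f v else 0)"
    unfolding free_mult_def by (intro sum.cong) (auto simp: word_def)
  then show "free_mult (word []) f v = f v" by simp
qed

lemma free_mult_word_Cons: "free_mult (word (a # u)) f = lsh a (free_mult (word u) f)"
  by (simp add: word_Cons free_mult_lsh)

lemma free_mult_word_word: "free_mult (word u) (word v) = word (u @ v)"
  by (induction u) (simp_all add: free_mult_word_Nil free_mult_lsh word_Cons)

lemma free_mult_nonzero:
  assumes "free_mult f h w \<noteq> 0"
  shows "\<exists>u v. w = u @ v \<and> f u \<noteq> 0 \<and> h v \<noteq> 0"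
proof -
  obtain k where "f (take k w) * h (drop k w) \<noteq> 0"
    using assms unfolding free_mult_def by (meson sum.neutral)
  then show ?thesis by (intro exI[of _ "take k w"] exI[of _ "drop k w"]) auto
qed

lemma word_nonzero: "word u v \<noteq> 0 \<longleftrightarrow> v = u"
  by (simp add: word_def)

lemma flin_eq_on_span:
  assumes "flin S" "flin T" "\<And>x. x \<in> X \<Longrightarrow> S x = T x" "f \<in> fv.span X"
  shows "S f = T f"
proof -
  have "(\<lambda>y. S f y - T f y) \<in> {\<lambda>y. 0}"
    by (rule flin_span[OF flin_minus[OF assms(1,2)] _ _ assms(4)])
      (auto simp: assms(3) intro!: subspaceI)
  then have "S f y - T f y = 0" for y by (simp add: fun_eq_iff)
  then show ?thesis by (intro ext) simp
qed

text \<open>The derivation with \<open>\<partial> e\<^sub>x = 1\<close> for \<open>x \<in> N\<close> and \<open>\<partial> e\<^sub>x = 0\<close> otherwise, by recursion on the word at which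
  the result is evaluated.\<close>

fun bdy :: "'a set \<Rightarrow> ('a list \<Rightarrow> complex) \<Rightarrow> 'a list \<Rightarrow> complex" where
  "bdy N f [] = (\<Sum>x\<in>N. f [x])"
| "bdy N f (y # v) = (\<Sum>x\<in>N. f (x # y # v)) - bdy N (\<lambda>w. f (y # w)) v"

lemma flin_bdy: "flin (bdy N)"
proof -
  have "bdy N (\<lambda>x. f x + a * g x) v = bdy N f v + a * bdy N g v" for f g a v
    by (induction v arbitrary: f g) (simp_all add: sum.distrib sum_distrib_left algebra_simps)
  then show ?thesis by (auto simp: flin_def)
qed

lemma bdy_zero: "bdy N (\<lambda>x. 0) = (\<lambda>x. 0)"
  by (rule flin_zero[OF flin_bdy])

text \<open>For a in N this is the homotopy formula: boundary of e_a f plus e_a times the boundary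
  of f equals f.\<close>

lemma bdy_lsh:
  assumes "finite N"
  shows "bdy N (lsh a f) = (\<lambda>v. (if a \<in> N then f v else 0) - lsh a (bdy N f) v)"
proof
  fix v show "bdy N (lsh a f) v = (if a \<in> N then f v else 0) - lsh a (bdy N f) v"
  proof (cases v)
    case Nil
    then show ?thesis using assms by simp
  next
    case (Cons y v')
    have "(\<lambda>w. lsh a f (y # w)) = (if y = a then f else (\<lambda>x. 0))" by auto
    then show ?thesis unfolding Cons using assms by (simp add: bdy_zero)
  qed
qed

lemma bdy_word_Nil: "bdy N (word []) = (\<lambda>x. 0)"
proof
  fix v show "bdy N (word []) v = 0"
  proof (cases v)
    case (Cons y v')
    have "(\<lambda>w. word [] (y # w)) = (\<lambda>x. 0)" by (auto simp: word_def)
    then show ?thesis unfolding Cons by (simp add: bdy_zero) (simp add: word_def)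
  qed (simp add: word_def)
qed

lemma bdy_word_Cons:
  "finite N \<Longrightarrow> bdy N (word (a # w)) = (\<lambda>v. (if a \<in> N then word w v else 0) - lsh a (bdy N (word w)) v)"
  by (simp add: word_Cons bdy_lsh)

lemma lsh_zero: "lsh a (\<lambda>x. 0) = (\<lambda>x. 0)"
  by (rule flin_zero[OF flin_lsh])

lemma bdy_single: "finite N \<Longrightarrow> bdy N (word [x]) = (\<lambda>v. if x \<in> N then word [] v else 0)"
  by (simp add: bdy_word_Cons bdy_word_Nil lsh_zero)

lemma bdy_pair:
  assumes "finite N"
  shows "bdy N (word [x, y]) = (\<lambda>v. (if x \<in> N then word [y] v else 0) - (if y \<in> N then word [x] v else 0))"
proof -
  have "lsh x (\<lambda>v. if y \<in> N then word [] v else 0) = (\<lambda>v. if y \<in> N then word [x] v else 0)"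
    by (cases "y \<in> N") (simp_all add: lsh_zero word_Cons)
  then show ?thesis unfolding bdy_word_Cons[OF assms, of x "[y]"] bdy_single[OF assms] by simp
qed

lemma bdy_bdy_word:
  assumes "finite N"
  shows "bdy N (bdy N (word w)) = (\<lambda>x. 0)"
proof (induction w)
  case Nil
  then show ?case by (simp add: bdy_word_Nil bdy_zero)
next
  case (Cons a w)
  have "bdy N (bdy N (word (a # w))) = (\<lambda>v. bdy N (\<lambda>v. if a \<in> N then word w v else 0) v - bdy N (lsh a (bdy N (word w))) v)"
    unfolding bdy_word_Cons[OF assms] by (rule flin_diff[OF flin_bdy])
  also have "\<dots> = (\<lambda>v. lsh a (bdy N (bdy N (word w))) v)"
    by (simp add: bdy_lsh[OF assms] bdy_zero fun_eq_iff)
  also have "\<dots> = (\<lambda>x. 0)" unfolding Cons by (rule flin_zero[OF flin_lsh])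
  finally show ?case .
qed

text \<open>The graded Leibniz rule; each letter of the left factor contributes one sign.\<close>

lemma bdy_free_mult_word:
  assumes "finite N"
  shows "bdy N (free_mult (word w) f) = (\<lambda>v. free_mult (bdy N (word w)) f v + (- 1) ^ length w * free_mult (word w) (bdy N f) v)"
proof (induction w)
  case Nil
  have "free_mult (\<lambda>x. 0) f = (\<lambda>x. 0)" by (rule flin_zero[OF flin_free_mult_left])
  then show ?case by (simp add: bdy_word_Nil free_mult_word_Nil)
next
  case (Cons a w)
  have 1: "bdy N (free_mult (word (a # w)) f) = (\<lambda>v. (if a \<in> N then free_mult (word w) f v else 0)
      - lsh a (\<lambda>v. free_mult (bdy N (word w)) f v + (- 1) ^ length w * free_mult (word w) (bdy N f) v) v)"
    unfolding free_mult_word_Cons bdy_lsh[OF assms] Cons ..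
  have "lsh a (\<lambda>v. free_mult (bdy N (word w)) f v + (- 1) ^ length w * free_mult (word w) (bdy N f) v)
    = (\<lambda>v. lsh a (free_mult (bdy N (word w)) f) v + (- 1) ^ length w * lsh a (free_mult (word w) (bdy N f)) v)"
    by (rule flinD[OF flin_lsh])
  moreover have "free_mult (bdy N (word (a # w))) f = (\<lambda>v. (if a \<in> N then free_mult (word w) f v else 0) - lsh a (free_mult (bdy N (word w)) f) v)"
  proof -
    have "free_mult (\<lambda>v. (if a \<in> N then word w v else 0) - lsh a (bdy N (word w)) v) f
      = (\<lambda>v. free_mult (\<lambda>v. if a \<in> N then word w v else 0) f v - free_mult (lsh a (bdy N (word w))) f v)"
      by (rule flin_diff[OF flin_free_mult_left])
    moreover have "free_mult (\<lambda>v. 0) f = (\<lambda>v. 0)" by (rule flin_zero[OF flin_free_mult_left])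
    ultimately show ?thesis unfolding bdy_word_Cons[OF assms] free_mult_lsh by (simp add: fun_eq_iff)
  qed
  ultimately show ?case unfolding 1 by (simp add: free_mult_word_Cons fun_eq_iff)
qed

lemma bdy_free_mult_homogeneous:
  assumes "finite N" "p \<in> fv.span (word ` {w. length w = n})"
  shows "bdy N (free_mult p f) = (\<lambda>v. free_mult (bdy N p) f v + (- 1) ^ n * free_mult p (bdy N f) v)"
proof (rule flin_eq_on_span[OF _ _ _ assms(2)])
  show "flin (\<lambda>p. bdy N (free_mult p f))" by (rule flin_comp[OF flin_bdy flin_free_mult_left])
  have "flin (\<lambda>p. free_mult (bdy N p) f)" by (rule flin_comp[OF flin_free_mult_left flin_bdy])
  then show "flin (\<lambda>p v. free_mult (bdy N p) f v + (- 1) ^ n * free_mult p (bdy N f) v)"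
    using flin_free_mult_left[of "bdy N f"] by (simp add: flin_def algebra_simps)
qed (auto simp: bdy_free_mult_word[OF assms(1)])

text \<open>Identifies the alternating sum used in \<open>matroid_rels\<close> as a
  boundary.\<close>

lemma bdy_word_eq_sum:
  assumes "finite N" "set c \<subseteq> N"
  shows "bdy N (word c) = (\<lambda>v. \<Sum>k<length c. (- 1) ^ k * word (take k c @ drop (Suc k) c) v)"
  using assms(2)
proof (induction c)
  case Nil
  then show ?case by (simp add: bdy_word_Nil)
next
  case (Cons a c)
  have "lsh a (\<lambda>v. \<Sum>k<length c. (- 1) ^ k * word (take k c @ drop (Suc k) c) v)
     = (\<lambda>v. \<Sum>k<length c. (- 1) ^ k * word (a # take k c @ drop (Suc k) c) v)"
    unfolding flin_sum[OF flin_lsh] word_Cons ..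
  then show ?case using Cons assms(1)
    by (simp add: bdy_word_Cons sum.lessThan_Suc_shift sum_negf del: sum.lessThan_Suc)
qed

lemma bdy_supported:
  assumes "\<And>w. f w \<noteq> 0 \<Longrightarrow> w \<in> lists S \<and> length w = j" "bdy N f v \<noteq> 0"
  shows "v \<in> lists S \<and> Suc (length v) = j"
  using assms
proof (induction v arbitrary: f j)
  case Nil
  then obtain x where "f [x] \<noteq> 0" by (auto elim: sum.not_neutral_contains_not_neutral)
  then show ?case using Nil(1)[of "[x]"] by simp
next
  case (Cons y v)
  show ?case
  proof (cases "(\<Sum>x\<in>N. f (x # y # v)) = 0")
    case False
    then obtain x where "f (x # y # v) \<noteq> 0" by (auto elim: sum.not_neutral_contains_not_neutral)
    then show ?thesis using Cons.prems(1)[of "x # y # v"] by simp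
  next
    case True
    then have nz: "bdy N (\<lambda>w. f (y # w)) v \<noteq> 0" using Cons.prems(2) by simp
    have "\<exists>w. f (y # w) \<noteq> 0"
    proof (rule ccontr)
      assume "\<not> (\<exists>w. f (y # w) \<noteq> 0)"
      then have "(\<lambda>w. f (y # w)) = (\<lambda>x. 0)" by auto
      then show False using nz bdy_zero[of N] by simp
    qed
    then obtain w where w: "f (y # w) \<noteq> 0" by blast
    then have "y \<in> S" "j > 0" using Cons.prems(1)[OF w] by auto
    have "v \<in> lists S \<and> Suc (length v) = j - 1"
    proof (rule Cons.IH[OF _ nz])
      fix u assume "f (y # u) \<noteq> 0"
      then show "u \<in> lists S \<and> length u = j - 1" using Cons.prems(1)[of "y # u"] by auto
    qed
    then show ?thesis using \<open>y \<in> S\<close> by auto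
  qed
qed

section \<open>Permutations of the generators and the Orlik--Solomon ideal\<close>

definition wact :: "'a set \<Rightarrow> ('a \<Rightarrow> 'a) \<Rightarrow> ('a list \<Rightarrow> complex) \<Rightarrow> 'a list \<Rightarrow> complex" where
  "wact S \<sigma> f = (\<lambda>v. \<Sum>w | w \<in> lists S \<and> map \<sigma> w = v. f w)"

lemma free_action_eq_wact: "free_action S \<phi> g = wact S (\<phi> g)"
  by (simp add: free_action_def wact_def fun_eq_iff)

lemma flin_wact: "flin (wact S \<sigma>)"
  by (simp add: flin_def wact_def sum.distrib sum_distrib_left)

lemma wact_word:
  fixes \<sigma> :: "'a \<Rightarrow> 'a"
  assumes "finite S" "w \<in> lists S"
  shows "wact S \<sigma> (word w) = word (map \<sigma> w)"
proof
  fix v :: "'a list"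
  have "finite {u. set u \<subseteq> S \<and> length u = length v}" by (rule finite_lists_length_eq[OF assms(1)])
  then have "finite {u. u \<in> lists S \<and> map \<sigma> u = v}" by (rule rev_finite_subset) auto
  moreover have "wact S \<sigma> (word w) v = (\<Sum>u | u \<in> lists S \<and> map \<sigma> u = v. if u = w then 1 else 0)"
    unfolding wact_def by (intro sum.cong) (auto simp: word_def)
  ultimately show "wact S \<sigma> (word w) v = word (map \<sigma> w) v"
    using assms(2) by (auto simp: word_def)
qed

context finite_matroid
begin

abbreviation "OSI \<equiv> OS_ideal M"
abbreviation "rels \<equiv> exterior_rels E \<union> matroid_rels M"
text \<open>The boundary must send loops to 0: the generator of a loop is itself a relation, and a
  boundary equal to 1 would leave the ideal.\<close>

abbreviation "nonloops \<equiv> E - loops M"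
abbreviation "polys \<equiv> fv.span (word ` lists E)"

lemma finite_nonloops: "finite nonloops"
  using finite_ground by simp

lemma OSI_subspace: "fv.subspace OSI"
  unfolding OS_ideal_def by (rule fv.subspace_span)

lemma OSI_gen:
  "u \<in> lists E \<Longrightarrow> v \<in> lists E \<Longrightarrow> p \<in> rels \<Longrightarrow> free_mult (word u) (free_mult p (word v)) \<in> OSI"
  unfolding OS_ideal_def by (rule fv.span_base) blast

lemma OSI_induct:
  assumes "flin T" "fv.subspace U"
    and "\<And>u v p. u \<in> lists E \<Longrightarrow> v \<in> lists E \<Longrightarrow> p \<in> rels \<Longrightarrow> T (free_mult (word u) (free_mult p (word v))) \<in> U"
    and "f \<in> OSI"
  shows "T f \<in> U"
  using assms(4) unfolding OS_ideal_def
  by (rule flin_span[OF assms(1) _ assms(2), rotated]) (use assms(3) in blast)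

lemma OSI_lsh: "a \<in> E \<Longrightarrow> f \<in> OSI \<Longrightarrow> lsh a f \<in> OSI"
  by (rule OSI_induct[OF flin_lsh OSI_subspace])
    (auto simp: free_mult_word_Cons[symmetric] intro!: OSI_gen)

lemma OSI_rel_mult:
  assumes "p \<in> rels" "f \<in> polys"
  shows "free_mult p f \<in> OSI"
proof (rule flin_span[OF flin_free_mult_right _ OSI_subspace assms(2)])
  fix x assume "x \<in> word ` lists E"
  then show "free_mult p x \<in> OSI" using OSI_gen[of "[]" _ p] assms(1) by (auto simp: free_mult_word_Nil)
qed

lemma polys_subspace: "fv.subspace polys"
  by (rule fv.subspace_span)

lemma word_polys: "w \<in> lists E \<Longrightarrow> word w \<in> polys"
  by (rule fv.span_base) auto

lemma lsh_polys: "a \<in> E \<Longrightarrow> f \<in> polys \<Longrightarrow> lsh a f \<in> polys"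
  by (rule flin_span[OF flin_lsh _ polys_subspace]) (auto simp: word_Cons[symmetric] intro!: word_polys)

lemma bdy_word_polys: "w \<in> lists E \<Longrightarrow> bdy nonloops (word w) \<in> polys"
proof (induction w)
  case Nil
  then show ?case using subspace_zero[OF polys_subspace] by (simp add: bdy_word_Nil)
next
  case (Cons a w)
  have "(\<lambda>v. if a \<in> nonloops then word w v else 0) \<in> polys"
    using Cons word_polys[of w] subspace_zero[OF polys_subspace] by (cases "a \<in> nonloops") auto
  moreover have "lsh a (bdy nonloops (word w)) \<in> polys" using Cons by (auto intro!: lsh_polys)
  ultimately show ?case unfolding bdy_word_Cons[OF finite_nonloops] by (rule subspace_diff[OF polys_subspace])
qed

lemma circuit_rel_eq_bdy:
  assumes "2 \<le> length c" "distinct c" "set c \<in> circuits M"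
  shows "(\<lambda>v. \<Sum>k<length c. (- 1) ^ k * word (take k c @ drop (Suc k) c) v) = bdy nonloops (word c)"
proof -
  have "set c \<subseteq> nonloops"
    using circuit_no_loop[OF assms(3)] assms distinct_card[OF assms(2)] by (auto simp: circuits_def)
  then show ?thesis using bdy_word_eq_sum[OF finite_nonloops] by simp
qed

lemma rels_cases:
  assumes "p \<in> rels"
  obtains (square) x where "x \<in> E" "p = word [x, x]"
  | (anti) x y where "x \<in> E" "y \<in> E" "p = (\<lambda>v. word [x, y] v + word [y, x] v)"
  | (loop) x where "x \<in> loops M" "x \<in> E" "p = word [x]"
  | (circuit) c where "distinct c" "2 \<le> length c" "set c \<in> circuits M" "c \<in> lists E"
      "p = (\<lambda>v. \<Sum>k<length c. (- 1) ^ k * word (take k c @ drop (Suc k) c) v)" "p = bdy nonloops (word c)"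
proof -
  have l: "x \<in> E" if "x \<in> loops M" for x using that by (simp add: loops_def)
  have c: "c \<in> lists E" if "set c \<in> circuits M" for c using that by (auto simp: circuits_def)
  consider x where "x \<in> E" "p = word [x, x]" | x y where "x \<in> E" "y \<in> E" "p = word [x, y] + word [y, x]"
    | x where "x \<in> loops M" "p = word [x]"
    | c where "distinct c" "2 \<le> length c" "set c \<in> circuits M"
      "p = (\<lambda>v. \<Sum>k<length c. (- 1) ^ k * word (take k c @ drop (Suc k) c) v)"
    using assms unfolding exterior_rels_def matroid_rels_def by blast
  then show thesis
  proof cases
    case 1
    then show ?thesis by (rule square)
  next
    case 2
    then show ?thesis by (intro anti[of x y]) (simp_all add: plus_fun_def)
  next
    case 3
    then show ?thesis using l by (intro loop) auto
  next
    case 4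
    then show ?thesis using c circuit_rel_eq_bdy by (intro circuit) auto
  qed
qed

text \<open>Squares and anticommutators are cycles by cancellation, loops by the choice of
  \<open>nonloops\<close>, and circuit relations because they are boundaries of words.\<close>

lemma rels_homogeneous:
  assumes "p \<in> rels"
  shows "\<exists>n. p \<in> fv.span (word ` {w. length w = n})" "bdy nonloops p = (\<lambda>x. 0)" "p \<in> polys"
proof -
  let ?N = nonloops and ?h = "\<lambda>n. fv.span (word ` {w :: 'a list. length w = n})"
  have sub: "fv.subspace (?h n)" for n by (rule fv.subspace_span)
  have base: "word w \<in> ?h (length w)" for w by (rule fv.span_base) auto
  have "(\<exists>n. p \<in> ?h n) \<and> bdy ?N p = (\<lambda>x. 0) \<and> p \<in> polys"
    using assms
  proof (cases rule: rels_cases)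
    case (square x)
    then show ?thesis using base[of "[x, x]"] word_polys[of "[x, x]"] bdy_pair[OF finite_nonloops, of x x]
      by auto
  next
    case (anti x y)
    have "p \<in> ?h 2" unfolding anti(3) using base[of "[x, y]"] base[of "[y, x]"]
      by (intro subspace_add[OF sub]) (simp_all add: numeral_2_eq_2)
    moreover have "p \<in> polys" unfolding anti(3) using anti
      by (intro subspace_add[OF polys_subspace] word_polys) auto
    moreover have "bdy ?N p = (\<lambda>x. 0)" unfolding anti(3) flin_add[OF flin_bdy]
      by (simp add: bdy_pair[OF finite_nonloops])
    ultimately show ?thesis by blast
  next
    case (loop x)
    then show ?thesis using base[of "[x]"] word_polys[of "[x]"] bdy_single[OF finite_nonloops, of x]
      by auto
  next
    case (circuit c)
    have "p \<in> ?h (length c - 1)" unfolding circuit(5)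
    proof (intro subspace_sum[OF sub] subspace_scale[OF sub])
      fix k assume "k \<in> {..<length c}"
      then have "length (take k c @ drop (Suc k) c) = length c - 1" by auto
      then show "word (take k c @ drop (Suc k) c) \<in> ?h (length c - 1)" using base by metis
    qed
    moreover have "p \<in> polys" unfolding circuit(6) using circuit(4) by (rule bdy_word_polys)
    moreover have "bdy ?N p = (\<lambda>x. 0)" unfolding circuit(6) by (rule bdy_bdy_word[OF finite_nonloops])
    ultimately show ?thesis by blast
  qed
  then show "\<exists>n. p \<in> ?h n" "bdy ?N p = (\<lambda>x. 0)" "p \<in> polys" by auto
qed

text \<open>All generators are cycles, so the Leibniz rule shows that the ideal is closed under the boundary.\<close>

lemma OSI_bdy:
  assumes "f \<in> OSI"
  shows "bdy nonloops f \<in> OSI"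
proof (rule OSI_induct[OF flin_bdy OSI_subspace _ assms])
  fix u v p assume uv: "u \<in> lists E" "v \<in> lists E" and p: "p \<in> rels"
  obtain n where n: "p \<in> fv.span (word ` {w. length w = n})" using rels_homogeneous(1)[OF p] by blast
  show "bdy nonloops (free_mult (word u) (free_mult p (word v))) \<in> OSI"
    using uv(1)
  proof (induction u)
    case Nil
    \<comment> \<open>Since p is a cycle, only the term in which the boundary hits the right factor
      remains, and it is again a multiple of p.\<close>
    have "free_mult (\<lambda>x. 0) (word v) = (\<lambda>x. 0)" by (rule flin_zero[OF flin_free_mult_left])
    then have "bdy nonloops (free_mult p (word v)) = (\<lambda>w. (- 1) ^ n * free_mult p (bdy nonloops (word v)) w)"
      unfolding bdy_free_mult_homogeneous[OF finite_nonloops n] rels_homogeneous(2)[OF p] by simp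
    also have "\<dots> \<in> OSI"
      by (intro subspace_scale[OF OSI_subspace] OSI_rel_mult[OF p] bdy_word_polys uv(2))
    finally show ?case by (simp add: free_mult_word_Nil)
  next
    case (Cons a u)
    let ?X = "free_mult (word u) (free_mult p (word v))"
    have X: "?X \<in> OSI" using Cons uv p by (intro OSI_gen) auto
    have "(\<lambda>v. if a \<in> nonloops then ?X v else 0) \<in> OSI"
      using X subspace_zero[OF OSI_subspace] by (cases "a \<in> nonloops") auto
    moreover have "lsh a (bdy nonloops ?X) \<in> OSI" using Cons by (intro OSI_lsh) auto
    ultimately show ?case unfolding free_mult_word_Cons bdy_lsh[OF finite_nonloops]
      by (rule subspace_diff[OF OSI_subspace])
  qed
qed

section \<open>Words with dependent letters\<close>

lemma OSI_swap:
  assumes "u \<in> lists E" "v \<in> lists E" "x \<in> E" "y \<in> E"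
  shows "word (u @ x # y # v) \<in> OSI \<longleftrightarrow> word (u @ y # x # v) \<in> OSI"
proof -
  let ?p = "word [x, y] + word [y, x] :: 'a list \<Rightarrow> complex"
  have "?p \<in> rels" using assms by (auto simp: exterior_rels_def)
  then have "free_mult (word u) (free_mult ?p (word v)) \<in> OSI" using assms by (intro OSI_gen)
  also have "free_mult (word u) (free_mult ?p (word v)) = (\<lambda>w. word (u @ x # y # v) w + word (u @ y # x # v) w)"
  proof -
    have "free_mult ?p (word v) = (\<lambda>w. free_mult (word [x, y]) (word v) w + free_mult (word [y, x]) (word v) w)"
      unfolding plus_fun_def by (rule flin_add[OF flin_free_mult_left])
    then show ?thesis
      unfolding free_mult_word_word by (simp add: flin_add[OF flin_free_mult_right] free_mult_word_word)
  qed
  finally have s: "(\<lambda>w. word (u @ x # y # v) w + word (u @ y # x # v) w) \<in> OSI" .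
  show ?thesis
  proof
    assume "word (u @ x # y # v) \<in> OSI"
    from subspace_diff[OF OSI_subspace s this] show "word (u @ y # x # v) \<in> OSI" by simp
  next
    assume "word (u @ y # x # v) \<in> OSI"
    from subspace_diff[OF OSI_subspace s this] show "word (u @ x # y # v) \<in> OSI" by simp
  qed
qed

lemma OSI_move:
  assumes "u \<in> lists E" "a \<in> E" "x \<in> lists E" "y \<in> lists E"
  shows "word (u @ a # x @ y) \<in> OSI \<longleftrightarrow> word (u @ x @ a # y) \<in> OSI"
  using assms(1,3)
proof (induction x arbitrary: u)
  case (Cons b x)
  have "word (u @ a # b # (x @ y)) \<in> OSI \<longleftrightarrow> word (u @ b # a # (x @ y)) \<in> OSI"
    using Cons assms by (intro OSI_swap) auto
  also have "\<dots> \<longleftrightarrow> word ((u @ [b]) @ x @ a # y) \<in> OSI"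
    using Cons.IH[of "u @ [b]"] Cons.prems by auto
  finally show ?case by simp
qed simp

text \<open>Modulo the ideal a reordering changes a word only by a sign, which does not affect
  membership.\<close>

lemma OSI_mset:
  assumes "u \<in> lists E" "w \<in> lists E" "mset w = mset w'"
  shows "word (u @ w) \<in> OSI \<longleftrightarrow> word (u @ w') \<in> OSI"
  using assms
proof (induction w arbitrary: u w')
  case (Cons a w)
  have "a \<in> set w'" using Cons.prems(3) by (metis list.set_intros(1) set_mset_mset)
  then obtain x y where w': "w' = x @ a # y" by (meson split_list)
  have m: "mset w = mset (x @ y)" using Cons.prems(3) by (simp add: w')
  then have xy: "x @ y \<in> lists E" using Cons.prems(2) by (metis in_lists_conv_set list.set_intros(2) set_mset_mset)
  have "word ((u @ [a]) @ w) \<in> OSI \<longleftrightarrow> word ((u @ [a]) @ x @ y) \<in> OSI"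
    using Cons.IH[of "u @ [a]" "x @ y"] Cons.prems m by auto
  also have "\<dots> \<longleftrightarrow> word (u @ x @ a # y) \<in> OSI"
    using OSI_move[of u a x y] Cons.prems xy by auto
  finally show ?case by (simp add: w')
qed simp

text \<open>A word with a repeated letter can be reordered to start with a square. Otherwise bring a
  circuit a # c to the front: e_a times its boundary lies in the ideal and equals the circuit word
  minus e_a e_a times the boundary of c, where the last term starts with a square. A one-element
  circuit is a loop.\<close>

lemma OSI_dependent:
  assumes w: "w \<in> lists E" and dep: "\<not> distinct w \<or> set w \<notin> indeps M"
  shows "word w \<in> OSI"
proof (cases "distinct w")
  case False
  then obtain xs ys zs y where "w = xs @ [y] @ ys @ [y] @ zs" using not_distinct_decomp by blast
  then have m: "mset w = mset ([y, y] @ xs @ ys @ zs)" and l: "y \<in> E" "xs @ ys @ zs \<in> lists E" using w by auto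
  have "free_mult (word [y, y]) (word (xs @ ys @ zs)) \<in> OSI"
    using l by (intro OSI_rel_mult word_polys) (auto simp: exterior_rels_def)
  then show ?thesis using OSI_mset[of "[]" w "[y, y] @ xs @ ys @ zs"] m w by (simp add: free_mult_word_word)
next
  case True
  then have "set w \<notin> indeps M" "set w \<subseteq> E" using dep w by auto
  then obtain C where C: "C \<in> circuits M" "C \<subseteq> set w" using dependent_contains_circuit by blast
  obtain cs where cs: "distinct cs" "set cs = C"
    using finite_distinct_list[OF finite_subset[OF C(2)]] by auto
  define v where "v = filter (\<lambda>x. x \<notin> C) w"
  have cE: "cs \<in> lists E" and vE: "v \<in> lists E" using C cs w by (auto simp: v_def)
  have "distinct (cs @ v)" "set (cs @ v) = set w" using True cs C by (auto simp: v_def)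
  then have m: "mset w = mset (cs @ v)" using True set_eq_iff_mset_eq_distinct[of w "cs @ v"] by blast
  have "C \<noteq> {}" using C indep_empty by (auto simp: circuits_def)
  then obtain a c where ac: "cs = a # c" using cs by (cases cs) auto
  have aE: "a \<in> E" "c \<in> lists E" using cE ac by auto
  have "word (cs @ v) \<in> OSI"
  proof (cases "c = []")
    case True
    then have "a \<in> loops M" using ac cs C aE by (auto simp: loops_def circuits_def)
    then have "free_mult (word [a]) (word v) \<in> OSI"
      using vE by (intro OSI_rel_mult word_polys) (auto simp: matroid_rels_def)
    then show ?thesis using True ac by (simp add: free_mult_word_word)
  next
    case False
    then have l2: "2 \<le> length cs" using ac by (cases c) auto
    let ?N = nonloops
    have aN: "a \<in> ?N"
      using circuit_no_loop[OF C(1), of a] l2 distinct_card[OF cs(1)] cs ac aE by auto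
    have "bdy ?N (word cs) \<in> rels"
    proof -
      have "(\<lambda>v. \<Sum>k<length cs. (- 1) ^ k * word (take k cs @ drop (Suc k) cs) v) \<in> matroid_rels M"
        unfolding matroid_rels_def using cs C l2 by blast
      then show ?thesis using circuit_rel_eq_bdy[OF l2 cs(1)] cs C by simp
    qed
    then have 1: "lsh a (free_mult (bdy ?N (word cs)) (word v)) \<in> OSI"
      using aE vE by (intro OSI_lsh OSI_rel_mult word_polys)
    let ?X = "free_mult (bdy ?N (word c)) (word v)"
    have X: "?X \<in> polys"
    proof (rule flin_span[OF flin_free_mult_left _ polys_subspace bdy_word_polys[OF aE(2)]])
      fix x assume "x \<in> word ` lists E"
      then show "free_mult x (word v) \<in> polys" using vE by (auto simp: free_mult_word_word intro!: word_polys)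
    qed
    have "free_mult (word [a, a]) ?X \<in> OSI"
      using aE by (intro OSI_rel_mult X) (auto simp: exterior_rels_def)
    then have 2: "lsh a (lsh a ?X) \<in> OSI" by (simp add: free_mult_word_Cons free_mult_word_Nil)
    have "free_mult (bdy ?N (word cs)) (word v) = (\<lambda>x. word (c @ v) x - lsh a ?X x)"
    proof -
      have "bdy ?N (word cs) = (\<lambda>x. word c x - lsh a (bdy ?N (word c)) x)"
        unfolding ac bdy_word_Cons[OF finite_nonloops] using aN by simp
      then show ?thesis by (simp only: flin_diff[OF flin_free_mult_left] free_mult_lsh free_mult_word_word)
    qed
    then have "lsh a (free_mult (bdy ?N (word cs)) (word v)) = (\<lambda>x. word (cs @ v) x - lsh a (lsh a ?X) x)"
      by (simp only: flin_diff[OF flin_lsh] word_Cons[symmetric] ac append_Cons)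
    with subspace_add[OF OSI_subspace 1 2] show ?thesis by simp
  qed
  then show ?thesis using OSI_mset[of "[]" w "cs @ v"] m w by simp
qed

end

section \<open>Traces on the Orlik--Solomon algebra\<close>

text \<open>The trace of \<open>\<sigma>\<close> in degree \<open>j\<close>; for automorphisms
  \<open>os_trace_eq\<close> removes the choice of basis.\<close>

definition os_trace :: "'a matroid \<Rightarrow> ('a \<Rightarrow> 'a) \<Rightarrow> nat \<Rightarrow> complex" where
  "os_trace M \<sigma> j =
     (let B = SOME B. qbasis (free_degree (ground M) j) (OS_ideal M) B word
      in qtrace (OS_ideal M) B word (wact (ground M) \<sigma>))"

lemma free_degree_eq: "free_degree S j = supported {w \<in> lists S. length w = j}"
  by (auto simp: free_degree_def supported_def)

lemma finite_words: "finite S \<Longrightarrow> finite {w \<in> lists S. length w = j}"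
  using finite_lists_length_eq[of S j] by (rule rev_finite_subset) auto

lemma word_free_degree: "word w \<in> free_degree S j \<longleftrightarrow> w \<in> lists S \<and> length w = j"
  by (auto simp: free_degree_def word_def)

lemma wact_free_degree:
  assumes "\<sigma> ` S \<subseteq> S" "f \<in> free_degree S j"
  shows "wact S \<sigma> f \<in> free_degree S j"
  unfolding free_degree_def
proof (intro CollectI allI impI)
  fix v assume "wact S \<sigma> f v \<noteq> 0"
  then obtain w where w: "w \<in> lists S" "map \<sigma> w = v" "f w \<noteq> 0"
    unfolding wact_def by (auto elim: sum.not_neutral_contains_not_neutral)
  have "set w \<subseteq> S" using w(1) by auto
  then have "v \<in> lists S" using w(2) assms(1) by (auto simp: subset_iff)
  moreover have "length w = j" using w(3) assms(2) by (simp add: free_degree_def)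
  ultimately show "v \<in> lists S \<and> length v = j" using w(2) by auto
qed

lemma set_take_drop_Suc:
  assumes "distinct c" "k < length c"
  shows "set (take k c @ drop (Suc k) c) = set c - {c ! k}"
proof -
  have "c = take k c @ c ! k # drop (Suc k) c" using assms(2) by (rule id_take_nth_drop)
  then have "set c = insert (c ! k) (set (take k c @ drop (Suc k) c))" "c ! k \<notin> set (take k c @ drop (Suc k) c)"
    using assms(1) by (metis Un_insert_right list.simps(15) set_append, metis distinct_append not_distinct_conv_prefix
      distinct.simps(2) Un_iff disjoint_insert(1) list.simps(15) set_append)
  then show ?thesis by auto
qed

lemma qtrace_cong: "(\<And>i. i \<in> I \<Longrightarrow> S (b i) = T (b i)) \<Longrightarrow> qtrace U I b S = qtrace U I b T"
  by (simp add: qtrace_def)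

context finite_matroid
begin

section \<open>Localizing the ideal and grading it by flats\<close>

lemma circuits_localization: "F \<subseteq> E \<Longrightarrow> circuits (localization M F) = {C \<in> circuits M. C \<subseteq> F}"
  by (auto simp: circuits_def localization_def)

lemma loops_localization: "F \<subseteq> E \<Longrightarrow> loops (localization M F) = {x \<in> loops M. x \<in> F}"
  by (auto simp: loops_def localization_def)

lemma ground_localization: "ground (localization M F) = F"
  by (simp add: localization_def)

lemma OSI_localization_subset:
  assumes F: "F \<subseteq> E"
  shows "OS_ideal (localization M F) \<subseteq> OSI"
proof -
  have "exterior_rels F \<subseteq> exterior_rels E" using F unfolding exterior_rels_def by blast
  moreover have "matroid_rels (localization M F) \<subseteq> matroid_rels M"
    unfolding matroid_rels_def circuits_localization[OF F] loops_localization[OF F] by blast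
  moreover have "lists F \<subseteq> lists E" using F by (rule lists_mono)
  ultimately show ?thesis
    unfolding OS_ideal_def ground_localization by (intro fv.span_mono) blast
qed

text \<open>Z collects the letters of the relation: one element, two elements, or a circuit. Each
  word that occurs spans the closure of Z, by \<open>circuit_cl\<close> in the circuit case, and the
  relation is already one of every localization containing Z.\<close>

lemma rel_support:
  assumes "p \<in> rels"
  shows "\<exists>Z\<subseteq>E. (\<forall>q. p q \<noteq> 0 \<longrightarrow> set q \<subseteq> Z \<and> Z \<subseteq> cl (set q)) \<and> p [] = 0 \<and>
    (\<forall>F. F \<subseteq> E \<longrightarrow> Z \<subseteq> F \<longrightarrow> p \<in> exterior_rels F \<union> matroid_rels (localization M F))"
  using assms
proof (cases rule: rels_cases)
  case (square x)
  then show ?thesis using subset_cl[of "{x}"]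
    by (intro exI[of _ "{x}"]) (auto simp: word_def exterior_rels_def split: if_splits)
next
  case (anti x y)
  have q: "set q = {x, y}" if "p q \<noteq> 0" for q
  proof -
    have "word [x, y] q \<noteq> 0 \<or> word [y, x] q \<noteq> 0" using that by (auto simp: anti(3))
    then show ?thesis unfolding word_nonzero by auto
  qed
  moreover have "p = word [x, y] + word [y, x]" by (simp add: anti(3) plus_fun_def)
  moreover have "p [] = 0" by (simp add: anti(3) word_def)
  moreover have "p \<in> exterior_rels F" if "F \<subseteq> E" "{x, y} \<subseteq> F" for F
    using that unfolding exterior_rels_def \<open>p = word [x, y] + word [y, x]\<close> by blast
  ultimately show ?thesis using subset_cl[of "{x, y}"] anti(1,2) q
    by (intro exI[of _ "{x, y}"] conjI) auto
next
  case (loop x)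
  have "word [x] \<in> matroid_rels (localization M F)" if "F \<subseteq> E" "{x} \<subseteq> F" for F
    using that loop by (auto simp: matroid_rels_def loops_localization)
  then show ?thesis using subset_cl[of "{x}"] loop
    by (intro exI[of _ "{x}"]) (auto simp: word_def split: if_splits)
next
  case (circuit c)
  have q: "\<exists>k<length c. q = take k c @ drop (Suc k) c" if nz: "p q \<noteq> 0" for q
  proof -
    obtain k where "k < length c" "(- 1) ^ k * word (take k c @ drop (Suc k) c) q \<noteq> 0"
      using nz unfolding circuit(5) by (auto elim: sum.not_neutral_contains_not_neutral)
    then show ?thesis by (auto simp: word_def split: if_splits)
  qed
  have cE: "set c \<subseteq> E" using circuit(4) by auto
  have "set q \<subseteq> set c \<and> set c \<subseteq> cl (set q)" if nz: "p q \<noteq> 0" for q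
  proof -
    obtain k where k: "k < length c" "q = take k c @ drop (Suc k) c" using q[OF nz] by blast
    then have "set q = set c - {c ! k}" using set_take_drop_Suc[OF circuit(1)] by simp
    moreover have "cl (set c - {c ! k}) = cl (set c)" using k by (intro circuit_cl circuit) auto
    ultimately show ?thesis using subset_cl[OF cE] by auto
  qed
  moreover have "p [] = 0"
  proof (rule ccontr)
    assume "p [] \<noteq> 0"
    then obtain k where "k < length c" "[] = take k c @ drop (Suc k) c" using q by blast
    then show False using circuit(2) by auto
  qed
  moreover have "p \<in> matroid_rels (localization M F)" if "F \<subseteq> E" "set c \<subseteq> F" for F
    unfolding matroid_rels_def circuits_localization[OF that(1)] using circuit that(2) by blast
  ultimately show ?thesis using cE by (intro exI[of _ "set c"]) auto
qed

lemma gen_support: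
  assumes "free_mult (word u) (free_mult p (word v)) w \<noteq> 0"
  shows "\<exists>q. w = u @ q @ v \<and> p q \<noteq> 0"
proof -
  obtain u' w' where 1: "w = u' @ w'" "word u u' \<noteq> 0" "free_mult p (word v) w' \<noteq> 0"
    using free_mult_nonzero[OF assms] by blast
  then obtain q v' where "w' = q @ v'" "p q \<noteq> 0" "word v v' \<noteq> 0"
    using free_mult_nonzero[OF 1(3)] by blast
  then show ?thesis using 1 by (auto simp: word_nonzero)
qed

text \<open>Keeps the unit out of the ideal, so degree 0 of the quotient is one-dimensional.
  Restricting boundary relations to circuits with at least two elements is what makes this
  true.\<close>

lemma OSI_Nil: "f \<in> OSI \<Longrightarrow> f [] = 0"
proof -
  assume f: "f \<in> OSI"
  have "(\<lambda>f. f) f \<in> {f. f [] = 0}"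
  proof (rule OSI_induct[OF _ _ _ f])
    fix u v p assume p: "p \<in> rels"
    show "free_mult (word u) (free_mult p (word v)) \<in> {f. f [] = 0}"
      using gen_support[of u p v "[]"] rel_support[OF p] by auto
  qed (auto simp: flin_def intro!: subspaceI)
  then show ?thesis by simp
qed

definition flat_part :: "'a set \<Rightarrow> ('a list \<Rightarrow> complex) \<Rightarrow> 'a list \<Rightarrow> complex" where
  "flat_part F f = (\<lambda>v. if cl (set v) = F then f v else 0)"

lemma flin_flat_part: "flin (flat_part F)"
  by (auto simp: flin_def flat_part_def)

text \<open>Each generator is homogeneous for the grading of words by the flat they span.\<close>

lemma OSI_flat_part:
  assumes F: "F \<in> flats M" and f: "f \<in> OSI"
  shows "flat_part F f \<in> OS_ideal (localization M F)"
proof -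
  interpret L: finite_matroid "localization M F"
    by unfold_locales (rule localization_matroid[OF flat_subset[OF F]])
  show ?thesis
  proof (rule OSI_induct[OF flin_flat_part L.OSI_subspace _ f])
    fix u v p assume uv: "u \<in> lists E" "v \<in> lists E" and p: "p \<in> rels"
    let ?X = "free_mult (word u) (free_mult p (word v))"
    from rel_support[OF p] obtain Z where Zc: "Z \<subseteq> E \<and> (\<forall>q. p q \<noteq> 0 \<longrightarrow> set q \<subseteq> Z \<and> Z \<subseteq> cl (set q)) \<and> p [] = 0 \<and>
      (\<forall>F. F \<subseteq> E \<longrightarrow> Z \<subseteq> F \<longrightarrow> p \<in> exterior_rels F \<union> matroid_rels (localization M F))" by (rule exE)
    have Z: "Z \<subseteq> E" "\<And>q. p q \<noteq> 0 \<Longrightarrow> set q \<subseteq> Z \<and> Z \<subseteq> cl (set q)"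
      "\<And>F. F \<subseteq> E \<Longrightarrow> Z \<subseteq> F \<Longrightarrow> p \<in> exterior_rels F \<union> matroid_rels (localization M F)"
      using Zc by simp_all
    let ?S = "set u \<union> Z \<union> set v"
    have SE: "?S \<subseteq> E" using uv Z(1) by auto
    \<comment> \<open>Between the fixed outer words, the letters of any word of p have Z in their
      closure, so all words of the generator span one and the same flat.\<close>
    have cl: "cl (set w) = cl ?S" if nz: "?X w \<noteq> 0" for w
    proof -
      obtain q where q: "w = u @ q @ v" "p q \<noteq> 0" using gen_support[OF nz] by blast
      then have sw: "set w = set u \<union> set q \<union> set v" and qZ: "set q \<subseteq> Z" "Z \<subseteq> cl (set q)" using Z(2) by auto
      have wE: "set w \<subseteq> E" using sw qZ SE by auto
      have "cl (set q) \<subseteq> cl (set w)" using sw wE by (intro cl_mono) auto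
      then have "?S \<subseteq> cl (set w)" using sw qZ subset_cl[OF wE] by auto
      then have "cl ?S \<subseteq> cl (set w)" by (rule cl_subset_flat[OF cl_flat[OF wE]])
      moreover have "cl (set w) \<subseteq> cl ?S" using sw qZ SE by (intro cl_mono) auto
      ultimately show ?thesis by auto
    qed
    show "flat_part F ?X \<in> OS_ideal (localization M F)"
    proof (cases "cl ?S = F")
      case True
      then have SF: "?S \<subseteq> F" using subset_cl[OF SE] by auto
      have "flat_part F ?X = ?X"
      proof
        fix w show "flat_part F ?X w = ?X w" using cl[of w] True by (cases "?X w = 0") (simp_all add: flat_part_def)
      qed
      moreover have "?X \<in> OS_ideal (localization M F)"
        using SF Z(3)[OF flat_subset[OF F]] by (intro L.OSI_gen) (auto simp: ground_localization)
      ultimately show ?thesis by simp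
    next
      case False
      have "flat_part F ?X = (\<lambda>x. 0)"
      proof
        fix w show "flat_part F ?X w = 0" using cl[of w] False by (cases "?X w = 0") (simp_all add: flat_part_def)
      qed
      then show ?thesis using subspace_zero[OF L.OSI_subspace] by simp
    qed
  qed
qed

lemma wact_rel:
  assumes \<sigma>: "matroid_aut M \<sigma>" and p: "p \<in> rels"
  shows "wact E \<sigma> p \<in> rels"
proof -
  have E: "\<sigma> x \<in> E" if "x \<in> E" for x using \<sigma> that by (auto simp: matroid_aut_def bij_betw_def)
  note ww = wact_word[OF finite_ground]
  show ?thesis using p
  proof (cases rule: rels_cases)
    case (square x)
    then show ?thesis using E by (auto simp: ww exterior_rels_def)
  next
    case (anti x y)
    have "wact E \<sigma> p = word [\<sigma> x, \<sigma> y] + word [\<sigma> y, \<sigma> x]"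
      unfolding anti(3) flin_add[OF flin_wact] using anti(1,2) by (simp add: ww plus_fun_def)
    then show ?thesis using E anti(1,2) by (auto simp: exterior_rels_def)
  next
    case (loop x)
    then have "\<sigma> x \<in> loops M" using aut_loops[OF \<sigma>] by simp
    then show ?thesis using loop by (auto simp: ww matroid_rels_def)
  next
    case (circuit c)
    have "wact E \<sigma> p = (\<lambda>v. \<Sum>k<length c. (- 1) ^ k * word (take k (map \<sigma> c) @ drop (Suc k) (map \<sigma> c)) v)"
      unfolding circuit(5) flin_sum[OF flin_wact]
    proof (intro ext sum.cong refl)
      fix v k
      have "take k c @ drop (Suc k) c \<in> lists E"
        using circuit(4) by (auto dest: in_set_takeD in_set_dropD)
      then show "(- 1) ^ k * wact E \<sigma> (word (take k c @ drop (Suc k) c)) v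
        = (- 1) ^ k * word (take k (map \<sigma> c) @ drop (Suc k) (map \<sigma> c)) v"
        by (simp add: ww take_map drop_map)
    qed
    moreover have "distinct (map \<sigma> c)"
      using circuit(1,4) \<sigma> by (auto simp: distinct_map matroid_aut_def bij_betw_def intro: inj_on_subset)
    moreover have "set (map \<sigma> c) \<in> circuits M" using aut_circuits[OF \<sigma> circuit(3)] by simp
    ultimately have "wact E \<sigma> p \<in> matroid_rels M"
      unfolding matroid_rels_def using circuit(2) by (intro UnI2 CollectI exI[of _ "map \<sigma> c"]) simp
    then show ?thesis by simp
  qed
qed

lemma OSI_wact:
  assumes \<sigma>: "matroid_aut M \<sigma>" and f: "f \<in> OSI"
  shows "wact E \<sigma> f \<in> OSI"
proof (rule OSI_induct[OF flin_wact OSI_subspace _ f])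
  fix u v p assume uv: "u \<in> lists E" "v \<in> lists E" and p: "p \<in> rels"
  have E: "\<sigma> x \<in> E" if "x \<in> E" for x using \<sigma> that by (auto simp: matroid_aut_def bij_betw_def)
  have "wact E \<sigma> (free_mult (word u) (free_mult p (word v)))
      = free_mult (word (map \<sigma> u)) (free_mult (wact E \<sigma> p) (word (map \<sigma> v)))"
  proof (rule flin_eq_on_span[OF _ _ _ rels_homogeneous(3)[OF p]])
    show "flin (\<lambda>p. wact E \<sigma> (free_mult (word u) (free_mult p (word v))))"
      by (rule flin_comp[OF flin_wact flin_comp[OF flin_free_mult_right flin_free_mult_left]])
    show "flin (\<lambda>p. free_mult (word (map \<sigma> u)) (free_mult (wact E \<sigma> p) (word (map \<sigma> v))))"
      by (rule flin_comp[OF flin_free_mult_right flin_comp[OF flin_free_mult_left flin_wact]])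
    fix x assume "x \<in> word ` lists E"
    then obtain w where w: "x = word w" "w \<in> lists E" by blast
    have "u @ w @ v \<in> lists E" using uv w(2) by simp
    from wact_word[OF finite_ground this, of \<sigma>] wact_word[OF finite_ground w(2), of \<sigma>]
    show "wact E \<sigma> (free_mult (word u) (free_mult x (word v)))
      = free_mult (word (map \<sigma> u)) (free_mult (wact E \<sigma> x) (word (map \<sigma> v)))"
      unfolding w(1) by (simp add: free_mult_word_word)
  qed
  also have "\<dots> \<in> OSI" using uv E wact_rel[OF \<sigma> p] by (intro OSI_gen) auto
  finally show "wact E \<sigma> (free_mult (word u) (free_mult p (word v))) \<in> OSI" .
qed

lemma os_basis: "qbasis (free_degree E j) OSI (SOME B. qbasis (free_degree E j) OSI B word) word"
proof -
  obtain B where "qbasis (free_degree E j) OSI B word"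
    unfolding free_degree_eq using qbasis_words_exists[OF finite_words[OF finite_ground] OSI_subspace] by blast
  then show ?thesis by (rule someI)
qed

lemma aut_image: "matroid_aut M \<sigma> \<Longrightarrow> \<sigma> ` E = E"
  by (simp add: matroid_aut_def bij_betw_def)

lemma os_trace_eq:
  assumes \<sigma>: "matroid_aut M \<sigma>" and J: "qbasis (free_degree E j) OSI J b"
  shows "os_trace M \<sigma> j = qtrace OSI J b (wact E \<sigma>)"
  unfolding os_trace_def Let_def
  by (rule qtrace_basis_change[OF OSI_subspace os_basis J _ OSI_wact[OF \<sigma>] flin_wact])
    (use aut_image[OF \<sigma>] in \<open>auto intro: wact_free_degree\<close>)

lemma os_trace_0: "matroid_aut M \<sigma> \<Longrightarrow> os_trace M \<sigma> 0 = 1"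
proof -
  assume \<sigma>: "matroid_aut M \<sigma>"
  have q: "qbasis (free_degree E 0) OSI {[] :: 'a list} word"
    unfolding qbasis_def
  proof (intro conjI ballI allI impI)
    fix f assume "f \<in> free_degree E 0"
    then have "f x = 0" if "x \<noteq> []" for x using that by (auto simp: free_degree_def)
    then have "(\<lambda>x. f x - (\<Sum>i\<in>{[]}. f i * word i x)) = (\<lambda>x. 0)" by (auto simp: word_def fun_eq_iff)
    then show "\<exists>c. (\<lambda>x. f x - (\<Sum>i\<in>{[]}. c i * word i x)) \<in> OSI"
      using subspace_zero[OF OSI_subspace] by (intro exI[of _ f]) simp
  next
    fix c i assume c: "(\<lambda>x. \<Sum>i\<in>{[]}. c i * word i x) \<in> OSI" "i \<in> {[] :: 'a list}"
    show "c i = 0" using OSI_Nil[OF c(1)] c(2) by (simp add: word_def)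
  qed (auto simp: word_free_degree)
  have "(\<lambda>x. word [] x - (\<Sum>i\<in>{[]}. 1 * word i x)) \<in> OSI" using subspace_zero[OF OSI_subspace] by simp
  then have "qcoord OSI {[]} word (word []) [] = 1"
    using qcoord_eqI[OF OSI_subspace q, of "word []" "\<lambda>_. 1" "[]"] by simp
  then show ?thesis
    unfolding os_trace_eq[OF \<sigma> q] qtrace_def by (simp add: wact_word[OF finite_ground])
qed

text \<open>Automorphisms permute the nonloops, so both sides obey the same recursion on the first
  letter.\<close>

lemma wact_bdy:
  assumes \<sigma>: "matroid_aut M \<sigma>" and f: "f \<in> free_degree E j"
  shows "wact E \<sigma> (bdy nonloops f) = bdy nonloops (wact E \<sigma> f)"
proof (rule flin_eq_on_supported[OF finite_words[OF finite_ground] flin_comp[OF flin_wact flin_bdy] flin_comp[OF flin_bdy flin_wact]])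
  show "f \<in> supported {w \<in> lists E. length w = j}" using f by (simp add: free_degree_eq)
  have "w \<in> lists E \<Longrightarrow> wact E \<sigma> (bdy nonloops (word w)) = bdy nonloops (wact E \<sigma> (word w))" for w
  proof (induction w)
    case Nil
    then show ?case by (simp add: bdy_word_Nil wact_word[OF finite_ground] flin_zero[OF flin_wact])
  next
    case (Cons a w)
    from Cons.prems have aw: "a \<in> E" "w \<in> lists E" by simp_all
    have N: "\<sigma> a \<in> nonloops \<longleftrightarrow> a \<in> nonloops" using aut_loops[OF \<sigma> aw(1)] aut_image[OF \<sigma>] aw(1) by auto
    have comm: "wact E \<sigma> (lsh a X) = lsh (\<sigma> a) (wact E \<sigma> X)" if "X \<in> polys" for X
    proof (rule flin_eq_on_span[OF flin_comp[OF flin_wact flin_lsh] flin_comp[OF flin_lsh flin_wact] _ that])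
      fix x assume "x \<in> word ` lists E"
      then obtain w' where w': "x = word w'" "w' \<in> lists E" by blast
      then have "a # w' \<in> lists E" using aw(1) by simp
      from wact_word[OF finite_ground this, of \<sigma>] wact_word[OF finite_ground w'(2), of \<sigma>]
      show "wact E \<sigma> (lsh a x) = lsh (\<sigma> a) (wact E \<sigma> x)" by (simp add: w'(1) word_Cons)
    qed
    have z: "wact E \<sigma> (\<lambda>x. 0) = (\<lambda>x. 0)" by (rule flin_zero[OF flin_wact])
    have "wact E \<sigma> (bdy nonloops (word (a # w)))
      = (\<lambda>v. wact E \<sigma> (\<lambda>v. if a \<in> nonloops then word w v else 0) v - lsh (\<sigma> a) (wact E \<sigma> (bdy nonloops (word w))) v)"
      unfolding bdy_word_Cons[OF finite_nonloops] flin_diff[OF flin_wact] comm[OF bdy_word_polys[OF aw(2)]] ..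
    also have "\<dots> = (\<lambda>v. (if a \<in> nonloops then word (map \<sigma> w) v else 0) - lsh (\<sigma> a) (bdy nonloops (word (map \<sigma> w))) v)"
      using Cons.IH[OF aw(2)] aw z by (cases "a \<in> nonloops") (simp_all add: wact_word[OF finite_ground])
    also have "\<dots> = bdy nonloops (word (map \<sigma> (a # w)))"
      using N by (simp add: bdy_word_Cons[OF finite_nonloops])
    finally show ?case using wact_word[OF finite_ground Cons.prems, of \<sigma>] by simp
  qed
  then show "wact E \<sigma> (bdy nonloops (word w)) = bdy nonloops (wact E \<sigma> (word w))"
    if "w \<in> {w \<in> lists E. length w = j}" for w using that by simp
qed

text \<open>With \<open>\<tau> j\<close> the trace of \<open>e\<^sub>a \<partial> \<sigma>\<close> in degree \<open>j\<close>, the homotopy \<open>\<partial> e\<^sub>a + e\<^sub>a \<partial> = 1\<close> and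
  \<open>tr (P Q) = tr (Q P)\<close> give the trace of \<open>\<sigma>\<close> in degree \<open>j\<close> as \<open>\<tau> j + \<tau> (j + 1)\<close>.\<close>

lemma os_trace_alternating_sum:
  assumes \<sigma>: "matroid_aut M \<sigma>"
  shows "(\<Sum>j\<le>matroid_rk M. (- 1) ^ j * os_trace M \<sigma> j) = (if matroid_rk M = 0 then 1 else 0)"
proof (cases "matroid_rk M = 0")
  case True
  then show ?thesis using os_trace_0[OF \<sigma>] by simp
next
  case False
  let ?N = nonloops and ?s = "wact E \<sigma>" and ?V = "free_degree E"
  \<comment> \<open>Positive rank provides a nonloop a, and multiplication by its generator is a
    contracting homotopy for the boundary.\<close>
  have "E \<noteq> loops M" using False flat_rk_0[OF ground_flat] loops_eq by auto
  then obtain a where a: "a \<in> E" "a \<in> ?N" by (auto simp: loops_def)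
  define B where "B = (\<lambda>j. SOME B. qbasis (?V j) OSI B word)"
  have qb: "qbasis (?V j) OSI (B j) word" for j unfolding B_def by (rule os_basis)
  define \<tau> where "\<tau> = (\<lambda>j. qtrace OSI (B j) word (\<lambda>f. lsh a (bdy ?N (?s f))))"
  have BV: "word w \<in> ?V j" if "w \<in> B j" for w j using qb[of j] that by (simp add: qbasis_def)
  have sV: "?s f \<in> ?V j" if "f \<in> ?V j" for f j
    using wact_free_degree[of \<sigma> E f j] aut_image[OF \<sigma>] that by auto
  have lV: "lsh a f \<in> ?V (Suc j)" if "f \<in> ?V j" for f j
    using that a unfolding free_degree_def
    by (auto simp: lsh_def split: list.splits if_splits)
  have dV: "bdy ?N f \<in> ?V j" if "f \<in> ?V (Suc j)" for f j
    unfolding free_degree_def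
  proof (intro CollectI allI impI)
    fix v assume "bdy ?N f v \<noteq> 0"
    from bdy_supported[OF _ this, of E "Suc j"] that show "v \<in> lists E \<and> length v = j"
      by (simp add: free_degree_def)
  qed
  have d0: "bdy ?N f = (\<lambda>x. 0)" if "f \<in> ?V 0" for f
  proof
    fix v show "bdy ?N f v = 0"
      using bdy_supported[of f E 0 ?N v] that by (auto simp: free_degree_def)
  qed
  have ldV: "lsh a (bdy ?N f) \<in> ?V j" if "f \<in> ?V j" for f j
  proof (cases j)
    case 0
    then show ?thesis using d0 that by (simp add: lsh_zero free_degree_def)
  next
    case (Suc i)
    then show ?thesis using lV dV that by simp
  qed
  have step: "os_trace M \<sigma> j = \<tau> (Suc j) + \<tau> j" for j
  proof -
    have "os_trace M \<sigma> j = qtrace OSI (B j) word ?s" by (rule os_trace_eq[OF \<sigma> qb])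
    also have "\<dots> = qtrace OSI (B j) word (\<lambda>f. bdy ?N (lsh a (?s f))) + \<tau> j"
      unfolding \<tau>_def
    proof (rule qtrace_add[OF OSI_subspace qb])
      fix w assume w: "w \<in> B j"
      show "bdy ?N (lsh a (?s (word w))) \<in> ?V j" by (intro dV lV sV BV w)
      show "lsh a (bdy ?N (?s (word w))) \<in> ?V j" by (intro ldV sV BV w)
      show "?s (word w) = (\<lambda>x. bdy ?N (lsh a (?s (word w))) x + lsh a (bdy ?N (?s (word w))) x)"
        using a(2) by (simp add: bdy_lsh[OF finite_nonloops])
    qed
    \<comment> \<open>Cyclicity with e_a \<open>\<sigma>\<close> raising the degree and the boundary
      lowering it; commuting the boundary past \<open>\<sigma>\<close> turns the result into
      \<open>\<tau> (Suc j)\<close>.\<close>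
    also have "qtrace OSI (B j) word (\<lambda>f. bdy ?N (lsh a (?s f))) = qtrace OSI (B (Suc j)) word (\<lambda>f. lsh a (?s (bdy ?N f)))"
      by (rule qtrace_commute[OF OSI_subspace OSI_subspace qb qb, where P = "\<lambda>f. lsh a (?s f)" and Q = "bdy ?N"])
        (use a sV lV dV OSI_lsh OSI_wact[OF \<sigma>] OSI_bdy flin_bdy flin_comp[OF flin_lsh flin_wact] in auto)
    also have "\<dots> = \<tau> (Suc j)" unfolding \<tau>_def
      by (rule qtrace_cong) (simp add: wact_bdy[OF \<sigma> BV])
    finally show ?thesis .
  qed
  have z0: "qcoord OSI (B j) word (\<lambda>x. 0) w = 0" if "w \<in> B j" for j w
    using qcoord_eqI[OF OSI_subspace qb[of j], where f = "\<lambda>x. 0" and c = "\<lambda>_. 0" and i = w]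
      subspace_zero[OF OSI_subspace] that by simp
  have t0: "\<tau> 0 = 0"
    unfolding \<tau>_def qtrace_def using z0 by (intro sum.neutral) (auto simp: d0[OF sV[OF BV]] lsh_zero)
  \<comment> \<open>Words longer than the rank have dependent letters and lie in the ideal, so the
    quotient vanishes there and the telescoping sum stops.\<close>
  have "B (Suc (matroid_rk M)) = {}"
  proof (rule ccontr)
    assume "B (Suc (matroid_rk M)) \<noteq> {}"
    then obtain w where w: "w \<in> B (Suc (matroid_rk M))" by blast
    from BV[OF w] have wl: "w \<in> lists E" "length w = Suc (matroid_rk M)" unfolding word_free_degree by simp_all
    have "\<not> distinct w \<or> set w \<notin> indeps M"
    proof (rule ccontr)
      assume "\<not> (\<not> distinct w \<or> set w \<notin> indeps M)"
      then have "card (set w) \<le> matroid_rk M" "distinct w" using rk_ge[of "set w" E] wl(1) by auto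
      then show False using wl(2) distinct_card[of w] by simp
    qed
    then have "word w \<in> OSI" by (rule OSI_dependent[OF wl(1)])
    moreover have "(\<lambda>x. \<Sum>i\<in>B (Suc (matroid_rk M)). (if i = w then 1 else 0) * word i x) = word w"
    proof
      fix x
      have "(\<Sum>i\<in>B (Suc (matroid_rk M)). (if i = w then 1 else 0) * word i x) = (\<Sum>i\<in>B (Suc (matroid_rk M)). if i = w then word w x else 0)"
        by (intro sum.cong) auto
      then show "(\<Sum>i\<in>B (Suc (matroid_rk M)). (if i = w then 1 else 0) * word i x) = word w x"
        using w qb[of "Suc (matroid_rk M)"] by (simp add: qbasis_def)
    qed
    ultimately have "(if w = w then 1 else 0) = (0 :: complex)"
      by (intro qbasis_indep[OF qb _ w]) simp
    then show False by simp
  qed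
  then have tn: "\<tau> (Suc (matroid_rk M)) = 0" by (simp add: \<tau>_def qtrace_def)
  have "(\<Sum>j\<le>n. (- 1) ^ j * os_trace M \<sigma> j) = \<tau> 0 + (- 1) ^ n * \<tau> (Suc n)" for n
    by (induction n) (simp_all add: step algebra_simps)
  then show ?thesis using t0 tn False by simp
qed

end

section \<open>Brieskorn's decomposition\<close>

context finite_matroid
begin

lemma aut_localization:
  assumes "matroid_aut M \<sigma>" "F \<subseteq> E" "\<sigma> ` F = F"
  shows "matroid_aut (localization M F) \<sigma>"
proof -
  have inj: "inj_on \<sigma> F" using assms by (auto simp: matroid_aut_def bij_betw_def intro: inj_on_subset)
  have "\<sigma> ` X \<in> indeps M \<longleftrightarrow> X \<in> indeps M" "\<sigma> ` X \<subseteq> F" if "X \<subseteq> F" for X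
    using assms that by (auto simp: matroid_aut_def)
  then show ?thesis using inj assms(3)
    by (auto simp: matroid_aut_def localization_def bij_betw_def)
qed

lemma aut_flat:
  assumes "matroid_aut M \<sigma>" "F \<in> flats M"
  shows "\<sigma> ` F \<in> flats M"
proof -
  have "cl (\<sigma> ` F) = \<sigma> ` F" using aut_cl[OF assms(1) flat_subset[OF assms(2)]] cl_flat_eq[OF assms(2)] by simp
  moreover have "\<sigma> ` F \<subseteq> E" using aut_image[OF assms(1)] flat_subset[OF assms(2)] by blast
  ultimately show ?thesis using cl_flat[of "\<sigma> ` F"] by simp
qed

text \<open>Distinct independent letters would span a flat of rank j.\<close>

lemma OSI_low_rank_word:
  assumes "w \<in> lists E" "length w = j" "rk M (cl (set w)) \<noteq> j"
  shows "word w \<in> OSI"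
proof (rule OSI_dependent[OF assms(1)], rule ccontr)
  assume "\<not> (\<not> distinct w \<or> set w \<notin> indeps M)"
  then have "rk M (set w) = j" using rk_indep[of "set w"] distinct_card[of w] assms(2) by simp
  then show False using rk_cl[of "set w"] assms(1,3) by auto
qed

text \<open>Brieskorn's decomposition: degree \<open>j\<close> splits over the flats of rank \<open>j\<close>, and \<open>\<sigma>\<close> permutes the summands.\<close>

lemma os_trace_flats:
  assumes \<sigma>: "matroid_aut M \<sigma>"
  shows "os_trace M \<sigma> j = (\<Sum>F | F \<in> flats M \<and> \<sigma> ` F = F \<and> rk M F = j. os_trace (localization M F) \<sigma> j)"
proof -
  define Y where "Y = (\<lambda>F. {w \<in> lists E. length w = j \<and> cl (set w) = F})"
  define Fl where "Fl = {F \<in> flats M. rk M F = j}"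
  have finY: "finite (Y F)" for F
    unfolding Y_def by (rule finite_subset[OF _ finite_words[OF finite_ground, of j]]) auto
  have finFl: "finite Fl" using finite_flats by (simp add: Fl_def)
  \<comment> \<open>Basis words are selected flat by flat, modulo the full ideal. The same words
    will be shown to form a basis for the localization at F.\<close>
  define Bf where "Bf = (\<lambda>F. SOME B. B \<subseteq> Y F \<and> qbasis (supported (Y F)) OSI B word)"
  have "Bf F \<subseteq> Y F \<and> qbasis (supported (Y F)) OSI (Bf F) word" for F
    unfolding Bf_def by (rule someI_ex) (rule qbasis_words_exists[OF finY OSI_subspace])
  then have BY: "Bf F \<subseteq> Y F" and qF: "qbasis (supported (Y F)) OSI (Bf F) word" for F by simp_all
  define B where "B = (\<Union>F\<in>Fl. Bf F)"
  have BF: "w \<in> lists E" "length w = j" "cl (set w) = F" if "w \<in> Bf F" for w F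
    using BY[of F] that by (auto simp: Y_def)
  have finBf: "finite (Bf F)" for F using finite_subset[OF BY finY] .
  have finB: "finite B" using finFl finBf by (simp add: B_def)
  have Bcl: "{w \<in> B. cl (set w) = F} = Bf F" if "F \<in> Fl" for F
    using that BF(3) by (auto simp: B_def)
  have restr: "(\<Sum>w\<in>B. (if cl (set w) = F then c w else 0) * word w x) = (\<Sum>w\<in>Bf F. c w * word w x)"
    if "F \<in> Fl" for F c x
  proof -
    have "(\<Sum>w\<in>B. (if cl (set w) = F then c w else 0) * word w x) = (\<Sum>w\<in>B. if cl (set w) = F then c w * word w x else 0)"
      by (intro sum.cong) auto
    also have "\<dots> = (\<Sum>w\<in>{w \<in> B. cl (set w) = F}. c w * word w x)" using finB by (simp add: sum.inter_filter)
    finally show ?thesis unfolding Bcl[OF that] .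
  qed
  have Bsum: "(\<Sum>w\<in>B. g w) = (\<Sum>F\<in>Fl. \<Sum>w\<in>Bf F. g w)" for g :: "'a list \<Rightarrow> complex"
  proof -
    have "Bf F \<inter> Bf F' = {}" if "F \<noteq> F'" for F F'
      using that BF(3)[of _ F] BF(3)[of _ F'] by blast
    then show ?thesis unfolding B_def using finFl finBf by (intro sum.UNION_disjoint) auto
  qed
  have fpY: "flat_part F f \<in> supported (Y F)" if "f \<in> free_degree E j" for F f
    using that by (auto simp: flat_part_def supported_def Y_def free_degree_def split: if_splits)
  have fpw: "flat_part F (word w) = (if cl (set w) = F then word w else (\<lambda>x. 0))" for F w
    by (auto simp: flat_part_def word_def fun_eq_iff)
  have qB: "qbasis (free_degree E j) OSI B word"
    unfolding qbasis_def
  proof (intro conjI ballI allI impI)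
    show "word w \<in> free_degree E j" if "w \<in> B" for w
      using that BF(1,2) by (auto simp: B_def word_free_degree simp del: in_lists_conv_set)
  next
    fix f assume f: "f \<in> free_degree E j"
    define cF where "cF = (\<lambda>F. qcoord OSI (Bf F) word (flat_part F f))"
    \<comment> \<open>The difference between f and its proposed expansion, cut into components by
      flats. A component at a flat of rank other than j consists of dependent words and lies in the
      ideal.\<close>
    define g where "g = (\<lambda>F. if F \<in> Fl then (\<lambda>x. flat_part F f x - (\<Sum>w\<in>Bf F. cF F w * word w x)) else flat_part F f)"
    have "g F \<in> OSI" if F: "F \<in> flats M" for F
    proof (cases "F \<in> Fl")
      case True
      then show ?thesis using qcoord[OF qF fpY[OF f]] by (simp add: g_def cF_def)
    next
      case False
      then have "rk M F \<noteq> j" using F by (simp add: Fl_def)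
      then have "flat_part F f \<in> OSI"
        by (intro supported_in_subspace[OF finY OSI_subspace _ fpY[OF f, of F]]) (auto simp: Y_def intro!: OSI_low_rank_word)
      then show ?thesis using False by (simp add: g_def)
    qed
    then have "(\<lambda>x. \<Sum>F\<in>flats M. g F x) \<in> OSI" by (intro subspace_sum OSI_subspace)
    moreover have "(\<Sum>F\<in>flats M. g F x) = f x - (\<Sum>w\<in>B. cF (cl (set w)) w * word w x)" for x
    proof -
      have "(\<Sum>F\<in>flats M. flat_part F f x) = f x"
      proof (cases "f x = 0")
        case True
        then show ?thesis by (auto simp: flat_part_def intro!: sum.neutral)
      next
        case False
        then have "set x \<subseteq> E" using f by (auto simp: free_degree_def)
        then have "cl (set x) \<in> flats M" by (rule cl_flat)
        then show ?thesis using finite_flats by (simp add: flat_part_def)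
      qed
      moreover have "(\<Sum>F\<in>flats M. if F \<in> Fl then (\<Sum>w\<in>Bf F. cF F w * word w x) else 0) = (\<Sum>w\<in>B. cF (cl (set w)) w * word w x)"
      proof -
        have "(\<Sum>F\<in>flats M. if F \<in> Fl then (\<Sum>w\<in>Bf F. cF F w * word w x) else 0) = (\<Sum>F\<in>Fl. \<Sum>w\<in>Bf F. cF F w * word w x)"
          using finite_flats by (simp add: Fl_def sum.inter_filter)
        also have "\<dots> = (\<Sum>F\<in>Fl. \<Sum>w\<in>Bf F. cF (cl (set w)) w * word w x)"
          using BF(3) by (intro sum.cong refl) simp
        finally show ?thesis unfolding Bsum .
      qed
      moreover have "g F x = flat_part F f x - (if F \<in> Fl then (\<Sum>w\<in>Bf F. cF F w * word w x) else 0)" for F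
        by (simp add: g_def)
      ultimately show ?thesis by (simp add: sum_subtractf)
    qed
    ultimately have "(\<lambda>x. f x - (\<Sum>w\<in>B. cF (cl (set w)) w * word w x)) \<in> OSI" by simp
    then show "\<exists>c. (\<lambda>x. f x - (\<Sum>w\<in>B. c w * word w x)) \<in> OSI" by (rule exI[of _ "\<lambda>w. cF (cl (set w)) w"])
  next
    fix c w assume c: "(\<lambda>x. \<Sum>w\<in>B. c w * word w x) \<in> OSI" and w: "w \<in> B"
    then obtain F where F: "F \<in> Fl" "w \<in> Bf F" by (auto simp: B_def)
    have Fl: "F \<in> flats M" using F by (simp add: Fl_def)
    \<comment> \<open>The ideal contains the flat components of its elements, so a linear relation
      among the basis words splits into one relation for each flat.\<close>
    have "flat_part F (\<lambda>x. \<Sum>w\<in>B. c w * word w x) = (\<lambda>x. \<Sum>w\<in>Bf F. c w * word w x)"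
    proof
      fix x
      have "flat_part F (\<lambda>x. \<Sum>w\<in>B. c w * word w x) x = (\<Sum>w\<in>B. (if cl (set w) = F then c w else 0) * word w x)"
        unfolding flin_sum[OF flin_flat_part] fpw by (intro sum.cong) auto
      then show "flat_part F (\<lambda>x. \<Sum>w\<in>B. c w * word w x) x = (\<Sum>w\<in>Bf F. c w * word w x)"
        unfolding restr[OF F(1)] .
    qed
    then have "(\<lambda>x. \<Sum>w\<in>Bf F. c w * word w x) \<in> OSI"
      using OSI_flat_part[OF Fl c] OSI_localization_subset[OF flat_subset[OF Fl]] by auto
    then show "c w = 0" by (rule qbasis_indep[OF qF _ F(2)])
  qed (rule finB)
  have qL: "qbasis (free_degree F j) (OS_ideal (localization M F)) (Bf F) word" if F: "F \<in> Fl" for F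
    unfolding qbasis_def
  proof (intro conjI ballI allI impI)
    have Fl: "F \<in> flats M" and rF: "rk M F = j" and FE: "F \<subseteq> E" using F flat_subset by (auto simp: Fl_def)
    interpret L: finite_matroid "localization M F" by unfold_locales (rule localization_matroid[OF FE])
    show "word w \<in> free_degree F j" if w: "w \<in> Bf F" for w
      using BF[OF w] subset_cl[of "set w"] by (auto simp: word_free_degree)
    show "c w = 0" if "(\<lambda>x. \<Sum>w\<in>Bf F. c w * word w x) \<in> OS_ideal (localization M F)" "w \<in> Bf F" for c w
      using qbasis_indep[OF qF _ that(2)] that(1) OSI_localization_subset[OF FE] by blast
    fix f assume f: "f \<in> free_degree F j"
    then have fE: "f \<in> free_degree E j" using lists_mono[OF FE] unfolding free_degree_def by blast
    obtain c where c: "(\<lambda>x. flat_part F f x - (\<Sum>w\<in>Bf F. c w * word w x)) \<in> OSI"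
      using qbasis_spanning[OF qF fpY[OF fE]] by blast
    let ?h = "\<lambda>x. flat_part F f x - (\<Sum>w\<in>Bf F. c w * word w x)"
    have "flat_part F ?h = ?h"
    proof -
      have "flat_part F (flat_part F f) = flat_part F f" by (auto simp: flat_part_def)
      moreover have "flat_part F (\<lambda>x. \<Sum>w\<in>Bf F. c w * word w x) = (\<lambda>x. \<Sum>w\<in>Bf F. c w * word w x)"
        unfolding flin_sum[OF flin_flat_part] fpw using BF(3) by (intro ext sum.cong) auto
      ultimately show ?thesis unfolding flin_diff[OF flin_flat_part] by simp
    qed
    then have h: "?h \<in> OS_ideal (localization M F)" using OSI_flat_part[OF Fl c] by simp
    \<comment> \<open>A word of length j = rk F with letters in F that fails to span F is dependent,
      so it vanishes in the algebra of the localization.\<close>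
    have r: "(\<lambda>x. f x - flat_part F f x) \<in> OS_ideal (localization M F)"
    proof (rule supported_in_subspace[of "{w \<in> lists F. length w = j \<and> cl (set w) \<noteq> F}"])
      show "finite {w \<in> lists F. length w = j \<and> cl (set w) \<noteq> F}"
        by (rule finite_subset[OF _ finite_words[OF finite_subset[OF FE finite_ground], of j]]) auto
      show "(\<lambda>x. f x - flat_part F f x) \<in> supported {w \<in> lists F. length w = j \<and> cl (set w) \<noteq> F}"
        using f by (auto simp: supported_def flat_part_def free_degree_def split: if_splits)
      fix w assume "w \<in> {w \<in> lists F. length w = j \<and> cl (set w) \<noteq> F}"
      then have w: "w \<in> lists F" "length w = j" "cl (set w) \<noteq> F" by simp_all
      have "\<not> distinct w \<or> set w \<notin> indeps (localization M F)"
      proof (rule ccontr)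
        assume "\<not> (\<not> distinct w \<or> set w \<notin> indeps (localization M F))"
        then have "distinct w" "set w \<in> indeps M" by (auto simp: localization_def)
        then have "rk M (set w) = rk M F" using rk_indep[of "set w"] distinct_card[of w] w(2) rF by simp
        moreover have "set w \<subseteq> F" using w(1) by auto
        ultimately have "cl (set w) = cl F" using FE by (intro cl_eqI)
        then show False using w(3) cl_flat_eq[OF Fl] by simp
      qed
      then show "word w \<in> OS_ideal (localization M F)" using w(1) by (intro L.OSI_dependent) (simp_all add: ground_localization)
    qed (rule L.OSI_subspace)
    have "(\<lambda>x. f x - (\<Sum>w\<in>Bf F. c w * word w x)) = (\<lambda>x. (f x - flat_part F f x) + ?h x)" by simp
    then show "\<exists>c. (\<lambda>x. f x - (\<Sum>w\<in>Bf F. c w * word w x)) \<in> OS_ideal (localization M F)"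
      using subspace_add[OF L.OSI_subspace r h] by (intro exI[of _ c]) simp
  qed (rule finBf)
  \<comment> \<open>\<open>\<sigma>\<close> carries the summand of F to that of its image, so a
    diagonal entry can be nonzero only when F is fixed.\<close>
  have coord: "qcoord OSI B word (wact E \<sigma> (word w)) w =
      (if \<sigma> ` F = F then qcoord (OS_ideal (localization M F)) (Bf F) word (wact F \<sigma> (word w)) w else 0)"
    if F: "F \<in> Fl" and w: "w \<in> Bf F" for F w
  proof -
    note w' = BF[OF w]
    have Fl: "F \<in> flats M" and FE: "F \<subseteq> E" and rF: "rk M F = j" using F flat_subset by (auto simp: Fl_def)
    have sw: "set w \<subseteq> E" "set w \<subseteq> F" using w' subset_cl[of "set w"] by auto
    let ?F = "\<sigma> ` F" and ?x = "word (map \<sigma> w) :: 'a list \<Rightarrow> complex"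
    have F': "?F \<in> Fl" using aut_flat[OF \<sigma> Fl] aut_rk[OF \<sigma> FE] rF by (simp add: Fl_def)
    have "set (map \<sigma> w) \<subseteq> E" using sw aut_image[OF \<sigma>] by auto
    moreover have "cl (set (map \<sigma> w)) = ?F" using aut_cl[OF \<sigma> sw(1)] w'(3) by simp
    ultimately have xY: "?x \<in> supported (Y ?F)" using w'(2) by (auto simp: supported_def Y_def word_def split: if_splits)
    have xw: "wact E \<sigma> (word w) = ?x" "wact F \<sigma> (word w) = ?x"
      using wact_word[OF finite_ground w'(1)] wact_word[OF finite_subset[OF FE finite_ground], of w] sw(2) by auto
    let ?c = "qcoord OSI (Bf ?F) word ?x"
    have "(\<lambda>x. ?x x - (\<Sum>v\<in>B. (if cl (set v) = ?F then ?c v else 0) * word v x)) \<in> OSI"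
      unfolding restr[OF F'] by (rule qcoord[OF qF xY])
    moreover have "w \<in> B" using F w by (auto simp: B_def)
    ultimately have 1: "qcoord OSI B word ?x w = (if cl (set w) = ?F then ?c w else 0)"
      using qcoord_eqI[OF OSI_subspace qB, where f = ?x and c = "\<lambda>v. if cl (set v) = ?F then ?c v else 0" and i = w] by simp
    show ?thesis
    proof (cases "?F = F")
      case True
      have "set (map \<sigma> w) \<subseteq> F" using sw(2) True by auto
      then have "?x \<in> free_degree F j" using w'(2) by (auto simp: word_free_degree)
      from qcoord[OF qL[OF F] this] OSI_localization_subset[OF FE]
      have "(\<lambda>x. ?x x - (\<Sum>i\<in>Bf F. qcoord (OS_ideal (localization M F)) (Bf F) word ?x i * word i x)) \<in> OSI" by blast
      then have "?c w = qcoord (OS_ideal (localization M F)) (Bf F) word ?x w"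
        using qcoord_eqI[OF OSI_subspace qF[of F], where f = ?x and c = "qcoord (OS_ideal (localization M F)) (Bf F) word ?x" and i = w] w True by simp
      then show ?thesis using 1 True w'(3) xw by simp
    next
      case False
      then show ?thesis using 1 w'(3) xw by auto
    qed
  qed
  have "os_trace M \<sigma> j = (\<Sum>w\<in>B. qcoord OSI B word (wact E \<sigma> (word w)) w)"
    unfolding os_trace_eq[OF \<sigma> qB] qtrace_def ..
  also have "\<dots> = (\<Sum>F\<in>Fl. \<Sum>w\<in>Bf F. qcoord OSI B word (wact E \<sigma> (word w)) w)" by (rule Bsum)
  also have "\<dots> = (\<Sum>F\<in>Fl. if \<sigma> ` F = F then os_trace (localization M F) \<sigma> j else 0)"
  proof (rule sum.cong[OF refl])
    fix F assume F: "F \<in> Fl"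
    then have FE: "F \<subseteq> E" using flat_subset by (auto simp: Fl_def)
    interpret L: finite_matroid "localization M F" by unfold_locales (rule localization_matroid[OF FE])
    show "(\<Sum>w\<in>Bf F. qcoord OSI B word (wact E \<sigma> (word w)) w) = (if \<sigma> ` F = F then os_trace (localization M F) \<sigma> j else 0)"
    proof (cases "\<sigma> ` F = F")
      case True
      have "os_trace (localization M F) \<sigma> j = qtrace (OS_ideal (localization M F)) (Bf F) word (wact F \<sigma>)"
        using L.os_trace_eq[OF aut_localization[OF \<sigma> FE True], of j "Bf F" word] qL[OF F] by (simp add: ground_localization)
      then show ?thesis using True coord[OF F] by (simp add: qtrace_def)
    qed (use coord[OF F] in simp)
  qed
  also have "\<dots> = (\<Sum>F | F \<in> flats M \<and> \<sigma> ` F = F \<and> rk M F = j. os_trace (localization M F) \<sigma> j)"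
  proof -
    have "(\<Sum>F\<in>Fl. if \<sigma> ` F = F then os_trace (localization M F) \<sigma> j else 0) = (\<Sum>F\<in>{F \<in> Fl. \<sigma> ` F = F}. os_trace (localization M F) \<sigma> j)"
      using finFl by (simp add: sum.inter_filter)
    also have "{F \<in> Fl. \<sigma> ` F = F} = {F. F \<in> flats M \<and> \<sigma> ` F = F \<and> rk M F = j}" by (auto simp: Fl_def)
    finally show ?thesis .
  qed
  finally show ?thesis .
qed

section \<open>The Moebius function of the poset of fixed flats\<close>

definition fixed_flats :: "('a \<Rightarrow> 'a) \<Rightarrow> 'a set set" where
  "fixed_flats \<sigma> = {F \<in> flats M. \<sigma> ` F = F}"

text \<open>For fixed F this is the Moebius function from the bottom flat to F;
  \<open>mu_sum\<close> is the identity that characterizes it.\<close>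

definition mu :: "('a \<Rightarrow> 'a) \<Rightarrow> 'a set \<Rightarrow> complex" where
  "mu \<sigma> F = (- 1) ^ rk M F * os_trace (localization M F) \<sigma> (rk M F)"

text \<open>Brieskorn's decomposition of the localization, whose localizations at smaller flats are
  those of M.\<close>

lemma os_trace_localization:
  assumes \<sigma>: "matroid_aut M \<sigma>" and F: "F \<in> fixed_flats \<sigma>"
  shows "(- 1) ^ j * os_trace (localization M F) \<sigma> j = (\<Sum>X | X \<in> fixed_flats \<sigma> \<and> X \<subseteq> F \<and> rk M X = j. mu \<sigma> X)"
proof -
  have FE: "F \<subseteq> E" and Fl: "F \<in> flats M" and sF: "\<sigma> ` F = F" using F flat_subset by (auto simp: fixed_flats_def)
  interpret L: finite_matroid "localization M F" by unfold_locales (rule localization_matroid[OF FE])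
  have ll: "localization (localization M F) X = localization M X" if "X \<subseteq> F" for X
    using that by (auto simp: localization_def)
  have "os_trace (localization M F) \<sigma> j = (\<Sum>X | X \<in> flats (localization M F) \<and> \<sigma> ` X = X \<and> rk (localization M F) X = j.
      os_trace (localization (localization M F) X) \<sigma> j)"
    by (rule L.os_trace_flats[OF aut_localization[OF \<sigma> FE sF]])
  also have "\<dots> = (\<Sum>X | X \<in> fixed_flats \<sigma> \<and> X \<subseteq> F \<and> rk M X = j. os_trace (localization M X) \<sigma> j)"
    by (rule sum.cong) (auto simp: flats_localization[OF Fl] fixed_flats_def rk_localization ll)
  finally show ?thesis by (simp add: sum_distrib_left mu_def)
qed

text \<open>Grouping the fixed flats below F by rank turns the sum into the alternating sum of
  traces for the localization at F, which vanishes in positive rank.\<close>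

lemma mu_sum:
  assumes \<sigma>: "matroid_aut M \<sigma>" and F: "F \<in> fixed_flats \<sigma>"
  shows "(\<Sum>X | X \<in> fixed_flats \<sigma> \<and> X \<subseteq> F. mu \<sigma> X) = (if F = cl {} then 1 else 0)"
proof -
  have FE: "F \<subseteq> E" and Fl: "F \<in> flats M" and sF: "\<sigma> ` F = F" using F flat_subset by (auto simp: fixed_flats_def)
  interpret L: finite_matroid "localization M F" by unfold_locales (rule localization_matroid[OF FE])
  have rkF: "matroid_rk (localization M F) = rk M F" by (simp add: ground_localization rk_localization)
  have fin: "finite {X. X \<in> fixed_flats \<sigma> \<and> X \<subseteq> F}" using finite_flats by (auto simp: fixed_flats_def)
  have "(if F = cl {} then 1 else 0) = (\<Sum>j\<le>rk M F. (- 1) ^ j * os_trace (localization M F) \<sigma> j)"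
    using L.os_trace_alternating_sum[OF aut_localization[OF \<sigma> FE sF]] flat_rk_0[OF Fl] unfolding rkF by simp
  also have "\<dots> = (\<Sum>j\<le>rk M F. \<Sum>X | X \<in> {X. X \<in> fixed_flats \<sigma> \<and> X \<subseteq> F} \<and> rk M X = j. mu \<sigma> X)"
    unfolding os_trace_localization[OF assms] by simp
  also have "\<dots> = (\<Sum>X | X \<in> fixed_flats \<sigma> \<and> X \<subseteq> F. mu \<sigma> X)"
    using fin rk_mono by (intro sum.group) auto
  finally show ?thesis by simp
qed

lemma ranked_poset_fixed_flats:
  assumes \<sigma>: "matroid_aut M \<sigma>"
  shows "ranked_poset (fixed_flats \<sigma>) (crk M) E"
proof
  show "finite (fixed_flats \<sigma>)" using finite_flats by (simp add: fixed_flats_def)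
  show "E \<in> fixed_flats \<sigma>" using ground_flat aut_image[OF \<sigma>] by (simp add: fixed_flats_def)
  show "X \<subseteq> E" if "X \<in> fixed_flats \<sigma>" for X using that flat_subset by (auto simp: fixed_flats_def)
  show "crk M E = 0" by (simp add: crk_def)
  show "crk M Y < crk M X" if "X \<in> fixed_flats \<sigma>" "Y \<in> fixed_flats \<sigma>" "X \<subset> Y" for X Y
    using flat_rk_strict[of X Y] that by (simp add: crk_def fixed_flats_def)
qed

lemma bot_fixed:
  assumes \<sigma>: "matroid_aut M \<sigma>"
  shows "cl {} \<in> fixed_flats \<sigma>"
  using bot_flat(1) aut_cl[OF \<sigma>, of "{}"] by (simp add: fixed_flats_def)

end

section \<open>Equivariant Kazhdan--Lusztig polynomials\<close>

lemma group_actionI: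
  assumes "group G" "\<And>g. g \<in> carrier G \<Longrightarrow> \<phi> g \<in> extensional S" "\<And>g. g \<in> carrier G \<Longrightarrow> bij_betw (\<phi> g) S S"
    and "\<And>g h x. g \<in> carrier G \<Longrightarrow> h \<in> carrier G \<Longrightarrow> x \<in> S \<Longrightarrow> \<phi> (g \<otimes>\<^bsub>G\<^esub> h) x = \<phi> g (\<phi> h x)"
  shows "group_action G S \<phi>"
proof -
  interpret group G by fact
  have B: "\<phi> g \<in> Bij S" if "g \<in> carrier G" for g using assms(2,3)[OF that] by (simp add: Bij_def)
  have "\<phi> (g \<otimes>\<^bsub>G\<^esub> h) = compose S (\<phi> g) (\<phi> h)" if gh: "g \<in> carrier G" "h \<in> carrier G" for g h
  proof
    fix x show "\<phi> (g \<otimes>\<^bsub>G\<^esub> h) x = compose S (\<phi> g) (\<phi> h) x"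
      using assms(4)[OF gh] assms(2)[OF m_closed[OF gh]] by (cases "x \<in> S") (auto simp: compose_def extensional_def)
  qed
  then have "\<phi> \<in> hom G (BijGroup S)" using B by (auto simp: hom_def BijGroup_def)
  then show ?thesis
    using assms(1) group_BijGroup[of S] by (simp add: group_action_def group_hom_def group_hom_axioms_def)
qed

section \<open>Stabilizers, restricted actions and characters of the coefficients\<close>

locale equivariant =
  fixes G :: "'g monoid" and M :: "'a matroid" and \<phi> :: "'g \<Rightarrow> 'a \<Rightarrow> 'a"
  assumes equivariant: "equivariant_matroid G M \<phi>"
begin

sublocale finite_group G
  using equivariant by (simp add: equivariant_matroid_def finite_group_def finite_group_axioms_def)

sublocale finite_matroid M
  using equivariant by unfold_locales (simp add: equivariant_matroid_def)

lemma action: "group_action G E \<phi>"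
  using equivariant by (simp add: equivariant_matroid_def)

lemma action_bij: "g \<in> carrier G \<Longrightarrow> bij_betw (\<phi> g) E E"
  using group_action.bij_prop0[OF action, of g] by (simp add: Bij_def)

lemma action_mult: "g \<in> carrier G \<Longrightarrow> h \<in> carrier G \<Longrightarrow> x \<in> E \<Longrightarrow> \<phi> (g \<otimes>\<^bsub>G\<^esub> h) x = \<phi> g (\<phi> h x)"
  using group_action.composition_rule[OF action] by simp

lemma action_one: "x \<in> E \<Longrightarrow> \<phi> \<one>\<^bsub>G\<^esub> x = x"
  using fun_cong[OF group_action.id_eq_one[OF action], of x] by simp

lemma action_aut: "g \<in> carrier G \<Longrightarrow> matroid_aut M (\<phi> g)"
  using equivariant by (intro matroid_autI action_bij) (auto simp: equivariant_matroid_def)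

lemma image_mult: "g \<in> carrier G \<Longrightarrow> h \<in> carrier G \<Longrightarrow> X \<subseteq> E \<Longrightarrow> \<phi> (g \<otimes>\<^bsub>G\<^esub> h) ` X = \<phi> g ` \<phi> h ` X"
  unfolding image_image by (rule image_cong) (auto simp: action_mult)

lemma image_one: "X \<subseteq> E \<Longrightarrow> \<phi> \<one>\<^bsub>G\<^esub> ` X = X"
proof -
  assume "X \<subseteq> E"
  then have "\<phi> \<one>\<^bsub>G\<^esub> ` X = (\<lambda>x. x) ` X" using action_one by (intro image_cong) auto
  then show ?thesis by simp
qed

lemma stabilizer_subgroup_flat:
  assumes "F \<subseteq> E"
  shows "subgroup (stabilizer G (\<lambda>g. (`) (\<phi> g)) F) G"
proof (rule subgroupI)
  show "stabilizer G (\<lambda>g. (`) (\<phi> g)) F \<noteq> {}" using image_one[OF assms] by (auto simp: stabilizer_def)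
  fix a b assume a: "a \<in> stabilizer G (\<lambda>g. (`) (\<phi> g)) F"
  then have ac: "a \<in> carrier G" "\<phi> a ` F = F" by (auto simp: stabilizer_def)
  have "\<phi> (inv\<^bsub>G\<^esub> a) ` F = \<phi> (inv\<^bsub>G\<^esub> a) ` \<phi> a ` F" using ac by simp
  also have "\<dots> = F" using image_mult[of "inv\<^bsub>G\<^esub> a" a F] ac assms image_one by simp
  finally show "inv\<^bsub>G\<^esub> a \<in> stabilizer G (\<lambda>g. (`) (\<phi> g)) F" using ac by (simp add: stabilizer_def)
  assume "b \<in> stabilizer G (\<lambda>g. (`) (\<phi> g)) F"
  then show "a \<otimes>\<^bsub>G\<^esub> b \<in> stabilizer G (\<lambda>g. (`) (\<phi> g)) F"
    using ac assms by (auto simp: stabilizer_def image_mult)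
qed (auto simp: stabilizer_def)

lemma restrict_group_action:
  assumes H: "subgroup H G" and S: "S \<subseteq> E" "\<And>g. g \<in> H \<Longrightarrow> \<phi> g ` S = S"
  shows "group_action (G\<lparr>carrier := H\<rparr>) S (restrict_action \<phi> S)"
proof (rule group_actionI)
  show "group (G\<lparr>carrier := H\<rparr>)" by (rule subgroup.subgroup_is_group[OF H is_group])
  have c: "g \<in> carrier G" if "g \<in> H" for g using subgroup.mem_carrier[OF H that] .
  show "bij_betw (restrict_action \<phi> S g) S S" if "g \<in> carrier (G\<lparr>carrier := H\<rparr>)" for g
  proof -
    have "inj_on (\<phi> g) S" using action_bij[of g] c S(1) that by (auto simp: bij_betw_def intro: inj_on_subset)
    then show ?thesis using S(2)[of g] that by (auto simp: bij_betw_def restrict_action_def inj_on_def)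
  qed
  show "restrict_action \<phi> S (g \<otimes>\<^bsub>G\<lparr>carrier := H\<rparr>\<^esub> h) x = restrict_action \<phi> S g (restrict_action \<phi> S h x)"
    if "g \<in> carrier (G\<lparr>carrier := H\<rparr>)" "h \<in> carrier (G\<lparr>carrier := H\<rparr>)" "x \<in> S" for g h x
  proof -
    have "\<phi> h x \<in> S" using S(2)[of h] that by auto
    then show ?thesis using that c S(1) action_mult[of g h x] by (auto simp: restrict_action_def)
  qed
qed (auto simp: restrict_action_def)

lemma restrict_action_image: "X \<subseteq> S \<Longrightarrow> restrict_action \<phi> S g ` X = \<phi> g ` X"
  by (auto simp: restrict_action_def)

lemma flat_stab_carrier: "carrier (flat_stab G \<phi> F) = {g \<in> carrier G. \<phi> g ` F = F}"
  by (simp add: flat_stab_def stabilizer_def)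

lemma flat_stab_equivariant:
  assumes F: "F \<in> flats M"
  shows "equivariant_matroid (flat_stab G \<phi> F) (localization M F) (restrict_action \<phi> F)"
    and "equivariant_matroid (flat_stab G \<phi> F) (contraction M F) (restrict_action \<phi> (E - F))"
proof -
  let ?H = "stabilizer G (\<lambda>g. (`) (\<phi> g)) F"
  have FE: "F \<subseteq> E" using F by (rule flat_subset)
  have H: "subgroup ?H G" by (rule stabilizer_subgroup_flat[OF FE])
  have fs: "flat_stab G \<phi> F = G\<lparr>carrier := ?H\<rparr>" by (simp add: flat_stab_def)
  interpret H: finite_group "flat_stab G \<phi> F" unfolding fs by (rule finite_group_subgroup[OF H])
  have h: "g \<in> carrier G" "\<phi> g ` F = F" if "g \<in> ?H" for g using that by (auto simp: stabilizer_def)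
  have h': "\<phi> g ` (E - F) = E - F" if "g \<in> ?H" for g
  proof -
    have "inj_on (\<phi> g) E" "\<phi> g ` E = E" using action_bij[OF h(1)[OF that]] by (auto simp: bij_betw_def)
    then show ?thesis using inj_on_image_set_diff[of "\<phi> g" E E F] h(2)[OF that] FE by auto
  qed
  have flat: "\<phi> g ` X \<in> flats M" if "g \<in> ?H" "X \<in> flats M" for g X
    using aut_flat[OF action_aut[OF h(1)[OF that(1)]] that(2)] .
  have "restrict_action \<phi> F g ` X \<in> flats (localization M F)" if "g \<in> ?H" "X \<in> flats (localization M F)" for g X
    using that flat[of g X] h(2)[of g] by (auto simp: flats_localization[OF F] restrict_action_image)
  then show "equivariant_matroid (flat_stab G \<phi> F) (localization M F) (restrict_action \<phi> F)"
    using H.is_group H.finite_carrier localization_matroid[OF FE] restrict_group_action[OF H FE h(2)]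
    by (simp add: equivariant_matroid_def ground_localization fs)
  have "restrict_action \<phi> (E - F) g ` X \<in> flats (contraction M F)" if g: "g \<in> ?H" and X: "X \<in> flats (contraction M F)" for g X
  proof -
    have XE: "X \<subseteq> E - F" "X \<union> F \<in> flats M" using X by (auto simp: flats_contraction[OF FE])
    have "\<phi> g ` X \<union> F = \<phi> g ` (X \<union> F)" using h(2)[OF g] by auto
    then have "\<phi> g ` X \<union> F \<in> flats M" using flat[OF g XE(2)] by simp
    moreover have "\<phi> g ` X \<subseteq> E - F" using XE(1) h'[OF g] by blast
    ultimately show ?thesis using XE(1) by (simp add: flats_contraction[OF FE] restrict_action_image)
  qed
  then show "equivariant_matroid (flat_stab G \<phi> F) (contraction M F) (restrict_action \<phi> (E - F))"
    using H.is_group H.finite_carrier contraction_matroid restrict_group_action[OF H Diff_subset h']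
    by (simp add: equivariant_matroid_def contraction_ground fs)
qed

text \<open>A basis of words guarantees that the choice in \<open>OS\<close> succeeds; the resulting
  character is the trace, whichever matrix form was chosen.\<close>

lemma OS_props:
  shows "OS G M \<phi> j \<in> carrier (Rep G)"
    and "g \<in> carrier G \<Longrightarrow> vchar (OS G M \<phi> j) g = os_trace M (\<phi> g) j"
proof -
  let ?V = "free_degree E j" and ?act = "free_action E \<phi>"
  define R where "R = (SOME R. quotient_rep G ?V OSI ?act R)"
  have act: "?act g = wact E (\<phi> g)" for g by (rule free_action_eq_wact)
  have T: "\<And>f. f \<in> ?V \<Longrightarrow> ?act g f \<in> ?V" "\<And>f. f \<in> OSI \<Longrightarrow> ?act g f \<in> OSI" "flin (?act g)" if g: "g \<in> carrier G" for g
    unfolding act using wact_free_degree[of "\<phi> g" E] aut_image[OF action_aut[OF g]] OSI_wact[OF action_aut[OF g]] flin_wact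
    by auto
  have im: "\<phi> g x \<in> E" if "g \<in> carrier G" "x \<in> E" for g x using aut_image[OF action_aut[OF that(1)]] that(2) by auto
  note ext = flin_eq_on_supported[OF finite_words[OF finite_ground, of j]]
  have "\<exists>R. quotient_rep G ?V OSI ?act R"
  proof (rule quotient_rep_exists[OF is_group OSI_subspace os_basis T])
    fix f assume f: "f \<in> ?V"
    show "?act \<one>\<^bsub>G\<^esub> f = f"
    proof (rule ext[where T = "\<lambda>f. f"])
      fix w assume "w \<in> {w \<in> lists E. length w = j}"
      then have w: "w \<in> lists E" by simp
      then have "map (\<phi> \<one>\<^bsub>G\<^esub>) w = w" using action_one by (intro map_idI) auto
      then show "?act \<one>\<^bsub>G\<^esub> (word w) = word w" unfolding act wact_word[OF finite_ground w] by simp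
    qed (use f T(3) in \<open>auto simp: free_degree_eq flin_def\<close>)
    fix g h assume gh: "g \<in> carrier G" "h \<in> carrier G"
    show "?act (g \<otimes>\<^bsub>G\<^esub> h) f = ?act g (?act h f)"
    proof (rule ext[where T = "\<lambda>f. ?act g (?act h f)"])
      fix w assume "w \<in> {w \<in> lists E. length w = j}"
      then have w: "w \<in> lists E" by simp
      have w2: "map (\<phi> h) w \<in> lists E" using w im[OF gh(2)] by auto
      have "map (\<phi> (g \<otimes>\<^bsub>G\<^esub> h)) w = map (\<phi> g) (map (\<phi> h) w)"
        using w action_mult[OF gh] by auto
      then show "?act (g \<otimes>\<^bsub>G\<^esub> h) (word w) = ?act g (?act h (word w))"
        unfolding act wact_word[OF finite_ground w] wact_word[OF finite_ground w2] by (rule arg_cong)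
    qed (use f T(3) gh flin_comp in \<open>auto simp: free_degree_eq\<close>)
  qed
  then have R: "quotient_rep G ?V OSI ?act R" unfolding R_def by (rule someI_ex)
  then have rep: "is_rep G R" by (simp add: quotient_rep_def)
  have OS: "OS G M \<phi> j = rep_class G R" by (simp add: OS_def R_def)
  show "OS G M \<phi> j \<in> carrier (Rep G)" unfolding OS by (rule rep_class(1)[OF rep])
  assume g: "g \<in> carrier G"
  have "vchar (OS G M \<phi> j) g = rchar R g" unfolding OS by (rule rep_class(2)[OF rep g])
  also have "\<dots> = qtrace OSI (SOME B. qbasis ?V OSI B word) word (?act g)"
    by (rule quotient_rep_rchar[OF R OSI_subspace os_basis g T[OF g]])
  finally show "vchar (OS G M \<phi> j) g = os_trace M (\<phi> g) j" by (simp add: os_trace_def act)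
qed

lemma Hpoly_props:
  shows "Hpoly G M \<phi> k \<in> carrier (Rep G)"
    and "g \<in> carrier G \<Longrightarrow> vchar (Hpoly G M \<phi> k) g =
      (if k \<le> matroid_rk M then (- 1) ^ (matroid_rk M - k) * os_trace M (\<phi> g) (matroid_rk M - k) else 0)"
  by (auto simp: Hpoly_def Rep_int_multiple OS_props Rep_zero)

lemma vpoly_mult_props:
  assumes "\<And>a. p a \<in> carrier (Rep G)" "\<And>a. q a \<in> carrier (Rep G)"
  shows "vpoly_mult G p q k \<in> carrier (Rep G)"
    and "g \<in> carrier G \<Longrightarrow> vchar (vpoly_mult G p q k) g = (\<Sum>a\<le>k. vchar (p a) g * vchar (q (k - a)) g)"
  unfolding vpoly_mult_def using assms by (simp_all add: Rep_finsum Rep_mult)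

abbreviation kl_char :: "'g \<Rightarrow> nat \<Rightarrow> complex" where
  "kl_char g k \<equiv> of_int (kl_number (fixed_flats (\<phi> g)) (crk M) (int (matroid_rk M)) (int k))"

text \<open>The character at g of the degree k term that \<open>KL_rhs\<close> attaches to a g-fixed
  flat F, with the predicted numbers already in place of the polynomial of the contraction.\<close>

definition summand :: "nat \<Rightarrow> 'a set \<Rightarrow> 'g \<Rightarrow> complex" where
  "summand k F g = (\<Sum>a\<le>k. (\<Sum>X | X \<in> fixed_flats (\<phi> g) \<and> X \<subseteq> F \<and> crk M X - crk M F = int a. mu (\<phi> g) X) *
     of_int (kl_number (above (fixed_flats (\<phi> g)) F) (crk M) (crk M F) (int (k - a))))"

lemma crk_bot: "crk M (cl {}) = int (matroid_rk M)"
  using bot_flat(3) by (simp add: crk_def)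

lemma summand_sum:
  assumes g: "g \<in> carrier G" and k: "k \<le> matroid_rk M"
  shows "(\<Sum>F\<in>fixed_flats (\<phi> g). summand k F g) = kl_char g (matroid_rk M - k)"
proof -
  let ?s = "\<phi> g"
  have s: "matroid_aut M ?s" by (rule action_aut[OF g])
  interpret ranked_poset "fixed_flats ?s" "crk M" E by (rule ranked_poset_fixed_flats[OF s])
  have b: "cl {} \<subseteq> X" if "X \<in> fixed_flats ?s" for X using bot_flat(2)[of X] that by (simp add: fixed_flats_def)
  have "above (fixed_flats ?s) (cl {}) = fixed_flats ?s" using b by (auto simp: above_def)
  then show ?thesis
    using kl_recursion[OF bot_fixed[OF s] b mu_sum[OF s], of k] k
    unfolding summand_def crk_bot by (simp add: of_nat_diff)
qed

lemma fixed_flats_translate: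
  assumes g: "g \<in> carrier G" and k: "k \<in> carrier G"
  defines "h \<equiv> inv\<^bsub>G\<^esub> k \<otimes>\<^bsub>G\<^esub> g \<otimes>\<^bsub>G\<^esub> k"
  shows "bij_betw ((`) (\<phi> k)) (fixed_flats (\<phi> h)) (fixed_flats (\<phi> g))"
proof (rule bij_betwI[where g = "(`) (\<phi> (inv\<^bsub>G\<^esub> k))"])
  have hc: "h \<in> carrier G" using g k by (simp add: h_def)
  have kh: "k \<otimes>\<^bsub>G\<^esub> h = g \<otimes>\<^bsub>G\<^esub> k" using g k by (simp add: h_def m_assoc[symmetric])
  have hk: "h \<otimes>\<^bsub>G\<^esub> inv\<^bsub>G\<^esub> k = inv\<^bsub>G\<^esub> k \<otimes>\<^bsub>G\<^esub> g" using g k by (simp add: h_def m_assoc)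
  have fE: "X \<subseteq> E" if "X \<in> fixed_flats \<sigma>" for X \<sigma> using that flat_subset by (auto simp: fixed_flats_def)
  show "(`) (\<phi> k) \<in> fixed_flats (\<phi> h) \<rightarrow> fixed_flats (\<phi> g)"
  proof
    fix X assume X: "X \<in> fixed_flats (\<phi> h)"
    have "\<phi> g ` \<phi> k ` X = \<phi> (k \<otimes>\<^bsub>G\<^esub> h) ` X" using image_mult[OF g k fE[OF X]] kh by simp
    also have "\<dots> = \<phi> k ` X" using image_mult[OF k hc fE[OF X]] X by (simp add: fixed_flats_def)
    finally show "\<phi> k ` X \<in> fixed_flats (\<phi> g)"
      using X aut_flat[OF action_aut[OF k]] by (simp add: fixed_flats_def)
  qed
  show "(`) (\<phi> (inv\<^bsub>G\<^esub> k)) \<in> fixed_flats (\<phi> g) \<rightarrow> fixed_flats (\<phi> h)"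
  proof
    fix X assume X: "X \<in> fixed_flats (\<phi> g)"
    have "\<phi> h ` \<phi> (inv\<^bsub>G\<^esub> k) ` X = \<phi> (inv\<^bsub>G\<^esub> k \<otimes>\<^bsub>G\<^esub> g) ` X" using image_mult[OF hc inv_closed[OF k] fE[OF X]] hk by simp
    also have "\<dots> = \<phi> (inv\<^bsub>G\<^esub> k) ` X" using image_mult[OF inv_closed[OF k] g fE[OF X]] X by (simp add: fixed_flats_def)
    finally show "\<phi> (inv\<^bsub>G\<^esub> k) ` X \<in> fixed_flats (\<phi> h)"
      using X aut_flat[OF action_aut[OF inv_closed[OF k]]] by (simp add: fixed_flats_def)
  qed
  show "\<phi> (inv\<^bsub>G\<^esub> k) ` \<phi> k ` X = X" if "X \<in> fixed_flats (\<phi> h)" for X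
    using image_mult[OF inv_closed[OF k] k fE[OF that]] k image_one[OF fE[OF that]] by simp
  show "\<phi> k ` \<phi> (inv\<^bsub>G\<^esub> k) ` X = X" if "X \<in> fixed_flats (\<phi> g)" for X
    using image_mult[OF k inv_closed[OF k] fE[OF that]] k image_one[OF fE[OF that]] by simp
qed

text \<open>Supplies the conjugation hypothesis of \<open>vchar_orbit_sum\<close>. Translation by k
  is an order isomorphism between the posets of fixed flats that preserves coranks, so it carries
  over both the Moebius function and the Kazhdan--Lusztig numbers.\<close>

lemma summand_translate:
  assumes F: "F \<in> flats M" and g: "g \<in> carrier G" and k: "k \<in> carrier G" and fixed: "\<phi> g ` \<phi> k ` F = \<phi> k ` F"
  shows "summand m (\<phi> k ` F) g = summand m F (inv\<^bsub>G\<^esub> k \<otimes>\<^bsub>G\<^esub> g \<otimes>\<^bsub>G\<^esub> k)"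
proof -
  define h where "h = inv\<^bsub>G\<^esub> k \<otimes>\<^bsub>G\<^esub> g \<otimes>\<^bsub>G\<^esub> k"
  let ?L = "fixed_flats (\<phi> h)" and ?L' = "fixed_flats (\<phi> g)" and ?t = "(`) (\<phi> k)"
  have hc: "h \<in> carrier G" using g k by (simp add: h_def)
  have bij: "bij_betw ?t ?L ?L'" unfolding h_def by (rule fixed_flats_translate[OF g k])
  have sk: "matroid_aut M (\<phi> k)" by (rule action_aut[OF k])
  have inj: "inj_on (\<phi> k) E" using action_bij[OF k] by (simp add: bij_betw_def)
  have fE: "X \<subseteq> E" if "X \<in> ?L" for X using that flat_subset by (auto simp: fixed_flats_def)
  have sub: "\<phi> k ` X \<subseteq> \<phi> k ` Y \<longleftrightarrow> X \<subseteq> Y" if "X \<subseteq> E" "Y \<subseteq> E" for X Y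
    using inj that by (metis image_mono inj_on_image_mem_iff image_subset_iff subsetI subset_iff)
  have FE: "F \<subseteq> E" using F by (rule flat_subset)
  have c: "crk M (\<phi> k ` X) = crk M X" if "X \<subseteq> E" for X using aut_rk[OF sk that] by (simp add: crk_def)
  have mu: "mu (\<phi> g) (\<phi> k ` X) = mu (\<phi> h) X" if X: "X \<in> ?L" for X
  proof (rule moebius_transport[where \<theta> = ?t and L = ?L and L' = ?L' and botF = "cl {}" and botF' = "cl {}"])
    show "finite ?L" "finite ?L'" using finite_flats by (auto simp: fixed_flats_def)
    show "finite X" if "X \<in> ?L" for X using fE[OF that] finite_ground by (rule finite_subset)
    show "bij_betw ?t ?L ?L'" by (rule bij)
    show "\<phi> k ` X \<subseteq> \<phi> k ` Y \<longleftrightarrow> X \<subseteq> Y" if "X \<in> ?L" "Y \<in> ?L" for X Y using sub fE that by simp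
    show "cl {} \<in> ?L" by (rule bot_fixed[OF action_aut[OF hc]])
    show "\<phi> k ` cl {} = cl {}" using aut_cl[OF sk, of "{}"] by simp
    show "(\<Sum>E | E \<in> ?L \<and> E \<subseteq> F. mu (\<phi> h) E) = (if F = cl {} then 1 else 0)" if "F \<in> ?L" for F
      by (rule mu_sum[OF action_aut[OF hc] that])
    show "(\<Sum>E | E \<in> ?L' \<and> E \<subseteq> F. mu (\<phi> g) E) = (if F = cl {} then 1 else 0)" if "F \<in> ?L'" for F
      by (rule mu_sum[OF action_aut[OF g] that])
  qed (rule X)
  have "(\<Sum>X | X \<in> ?L' \<and> X \<subseteq> \<phi> k ` F \<and> crk M X - crk M (\<phi> k ` F) = int a. mu (\<phi> g) X)
      = (\<Sum>X | X \<in> ?L \<and> X \<subseteq> F \<and> crk M X - crk M F = int a. mu (\<phi> h) X)" for a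
  proof (rule sum.reindex_bij_betw[symmetric, THEN trans, of ?t])
    show "bij_betw ?t {X. X \<in> ?L \<and> X \<subseteq> F \<and> crk M X - crk M F = int a} {X. X \<in> ?L' \<and> X \<subseteq> \<phi> k ` F \<and> crk M X - crk M (\<phi> k ` F) = int a}"
    proof (rule bij_betw_imageI)
      show "inj_on ?t {X. X \<in> ?L \<and> X \<subseteq> F \<and> crk M X - crk M F = int a}"
        using bij by (auto simp: bij_betw_def inj_on_def)
      show "?t ` {X. X \<in> ?L \<and> X \<subseteq> F \<and> crk M X - crk M F = int a} = {X. X \<in> ?L' \<and> X \<subseteq> \<phi> k ` F \<and> crk M X - crk M (\<phi> k ` F) = int a}"
      proof (intro equalityI subsetI)
        fix Y assume "Y \<in> ?t ` {X. X \<in> ?L \<and> X \<subseteq> F \<and> crk M X - crk M F = int a}"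
        then obtain X where X: "X \<in> ?L" "X \<subseteq> F" "crk M X - crk M F = int a" "Y = \<phi> k ` X" by blast
        then show "Y \<in> {X. X \<in> ?L' \<and> X \<subseteq> \<phi> k ` F \<and> crk M X - crk M (\<phi> k ` F) = int a}"
          using bij c[OF fE[OF X(1)]] c[OF FE] sub[OF fE[OF X(1)] FE] by (auto simp: bij_betw_def)
      next
        fix Y assume Y: "Y \<in> {X. X \<in> ?L' \<and> X \<subseteq> \<phi> k ` F \<and> crk M X - crk M (\<phi> k ` F) = int a}"
        then have "Y \<in> ?t ` ?L" using bij_betw_imp_surj_on[OF bij] by simp
        then obtain X where X: "X \<in> ?L" "Y = \<phi> k ` X" by (rule imageE)
        then show "Y \<in> ?t ` {X. X \<in> ?L \<and> X \<subseteq> F \<and> crk M X - crk M F = int a}"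
          using Y c[OF fE[OF X(1)]] c[OF FE] sub[OF fE[OF X(1)] FE] by auto
      qed
    qed
  qed (use mu in \<open>auto intro!: sum.cong\<close>)
  moreover have "kl_number (above ?L' (\<phi> k ` F)) (crk M) (crk M (\<phi> k ` F)) i = kl_number (above ?L F) (crk M) (crk M F) i" for i
    unfolding c[OF FE]
  proof (rule kl_number_transport[symmetric, where \<theta> = ?t])
    show "bij_betw ?t (above ?L F) (above ?L' (\<phi> k ` F))"
    proof (rule bij_betw_imageI)
      show "inj_on ?t (above ?L F)" using bij by (auto simp: bij_betw_def inj_on_def above_def)
      show "?t ` above ?L F = above ?L' (\<phi> k ` F)"
      proof (intro equalityI subsetI)
        fix Y assume "Y \<in> ?t ` above ?L F"
        then obtain X where X: "X \<in> ?L" "F \<subseteq> X" "Y = \<phi> k ` X" by (auto simp: above_def)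
        then show "Y \<in> above ?L' (\<phi> k ` F)" using bij by (auto simp: bij_betw_def above_def)
      next
        fix Y assume Y: "Y \<in> above ?L' (\<phi> k ` F)"
        then have "Y \<in> ?t ` ?L" using bij_betw_imp_surj_on[OF bij] by (simp add: above_def)
        then obtain X where X: "X \<in> ?L" "Y = \<phi> k ` X" by (rule imageE)
        then show "Y \<in> ?t ` above ?L F" using Y sub[OF FE fE[OF X(1)]] by (auto simp: above_def)
      qed
    qed
    show "\<phi> k ` X \<subseteq> \<phi> k ` Y \<longleftrightarrow> X \<subseteq> Y" if "X \<in> above ?L F" "Y \<in> above ?L F" for X Y
      using sub fE that by (simp add: above_def)
    show "crk M (\<phi> k ` X) = crk M X" if "X \<in> above ?L F" for X using c fE that by (simp add: above_def)
  qed
  ultimately show ?thesis by (simp add: summand_def h_def[symmetric])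
qed

end

section \<open>Localizations, contractions and flags at a group element\<close>

lemma os_trace_cong: "(\<And>x. x \<in> ground M \<Longrightarrow> \<sigma> x = \<tau> x) \<Longrightarrow> os_trace M \<sigma> j = os_trace M \<tau> j"
proof -
  assume eq: "\<And>x. x \<in> ground M \<Longrightarrow> \<sigma> x = \<tau> x"
  have "map \<sigma> w = map \<tau> w" if "w \<in> lists (ground M)" for w using that eq by (intro map_cong) auto
  then have "{w. w \<in> lists (ground M) \<and> map \<sigma> w = v} = {w. w \<in> lists (ground M) \<and> map \<tau> w = v}" for v by (intro Collect_cong) metis
  then have "wact (ground M) \<sigma> = wact (ground M) \<tau>" by (simp add: wact_def fun_eq_iff)
  then show ?thesis by (simp add: os_trace_def)
qed

context equivariant
begin

text \<open>Coefficient a of H comes from degree rk F - a of the algebra, that is from the flats X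
  below F with crk X - crk F = a.\<close>

lemma Hpoly_localization:
  assumes F: "F \<in> flats M" and h: "h \<in> carrier G" "\<phi> h ` F = F"
  shows "vchar (Hpoly (flat_stab G \<phi> F) (localization M F) (restrict_action \<phi> F) a) h =
    (\<Sum>X | X \<in> fixed_flats (\<phi> h) \<and> X \<subseteq> F \<and> crk M X - crk M F = int a. mu (\<phi> h) X)"
proof -
  interpret S: equivariant "flat_stab G \<phi> F" "localization M F" "restrict_action \<phi> F"
    by unfold_locales (rule flat_stab_equivariant(1)[OF F])
  have hS: "h \<in> carrier (flat_stab G \<phi> F)" using h by (simp add: flat_stab_carrier)
  have rF: "matroid_rk (localization M F) = rk M F" by (simp add: ground_localization rk_localization)
  have Ff: "F \<in> fixed_flats (\<phi> h)" using F h by (simp add: fixed_flats_def)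
  have set: "{X. X \<in> fixed_flats (\<phi> h) \<and> X \<subseteq> F \<and> crk M X - crk M F = int a}
    = (if a \<le> rk M F then {X. X \<in> fixed_flats (\<phi> h) \<and> X \<subseteq> F \<and> rk M X = rk M F - a} else {})"
    by (auto simp: crk_def)
  have tr: "os_trace (localization M F) (restrict_action \<phi> F h) j = os_trace (localization M F) (\<phi> h) j" for j
    by (rule os_trace_cong) (simp add: ground_localization restrict_action_def)
  show ?thesis
    unfolding S.Hpoly_props(2)[OF hS] rF set tr
    using os_trace_localization[OF action_aut[OF h(1)] Ff] by simp
qed

text \<open>Removing F from the fixed flats above it is an order isomorphism onto the fixed flats of
  the contraction and preserves coranks.\<close>

lemma contraction_kl_number:
  assumes F: "F \<in> flats M" and h: "h \<in> carrier G" "\<phi> h ` F = F"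
  shows "kl_number (finite_matroid.fixed_flats (contraction M F) (restrict_action \<phi> (E - F) h))
      (crk (contraction M F)) (int (matroid_rk (contraction M F))) i
    = kl_number (above (fixed_flats (\<phi> h)) F) (crk M) (crk M F) i"
proof -
  have FE: "F \<subseteq> E" using F by (rule flat_subset)
  interpret C: finite_matroid "contraction M F" by unfold_locales (rule contraction_matroid)
  have inj: "inj_on (\<phi> h) E" using action_bij[OF h(1)] by (simp add: bij_betw_def)
  have n: "int (matroid_rk (contraction M F)) = crk M F"
  proof -
    have "E - F \<union> F = E" using FE by auto
    then show ?thesis using rk_mono[OF FE] by (simp add: contraction_ground rk_contraction crk_def of_nat_diff)
  qed
  let ?U = "above (fixed_flats (\<phi> h)) F" and ?s = "restrict_action \<phi> (E - F) h"
  have U: "X \<in> flats M" "\<phi> h ` X = X" "F \<subseteq> X" "X \<subseteq> E" if "X \<in> ?U" for X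
    using that flat_subset by (auto simp: above_def fixed_flats_def)
  have "?s ` Y = \<phi> h ` Y" if "Y \<subseteq> E - F" for Y by (rule restrict_action_image[OF that])
  then have C: "C.fixed_flats ?s = {Y. Y \<subseteq> E - F \<and> Y \<union> F \<in> flats M \<and> \<phi> h ` Y = Y}"
    unfolding C.fixed_flats_def flats_contraction[OF FE]
    by (intro Collect_cong) (simp only: mem_Collect_eq conj_assoc cong: conj_cong)
  have "kl_number ?U (crk M) (crk M F) i = kl_number (C.fixed_flats ?s) (crk (contraction M F)) (crk M F) i"
  proof (rule kl_number_transport[where \<theta> = "\<lambda>X. X - F"])
    show "bij_betw (\<lambda>X. X - F) ?U (C.fixed_flats ?s)"
    proof (rule bij_betwI[where g = "\<lambda>Y. Y \<union> F"])
      show "(\<lambda>X. X - F) \<in> ?U \<rightarrow> C.fixed_flats ?s"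
      proof
        fix X assume X: "X \<in> ?U"
        have "\<phi> h ` (X - F) = X - F"
          using inj_on_image_set_diff[OF inj, of X F] U[OF X] FE h(2) by auto
        moreover have "X - F \<union> F = X" using U(3)[OF X] by auto
        ultimately show "X - F \<in> C.fixed_flats ?s" using U[OF X] by (auto simp: C)
      qed
      show "(\<lambda>Y. Y \<union> F) \<in> C.fixed_flats ?s \<rightarrow> ?U"
        using h(2) by (auto simp: C above_def fixed_flats_def image_Un)
      show "X - F \<union> F = X" if "X \<in> ?U" for X using U(3)[OF that] by auto
      show "Y \<union> F - F = Y" if "Y \<in> C.fixed_flats ?s" for Y using that by (auto simp: C)
    qed
    show "X - F \<subseteq> Y - F \<longleftrightarrow> X \<subseteq> Y" if "X \<in> ?U" "Y \<in> ?U" for X Y using U(3)[OF that(1)] U(3)[OF that(2)] by auto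
    show "crk (contraction M F) (X - F) = crk M X" if "X \<in> ?U" for X
      by (rule crk_contraction[OF U(3)[OF that] U(4)[OF that]])
  qed
  then show ?thesis using n by simp
qed

text \<open>A permutation character counts fixed basis elements, and a flag is fixed exactly when
  all its members are.\<close>

lemma W_props:
  shows "W G M \<phi> r d \<in> carrier (Rep G)"
    and "g \<in> carrier G \<Longrightarrow> vchar (W G M \<phi> r d) g = of_nat (card (chains (fixed_flats (\<phi> g)) (crk M) r d))"
proof -
  let ?a = "\<lambda>g F. \<lambda>j\<in>{1..r}. \<phi> g ` F j"
  have fl: "flags M r d = chains (flats M) (crk M) r d" by (simp add: flags_def chains_def)
  have fin: "finite (flags M r d)" unfolding fl by (rule finite_chains[OF finite_flats])
  have mem1: "F j \<in> flats M" if "F \<in> flags M r d" "j \<in> {1..r}" for F j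
    using that by (auto simp: flags_def)
  note mem = mem1 flat_subset[OF mem1]
  have und: "F j = undefined" if "F \<in> flags M r d" "j \<notin> {1..r}" for F j
    using that by (auto simp: flags_def PiE_def extensional_def)
  have cl: "?a g F \<in> flags M r d" if g: "g \<in> carrier G" and F: "F \<in> flags M r d" for g F
  proof -
    have "crk M (\<phi> g ` F j) = d j" if "j \<in> {1..r}" for j
      using aut_rk[OF action_aut[OF g] mem(2)[OF F that]] F that by (auto simp: flags_def crk_def)
    moreover have "\<phi> g ` F j \<in> flats M" if "j \<in> {1..r}" for j using aut_flat[OF action_aut[OF g] mem(1)[OF F that]] .
    moreover have "\<phi> g ` F (Suc j) \<subseteq> \<phi> g ` F j" if "j \<in> {1..<r}" for j
      using F that by (intro image_mono) (auto simp: flags_def)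
    ultimately show ?thesis by (auto simp: flags_def)
  qed
  have one: "?a \<one>\<^bsub>G\<^esub> F = F" if F: "F \<in> flags M r d" for F
    using image_one[OF mem(2)[OF F]] und[OF F] by (intro ext) (auto simp: restrict_def)
  have mult: "?a (g \<otimes>\<^bsub>G\<^esub> h) F = ?a g (?a h F)" if "g \<in> carrier G" "h \<in> carrier G" "F \<in> flags M r d" for g h F
    using image_mult[OF that(1,2) mem(2)[OF that(3)]] by (auto simp: restrict_def fun_eq_iff)
  note p = perm_rep_props[OF is_group fin, of ?a, OF cl one mult]
  show "W G M \<phi> r d \<in> carrier (Rep G)" unfolding W_def by (rule rep_class(1)[OF p(1)])
  assume g: "g \<in> carrier G"
  have "{F \<in> flags M r d. ?a g F = F} = chains (fixed_flats (\<phi> g)) (crk M) r d"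
  proof (intro equalityI subsetI)
    fix F assume "F \<in> {F \<in> flags M r d. ?a g F = F}"
    then have F: "F \<in> flags M r d" "?a g F = F" by auto
    have "\<phi> g ` F j = F j" if "j \<in> {1..r}" for j using fun_cong[OF F(2), of j] that by simp
    then show "F \<in> chains (fixed_flats (\<phi> g)) (crk M) r d"
      using F(1) by (auto simp: flags_def chains_def fixed_flats_def PiE_def Pi_def)
  next
    fix F assume F: "F \<in> chains (fixed_flats (\<phi> g)) (crk M) r d"
    then have "F \<in> flags M r d" by (auto simp: flags_def chains_def fixed_flats_def PiE_def Pi_def)
    moreover have "?a g F = F"
    proof
      fix j show "?a g F j = F j"
        using F und[OF \<open>F \<in> flags M r d\<close>, of j] by (cases "j \<in> {1..r}") (auto simp: chains_def fixed_flats_def PiE_def Pi_def)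
    qed
    ultimately show "F \<in> {F \<in> flags M r d. ?a g F = F}" by simp
  qed
  moreover have "vchar (W G M \<phi> r d) g = of_nat (card {F \<in> flags M r d. ?a g F = F})"
    unfolding W_def by (rule trans[OF rep_class(2)[OF p(1) g] p(2)])
  ultimately show "vchar (W G M \<phi> r d) g = of_nat (card (chains (fixed_flats (\<phi> g)) (crk M) r d))"
    by (simp only:)
qed

end

text \<open>Both sides satisfy the same recursion; the minimal flat, whose contraction has full rank, contributes
  nothing in the degrees above half the rank that determine the coefficients.\<close>

lemma KL_character:
  assumes KL: "is_equivariant_KL P" and "equivariant_matroid G M \<phi>" "g \<in> carrier G"
  shows "vchar (P G M \<phi> k) g =
    of_int (kl_number (finite_matroid.fixed_flats M (\<phi> g)) (crk M) (int (matroid_rk M)) (int k))"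
  using assms(2,3)
proof (induction "matroid_rk M" arbitrary: G M \<phi> g k rule: less_induct)
  case less
  interpret equivariant G M \<phi> by unfold_locales (rule less.prems(1))
  let ?n = "matroid_rk M"
  note g = less.prems(2)
  have PK: "\<And>k. P G' M' \<phi>' k \<in> carrier (Rep G')"
    "matroid_rk M' = 0 \<Longrightarrow> P G' M' \<phi>' 0 = \<one>\<^bsub>Rep G'\<^esub> \<and> (\<forall>k>0. P G' M' \<phi>' k = \<zero>\<^bsub>Rep G'\<^esub>)"
    "\<And>k. matroid_rk M' > 0 \<Longrightarrow> real k \<ge> real (matroid_rk M') / 2 \<Longrightarrow> P G' M' \<phi>' k = \<zero>\<^bsub>Rep G'\<^esub>"
    "\<And>k. vpoly_reverse G' (matroid_rk M') (P G' M' \<phi>') k = KL_rhs P G' M' \<phi>' k"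
    if "equivariant_matroid G' M' \<phi>'" for G' M' \<phi>'
    using KL that unfolding is_equivariant_KL_def by simp_all
  note PM = PK[OF less.prems(1)]
  consider "?n = 0" | "?n > 0" "?n \<le> 2 * k" | "?n > 0" "2 * k < ?n" by linarith
  then show ?case
  proof cases
    case 1
    then show ?thesis using PM(2) g by (cases "k = 0") (simp_all add: kl_number_def Rep_one Rep_zero)
  next
    case 2
    then have "P G M \<phi> k = \<zero>\<^bsub>Rep G\<^esub>" by (intro PM(3)) auto
    moreover have "kl_number (fixed_flats (\<phi> g)) (crk M) (int ?n) (int k) = 0"
      using 2 by (intro kl_number_eq_0) auto
    ultimately show ?thesis using g by (simp add: Rep_zero)
  next
    case 3
    \<comment> \<open>The recursion is read at m = n - k, where its left side is the coefficient k.
      Since 2 k < n, this m lies above half the rank.\<close>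
    define m where "m = ?n - k"
    have m: "m \<le> ?n" "?n - m = k" "?n < 2 * m" using 3 by (auto simp: m_def)
    let ?\<alpha> = "\<lambda>g. (`) (\<phi> g)"
    let ?X = "\<lambda>F. vpoly_mult (flat_stab G \<phi> F) (Hpoly (flat_stab G \<phi> F) (localization M F) (restrict_action \<phi> F))
        (P (flat_stab G \<phi> F) (contraction M F) (restrict_action \<phi> (E - F))) m"
    have fs: "flat_stab G \<phi> F = G\<lparr>carrier := stabilizer G ?\<alpha> F\<rparr>" for F by (simp add: flat_stab_def)
    have X: "?X F \<in> carrier (Rep (flat_stab G \<phi> F))"
      and Xchar: "\<And>h. h \<in> carrier (flat_stab G \<phi> F) \<Longrightarrow> vchar (?X F) h = summand m F h" if F: "F \<in> flats M" for F
    proof -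
      note eL = flat_stab_equivariant(1)[OF F] and eC = flat_stab_equivariant(2)[OF F]
      interpret S: equivariant "flat_stab G \<phi> F" "localization M F" "restrict_action \<phi> F" by unfold_locales (rule eL)
      note PC = PK[OF eC]
      show "?X F \<in> carrier (Rep (flat_stab G \<phi> F))" by (intro S.vpoly_mult_props(1) S.Hpoly_props(1) PC(1))
      fix h assume hS: "h \<in> carrier (flat_stab G \<phi> F)"
      then have h: "h \<in> carrier G" "\<phi> h ` F = F" by (simp_all add: flat_stab_carrier)
      have FE: "F \<subseteq> E" using F by (rule flat_subset)
      have rC: "matroid_rk (contraction M F) = ?n - rk M F"
      proof -
        have "E - F \<union> F = E" using FE by auto
        then show ?thesis by (simp add: contraction_ground rk_contraction)
      qed
      have "vchar (?X F) h = (\<Sum>a\<le>m. vchar (Hpoly (flat_stab G \<phi> F) (localization M F) (restrict_action \<phi> F) a) h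
          * vchar (P (flat_stab G \<phi> F) (contraction M F) (restrict_action \<phi> (E - F)) (m - a)) h)"
        by (intro S.vpoly_mult_props(2) S.Hpoly_props(1) PC(1) hS)
      also have "\<dots> = summand m F h"
        unfolding summand_def
      proof (rule sum.cong[OF refl])
        fix a assume a: "a \<in> {..m}"
        let ?mu = "\<Sum>X | X \<in> fixed_flats (\<phi> h) \<and> X \<subseteq> F \<and> crk M X - crk M F = int a. mu (\<phi> h) X"
        let ?p = "vchar (P (flat_stab G \<phi> F) (contraction M F) (restrict_action \<phi> (E - F)) (m - a)) h"
        let ?k = "of_int (kl_number (above (fixed_flats (\<phi> h)) F) (crk M) (crk M F) (int (m - a))) :: complex"
        have "?mu * ?p = ?mu * ?k"
        \<comment> \<open>The contraction at the minimal flat has full rank, out of reach of the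
          induction hypothesis. For a > 0 no flat below F has the required corank; for a = 0 both
          sides vanish by the degree bound at m.\<close>
        proof (cases "rk M F = 0")
          case True
          show ?thesis
          proof (cases "a = 0")
            case False
            have "rk M F \<ge> rk M X" if "X \<subseteq> F" for X using rk_mono[OF that] .
            then have "{X. X \<in> fixed_flats (\<phi> h) \<and> X \<subseteq> F \<and> crk M X - crk M F = int a} = {}"
              using True False by (auto simp: crk_def)
            then show ?thesis by (simp only: sum.empty of_int_0 mult_zero_left)
          next
            case a0: True
            have "P (flat_stab G \<phi> F) (contraction M F) (restrict_action \<phi> (E - F)) m = \<zero>\<^bsub>Rep (flat_stab G \<phi> F)\<^esub>"
              using rC True 3 m by (intro PC(3)) auto
            moreover have "kl_number (above (fixed_flats (\<phi> h)) F) (crk M) (crk M F) (int m) = 0"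
              using True 3 m by (intro kl_number_eq_0) (auto simp: crk_def)
            ultimately show ?thesis using a0 hS by (simp add: S.Rep_zero)
          qed
        next
          case False
          then have "matroid_rk (contraction M F) < ?n" using rC 3 by simp
          from less.hyps[OF this eC hS, of "m - a"]
          have "?p = ?k" unfolding contraction_kl_number[OF F h] .
          then show ?thesis by simp
        qed
        then show "vchar (Hpoly (flat_stab G \<phi> F) (localization M F) (restrict_action \<phi> F) a) h * ?p = ?mu * ?k"
          unfolding Hpoly_localization[OF F h] .
      qed
      finally show "vchar (?X F) h = summand m F h" .
    qed
    have "P G M \<phi> k = vpoly_reverse G ?n (P G M \<phi>) m" using m by (simp add: vpoly_reverse_def)
    also have "\<dots> = (\<Oplus>\<^bsub>Rep G\<^esub>Q\<in>orbits G (flats M) ?\<alpha>. let F = SOME F. F \<in> Q in Ind G (G\<lparr>carrier := stabilizer G ?\<alpha> F\<rparr>) (?X F))"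
      unfolding PM(4) KL_rhs_def Let_def fs ..
    also have "vchar \<dots> g = (\<Sum>F | F \<in> flats M \<and> \<phi> g ` F = F. summand m F g)"
    proof (rule vchar_orbit_sum(2)[OF finite_flats _ _ _ _ _ _ g])
      show "\<phi> g ` F \<in> flats M" if "g \<in> carrier G" "F \<in> flats M" for g F using aut_flat[OF action_aut] that by blast
      show "\<phi> \<one>\<^bsub>G\<^esub> ` F = F" if "F \<in> flats M" for F using image_one[OF flat_subset[OF that]] .
      show "\<phi> (g \<otimes>\<^bsub>G\<^esub> h) ` F = \<phi> g ` \<phi> h ` F" if "g \<in> carrier G" "h \<in> carrier G" "F \<in> flats M" for g h F
        using image_mult[OF that(1,2) flat_subset[OF that(3)]] .
      show "?X F \<in> carrier (Rep (G\<lparr>carrier := stabilizer G ?\<alpha> F\<rparr>))" if "F \<in> flats M" for F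
        using X[OF that] unfolding fs .
      show "vchar (?X F) h = summand m F h" if "F \<in> flats M" "h \<in> stabilizer G ?\<alpha> F" for F h
        using Xchar[OF that(1), of h] that(2) by (simp add: fs)
      show "summand m (\<phi> k ` F) g = summand m F (inv\<^bsub>G\<^esub> k \<otimes>\<^bsub>G\<^esub> g \<otimes>\<^bsub>G\<^esub> k)"
        if "F \<in> flats M" "g \<in> carrier G" "k \<in> carrier G" "\<phi> g ` \<phi> k ` F = \<phi> k ` F" for F g k
        by (rule summand_translate[OF that])
    qed
    also have "\<dots> = (\<Sum>F\<in>fixed_flats (\<phi> g). summand m F g)" by (simp add: fixed_flats_def)
    also have "\<dots> = kl_char g (?n - m)" by (rule summand_sum[OF g m(1)])
    finally show ?thesis using m(2) by simp
  qed
qed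

theorem theorem6p1:
  fixes G :: "'g monoid" and M :: "'a matroid" and \<phi> :: "'g \<Rightarrow> 'a \<Rightarrow> 'a"
    and P :: "('g, 'a) KL_assignment" and i :: nat
  assumes "is_equivariant_KL P"
    and "equivariant_matroid G M \<phi>"
    and "i > 0"
  shows "P G M \<phi> i =
    (\<Oplus>\<^bsub>Rep G\<^esub>r\<in>{1..i}. \<Oplus>\<^bsub>Rep G\<^esub>S\<in>Pow {1..r}.
       [((-1) ^ card S :: int)] \<cdot>\<^bsub>Rep G\<^esub>
         (\<Oplus>\<^bsub>Rep G\<^esub>a\<in>index_seqs M i r.
            W G M \<phi> r (\<lambda>j. a (t_index S j) + a (j - 1))))"
proof -
  interpret equivariant G M \<phi> by unfold_locales (rule assms(2))
  let ?q = "int (matroid_rk M) - int i"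
  have seqs: "index_seqs M i r = steps r (int i) ?q" for r by (simp add: index_seqs_def steps_def)
  let ?W = "\<lambda>r S a. W G M \<phi> r (\<lambda>j. a (t_index S j) + a (j - 1))"
  let ?A = "\<lambda>r S. \<Oplus>\<^bsub>Rep G\<^esub>a\<in>index_seqs M i r. ?W r S a"
  let ?B = "\<lambda>r S. [((-1) ^ card S :: int)] \<cdot>\<^bsub>Rep G\<^esub> ?A r S"
  let ?C = "\<lambda>r. \<Oplus>\<^bsub>Rep G\<^esub>S\<in>Pow {1..r}. ?B r S"
  have finS: "finite (index_seqs M i r)" for r unfolding seqs by (rule finite_steps)
  have A: "?A r S \<in> carrier (Rep G)" for r S by (rule Rep_finsum(1)[OF finS W_props(1)])
  have B: "?B r S \<in> carrier (Rep G)" for r S by (rule Rep_int_multiple(1)[OF A])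
  have C: "?C r \<in> carrier (Rep G)" for r by (rule Rep_finsum(1)[OF _ B]) simp
  show ?thesis
  proof (rule Rep_eqI)
    show "P G M \<phi> i \<in> carrier (Rep G)" using assms(1,2) by (simp add: is_equivariant_KL_def)
    show "(\<Oplus>\<^bsub>Rep G\<^esub>r\<in>{1..i}. ?C r) \<in> carrier (Rep G)" by (rule Rep_finsum(1)[OF _ C]) simp
    fix g assume g: "g \<in> carrier G"
    let ?L = "fixed_flats (\<phi> g)"
    have "vchar (?C r) g = of_int (signed_chains ?L (crk M) r (int i) ?q)" for r
    proof -
      have "vchar (?C r) g = (\<Sum>S\<in>Pow {1..r}. vchar (?B r S) g)" by (rule Rep_finsum(2)[OF _ B g]) simp
      also have "\<dots> = (\<Sum>S\<in>Pow {1..r}. of_int ((-1) ^ card S) * (\<Sum>a\<in>index_seqs M i r. vchar (?W r S a) g))"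
        by (simp only: Rep_int_multiple(2)[OF A g] Rep_finsum(2)[OF finS W_props(1) g])
      also have "\<dots> = of_int (signed_chains ?L (crk M) r (int i) ?q)"
        by (simp add: W_props(2)[OF g] seqs signed_chains_def)
      finally show ?thesis .
    qed
    then have "vchar (\<Oplus>\<^bsub>Rep G\<^esub>r\<in>{1..i}. ?C r) g = of_int (\<Sum>r\<in>{1..i}. signed_chains ?L (crk M) r (int i) ?q)"
      using Rep_finsum(2)[OF finite_atLeastAtMost C g] by simp
    \<comment> \<open>\<open>kl_number\<close> starts at r = 0, a term that vanishes for i > 0. In
      rank 0 there are no sequences, as they would need i < -i.\<close>
    also have "(\<Sum>r\<in>{1..i}. signed_chains ?L (crk M) r (int i) ?q) = kl_number ?L (crk M) (int (matroid_rk M)) (int i)"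
    proof (cases "matroid_rk M = 0")
      case True
      then show ?thesis using assms(3) by (auto simp: kl_number_def intro!: sum.neutral signed_chains_eq_0)
    next
      case False
      have "{0..i} = insert 0 {1..i}" by auto
      then show ?thesis using False assms(3) by (simp add: kl_number_def signed_chains_0)
    qed
    finally show "vchar (P G M \<phi> i) g = vchar (\<Oplus>\<^bsub>Rep G\<^esub>r\<in>{1..i}. ?C r) g"
      using KL_character[OF assms(1,2) g, of i] by simp
  qed
qed

end
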